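(* Let $\mathfrak{A},\mathfrak{B}$ be small 2-categories, $\mathfrak{H}$ a 2-category, and $\mathcal{A}:\mathfrak{A}\to\mathfrak{H}$, $\mathrm{t}:\mathfrak{A}\to\mathfrak{B}$ pseudofunctors. If $\mathfrak{H}$ has the weighted bilimit $\mathrm{bilim}(\mathfrak{B}(b,\mathrm{t}-),\mathcal{A})$ for every object $b$ of $\mathfrak{B}$, then the right pseudo-Kan extension $\mathrm{PsRan}_{\mathrm{t}}\mathcal{A}$ exists. Furthermore, there is an equivalence $$\mathrm{PsRan}_{\mathrm{t}}\mathcal{A}(b)\simeq\mathrm{bilim}(\mathfrak{B}(b,\mathrm{t}-),\mathcal{A})$$ pseudonatural in $b$.
   Context: $[\mathfrak{A},\mathfrak{H}]_{PS}$ denotes the 2-category of pseudofunctors, pseudonatural transformations and modifications; $\mathsf{CAT}$ is the 2-category of categories. Weighted bilimit: for pseudofunctors $\mathcal{W}:\mathfrak{A}\to\mathsf{CAT}$ and $\mathcal{A}:\mathfrak{A}\to\mathfrak{H}$, $\mathrm{bilim}(\mathcal{W},\mathcal{A})$ is (if it exists) an object of $\mathfrak{H}$ endowed with an equivalence $\mathfrak{H}(X,\mathrm{bilim}(\mathcal{W},\mathcal{A}))\simeq[\mathfrak{A},\mathsf{CAT}]_{PS}(\mathcal{W},\mathfrak{H}(X,\mathcal{A}-))$ pseudonatural in $X$. Right pseudo-Kan extension: $\mathrm{PsRan}_{\mathrm{t}}\mathcal{A}:\mathfrak{B}\to\mathfrak{H}$ is (if it exists) a pseudofunctor with a pseudonatural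 transformation $\varepsilon_{\mathcal{A}}:(\mathrm{PsRan}_{\mathrm{t}}\mathcal{A})\circ\mathrm{t}\to\mathcal{A}$ such that $$[\mathfrak{B},\mathfrak{H}]_{PS}(-,\mathrm{PsRan}_{\mathrm{t}}\mathcal{A})\to[\mathfrak{A},\mathfrak{H}]_{PS}(-\circ\mathrm{t},\mathcal{A}),\quad\alpha\mapsto\varepsilon_{\mathcal{A}}\,(\alpha\mathrm{t})$$ is a pseudonatural equivalence. It is unique up to pseudonatural equivalence. *)

theory Defs
  imports Main "HOL-Library.FuncSet"
begin

text \<open>
  Conventions.  Structures are records over arbitrary types, and every map that is part of a
  functor, natural transformation, pseudofunctor, pseudonatural transformation or modification is
  extensional, so that two of these are equal iff they agree on the carriers.
  Smallness is not a separate condition: all cells form sets of elements of a type, and the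
  functor 2-categories below exist for every choice of types.
\<close>

section \<open>Categories and 2-categories\<close>

record ('o, 'a) cat =
  Obj :: "'o set"
  Arr :: "'a set"
  Dom :: "'a \<Rightarrow> 'o"
  Cod :: "'a \<Rightarrow> 'o"
  Idn :: "'o \<Rightarrow> 'a"
  Cmp :: "'a \<Rightarrow> 'a \<Rightarrow> 'a"

locale category =
  fixes C :: "('o, 'a) cat"
  assumes Dom_Obj: "f \<in> Arr C \<Longrightarrow> Dom C f \<in> Obj C"
    and Cod_Obj: "f \<in> Arr C \<Longrightarrow> Cod C f \<in> Obj C"
    and Idn_Arr: "x \<in> Obj C \<Longrightarrow> Idn C x \<in> Arr C"
    and Dom_Idn: "x \<in> Obj C \<Longrightarrow> Dom C (Idn C x) = x"
    and Cod_Idn: "x \<in> Obj C \<Longrightarrow> Cod C (Idn C x) = x"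
    and Cmp_Arr: "\<lbrakk>f \<in> Arr C; g \<in> Arr C; Dom C g = Cod C f\<rbrakk> \<Longrightarrow> Cmp C g f \<in> Arr C"
    and Dom_Cmp: "\<lbrakk>f \<in> Arr C; g \<in> Arr C; Dom C g = Cod C f\<rbrakk> \<Longrightarrow> Dom C (Cmp C g f) = Dom C f"
    and Cod_Cmp: "\<lbrakk>f \<in> Arr C; g \<in> Arr C; Dom C g = Cod C f\<rbrakk> \<Longrightarrow> Cod C (Cmp C g f) = Cod C g"
    and Cmp_Idn_right: "f \<in> Arr C \<Longrightarrow> Cmp C f (Idn C (Dom C f)) = f"
    and Cmp_Idn_left: "f \<in> Arr C \<Longrightarrow> Cmp C (Idn C (Cod C f)) f = f"
    and Cmp_assoc: "\<lbrakk>f \<in> Arr C; g \<in> Arr C; h \<in> Arr C; Dom C g = Cod C f; Dom C h = Cod C g\<rbrakk>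
      \<Longrightarrow> Cmp C (Cmp C h g) f = Cmp C h (Cmp C g f)"

text \<open>
  In a 2-category, \<open>src\<close> and \<open>trg\<close> refer to 1-cells, \<open>dom2\<close> and \<open>cod2\<close> to 2-cells;
  \<open>g \<odot> f\<close> is composition of 1-cells, \<open>\<beta> \<star> \<alpha>\<close> horizontal and \<open>\<beta> \<bullet> \<alpha>\<close> vertical
  composition of 2-cells, all in applicative order.
\<close>

record ('o, 'm, 'c) twocat =
  Ob :: "'o set"
  Mor :: "'m set"
  Cell :: "'c set"
  src :: "'m \<Rightarrow> 'o"
  trg :: "'m \<Rightarrow> 'o"
  dom2 :: "'c \<Rightarrow> 'm"
  cod2 :: "'c \<Rightarrow> 'm"
  id1 :: "'o \<Rightarrow> 'm"
  comp1 :: "'m \<Rightarrow> 'm \<Rightarrow> 'm" (infixr \<open>\<odot>\<index>\<close> 75)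
  id2 :: "'m \<Rightarrow> 'c"
  vcomp :: "'c \<Rightarrow> 'c \<Rightarrow> 'c" (infixr \<open>\<bullet>\<index>\<close> 70)
  hcomp :: "'c \<Rightarrow> 'c \<Rightarrow> 'c" (infixr \<open>\<star>\<index>\<close> 75)

definition homcat :: "('o, 'm, 'c) twocat \<Rightarrow> 'o \<Rightarrow> 'o \<Rightarrow> ('m, 'c) cat" where
  "homcat H X Y =
    \<lparr>Obj = {f \<in> Mor H. src H f = X \<and> trg H f = Y},
     Arr = {\<alpha> \<in> Cell H. src H (dom2 H \<alpha>) = X \<and> trg H (dom2 H \<alpha>) = Y},
     Dom = dom2 H, Cod = cod2 H, Idn = id2 H, Cmp = vcomp H\<rparr>"

locale two_category =
  fixes H :: "('o, 'm, 'c) twocat" (structure)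
  assumes src_Ob: "f \<in> Mor H \<Longrightarrow> src H f \<in> Ob H"
    and trg_Ob: "f \<in> Mor H \<Longrightarrow> trg H f \<in> Ob H"
    and dom2_Mor: "\<alpha> \<in> Cell H \<Longrightarrow> dom2 H \<alpha> \<in> Mor H"
    and cod2_Mor: "\<alpha> \<in> Cell H \<Longrightarrow> cod2 H \<alpha> \<in> Mor H"
    and src_cod2: "\<alpha> \<in> Cell H \<Longrightarrow> src H (cod2 H \<alpha>) = src H (dom2 H \<alpha>)"
    and trg_cod2: "\<alpha> \<in> Cell H \<Longrightarrow> trg H (cod2 H \<alpha>) = trg H (dom2 H \<alpha>)"
    and id1_Mor: "X \<in> Ob H \<Longrightarrow> id1 H X \<in> Mor H"
    and src_id1: "X \<in> Ob H \<Longrightarrow> src H (id1 H X) = X"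
    and trg_id1: "X \<in> Ob H \<Longrightarrow> trg H (id1 H X) = X"
    and comp1_Mor: "\<lbrakk>f \<in> Mor H; g \<in> Mor H; src H g = trg H f\<rbrakk> \<Longrightarrow> g \<odot> f \<in> Mor H"
    and src_comp1: "\<lbrakk>f \<in> Mor H; g \<in> Mor H; src H g = trg H f\<rbrakk> \<Longrightarrow> src H (g \<odot> f) = src H f"
    and trg_comp1: "\<lbrakk>f \<in> Mor H; g \<in> Mor H; src H g = trg H f\<rbrakk> \<Longrightarrow> trg H (g \<odot> f) = trg H g"
    and comp1_id_right: "f \<in> Mor H \<Longrightarrow> f \<odot> id1 H (src H f) = f"
    and comp1_id_left: "f \<in> Mor H \<Longrightarrow> id1 H (trg H f) \<odot> f = f"
    and comp1_assoc: "\<lbrakk>f \<in> Mor H; g \<in> Mor H; h \<in> Mor H; src H g = trg H f; src H h = trg H g\<rbrakk>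
      \<Longrightarrow> (h \<odot> g) \<odot> f = h \<odot> (g \<odot> f)"
    and homcat: "\<lbrakk>X \<in> Ob H; Y \<in> Ob H\<rbrakk> \<Longrightarrow> category (homcat H X Y)"
    and hcomp_Cell: "\<lbrakk>\<alpha> \<in> Cell H; \<beta> \<in> Cell H; src H (dom2 H \<beta>) = trg H (dom2 H \<alpha>)\<rbrakk>
      \<Longrightarrow> \<beta> \<star> \<alpha> \<in> Cell H"
    and dom2_hcomp: "\<lbrakk>\<alpha> \<in> Cell H; \<beta> \<in> Cell H; src H (dom2 H \<beta>) = trg H (dom2 H \<alpha>)\<rbrakk>
      \<Longrightarrow> dom2 H (\<beta> \<star> \<alpha>) = dom2 H \<beta> \<odot> dom2 H \<alpha>"
    and cod2_hcomp: "\<lbrakk>\<alpha> \<in> Cell H; \<beta> \<in> Cell H; src H (dom2 H \<beta>) = trg H (dom2 H \<alpha>)\<rbrakk>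
      \<Longrightarrow> cod2 H (\<beta> \<star> \<alpha>) = cod2 H \<beta> \<odot> cod2 H \<alpha>"
    and hcomp_id2: "\<lbrakk>f \<in> Mor H; g \<in> Mor H; src H g = trg H f\<rbrakk>
      \<Longrightarrow> id2 H g \<star> id2 H f = id2 H (g \<odot> f)"
    and interchange: "\<lbrakk>\<alpha> \<in> Cell H; \<alpha>' \<in> Cell H; \<beta> \<in> Cell H; \<beta>' \<in> Cell H;
        dom2 H \<alpha>' = cod2 H \<alpha>; dom2 H \<beta>' = cod2 H \<beta>; src H (dom2 H \<beta>) = trg H (dom2 H \<alpha>)\<rbrakk>
      \<Longrightarrow> (\<beta>' \<bullet> \<beta>) \<star> (\<alpha>' \<bullet> \<alpha>) = (\<beta>' \<star> \<alpha>') \<bullet> (\<beta> \<star> \<alpha>)"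
    and hcomp_id_right: "\<alpha> \<in> Cell H \<Longrightarrow> \<alpha> \<star> id2 H (id1 H (src H (dom2 H \<alpha>))) = \<alpha>"
    and hcomp_id_left: "\<alpha> \<in> Cell H \<Longrightarrow> id2 H (id1 H (trg H (dom2 H \<alpha>))) \<star> \<alpha> = \<alpha>"
    and hcomp_assoc: "\<lbrakk>\<alpha> \<in> Cell H; \<beta> \<in> Cell H; \<gamma> \<in> Cell H;
        src H (dom2 H \<beta>) = trg H (dom2 H \<alpha>); src H (dom2 H \<gamma>) = trg H (dom2 H \<beta>)\<rbrakk>
      \<Longrightarrow> (\<gamma> \<star> \<beta>) \<star> \<alpha> = \<gamma> \<star> (\<beta> \<star> \<alpha>)"

definition iso2 :: "('o, 'm, 'c) twocat \<Rightarrow> 'c \<Rightarrow> bool" where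
  "iso2 H \<alpha> \<longleftrightarrow> \<alpha> \<in> Cell H \<and>
    (\<exists>\<beta> \<in> Cell H. dom2 H \<beta> = cod2 H \<alpha> \<and> cod2 H \<beta> = dom2 H \<alpha> \<and>
      \<beta> \<bullet>\<^bsub>H\<^esub> \<alpha> = id2 H (dom2 H \<alpha>) \<and> \<alpha> \<bullet>\<^bsub>H\<^esub> \<beta> = id2 H (cod2 H \<alpha>))"

definition isomorphic1 :: "('o, 'm, 'c) twocat \<Rightarrow> 'm \<Rightarrow> 'm \<Rightarrow> bool" where
  "isomorphic1 H f g \<longleftrightarrow> (\<exists>\<alpha>. iso2 H \<alpha> \<and> dom2 H \<alpha> = f \<and> cod2 H \<alpha> = g)"

definition equivalence1 :: "('o, 'm, 'c) twocat \<Rightarrow> 'm \<Rightarrow> 'o \<Rightarrow> 'o \<Rightarrow> bool" where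
  "equivalence1 H f X Y \<longleftrightarrow> f \<in> Mor H \<and> src H f = X \<and> trg H f = Y \<and>
    (\<exists>g \<in> Mor H. src H g = Y \<and> trg H g = X \<and>
      isomorphic1 H (g \<odot>\<^bsub>H\<^esub> f) (id1 H X) \<and> isomorphic1 H (f \<odot>\<^bsub>H\<^esub> g) (id1 H Y))"

text \<open>The dual reversing 1-cells but not 2-cells.\<close>

definition op2 :: "('o, 'm, 'c) twocat \<Rightarrow> ('o, 'm, 'c) twocat" where
  "op2 H = H\<lparr>src := trg H, trg := src H,
    comp1 := (\<lambda>g f. f \<odot>\<^bsub>H\<^esub> g), hcomp := (\<lambda>\<beta> \<alpha>. \<alpha> \<star>\<^bsub>H\<^esub> \<beta>)\<rparr>"


section \<open>The 2-category of categories\<close>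

record ('o, 'a) fnct =
  fdom :: "('o, 'a) cat"
  fcod :: "('o, 'a) cat"
  fobj :: "'o \<Rightarrow> 'o"
  farr :: "'a \<Rightarrow> 'a"

locale fnctr =
  fixes F :: "('o, 'a) fnct"
  assumes category_fdom: "category (fdom F)"
    and category_fcod: "category (fcod F)"
    and fobj_ext: "fobj F \<in> extensional (Obj (fdom F))"
    and farr_ext: "farr F \<in> extensional (Arr (fdom F))"
    and fobj_Obj: "x \<in> Obj (fdom F) \<Longrightarrow> fobj F x \<in> Obj (fcod F)"
    and farr_Arr: "f \<in> Arr (fdom F) \<Longrightarrow> farr F f \<in> Arr (fcod F)"
    and Dom_farr: "f \<in> Arr (fdom F) \<Longrightarrow> Dom (fcod F) (farr F f) = fobj F (Dom (fdom F) f)"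
    and Cod_farr: "f \<in> Arr (fdom F) \<Longrightarrow> Cod (fcod F) (farr F f) = fobj F (Cod (fdom F) f)"
    and farr_Idn: "x \<in> Obj (fdom F) \<Longrightarrow> farr F (Idn (fdom F) x) = Idn (fcod F) (fobj F x)"
    and farr_Cmp: "\<lbrakk>f \<in> Arr (fdom F); g \<in> Arr (fdom F); Dom (fdom F) g = Cod (fdom F) f\<rbrakk>
      \<Longrightarrow> farr F (Cmp (fdom F) g f) = Cmp (fcod F) (farr F g) (farr F f)"

record ('o, 'a) ntr =
  ndom :: "('o, 'a) fnct"
  ncod :: "('o, 'a) fnct"
  ncmp :: "'o \<Rightarrow> 'a"

locale nat_trans =
  fixes \<tau> :: "('o, 'a) ntr"
  assumes fnctr_ndom: "fnctr (ndom \<tau>)"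
    and fnctr_ncod: "fnctr (ncod \<tau>)"
    and fdom_ncod: "fdom (ncod \<tau>) = fdom (ndom \<tau>)"
    and fcod_ncod: "fcod (ncod \<tau>) = fcod (ndom \<tau>)"
    and ncmp_ext: "ncmp \<tau> \<in> extensional (Obj (fdom (ndom \<tau>)))"
    and ncmp_Arr: "x \<in> Obj (fdom (ndom \<tau>)) \<Longrightarrow> ncmp \<tau> x \<in> Arr (fcod (ndom \<tau>))"
    and Dom_ncmp: "x \<in> Obj (fdom (ndom \<tau>))
      \<Longrightarrow> Dom (fcod (ndom \<tau>)) (ncmp \<tau> x) = fobj (ndom \<tau>) x"
    and Cod_ncmp: "x \<in> Obj (fdom (ndom \<tau>))
      \<Longrightarrow> Cod (fcod (ndom \<tau>)) (ncmp \<tau> x) = fobj (ncod \<tau>) x"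
    and ncmp_natural: "f \<in> Arr (fdom (ndom \<tau>))
      \<Longrightarrow> Cmp (fcod (ndom \<tau>)) (ncmp \<tau> (Cod (fdom (ndom \<tau>)) f)) (farr (ndom \<tau>) f)
        = Cmp (fcod (ndom \<tau>)) (farr (ncod \<tau>) f) (ncmp \<tau> (Dom (fdom (ndom \<tau>)) f))"

definition fnct_id :: "('o, 'a) cat \<Rightarrow> ('o, 'a) fnct" where
  "fnct_id C = \<lparr>fdom = C, fcod = C, fobj = (\<lambda>x \<in> Obj C. x), farr = (\<lambda>f \<in> Arr C. f)\<rparr>"

definition fnct_comp :: "('o, 'a) fnct \<Rightarrow> ('o, 'a) fnct \<Rightarrow> ('o, 'a) fnct" where
  "fnct_comp G F = \<lparr>fdom = fdom F, fcod = fcod G,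
    fobj = (\<lambda>x \<in> Obj (fdom F). fobj G (fobj F x)),
    farr = (\<lambda>f \<in> Arr (fdom F). farr G (farr F f))\<rparr>"

definition ntr_id :: "('o, 'a) fnct \<Rightarrow> ('o, 'a) ntr" where
  "ntr_id F = \<lparr>ndom = F, ncod = F, ncmp = (\<lambda>x \<in> Obj (fdom F). Idn (fcod F) (fobj F x))\<rparr>"

definition ntr_vcomp :: "('o, 'a) ntr \<Rightarrow> ('o, 'a) ntr \<Rightarrow> ('o, 'a) ntr" where
  "ntr_vcomp \<tau> \<sigma> = \<lparr>ndom = ndom \<sigma>, ncod = ncod \<tau>,
    ncmp = (\<lambda>x \<in> Obj (fdom (ndom \<sigma>)). Cmp (fcod (ndom \<sigma>)) (ncmp \<tau> x) (ncmp \<sigma> x))\<rparr>"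

definition ntr_hcomp :: "('o, 'a) ntr \<Rightarrow> ('o, 'a) ntr \<Rightarrow> ('o, 'a) ntr" where
  "ntr_hcomp \<tau> \<sigma> =
    \<lparr>ndom = fnct_comp (ndom \<tau>) (ndom \<sigma>), ncod = fnct_comp (ncod \<tau>) (ncod \<sigma>),
     ncmp = (\<lambda>x \<in> Obj (fdom (ndom \<sigma>)).
       Cmp (fcod (ndom \<tau>)) (ncmp \<tau> (fobj (ncod \<sigma>) x)) (farr (ndom \<tau>) (ncmp \<sigma> x)))\<rparr>"

text \<open>All categories whose objects and arrows are elements of the types \<open>'o\<close> and \<open>'a\<close>.\<close>

definition CAT :: "(('o, 'a) cat, ('o, 'a) fnct, ('o, 'a) ntr) twocat" where
  "CAT = \<lparr>Ob = {C. category C}, Mor = {F. fnctr F}, Cell = {\<tau>. nat_trans \<tau>},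
    src = fdom, trg = fcod, dom2 = ndom, cod2 = ncod,
    id1 = fnct_id, comp1 = fnct_comp, id2 = ntr_id, vcomp = ntr_vcomp, hcomp = ntr_hcomp\<rparr>"


section \<open>Pseudofunctors, pseudonatural transformations, modifications\<close>

text \<open>
  For a pseudofunctor \<open>F\<close>, \<open>psfc F g f : F g \<odot> F f \<Rightarrow> F (g \<odot> f)\<close> and
  \<open>psfu F a : id (F a) \<Rightarrow> F (id a)\<close> are the structure 2-cells.
\<close>

record ('o, 'm, 'c, 'p, 'n, 'd) psf =
  psf0 :: "'o \<Rightarrow> 'p"
  psf1 :: "'m \<Rightarrow> 'n"
  psf2 :: "'c \<Rightarrow> 'd"
  psfc :: "'m \<Rightarrow> 'm \<Rightarrow> 'd"
  psfu :: "'o \<Rightarrow> 'd"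

definition composable :: "('o, 'm, 'c) twocat \<Rightarrow> 'm \<Rightarrow> 'm \<Rightarrow> bool" where
  "composable A g f \<longleftrightarrow> f \<in> Mor A \<and> g \<in> Mor A \<and> src A g = trg A f"

locale pseudofunctor =
  fixes A :: "('o, 'm, 'c) twocat" and H :: "('p, 'n, 'd) twocat"
    and F :: "('o, 'm, 'c, 'p, 'n, 'd) psf"
  assumes two_category_A: "two_category A"
    and two_category_H: "two_category H"
    and psf0_ext: "psf0 F \<in> extensional (Ob A)"
    and psf1_ext: "psf1 F \<in> extensional (Mor A)"
    and psf2_ext: "psf2 F \<in> extensional (Cell A)"
    and psfc_ext: "\<not> composable A g f \<Longrightarrow> psfc F g f = undefined"
    and psfu_ext: "psfu F \<in> extensional (Ob A)"
    and psf0_Ob: "a \<in> Ob A \<Longrightarrow> psf0 F a \<in> Ob H"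
    and psf1_Mor: "f \<in> Mor A \<Longrightarrow> psf1 F f \<in> Mor H"
    and src_psf1: "f \<in> Mor A \<Longrightarrow> src H (psf1 F f) = psf0 F (src A f)"
    and trg_psf1: "f \<in> Mor A \<Longrightarrow> trg H (psf1 F f) = psf0 F (trg A f)"
    and psf2_Cell: "x \<in> Cell A \<Longrightarrow> psf2 F x \<in> Cell H"
    and dom2_psf2: "x \<in> Cell A \<Longrightarrow> dom2 H (psf2 F x) = psf1 F (dom2 A x)"
    and cod2_psf2: "x \<in> Cell A \<Longrightarrow> cod2 H (psf2 F x) = psf1 F (cod2 A x)"
    and psf2_id2: "f \<in> Mor A \<Longrightarrow> psf2 F (id2 A f) = id2 H (psf1 F f)"
    and psf2_vcomp: "\<lbrakk>x \<in> Cell A; y \<in> Cell A; dom2 A y = cod2 A x\<rbrakk>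
      \<Longrightarrow> psf2 F (y \<bullet>\<^bsub>A\<^esub> x) = psf2 F y \<bullet>\<^bsub>H\<^esub> psf2 F x"
    and psfc_iso: "composable A g f \<Longrightarrow> iso2 H (psfc F g f)"
    and dom2_psfc: "composable A g f \<Longrightarrow> dom2 H (psfc F g f) = psf1 F g \<odot>\<^bsub>H\<^esub> psf1 F f"
    and cod2_psfc: "composable A g f \<Longrightarrow> cod2 H (psfc F g f) = psf1 F (g \<odot>\<^bsub>A\<^esub> f)"
    and psfu_iso: "a \<in> Ob A \<Longrightarrow> iso2 H (psfu F a)"
    and dom2_psfu: "a \<in> Ob A \<Longrightarrow> dom2 H (psfu F a) = id1 H (psf0 F a)"
    and cod2_psfu: "a \<in> Ob A \<Longrightarrow> cod2 H (psfu F a) = psf1 F (id1 A a)"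
    and psfc_natural: "\<lbrakk>x \<in> Cell A; y \<in> Cell A; src A (dom2 A y) = trg A (dom2 A x)\<rbrakk>
      \<Longrightarrow> psf2 F (y \<star>\<^bsub>A\<^esub> x) \<bullet>\<^bsub>H\<^esub> psfc F (dom2 A y) (dom2 A x)
        = psfc F (cod2 A y) (cod2 A x) \<bullet>\<^bsub>H\<^esub> (psf2 F y \<star>\<^bsub>H\<^esub> psf2 F x)"
    and psfc_assoc: "\<lbrakk>composable A g f; composable A h g\<rbrakk>
      \<Longrightarrow> psfc F (h \<odot>\<^bsub>A\<^esub> g) f \<bullet>\<^bsub>H\<^esub> (psfc F h g \<star>\<^bsub>H\<^esub> id2 H (psf1 F f))
        = psfc F h (g \<odot>\<^bsub>A\<^esub> f) \<bullet>\<^bsub>H\<^esub> (id2 H (psf1 F h) \<star>\<^bsub>H\<^esub> psfc F g f)"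
    and psfc_unit_right: "f \<in> Mor A
      \<Longrightarrow> psfc F f (id1 A (src A f)) \<bullet>\<^bsub>H\<^esub> (id2 H (psf1 F f) \<star>\<^bsub>H\<^esub> psfu F (src A f)) = id2 H (psf1 F f)"
    and psfc_unit_left: "f \<in> Mor A
      \<Longrightarrow> psfc F (id1 A (trg A f)) f \<bullet>\<^bsub>H\<^esub> (psfu F (trg A f) \<star>\<^bsub>H\<^esub> id2 H (psf1 F f)) = id2 H (psf1 F f)"

text \<open>
  For a pseudonatural transformation \<open>\<alpha> : F \<rightarrow> G\<close> and \<open>f : a \<rightarrow> b\<close>, the 2-cell
  \<open>pnt2 \<alpha> f\<close> goes from \<open>G f \<odot> \<alpha> a\<close> to \<open>\<alpha> b \<odot> F f\<close>.
\<close>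

record ('o, 'm, 'c, 'p, 'n, 'd) pnt =
  pdom :: "('o, 'm, 'c, 'p, 'n, 'd) psf"
  pcod :: "('o, 'm, 'c, 'p, 'n, 'd) psf"
  pnt1 :: "'o \<Rightarrow> 'n"
  pnt2 :: "'m \<Rightarrow> 'd"

locale pseudonatural =
  fixes A :: "('o, 'm, 'c) twocat" and H :: "('p, 'n, 'd) twocat"
    and \<alpha> :: "('o, 'm, 'c, 'p, 'n, 'd) pnt"
  assumes pseudofunctor_pdom: "pseudofunctor A H (pdom \<alpha>)"
    and pseudofunctor_pcod: "pseudofunctor A H (pcod \<alpha>)"
    and pnt1_ext: "pnt1 \<alpha> \<in> extensional (Ob A)"
    and pnt2_ext: "pnt2 \<alpha> \<in> extensional (Mor A)"
    and pnt1_Mor: "a \<in> Ob A \<Longrightarrow> pnt1 \<alpha> a \<in> Mor H"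
    and src_pnt1: "a \<in> Ob A \<Longrightarrow> src H (pnt1 \<alpha> a) = psf0 (pdom \<alpha>) a"
    and trg_pnt1: "a \<in> Ob A \<Longrightarrow> trg H (pnt1 \<alpha> a) = psf0 (pcod \<alpha>) a"
    and pnt2_iso: "f \<in> Mor A \<Longrightarrow> iso2 H (pnt2 \<alpha> f)"
    and dom2_pnt2: "f \<in> Mor A
      \<Longrightarrow> dom2 H (pnt2 \<alpha> f) = psf1 (pcod \<alpha>) f \<odot>\<^bsub>H\<^esub> pnt1 \<alpha> (src A f)"
    and cod2_pnt2: "f \<in> Mor A
      \<Longrightarrow> cod2 H (pnt2 \<alpha> f) = pnt1 \<alpha> (trg A f) \<odot>\<^bsub>H\<^esub> psf1 (pdom \<alpha>) f"
    and pnt2_natural: "x \<in> Cell A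
      \<Longrightarrow> pnt2 \<alpha> (cod2 A x) \<bullet>\<^bsub>H\<^esub> (psf2 (pcod \<alpha>) x \<star>\<^bsub>H\<^esub> id2 H (pnt1 \<alpha> (src A (dom2 A x))))
        = (id2 H (pnt1 \<alpha> (trg A (dom2 A x))) \<star>\<^bsub>H\<^esub> psf2 (pdom \<alpha>) x) \<bullet>\<^bsub>H\<^esub> pnt2 \<alpha> (dom2 A x)"
    and pnt2_comp1: "composable A g f
      \<Longrightarrow> pnt2 \<alpha> (g \<odot>\<^bsub>A\<^esub> f) \<bullet>\<^bsub>H\<^esub> (psfc (pcod \<alpha>) g f \<star>\<^bsub>H\<^esub> id2 H (pnt1 \<alpha> (src A f)))
        = (id2 H (pnt1 \<alpha> (trg A g)) \<star>\<^bsub>H\<^esub> psfc (pdom \<alpha>) g f) \<bullet>\<^bsub>H\<^esub>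
          (pnt2 \<alpha> g \<star>\<^bsub>H\<^esub> id2 H (psf1 (pdom \<alpha>) f)) \<bullet>\<^bsub>H\<^esub>
          (id2 H (psf1 (pcod \<alpha>) g) \<star>\<^bsub>H\<^esub> pnt2 \<alpha> f)"
    and pnt2_id1: "a \<in> Ob A
      \<Longrightarrow> pnt2 \<alpha> (id1 A a) \<bullet>\<^bsub>H\<^esub> (psfu (pcod \<alpha>) a \<star>\<^bsub>H\<^esub> id2 H (pnt1 \<alpha> a))
        = id2 H (pnt1 \<alpha> a) \<star>\<^bsub>H\<^esub> psfu (pdom \<alpha>) a"

record ('o, 'm, 'c, 'p, 'n, 'd) mdf =
  mdom :: "('o, 'm, 'c, 'p, 'n, 'd) pnt"
  mcod :: "('o, 'm, 'c, 'p, 'n, 'd) pnt"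
  mdf2 :: "'o \<Rightarrow> 'd"

locale modification =
  fixes A :: "('o, 'm, 'c) twocat" and H :: "('p, 'n, 'd) twocat"
    and \<Gamma> :: "('o, 'm, 'c, 'p, 'n, 'd) mdf"
  assumes pseudonatural_mdom: "pseudonatural A H (mdom \<Gamma>)"
    and pseudonatural_mcod: "pseudonatural A H (mcod \<Gamma>)"
    and pdom_mcod: "pdom (mcod \<Gamma>) = pdom (mdom \<Gamma>)"
    and pcod_mcod: "pcod (mcod \<Gamma>) = pcod (mdom \<Gamma>)"
    and mdf2_ext: "mdf2 \<Gamma> \<in> extensional (Ob A)"
    and mdf2_Cell: "a \<in> Ob A \<Longrightarrow> mdf2 \<Gamma> a \<in> Cell H"
    and dom2_mdf2: "a \<in> Ob A \<Longrightarrow> dom2 H (mdf2 \<Gamma> a) = pnt1 (mdom \<Gamma>) a"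
    and cod2_mdf2: "a \<in> Ob A \<Longrightarrow> cod2 H (mdf2 \<Gamma> a) = pnt1 (mcod \<Gamma>) a"
    and mdf2_natural: "f \<in> Mor A
      \<Longrightarrow> pnt2 (mcod \<Gamma>) f \<bullet>\<^bsub>H\<^esub> (id2 H (psf1 (pcod (mdom \<Gamma>)) f) \<star>\<^bsub>H\<^esub> mdf2 \<Gamma> (src A f))
        = (mdf2 \<Gamma> (trg A f) \<star>\<^bsub>H\<^esub> id2 H (psf1 (pdom (mdom \<Gamma>)) f)) \<bullet>\<^bsub>H\<^esub> pnt2 (mdom \<Gamma>) f"

definition pnt_id ::
  "('o, 'm, 'c) twocat \<Rightarrow> ('p, 'n, 'd) twocat \<Rightarrow>
   ('o, 'm, 'c, 'p, 'n, 'd) psf \<Rightarrow> ('o, 'm, 'c, 'p, 'n, 'd) pnt" where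
  "pnt_id A H F = \<lparr>pdom = F, pcod = F,
    pnt1 = (\<lambda>a \<in> Ob A. id1 H (psf0 F a)), pnt2 = (\<lambda>f \<in> Mor A. id2 H (psf1 F f))\<rparr>"

definition pnt_comp ::
  "('o, 'm, 'c) twocat \<Rightarrow> ('p, 'n, 'd) twocat \<Rightarrow> ('o, 'm, 'c, 'p, 'n, 'd) pnt \<Rightarrow>
   ('o, 'm, 'c, 'p, 'n, 'd) pnt \<Rightarrow> ('o, 'm, 'c, 'p, 'n, 'd) pnt" where
  "pnt_comp A H \<beta> \<alpha> = \<lparr>pdom = pdom \<alpha>, pcod = pcod \<beta>,
    pnt1 = (\<lambda>a \<in> Ob A. pnt1 \<beta> a \<odot>\<^bsub>H\<^esub> pnt1 \<alpha> a),
    pnt2 = (\<lambda>f \<in> Mor A. (id2 H (pnt1 \<beta> (trg A f)) \<star>\<^bsub>H\<^esub> pnt2 \<alpha> f) \<bullet>\<^bsub>H\<^esub>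
                        (pnt2 \<beta> f \<star>\<^bsub>H\<^esub> id2 H (pnt1 \<alpha> (src A f))))\<rparr>"

definition mdf_id ::
  "('o, 'm, 'c) twocat \<Rightarrow> ('p, 'n, 'd) twocat \<Rightarrow>
   ('o, 'm, 'c, 'p, 'n, 'd) pnt \<Rightarrow> ('o, 'm, 'c, 'p, 'n, 'd) mdf" where
  "mdf_id A H \<alpha> = \<lparr>mdom = \<alpha>, mcod = \<alpha>, mdf2 = (\<lambda>a \<in> Ob A. id2 H (pnt1 \<alpha> a))\<rparr>"

definition mdf_vcomp ::
  "('o, 'm, 'c) twocat \<Rightarrow> ('p, 'n, 'd) twocat \<Rightarrow> ('o, 'm, 'c, 'p, 'n, 'd) mdf \<Rightarrow>
   ('o, 'm, 'c, 'p, 'n, 'd) mdf \<Rightarrow> ('o, 'm, 'c, 'p, 'n, 'd) mdf" where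
  "mdf_vcomp A H \<Delta> \<Gamma> = \<lparr>mdom = mdom \<Gamma>, mcod = mcod \<Delta>,
    mdf2 = (\<lambda>a \<in> Ob A. mdf2 \<Delta> a \<bullet>\<^bsub>H\<^esub> mdf2 \<Gamma> a)\<rparr>"

definition mdf_hcomp ::
  "('o, 'm, 'c) twocat \<Rightarrow> ('p, 'n, 'd) twocat \<Rightarrow> ('o, 'm, 'c, 'p, 'n, 'd) mdf \<Rightarrow>
   ('o, 'm, 'c, 'p, 'n, 'd) mdf \<Rightarrow> ('o, 'm, 'c, 'p, 'n, 'd) mdf" where
  "mdf_hcomp A H \<Delta> \<Gamma> =
    \<lparr>mdom = pnt_comp A H (mdom \<Delta>) (mdom \<Gamma>), mcod = pnt_comp A H (mcod \<Delta>) (mcod \<Gamma>),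
     mdf2 = (\<lambda>a \<in> Ob A. mdf2 \<Delta> a \<star>\<^bsub>H\<^esub> mdf2 \<Gamma> a)\<rparr>"

definition PS ::
  "('o, 'm, 'c) twocat \<Rightarrow> ('p, 'n, 'd) twocat \<Rightarrow>
   (('o, 'm, 'c, 'p, 'n, 'd) psf, ('o, 'm, 'c, 'p, 'n, 'd) pnt, ('o, 'm, 'c, 'p, 'n, 'd) mdf) twocat"
  where
  "PS A H = \<lparr>Ob = {F. pseudofunctor A H F}, Mor = {\<alpha>. pseudonatural A H \<alpha>},
    Cell = {\<Gamma>. modification A H \<Gamma>},
    src = pdom, trg = pcod, dom2 = mdom, cod2 = mcod,
    id1 = pnt_id A H, comp1 = pnt_comp A H,
    id2 = mdf_id A H, vcomp = mdf_vcomp A H, hcomp = mdf_hcomp A H\<rparr>"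


section \<open>Operations on pseudofunctors\<close>

definition psf_comp ::
  "('o, 'm, 'c) twocat \<Rightarrow> ('q, 'k, 'e) twocat \<Rightarrow> ('p, 'n, 'd, 'q, 'k, 'e) psf \<Rightarrow>
   ('o, 'm, 'c, 'p, 'n, 'd) psf \<Rightarrow> ('o, 'm, 'c, 'q, 'k, 'e) psf" where
  "psf_comp A K G F =
    \<lparr>psf0 = (\<lambda>a \<in> Ob A. psf0 G (psf0 F a)),
     psf1 = (\<lambda>f \<in> Mor A. psf1 G (psf1 F f)),
     psf2 = (\<lambda>x \<in> Cell A. psf2 G (psf2 F x)),
     psfc = (\<lambda>g f. if composable A g f
       then psf2 G (psfc F g f) \<bullet>\<^bsub>K\<^esub> psfc G (psf1 F g) (psf1 F f) else undefined),
     psfu = (\<lambda>a \<in> Ob A. psf2 G (psfu F a) \<bullet>\<^bsub>K\<^esub> psfu G (psf0 F a))\<rparr>"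

text \<open>\<open>F : A \<rightarrow> H\<close> regarded as a pseudofunctor \<open>op2 A \<rightarrow> op2 H\<close>.\<close>

definition psf_op :: "('o, 'm, 'c, 'p, 'n, 'd) psf \<Rightarrow> ('o, 'm, 'c, 'p, 'n, 'd) psf" where
  "psf_op F = F\<lparr>psfc := (\<lambda>g f. psfc F f g)\<rparr>"

text \<open>A (strict) 2-functor, given by its action on cells, as a pseudofunctor.\<close>

definition strict_psf ::
  "('o, 'm, 'c) twocat \<Rightarrow> ('p, 'n, 'd) twocat \<Rightarrow> ('o \<Rightarrow> 'p) \<Rightarrow> ('m \<Rightarrow> 'n) \<Rightarrow> ('c \<Rightarrow> 'd) \<Rightarrow>
   ('o, 'm, 'c, 'p, 'n, 'd) psf" where
  "strict_psf A H F0 F1 F2 =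
    \<lparr>psf0 = restrict F0 (Ob A), psf1 = restrict F1 (Mor A), psf2 = restrict F2 (Cell A),
     psfc = (\<lambda>g f. if composable A g f then id2 H (F1 (g \<odot>\<^bsub>A\<^esub> f)) else undefined),
     psfu = (\<lambda>a \<in> Ob A. id2 H (F1 (id1 A a)))\<rparr>"

text \<open>The covariant representable 2-functor \<open>K(X, -) : K \<rightarrow> CAT\<close>.\<close>

definition rep_fnct :: "('o, 'm, 'c) twocat \<Rightarrow> 'o \<Rightarrow> 'm \<Rightarrow> ('m, 'c) fnct" where
  "rep_fnct K X g = \<lparr>fdom = homcat K X (src K g), fcod = homcat K X (trg K g),
    fobj = (\<lambda>h \<in> Obj (homcat K X (src K g)). g \<odot>\<^bsub>K\<^esub> h),
    farr = (\<lambda>\<theta> \<in> Arr (homcat K X (src K g)). id2 K g \<star>\<^bsub>K\<^esub> \<theta>)\<rparr>"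

definition rep_ntr :: "('o, 'm, 'c) twocat \<Rightarrow> 'o \<Rightarrow> 'c \<Rightarrow> ('m, 'c) ntr" where
  "rep_ntr K X \<xi> = \<lparr>ndom = rep_fnct K X (dom2 K \<xi>), ncod = rep_fnct K X (cod2 K \<xi>),
    ncmp = (\<lambda>h \<in> Obj (homcat K X (src K (dom2 K \<xi>))). \<xi> \<star>\<^bsub>K\<^esub> id2 K h)\<rparr>"

definition rep ::
  "('o, 'm, 'c) twocat \<Rightarrow> 'o \<Rightarrow> ('o, 'm, 'c, ('m, 'c) cat, ('m, 'c) fnct, ('m, 'c) ntr) psf" where
  "rep K X = strict_psf K CAT (homcat K X) (rep_fnct K X) (rep_ntr K X)"

text \<open>
  The Yoneda 2-functor \<open>op2 K \<rightarrow> PS K CAT\<close>, \<open>X \<mapsto> K(X, -)\<close>.  Applied to \<open>op2 K\<close> it is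
  \<open>K \<rightarrow> PS (op2 K) CAT\<close>, \<open>Y \<mapsto> K(-, Y)\<close>, since \<open>rep (op2 K) Y\<close> is \<open>K(-, Y)\<close>.
\<close>

definition yon_fnct :: "('o, 'm, 'c) twocat \<Rightarrow> 'm \<Rightarrow> 'o \<Rightarrow> ('m, 'c) fnct" where
  "yon_fnct K f Y = \<lparr>fdom = homcat K (trg K f) Y, fcod = homcat K (src K f) Y,
    fobj = (\<lambda>h \<in> Obj (homcat K (trg K f) Y). h \<odot>\<^bsub>K\<^esub> f),
    farr = (\<lambda>\<theta> \<in> Arr (homcat K (trg K f) Y). \<theta> \<star>\<^bsub>K\<^esub> id2 K f)\<rparr>"

definition yon_ntr :: "('o, 'm, 'c) twocat \<Rightarrow> 'c \<Rightarrow> 'o \<Rightarrow> ('m, 'c) ntr" where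
  "yon_ntr K \<xi> Y = \<lparr>ndom = yon_fnct K (dom2 K \<xi>) Y, ncod = yon_fnct K (cod2 K \<xi>) Y,
    ncmp = (\<lambda>h \<in> Obj (homcat K (trg K (dom2 K \<xi>)) Y). id2 K h \<star>\<^bsub>K\<^esub> \<xi>)\<rparr>"

definition yon_pnt ::
  "('o, 'm, 'c) twocat \<Rightarrow> 'm \<Rightarrow> ('o, 'm, 'c, ('m, 'c) cat, ('m, 'c) fnct, ('m, 'c) ntr) pnt" where
  "yon_pnt K f = \<lparr>pdom = rep K (trg K f), pcod = rep K (src K f),
    pnt1 = (\<lambda>Y \<in> Ob K. yon_fnct K f Y),
    pnt2 = (\<lambda>g \<in> Mor K. ntr_id (fnct_comp (rep_fnct K (src K f) g) (yon_fnct K f (src K g))))\<rparr>"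

definition yon_mdf ::
  "('o, 'm, 'c) twocat \<Rightarrow> 'c \<Rightarrow> ('o, 'm, 'c, ('m, 'c) cat, ('m, 'c) fnct, ('m, 'c) ntr) mdf" where
  "yon_mdf K \<xi> = \<lparr>mdom = yon_pnt K (dom2 K \<xi>), mcod = yon_pnt K (cod2 K \<xi>),
    mdf2 = (\<lambda>Y \<in> Ob K. yon_ntr K \<xi> Y)\<rparr>"

definition yon ::
  "('o, 'm, 'c) twocat \<Rightarrow>
   ('o, 'm, 'c,
    ('o, 'm, 'c, ('m, 'c) cat, ('m, 'c) fnct, ('m, 'c) ntr) psf,
    ('o, 'm, 'c, ('m, 'c) cat, ('m, 'c) fnct, ('m, 'c) ntr) pnt,
    ('o, 'm, 'c, ('m, 'c) cat, ('m, 'c) fnct, ('m, 'c) ntr) mdf) psf" where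
  "yon K = strict_psf (op2 K) (PS K CAT) (rep K) (yon_pnt K) (yon_mdf K)"

text \<open>Precomposition with \<open>t : A \<rightarrow> B\<close> as a 2-functor \<open>PS B H \<rightarrow> PS A H\<close>.\<close>

definition pnt_pre ::
  "('a, 'f, 'x) twocat \<Rightarrow> ('p, 'n, 'd) twocat \<Rightarrow> ('a, 'f, 'x, 'o, 'm, 'c) psf \<Rightarrow>
   ('o, 'm, 'c, 'p, 'n, 'd) pnt \<Rightarrow> ('a, 'f, 'x, 'p, 'n, 'd) pnt" where
  "pnt_pre A H t \<alpha> = \<lparr>pdom = psf_comp A H (pdom \<alpha>) t, pcod = psf_comp A H (pcod \<alpha>) t,
    pnt1 = (\<lambda>a \<in> Ob A. pnt1 \<alpha> (psf0 t a)), pnt2 = (\<lambda>f \<in> Mor A. pnt2 \<alpha> (psf1 t f))\<rparr>"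

definition mdf_pre ::
  "('a, 'f, 'x) twocat \<Rightarrow> ('p, 'n, 'd) twocat \<Rightarrow> ('a, 'f, 'x, 'o, 'm, 'c) psf \<Rightarrow>
   ('o, 'm, 'c, 'p, 'n, 'd) mdf \<Rightarrow> ('a, 'f, 'x, 'p, 'n, 'd) mdf" where
  "mdf_pre A H t \<Gamma> = \<lparr>mdom = pnt_pre A H t (mdom \<Gamma>), mcod = pnt_pre A H t (mcod \<Gamma>),
    mdf2 = (\<lambda>a \<in> Ob A. mdf2 \<Gamma> (psf0 t a))\<rparr>"

definition precomp ::
  "('a, 'f, 'x) twocat \<Rightarrow> ('o, 'm, 'c) twocat \<Rightarrow> ('p, 'n, 'd) twocat \<Rightarrow>
   ('a, 'f, 'x, 'o, 'm, 'c) psf \<Rightarrow>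
   (('o, 'm, 'c, 'p, 'n, 'd) psf, ('o, 'm, 'c, 'p, 'n, 'd) pnt, ('o, 'm, 'c, 'p, 'n, 'd) mdf,
    ('a, 'f, 'x, 'p, 'n, 'd) psf, ('a, 'f, 'x, 'p, 'n, 'd) pnt, ('a, 'f, 'x, 'p, 'n, 'd) mdf) psf"
  where
  "precomp A B H t = strict_psf (PS B H) (PS A H)
    (\<lambda>F. psf_comp A H F t) (pnt_pre A H t) (mdf_pre A H t)"

text \<open>
  Postcomposition with a strict 2-functor \<open>K : H \<rightarrow> M\<close> as a 2-functor \<open>PS A H \<rightarrow> PS A M\<close>.
  (For a general pseudofunctor \<open>K\<close>, \<open>pnt2\<close> would have to be conjugated with \<open>psfc K\<close>.)
\<close>

definition pnt_post ::
  "('a, 'f, 'x) twocat \<Rightarrow> ('p, 'n, 'd) twocat \<Rightarrow> ('o, 'm, 'c, 'p, 'n, 'd) psf \<Rightarrow>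
   ('a, 'f, 'x, 'o, 'm, 'c) pnt \<Rightarrow> ('a, 'f, 'x, 'p, 'n, 'd) pnt" where
  "pnt_post A M K \<alpha> = \<lparr>pdom = psf_comp A M K (pdom \<alpha>), pcod = psf_comp A M K (pcod \<alpha>),
    pnt1 = (\<lambda>a \<in> Ob A. psf1 K (pnt1 \<alpha> a)), pnt2 = (\<lambda>f \<in> Mor A. psf2 K (pnt2 \<alpha> f))\<rparr>"

definition mdf_post ::
  "('a, 'f, 'x) twocat \<Rightarrow> ('p, 'n, 'd) twocat \<Rightarrow> ('o, 'm, 'c, 'p, 'n, 'd) psf \<Rightarrow>
   ('a, 'f, 'x, 'o, 'm, 'c) mdf \<Rightarrow> ('a, 'f, 'x, 'p, 'n, 'd) mdf" where
  "mdf_post A M K \<Gamma> = \<lparr>mdom = pnt_post A M K (mdom \<Gamma>), mcod = pnt_post A M K (mcod \<Gamma>),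
    mdf2 = (\<lambda>a \<in> Ob A. psf2 K (mdf2 \<Gamma> a))\<rparr>"

definition postcomp_strict ::
  "('a, 'f, 'x) twocat \<Rightarrow> ('o, 'm, 'c) twocat \<Rightarrow> ('p, 'n, 'd) twocat \<Rightarrow>
   ('o, 'm, 'c, 'p, 'n, 'd) psf \<Rightarrow>
   (('a, 'f, 'x, 'o, 'm, 'c) psf, ('a, 'f, 'x, 'o, 'm, 'c) pnt, ('a, 'f, 'x, 'o, 'm, 'c) mdf,
    ('a, 'f, 'x, 'p, 'n, 'd) psf, ('a, 'f, 'x, 'p, 'n, 'd) pnt, ('a, 'f, 'x, 'p, 'n, 'd) mdf) psf"
  where
  "postcomp_strict A H M K = strict_psf (PS A H) (PS A M)
    (psf_comp A M K) (pnt_post A M K) (mdf_post A M K)"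


section \<open>Comparing copies of CAT over different types\<close>

text \<open>
  Each pair of types has its own copy of \<open>CAT\<close>.  To speak of pseudonatural transformations between
  pseudofunctors into two different copies, both copies are embedded, as full sub-2-categories,
  into the copy over the sum types; the embeddings relabel objects and arrows along \<open>Inl\<close>
  and \<open>Inr\<close>.
\<close>

definition relabel_cat :: "('o \<Rightarrow> 'p) \<Rightarrow> ('a \<Rightarrow> 'b) \<Rightarrow> ('o, 'a) cat \<Rightarrow> ('p, 'b) cat" where
  "relabel_cat i j C = \<lparr>Obj = i ` Obj C, Arr = j ` Arr C,
    Dom = (\<lambda>f. i (Dom C (inv j f))), Cod = (\<lambda>f. i (Cod C (inv j f))),
    Idn = (\<lambda>x. j (Idn C (inv i x))), Cmp = (\<lambda>g f. j (Cmp C (inv j g) (inv j f)))\<rparr>"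

definition relabel_fnct :: "('o \<Rightarrow> 'p) \<Rightarrow> ('a \<Rightarrow> 'b) \<Rightarrow> ('o, 'a) fnct \<Rightarrow> ('p, 'b) fnct" where
  "relabel_fnct i j F =
    \<lparr>fdom = relabel_cat i j (fdom F), fcod = relabel_cat i j (fcod F),
     fobj = (\<lambda>x \<in> i ` Obj (fdom F). i (fobj F (inv i x))),
     farr = (\<lambda>f \<in> j ` Arr (fdom F). j (farr F (inv j f)))\<rparr>"

definition relabel_ntr :: "('o \<Rightarrow> 'p) \<Rightarrow> ('a \<Rightarrow> 'b) \<Rightarrow> ('o, 'a) ntr \<Rightarrow> ('p, 'b) ntr" where
  "relabel_ntr i j \<tau> =
    \<lparr>ndom = relabel_fnct i j (ndom \<tau>), ncod = relabel_fnct i j (ncod \<tau>),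
     ncmp = (\<lambda>x \<in> i ` Obj (fdom (ndom \<tau>)). j (ncmp \<tau> (inv i x)))\<rparr>"

definition relabel ::
  "('o \<Rightarrow> 'p) \<Rightarrow> ('a \<Rightarrow> 'b) \<Rightarrow>
   (('o, 'a) cat, ('o, 'a) fnct, ('o, 'a) ntr, ('p, 'b) cat, ('p, 'b) fnct, ('p, 'b) ntr) psf" where
  "relabel i j = strict_psf CAT CAT (relabel_cat i j) (relabel_fnct i j) (relabel_ntr i j)"

definition in_left ::
  "(('o, 'a) cat, ('o, 'a) fnct, ('o, 'a) ntr,
    ('o + 'p, 'a + 'b) cat, ('o + 'p, 'a + 'b) fnct, ('o + 'p, 'a + 'b) ntr) psf" where
  "in_left = relabel Inl Inl"

definition in_right ::
  "(('p, 'b) cat, ('p, 'b) fnct, ('p, 'b) ntr,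
    ('o + 'p, 'a + 'b) cat, ('o + 'p, 'a + 'b) fnct, ('o + 'p, 'a + 'b) ntr) psf" where
  "in_right = relabel Inr Inr"

text \<open>Pseudonatural equivalences between CAT-valued pseudofunctors.\<close>

definition pseudonatural_equivalence_CAT ::
  "('o, 'm, 'c) twocat \<Rightarrow>
   ('o, 'm, 'c, ('u + 'w, 'v + 'z) cat, ('u + 'w, 'v + 'z) fnct, ('u + 'w, 'v + 'z) ntr) pnt \<Rightarrow>
   ('o, 'm, 'c, ('u, 'v) cat, ('u, 'v) fnct, ('u, 'v) ntr) psf \<Rightarrow>
   ('o, 'm, 'c, ('w, 'z) cat, ('w, 'z) fnct, ('w, 'z) ntr) psf \<Rightarrow> bool" where
  "pseudonatural_equivalence_CAT K \<phi> F G \<longleftrightarrow>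
    equivalence1 (PS K CAT) \<phi> (psf_comp K CAT in_left F) (psf_comp K CAT in_right G)"


section \<open>Weighted bilimits\<close>

text \<open>\<open>X \<mapsto> H(X, \<A>-)\<close>, as a 2-functor \<open>op2 H \<rightarrow> PS A CAT\<close>.\<close>

definition yon_along where
  "yon_along A H \<A> = psf_comp (op2 H) (PS A CAT) (precomp A H CAT \<A>) (yon H)"

text \<open>
  \<open>X \<mapsto> [A, CAT](\<W>, H(X, \<A>-))\<close>, as a 2-functor \<open>op2 H \<rightarrow> CAT\<close>.  Here \<open>\<W>\<close> and \<open>H(X, \<A>-)\<close> are
  taken into a common copy of \<open>CAT\<close> by \<open>in_left\<close> and \<open>in_right\<close>.
\<close>

definition hom_along where
  "hom_along A H \<A> =
    psf_comp (op2 H) (PS A CAT) (postcomp_strict A CAT CAT in_right) (yon_along A H \<A>)"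

definition cones where
  "cones A H \<W> \<A> =
    psf_comp (op2 H) CAT (rep (PS A CAT) (psf_comp A CAT in_left \<W>)) (hom_along A H \<A>)"

text \<open>\<open>L\<close>, endowed with the equivalence \<open>\<phi> : H(-, L) \<simeq> [A, CAT](\<W>, H(-, \<A>))\<close>, is
  the weighted bilimit.\<close>

definition weighted_bilimit where
  "weighted_bilimit A H \<W> \<A> L \<phi> \<longleftrightarrow>
    L \<in> Ob H \<and> pseudonatural_equivalence_CAT (op2 H) \<phi> (rep (op2 H) L) (cones A H \<W> \<A>)"

text \<open>
  The dependence of weighted bilimits on the weight: for a family of weights
  \<open>\<V> : op2 B \<rightarrow> PS A CAT\<close>, the assignment \<open>b \<mapsto> [A, CAT](\<V> b, H(-, \<A>-))\<close>
  is a 2-functor \<open>B \<rightarrow> PS (op2 H) CAT\<close>.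
\<close>

definition cones_family where
  "cones_family A B H \<V> \<A> =
    (let W = psf_comp (op2 B) (PS A CAT) (postcomp_strict A CAT CAT in_left) \<V>
     in psf_comp B (PS (op2 H) CAT) (precomp (op2 H) (PS A CAT) CAT (hom_along A H \<A>))
          (psf_comp B (PS (PS A CAT) CAT) (yon (PS A CAT)) (psf_op W)))"

text \<open>
  \<open>L : B \<rightarrow> H\<close> is the pseudofunctor \<open>b \<mapsto> bilim(\<V> b, \<A>)\<close>: there is an equivalence
  \<open>\<Phi> : H(X, L b) \<simeq> [A, CAT](\<V> b, H(X, \<A>-))\<close> pseudonatural in \<open>X\<close> and \<open>b\<close>.
\<close>

definition weighted_bilimit_psf where
  "weighted_bilimit_psf A B H \<V> \<A> L \<Phi> \<longleftrightarrow> pseudofunctor B H L \<and>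
    equivalence1 (PS B (PS (op2 H) CAT)) \<Phi>
      (psf_comp B (PS (op2 H) CAT) (postcomp_strict (op2 H) CAT CAT in_left)
        (psf_comp B (PS (op2 H) CAT) (yon (op2 H)) L))
      (psf_comp B (PS (op2 H) CAT) (postcomp_strict (op2 H) CAT CAT in_right)
        (cones_family A B H \<V> \<A>))"


section \<open>Right pseudo-Kan extensions\<close>

text \<open>\<open>[B, H](-, R)\<close> and \<open>[A, H](- \<circ> t, \<A>)\<close>, as pseudofunctors \<open>op2 (PS B H) \<rightarrow> CAT\<close>.\<close>

definition kan_hom where
  "kan_hom B H R = rep (op2 (PS B H)) R"

definition kan_hom_along where
  "kan_hom_along A B H t \<A> =
    psf_comp (op2 (PS B H)) CAT (rep (op2 (PS A H)) \<A>) (psf_op (precomp A B H t))"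

text \<open>The functor \<open>[B, H](S, R) \<rightarrow> [A, H](S \<circ> t, \<A>)\<close>, \<open>\<alpha> \<mapsto> \<epsilon> (\<alpha> t)\<close>.\<close>

definition kan_fnct where
  "kan_fnct A B H t \<A> R \<epsilon> S =
    \<lparr>fdom = relabel_cat Inl Inl (psf0 (kan_hom B H R) S),
     fcod = relabel_cat Inr Inr (psf0 (kan_hom_along A B H t \<A>) S),
     fobj = (\<lambda>x \<in> Inl ` Obj (psf0 (kan_hom B H R) S).
       Inr (\<epsilon> \<odot>\<^bsub>PS A H\<^esub> pnt_pre A H t (projl x))),
     farr = (\<lambda>x \<in> Inl ` Arr (psf0 (kan_hom B H R) S).
       Inr (id2 (PS A H) \<epsilon> \<star>\<^bsub>PS A H\<^esub> mdf_pre A H t (projl x)))\<rparr>"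

text \<open>It is strictly natural in \<open>S\<close>: the structure 2-cells are identities.\<close>

definition kan_comparison where
  "kan_comparison A B H t \<A> R \<epsilon> =
    \<lparr>pdom = psf_comp (op2 (PS B H)) CAT in_left (kan_hom B H R),
     pcod = psf_comp (op2 (PS B H)) CAT in_right (kan_hom_along A B H t \<A>),
     pnt1 = (\<lambda>S \<in> Ob (PS B H). kan_fnct A B H t \<A> R \<epsilon> S),
     pnt2 = (\<lambda>\<sigma> \<in> Mor (PS B H). ntr_id (fnct_comp
       (psf1 (psf_comp (op2 (PS B H)) CAT in_right (kan_hom_along A B H t \<A>)) \<sigma>)
       (kan_fnct A B H t \<A> R \<epsilon> (pcod \<sigma>))))\<rparr>"

definition right_pseudo_Kan_extension where
  "right_pseudo_Kan_extension A B H t \<A> R \<epsilon> \<longleftrightarrow>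
    pseudofunctor B H R \<and>
    pseudonatural A H \<epsilon> \<and> pdom \<epsilon> = psf_comp A H R t \<and> pcod \<epsilon> = \<A> \<and>
    pseudonatural_equivalence_CAT (op2 (PS B H)) (kan_comparison A B H t \<A> R \<epsilon>)
      (kan_hom B H R) (kan_hom_along A B H t \<A>)"

end

theory Submission imports Defs begin

text \<open>
  By the Yoneda lemma the pointwise bilimits assemble into a pseudofunctor \<open>L\<close>: the equivalences
  \<open>H(-, L b) \<simeq> cones b\<close> are fully faithful, so the pseudofunctor structure of \<open>cones\<close> transports along
  them.  Evaluating the resulting equivalence at identities gives universal cones
  \<open>lam a f : L b \<rightarrow> \<A> a\<close> indexed by \<open>f : b \<rightarrow> t a\<close>, with coherence cells for \<open>A\<close> and for \<open>B\<close>, and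
  the counit is \<open>lam a 1\<close>.  A transformation \<open>\<gamma> : S t \<rightarrow> \<A>\<close> yields the cones \<open>\<gamma> a \<odot> S f\<close>; the universal
  property turns them into 1-cells \<open>S b \<rightarrow> L b\<close>, and all coherence conditions can be tested after
  composing with \<open>lam\<close>.  So \<open>\<alpha> \<mapsto> \<epsilon> (\<alpha> t)\<close> is fully faithful and essentially surjective, which
  also determines Kan extensions up to equivalence.
\<close>


text \<open>The definitions stack several levels: 2-cells of H, modifications between CAT-valued
  pseudofunctors, and modifications between transformations of such. The argument itself is about
  the first level, so the universal property is unpacked once, at \<open>universal_cone\<close>,
  into equations between 2-cells of H; from there on it is diagram chasing in H until the final
  comparison of hom-categories. What makes L the Kan extension is the isomorphism between
  \<open>lam a f\<close> and \<open>lam a 1 \<odot> L f\<close>, the compatibility with B taken at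
  an identity: the whole cone, with its coherence, is recovered from its values at identities. Two
  obstacles shape the rest. The two sides of a given equivalence are valued in copies of CAT over
  different types, so components carry \<open>Inl\<close>/\<open>Inr\<close> tags that are stripped
  before any calculation. And the equivalences are given objectwise, as mere pairs of isomorphisms;
  inverses that are pseudonatural in b are obtained by lifting through fully faithful components,
  which replaces any use of triangle identities.\<close>

section \<open>The calculus of 2-cells: typing, pasting, interchange\<close>

abbreviation (input) comp1_in (\<open>_ o{_} _\<close> [76, 0, 75] 75) where "g o{H} f \<equiv> comp1 H g f"
abbreviation (input) vcomp_in (\<open>_ #{_} _\<close> [71, 0, 70] 70) where "b #{H} a \<equiv> vcomp H b a"
abbreviation (input) hcomp_in (\<open>_ *{_} _\<close> [76, 0, 75] 75) where "b *{H} a \<equiv> hcomp H b a"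


text \<open>Composability of 2-cells as a single atom, so that rules such as
  \<open>vseq_vcomp\<close> and \<open>hseq_hcomp\<close> can reduce the typing of a long pasting to
  that of neighbouring cells; the simplifier then checks side conditions without unfolding
  composites.\<close>

definition vseq :: "('o, 'm, 'c) twocat => 'c => 'c => bool" where
 "vseq H be al \<longleftrightarrow> be \<in> Cell H & al \<in> Cell H & dom2 H be = cod2 H al"

definition hseq :: "('o, 'm, 'c) twocat => 'c => 'c => bool" where
 "hseq H be al \<longleftrightarrow> be \<in> Cell H & al \<in> Cell H & src H (dom2 H be) = trg H (dom2 H al)"

context two_category
begin

lemma homcat_simps [simp]:
 "Obj (homcat H X Y) = {f \<in> Mor H. src H f = X & trg H f = Y}"
 "Arr (homcat H X Y) = {al \<in> Cell H. src H (dom2 H al) = X & trg H (dom2 H al) = Y}"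
 "Dom (homcat H X Y) = dom2 H" "Cod (homcat H X Y) = cod2 H"
 "Idn (homcat H X Y) = id2 H" "Cmp (homcat H X Y) = vcomp H"
 by (simp_all add: homcat_def)

lemma homcat_src_trg: "f \<in> Mor H ==> category (homcat H (src H f) (trg H f))"
 by (simp add: homcat src_Ob trg_Ob)

lemmas two_cat_basic [simp] = src_Ob trg_Ob dom2_Mor cod2_Mor src_cod2 trg_cod2
 id1_Mor src_id1 trg_id1

lemma id2_typing [simp]:
 assumes "f \<in> Mor H"
 shows "id2 H f \<in> Cell H" "dom2 H (id2 H f) = f" "cod2 H (id2 H f) = f"
 using category.Idn_Arr[OF homcat_src_trg[OF assms], of f]
  category.Dom_Idn[OF homcat_src_trg[OF assms], of f]
  category.Cod_Idn[OF homcat_src_trg[OF assms], of f] assms by auto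

lemma comp1_typing [simp]:
 assumes "composable H g f"
 shows "g \<odot> f \<in> Mor H" "src H (g \<odot> f) = src H f" "trg H (g \<odot> f) = trg H g"
 using assms by (auto simp: composable_def comp1_Mor src_comp1 trg_comp1)

lemma vcomp_typing [simp]:
 assumes "vseq H be al"
 shows "be \<bullet> al \<in> Cell H" (is "PROP ?C0") "dom2 H (be \<bullet> al) = dom2 H al" (is "PROP ?C1") "cod2 H (be \<bullet> al) = cod2 H be" (is "PROP ?C2")
proof -
 have a: "al \<in> Cell H" "be \<in> Cell H" "dom2 H be = cod2 H al" using assms by (auto simp: vseq_def)
 then have m: "dom2 H al \<in> Mor H" by simp
 have b: "src H (dom2 H be) = src H (dom2 H al)" "trg H (dom2 H be) = trg H (dom2 H al)"
  using a by auto
 show "PROP ?C0" "PROP ?C1" "PROP ?C2"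
  using category.Cmp_Arr[OF homcat_src_trg[OF m], of al be]
   category.Dom_Cmp[OF homcat_src_trg[OF m], of al be]
   category.Cod_Cmp[OF homcat_src_trg[OF m], of al be] a b by auto
qed

lemma hcomp_typing [simp]:
 assumes "hseq H be al"
 shows "be \<star> al \<in> Cell H" "dom2 H (be \<star> al) = dom2 H be \<odot> dom2 H al"
  "cod2 H (be \<star> al) = cod2 H be \<odot> cod2 H al"
 using assms by (auto simp: hseq_def hcomp_Cell dom2_hcomp cod2_hcomp)

lemma composable_atom [simp]: "g \<in> Mor H ==> composable H g f \<longleftrightarrow> f \<in> Mor H & src H g = trg H f"
 by (auto simp: composable_def)

lemma vseq_atom [simp]: "be \<in> Cell H ==> vseq H be al \<longleftrightarrow> al \<in> Cell H & dom2 H be = cod2 H al"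
 by (auto simp: vseq_def)

lemma hseq_atom [simp]:
 "be \<in> Cell H ==> hseq H be al \<longleftrightarrow> al \<in> Cell H & src H (dom2 H be) = trg H (dom2 H al)"
 by (auto simp: hseq_def)

lemma composable_comp1 [simp]:
 "composable H f e ==> composable H g (f \<odot> e) \<longleftrightarrow> composable H g f"
 "composable H g f ==> composable H (g \<odot> f) e \<longleftrightarrow> composable H f e"
 by (auto simp: composable_def comp1_Mor src_comp1 trg_comp1)

lemma vseq_vcomp [simp]:
 "vseq H be ga ==> vseq H al (be \<bullet> ga) \<longleftrightarrow> vseq H al be"
 "vseq H al be ==> vseq H (al \<bullet> be) ga \<longleftrightarrow> vseq H be ga"
 using vcomp_typing unfolding vseq_def by auto

lemma hseq_vcomp [simp]:
 "vseq H be ga ==> hseq H al (be \<bullet> ga) \<longleftrightarrow> hseq H al ga"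
 "vseq H al be ==> hseq H (al \<bullet> be) ga \<longleftrightarrow> hseq H be ga"
 using vcomp_typing unfolding vseq_def hseq_def by auto

lemma hseq_hcomp [simp]:
 "hseq H be ga ==> hseq H al (be \<star> ga) \<longleftrightarrow> hseq H al be"
 "hseq H al be ==> hseq H (al \<star> be) ga \<longleftrightarrow> hseq H be ga"
 using hcomp_typing unfolding hseq_def by (auto simp: src_comp1 trg_comp1)

lemma vcomp_assoc:
 assumes "vseq H ga be" "vseq H be al" shows "(ga \<bullet> be) \<bullet> al = ga \<bullet> (be \<bullet> al)"
proof -
 have a: "al \<in> Cell H" "be \<in> Cell H" "ga \<in> Cell H" "dom2 H be = cod2 H al" "dom2 H ga = cod2 H be"
  using assms by (auto simp: vseq_def)
 then have m: "dom2 H al \<in> Mor H" by simp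
 have b: "src H (dom2 H be) = src H (dom2 H al)" "trg H (dom2 H be) = trg H (dom2 H al)"
  "src H (dom2 H ga) = src H (dom2 H al)" "trg H (dom2 H ga) = trg H (dom2 H al)"
  using a by auto
 show ?thesis
  using category.Cmp_assoc[OF homcat_src_trg[OF m], of al be ga] a b by auto
qed

lemma vcomp_id2 [simp]:
 assumes "al \<in> Cell H"
 shows "dom2 H al = f ==> al \<bullet> id2 H f = al" (is "PROP ?C0") "cod2 H al = f ==> id2 H f \<bullet> al = al" (is "PROP ?C1")
proof -
 have m: "dom2 H al \<in> Mor H" using assms by simp
 show "PROP ?C0" "PROP ?C1"
  using category.Cmp_Idn_right[OF homcat_src_trg[OF m], of al]
   category.Cmp_Idn_left[OF homcat_src_trg[OF m], of al] assms by auto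
qed

lemma comp1_id1 [simp]:
 assumes "f \<in> Mor H"
 shows "src H f = X ==> f \<odot> id1 H X = f" "trg H f = X ==> id1 H X \<odot> f = f"
 using assms comp1_id_left comp1_id_right by auto

lemma comp1_assoc': "composable H h g ==> composable H g f ==> (h \<odot> g) \<odot> f = h \<odot> (g \<odot> f)"
 by (auto simp: composable_def comp1_assoc)

lemma hcomp_assoc': "hseq H ga be ==> hseq H be al ==> (ga \<star> be) \<star> al = ga \<star> (be \<star> al)"
 by (auto simp: hseq_def hcomp_assoc)

lemma hcomp_id2' [simp]: "composable H g f ==> id2 H g \<star> id2 H f = id2 H (g \<odot> f)"
 by (auto simp: composable_def hcomp_id2)

lemma hcomp_id2_id2:
 assumes "composable H g f" "hseq H (id2 H f) al"
 shows "id2 H g \<star> (id2 H f \<star> al) = id2 H (g \<odot> f) \<star> al"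
 using assms by (subst hcomp_assoc'[symmetric]) (auto simp: composable_def hseq_def)

lemma hcomp_id1 [simp]:
 assumes "al \<in> Cell H"
 shows "src H (dom2 H al) = X ==> al \<star> id2 H (id1 H X) = al"
  "trg H (dom2 H al) = X ==> id2 H (id1 H X) \<star> al = al"
 using assms hcomp_id_left hcomp_id_right by auto

lemma interchange':
 assumes "vseq H al' al" "vseq H be' be" "hseq H be al"
 shows "(be' \<bullet> be) \<star> (al' \<bullet> al) = (be' \<star> al') \<bullet> (be \<star> al)"
 using assms interchange by (auto simp: vseq_def hseq_def)

lemma whisker_vcomp_left:
 assumes "vseq H be al" "f \<in> Mor H" "src H f = trg H (dom2 H al)"
 shows "id2 H f \<star> (be \<bullet> al) = (id2 H f \<star> be) \<bullet> (id2 H f \<star> al)"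
 using assms interchange'[of be al "id2 H f" "id2 H f"] by (auto simp: vseq_def hseq_def)

lemma whisker_vcomp_right:
 assumes "vseq H be al" "f \<in> Mor H" "trg H f = src H (dom2 H al)"
 shows "(be \<bullet> al) \<star> id2 H f = (be \<star> id2 H f) \<bullet> (al \<star> id2 H f)"
 using assms interchange'[of "id2 H f" "id2 H f" be al ] by (auto simp: vseq_def hseq_def)

text \<open>A normal form for pastings: a right-nested vertical composite of whiskered cells, with
  whiskerings distributed over vertical composition and adjacent identity factors merged. Nearly
  every diagram chase below normalises with it and supplies only the substantive squares.\<close>

lemmas pasting = vcomp_assoc hcomp_assoc' comp1_assoc' hcomp_id2_id2
 whisker_vcomp_left whisker_vcomp_right

text \<open>Two cells side by side can be performed in either order. This is how interchange enters
  the diagram chases: sliding a structure 2-cell past another cell is not covered by the normal form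
  \<open>pasting\<close> and is supplied by hand.\<close>

lemma exchange:
 assumes "hseq H be al"
 shows "(be \<star> id2 H (cod2 H al)) \<bullet> (id2 H (dom2 H be) \<star> al) =
  (id2 H (cod2 H be) \<star> al) \<bullet> (be \<star> id2 H (dom2 H al))" (is "PROP ?C0")
  "be \<star> al = (be \<star> id2 H (cod2 H al)) \<bullet> (id2 H (dom2 H be) \<star> al)"
  "be \<star> al = (id2 H (cod2 H be) \<star> al) \<bullet> (be \<star> id2 H (dom2 H al))"
proof -
 have *: "be \<in> Cell H" "al \<in> Cell H" "src H (dom2 H be) = trg H (dom2 H al)"
  using assms by (auto simp: hseq_def)
 show 2: "be \<star> al = (be \<star> id2 H (cod2 H al)) \<bullet> (id2 H (dom2 H be) \<star> al)"
  using * by (subst interchange'[symmetric]) auto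
 show 3: "be \<star> al = (id2 H (cod2 H be) \<star> al) \<bullet> (be \<star> id2 H (dom2 H al))"
  using * by (subst interchange'[symmetric]) auto
 show "PROP ?C0" using 2 3 by simp
qed

text \<open>In a right-nested composite, the left-hand side \<open>x \<bullet> y\<close> of an
  equation is no longer a subterm once something follows it; this form lets the equation act at the
  head of a longer composite.\<close>

lemma vcomp_pre:
 assumes "x \<bullet> y = z" "vseq H x y"
 shows "vseq H y w ==> x \<bullet> (y \<bullet> w) = z \<bullet> w"
 using assms by (metis vcomp_assoc)

end

section \<open>Invertible 2-cells and isomorphic 1-cells\<close>

text \<open>A chosen inverse; \<open>inv2_unique\<close> makes it independent of the choice, so that
  the usual algebra of inverses applies.\<close>

definition inv2 :: "('o, 'm, 'c) twocat => 'c => 'c" where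
 "inv2 H al = (SOME be. be \<in> Cell H & dom2 H be = cod2 H al & cod2 H be = dom2 H al &
   be #{H} al = id2 H (dom2 H al) & al #{H} be = id2 H (cod2 H al))"

context two_category
begin

lemma iso2_Cell: "iso2 H al ==> al \<in> Cell H"
 by (simp add: iso2_def)

lemma inv2_typing [simp]:
 assumes "iso2 H al"
 shows "inv2 H al \<in> Cell H" (is "PROP ?C0") "dom2 H (inv2 H al) = cod2 H al" (is "PROP ?C1") "cod2 H (inv2 H al) = dom2 H al" (is "PROP ?C2")
  "inv2 H al \<bullet> al = id2 H (dom2 H al)" (is "PROP ?C3") "al \<bullet> inv2 H al = id2 H (cod2 H al)" (is "PROP ?C4")
proof -
 have "\<exists>be. be \<in> Cell H & dom2 H be = cod2 H al & cod2 H be = dom2 H al &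
   be \<bullet> al = id2 H (dom2 H al) & al \<bullet> be = id2 H (cod2 H al)"
  using assms unfolding iso2_def by blast
 from someI_ex[OF this]
 show "PROP ?C0" "PROP ?C1" "PROP ?C2"
  "PROP ?C3" "PROP ?C4"
  unfolding inv2_def by auto
qed

lemma iso2I:
 assumes "vseq H be al" "vseq H al be" "be \<bullet> al = id2 H (dom2 H al)" "al \<bullet> be = id2 H (cod2 H al)"
 shows "iso2 H al"
 using assms unfolding iso2_def vseq_def by auto

lemma inv2_cancel [simp]:
 assumes "iso2 H al"
 shows "vseq H al be ==> inv2 H al \<bullet> (al \<bullet> be) = be" "vseq H (inv2 H al) be ==> al \<bullet> (inv2 H al \<bullet> be) = be"
 using assms iso2_Cell[OF assms]
 by (auto simp: vcomp_assoc[symmetric] vseq_def)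

lemma inv2_unique:
 assumes "vseq H be al" "vseq H al be" "be \<bullet> al = id2 H (dom2 H al)" "al \<bullet> be = id2 H (cod2 H al)"
 shows "inv2 H al = be"
proof -
 have i: "iso2 H al" using iso2I assms by blast
 have "inv2 H al = inv2 H al \<bullet> (al \<bullet> be)"
  using assms(4) i iso2_Cell[OF i] by simp
 also have "... = be" using inv2_cancel(1)[OF i assms(2)] .
 finally show ?thesis .
qed

lemma iso2_inv2 [simp]: "iso2 H al ==> iso2 H (inv2 H al)"
 by (rule iso2I[of al]) (auto simp: iso2_Cell)

lemma inv2_inv2 [simp]: "iso2 H al ==> inv2 H (inv2 H al) = al"
 by (rule inv2_unique) (auto simp: iso2_Cell)

lemma iso2_id2 [simp]: "f \<in> Mor H ==> iso2 H (id2 H f)"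
 by (rule iso2I[of "id2 H f"]) auto

lemma inv2_id2 [simp]: "f \<in> Mor H ==> inv2 H (id2 H f) = id2 H f"
 by (rule inv2_unique) auto

lemma inv2_vcomp:
 assumes "iso2 H al" "iso2 H be" "vseq H be al"
 shows "iso2 H (be \<bullet> al)" (is "PROP ?C0") "inv2 H (be \<bullet> al) = inv2 H al \<bullet> inv2 H be" (is "PROP ?C1")
proof -
 have [simp]: "al \<in> Cell H" "be \<in> Cell H" "dom2 H be = cod2 H al" using assms by (auto simp: vseq_def)
 show "PROP ?C0"
  by (rule iso2I[of "inv2 H al \<bullet> inv2 H be"]) (use assms in \<open>auto simp: vcomp_assoc\<close>)
 show "PROP ?C1"
  by (rule inv2_unique) (use assms in \<open>auto simp: vcomp_assoc\<close>)
qed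

lemma inv2_hcomp:
 assumes "iso2 H al" "iso2 H be" "hseq H be al"
 shows "iso2 H (be \<star> al)" (is "PROP ?C0") "inv2 H (be \<star> al) = inv2 H be \<star> inv2 H al" (is "PROP ?C1")
proof -
 have [simp]: "al \<in> Cell H" "be \<in> Cell H" "src H (dom2 H be) = trg H (dom2 H al)"
  using assms by (auto simp: hseq_def)
 show "PROP ?C0"
  by (rule iso2I[of "inv2 H be \<star> inv2 H al"]) (use assms in \<open>auto simp: interchange'[symmetric]\<close>)
 show "PROP ?C1"
  by (rule inv2_unique) (use assms in \<open>auto simp: interchange'[symmetric]\<close>)
qed

lemma iso2_vcomp [simp]: "vseq H be al ==> iso2 H al ==> iso2 H be ==> iso2 H (be \<bullet> al)"
 by (rule inv2_vcomp)

lemma iso2_hcomp [simp]: "hseq H be al ==> iso2 H al ==> iso2 H be ==> iso2 H (be \<star> al)"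
 by (rule inv2_hcomp)

lemma iso2_cancel_left:
 assumes "iso2 H al" "al \<bullet> be = al \<bullet> ga" "vseq H al be" "vseq H al ga"
 shows "be = ga"
 by (metis assms inv2_cancel(1))

lemma iso2_cancel_right:
 assumes "iso2 H al" "be \<bullet> al = ga \<bullet> al" "vseq H be al" "vseq H ga al"
 shows "be = ga"
proof -
 have c: "al \<in> Cell H" "be \<in> Cell H" "ga \<in> Cell H" "dom2 H be = cod2 H al" "dom2 H ga = cod2 H al"
  using assms(3,4) by (auto simp: vseq_def)
 have "(be \<bullet> al) \<bullet> inv2 H al = (ga \<bullet> al) \<bullet> inv2 H al" using assms(2) by simp
 then show ?thesis using assms(1) c by (simp add: vcomp_assoc)
qed

lemma isomorphic1D: "isomorphic1 H f g ==> f \<in> Mor H & g \<in> Mor H & src H g = src H f & trg H g = trg H f"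
 unfolding isomorphic1_def using iso2_Cell by force

lemma isomorphic1_refl: "f \<in> Mor H ==> isomorphic1 H f f"
 unfolding isomorphic1_def by (rule exI[of _ "id2 H f"]) simp

lemma isomorphic1_sym: "isomorphic1 H f g ==> isomorphic1 H g f"
 unfolding isomorphic1_def using iso2_inv2 inv2_typing by metis

lemma isomorphic1_trans:
 assumes "isomorphic1 H f g" "isomorphic1 H g h" shows "isomorphic1 H f h"
proof -
 obtain al be where "iso2 H al" "dom2 H al = f" "cod2 H al = g" "iso2 H be" "dom2 H be = g" "cod2 H be = h"
  using assms unfolding isomorphic1_def by auto
 then show ?thesis
  unfolding isomorphic1_def by (intro exI[of _ "be \<bullet> al"]) (auto simp: iso2_Cell)
qed

lemma isomorphic1_comp1:
 assumes "isomorphic1 H f f'" "isomorphic1 H g g'" "src H g = trg H f"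
 shows "isomorphic1 H (g \<odot> f) (g' \<odot> f')"
proof -
 obtain al be where "iso2 H al" "dom2 H al = f" "cod2 H al = f'" "iso2 H be" "dom2 H be = g" "cod2 H be = g'"
  using assms unfolding isomorphic1_def by auto
 then show ?thesis
  unfolding isomorphic1_def using assms(3) by (intro exI[of _ "be \<star> al"]) (auto simp: iso2_Cell)
qed

end

section \<open>Fully faithful 1-cells and equivalences\<close>

text \<open>The representable notion: composition with \<open>f\<close> is a full and faithful
  functor on each hom-category. Pseudonatural inverses are built later by solving equations of
  2-cells through such 1-cells.\<close>

definition fully_faithful1 :: "('o, 'm, 'c) twocat => 'm => bool" where
 "fully_faithful1 H f \<longleftrightarrow> f \<in> Mor H &
  (\<forall>u v \<tau>. composable H f u & composable H f v & src H u = src H v &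
   \<tau> \<in> Cell H & dom2 H \<tau> = f o{H} u & cod2 H \<tau> = f o{H} v -->
   (\<exists>!th. th \<in> Cell H & dom2 H th = u & cod2 H th = v & id2 H f *{H} th = \<tau>))"

context two_category
begin

text \<open>Naturality of \<eta> : g f \<cong> 1 writes \<open>th\<close> as the conjugate by \<eta>
  of \<open>g \<star> f \<star> th\<close>, so \<open>f \<star> th\<close> determines
  \<open>th\<close>. A single isomorphism enters, which allows the roles of \<open>f\<close> and
  \<open>g\<close> to be swapped in the next lemma.\<close>

lemma equivalence1_left_faithful:
 assumes g: "g \<in> Mor H" "f \<in> Mor H" "src H g = trg H f"
  and \<eta>: "isomorphic1 H (g \<odot> f) (id1 H (src H f))"
  and th: "th \<in> Cell H" "th' \<in> Cell H" "dom2 H th = dom2 H th'" "cod2 H th = cod2 H th'"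
   "src H f = trg H (dom2 H th)"
  and eq: "id2 H f \<star> th = id2 H f \<star> th'"
 shows "th = th'"
proof -
 obtain \<eta> where e: "iso2 H \<eta>" "dom2 H \<eta> = g \<odot> f" "cod2 H \<eta> = id1 H (src H f)"
  using \<eta> unfolding isomorphic1_def by auto
 have c [simp]: "\<eta> \<in> Cell H" using e iso2_Cell by blast
 have s: "src H (g \<odot> f) = src H f" "trg H (g \<odot> f) = src H f"
  using g e src_cod2[OF c] trg_cod2[OF c] by auto
 have *: "th = (\<eta> \<star> id2 H (cod2 H th)) \<bullet> (id2 H g \<star> (id2 H f \<star> th)) \<bullet> inv2 H (\<eta> \<star> id2 H (dom2 H th))"
  if "th \<in> Cell H" "src H f = trg H (dom2 H th)" for th
 proof -
  have "(\<eta> \<star> id2 H (cod2 H th)) \<bullet> (id2 H (g \<odot> f) \<star> th) =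
   (id2 H (id1 H (src H f)) \<star> th) \<bullet> (\<eta> \<star> id2 H (dom2 H th))"
   using exchange(1)[of \<eta> th] e that g s by simp
  also have "... = th \<bullet> (\<eta> \<star> id2 H (dom2 H th))"
   using that by simp
  finally have "(\<eta> \<star> id2 H (cod2 H th)) \<bullet> (id2 H g \<star> (id2 H f \<star> th)) \<bullet> inv2 H (\<eta> \<star> id2 H (dom2 H th))
    = (th \<bullet> (\<eta> \<star> id2 H (dom2 H th))) \<bullet> inv2 H (\<eta> \<star> id2 H (dom2 H th))"
   using e that g s by (simp add: pasting vcomp_pre)
  also have "... = th"
   using e that g s by (simp add: vcomp_assoc)
  finally show ?thesis by simp
 qed
 show ?thesis using *[of th] *[of th'] th eq by simp
qed

text \<open>The preimage of \<tau> is \<open>g \<star> \<tau>\<close> conjugated by \<eta>. At first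
  it is known to have the right image only after applying \<open>g\<close>; the isomorphism f g
  \<cong> 1 makes \<open>g\<close> faithful too, which removes that \<open>g\<close> and takes the
  place of a triangle identity.\<close>

lemma equivalence1_fully_faithful:
 assumes "equivalence1 H f X Y" shows "fully_faithful1 H f"
proof -
 obtain g where f [simp]: "f \<in> Mor H" "src H f = X" "trg H f = Y"
  and g [simp]: "g \<in> Mor H" "src H g = Y" "trg H g = X"
  and \<eta>: "isomorphic1 H (g \<odot> f) (id1 H X)" and ep: "isomorphic1 H (f \<odot> g) (id1 H Y)"
  using assms unfolding equivalence1_def by auto
 obtain \<eta> where e [simp]: "iso2 H \<eta>" "dom2 H \<eta> = g \<odot> f" "cod2 H \<eta> = id1 H X"
  using \<eta> unfolding isomorphic1_def by auto
 have c [simp]: "\<eta> \<in> Cell H" using e iso2_Cell by blast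
 have X [simp]: "X \<in> Ob H" using src_Ob[OF f(1)] f(2) by simp
 have "\<exists>!th. th \<in> Cell H & dom2 H th = u & cod2 H th = v & id2 H f \<star> th = \<tau>"
  if "composable H f u" "composable H f v" "src H u = src H v"
   and \<tau> [simp]: "\<tau> \<in> Cell H" "dom2 H \<tau> = f \<odot> u" "cod2 H \<tau> = f \<odot> v" for u v \<tau>
 proof -
  have u [simp]: "u \<in> Mor H" "v \<in> Mor H" "trg H u = X" "trg H v = X" "src H u = src H v"
   using that by (auto simp: composable_def)
  define th where "th = (\<eta> \<star> id2 H v) \<bullet> (id2 H g \<star> \<tau>) \<bullet> inv2 H (\<eta> \<star> id2 H u)"
  have t [simp]: "th \<in> Cell H" "dom2 H th = u" "cod2 H th = v"
   unfolding th_def by (simp_all add: comp1_assoc')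
  have "(\<eta> \<star> id2 H v) \<bullet> (id2 H (g \<odot> f) \<star> th) = th \<bullet> (\<eta> \<star> id2 H u)"
   using exchange(1)[of \<eta> th] by simp
  also have "... = (\<eta> \<star> id2 H v) \<bullet> (id2 H g \<star> \<tau>)"
   unfolding th_def by (simp add: pasting)
  finally have "id2 H (g \<odot> f) \<star> th = id2 H g \<star> \<tau>"
   by (rule iso2_cancel_left[rotated]) (simp_all add: comp1_assoc')
  then have "id2 H g \<star> (id2 H f \<star> th) = id2 H g \<star> \<tau>" by (simp add: hcomp_id2_id2)
  then have "id2 H f \<star> th = \<tau>"
   using equivalence1_left_faithful[of f g "id2 H f \<star> th" \<tau>] ep by simp
  moreover have "th' = th'' " if "th' \<in> Cell H" "dom2 H th' = u" "cod2 H th' = v" "id2 H f \<star> th' = \<tau>"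
   "th'' \<in> Cell H" "dom2 H th'' = u" "cod2 H th'' = v" "id2 H f \<star> th'' = \<tau>" for th' th''
   using equivalence1_left_faithful[of g f th' th''] \<eta> that by simp
  ultimately show ?thesis using t by metis
 qed
 then show ?thesis unfolding fully_faithful1_def using f(1) by blast
qed

lemma fully_faithful1_Mor: "fully_faithful1 H f ==> f \<in> Mor H"
 by (simp add: fully_faithful1_def)

lemma fully_faithful1_unique:
 assumes "fully_faithful1 H f" "th \<in> Cell H" "th' \<in> Cell H" "dom2 H th = dom2 H th'" "cod2 H th = cod2 H th'"
   "src H f = trg H (dom2 H th)" "id2 H f \<star> th = id2 H f \<star> th'"
 shows "th = th'"
proof -
 have m: "f \<in> Mor H" using assms(1) by (rule fully_faithful1_Mor)
 have "composable H f (dom2 H th)" "composable H f (cod2 H th)" "src H (dom2 H th) = src H (cod2 H th)"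
  "id2 H f \<star> th \<in> Cell H" "dom2 H (id2 H f \<star> th) = f \<odot> dom2 H th"
  "cod2 H (id2 H f \<star> th) = f \<odot> cod2 H th"
  using assms m by auto
 then have "\<exists>!th''. th'' \<in> Cell H & dom2 H th'' = dom2 H th & cod2 H th'' = cod2 H th &
  id2 H f \<star> th'' = id2 H f \<star> th"
  using assms(1) unfolding fully_faithful1_def by blast
 then show ?thesis using assms by metis
qed

lemma fully_faithful1_ex:
 assumes "fully_faithful1 H f" "composable H f u" "composable H f v" "src H u = src H v"
   "\<tau> \<in> Cell H" "dom2 H \<tau> = f \<odot> u" "cod2 H \<tau> = f \<odot> v"
 shows "\<exists>th. th \<in> Cell H & dom2 H th = u & cod2 H th = v & id2 H f \<star> th = \<tau>"
 using assms unfolding fully_faithful1_def by blast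

text \<open>Fullness lifts the inverse of the image, and faithfulness turns the two inverse laws
  back into laws for the lifts.\<close>

lemma fully_faithful1_iso2:
 assumes ff: "fully_faithful1 H f" and th: "th \<in> Cell H" "src H f = trg H (dom2 H th)"
  and i: "iso2 H (id2 H f \<star> th)"
 shows "iso2 H th"
proof -
 have m [simp]: "f \<in> Mor H" using assms(1) by (rule fully_faithful1_Mor)
 let ?i = "inv2 H (id2 H f \<star> th)"
 obtain th' where t: "th' \<in> Cell H" "dom2 H th' = cod2 H th" "cod2 H th' = dom2 H th" "id2 H f \<star> th' = ?i"
  using fully_faithful1_ex[OF ff, of "cod2 H th" "dom2 H th" ?i] th i by auto
 have "th' \<bullet> th = id2 H (dom2 H th)"
  by (rule fully_faithful1_unique[OF ff]) (use th i t in \<open>auto simp: whisker_vcomp_left\<close>)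
 moreover have "th \<bullet> th' = id2 H (cod2 H th)"
  by (rule fully_faithful1_unique[OF ff]) (use th i t in \<open>auto simp: whisker_vcomp_left\<close>)
 ultimately show ?thesis using th t by (intro iso2I[of th']) auto
qed

end

section \<open>Introduction rule for 2-categories and the dual on 1-cells\<close>

text \<open>The axiom that the homs are categories is restated on cells, which matches how CAT,
  \<open>PS\<close> and \<open>op2\<close> verify it: by computing with composites rather than hom
  by hom.\<close>

lemma two_categoryI:
 fixes H :: "('o, 'm, 'c) twocat" (structure)
 assumes "!!f. f \<in> Mor H ==> src H f \<in> Ob H"
  and "!!f. f \<in> Mor H ==> trg H f \<in> Ob H"
  and "!!al. al \<in> Cell H ==> dom2 H al \<in> Mor H"
  and "!!al. al \<in> Cell H ==> cod2 H al \<in> Mor H"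
  and "!!al. al \<in> Cell H ==> src H (cod2 H al) = src H (dom2 H al)"
  and "!!al. al \<in> Cell H ==> trg H (cod2 H al) = trg H (dom2 H al)"
  and "!!X. X \<in> Ob H ==> id1 H X \<in> Mor H"
  and "!!X. X \<in> Ob H ==> src H (id1 H X) = X"
  and "!!X. X \<in> Ob H ==> trg H (id1 H X) = X"
  and "!!f g. [|f \<in> Mor H; g \<in> Mor H; src H g = trg H f|] ==> g \<odot> f \<in> Mor H"
  and "!!f g. [|f \<in> Mor H; g \<in> Mor H; src H g = trg H f|] ==> src H (g \<odot> f) = src H f"
  and "!!f g. [|f \<in> Mor H; g \<in> Mor H; src H g = trg H f|] ==> trg H (g \<odot> f) = trg H g"
  and "!!f. f \<in> Mor H ==> f \<odot> id1 H (src H f) = f"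
  and "!!f. f \<in> Mor H ==> id1 H (trg H f) \<odot> f = f"
  and "!!f g h. [|f \<in> Mor H; g \<in> Mor H; h \<in> Mor H; src H g = trg H f; src H h = trg H g|]
   ==> (h \<odot> g) \<odot> f = h \<odot> (g \<odot> f)"
  and id2: "!!f. f \<in> Mor H ==> id2 H f \<in> Cell H"
   "!!f. f \<in> Mor H ==> dom2 H (id2 H f) = f"
   "!!f. f \<in> Mor H ==> cod2 H (id2 H f) = f"
  and vc: "!!al be. [|al \<in> Cell H; be \<in> Cell H; dom2 H be = cod2 H al|] ==> be \<bullet> al \<in> Cell H"
   "!!al be. [|al \<in> Cell H; be \<in> Cell H; dom2 H be = cod2 H al|] ==> dom2 H (be \<bullet> al) = dom2 H al"
   "!!al be. [|al \<in> Cell H; be \<in> Cell H; dom2 H be = cod2 H al|] ==> cod2 H (be \<bullet> al) = cod2 H be"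
   "!!al. al \<in> Cell H ==> al \<bullet> id2 H (dom2 H al) = al"
   "!!al. al \<in> Cell H ==> id2 H (cod2 H al) \<bullet> al = al"
   "!!al be ga. [|al \<in> Cell H; be \<in> Cell H; ga \<in> Cell H; dom2 H be = cod2 H al; dom2 H ga = cod2 H be|]
    ==> (ga \<bullet> be) \<bullet> al = ga \<bullet> (be \<bullet> al)"
  and "!!al be. [|al \<in> Cell H; be \<in> Cell H; src H (dom2 H be) = trg H (dom2 H al)|]
   ==> be \<star> al \<in> Cell H"
  and "!!al be. [|al \<in> Cell H; be \<in> Cell H; src H (dom2 H be) = trg H (dom2 H al)|]
   ==> dom2 H (be \<star> al) = dom2 H be \<odot> dom2 H al"
  and "!!al be. [|al \<in> Cell H; be \<in> Cell H; src H (dom2 H be) = trg H (dom2 H al)|]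
   ==> cod2 H (be \<star> al) = cod2 H be \<odot> cod2 H al"
  and "!!f g. [|f \<in> Mor H; g \<in> Mor H; src H g = trg H f|]
   ==> id2 H g \<star> id2 H f = id2 H (g \<odot> f)"
  and "!!al al' be be'. [|al \<in> Cell H; al' \<in> Cell H; be \<in> Cell H; be' \<in> Cell H;
    dom2 H al' = cod2 H al; dom2 H be' = cod2 H be; src H (dom2 H be) = trg H (dom2 H al)|]
   ==> (be' \<bullet> be) \<star> (al' \<bullet> al) = (be' \<star> al') \<bullet> (be \<star> al)"
  and "!!al. al \<in> Cell H ==> al \<star> id2 H (id1 H (src H (dom2 H al))) = al"
  and "!!al. al \<in> Cell H ==> id2 H (id1 H (trg H (dom2 H al))) \<star> al = al"
  and "!!al be ga. [|al \<in> Cell H; be \<in> Cell H; ga \<in> Cell H;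
    src H (dom2 H be) = trg H (dom2 H al); src H (dom2 H ga) = trg H (dom2 H be)|]
   ==> (ga \<star> be) \<star> al = ga \<star> (be \<star> al)"
 shows "two_category H"
proof (intro two_category.intro, goal_cases)
 case (16 X Y)
 show ?case
  by (intro category.intro) (simp_all add: homcat_def id2 vc assms(3-6))
qed (rule assms; assumption)+

lemma op2_simps [simp]:
 "Ob (op2 H) = Ob H" "Mor (op2 H) = Mor H" "Cell (op2 H) = Cell H" "src (op2 H) = trg H"
 "trg (op2 H) = src H" "dom2 (op2 H) = dom2 H" "cod2 (op2 H) = cod2 H" "id1 (op2 H) = id1 H"
 "comp1 (op2 H) g f = comp1 H f g" "id2 (op2 H) = id2 H" "vcomp (op2 H) = vcomp H"
 "hcomp (op2 H) be al = hcomp H al be"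
 by (simp_all add: op2_def)

lemma op2_seq [simp]:
 "composable (op2 H) g f = composable H f g" "vseq (op2 H) = vseq H"
 "iso2 (op2 H) = iso2 H" "inv2 (op2 H) = inv2 H"
 by (auto simp: composable_def vseq_def iso2_def inv2_def fun_eq_iff)

lemma (in two_category) two_category_op2: "two_category (op2 H)"
 by (rule two_categoryI) (auto simp: vcomp_assoc comp1_assoc' hcomp_assoc' interchange')

section \<open>The 2-category CAT\<close>

lemma CAT_simps [simp]:
 "C \<in> Ob CAT \<longleftrightarrow> category C" "F \<in> Mor CAT \<longleftrightarrow> fnctr F" "\<tau> \<in> Cell CAT \<longleftrightarrow> nat_trans \<tau>"
 "src CAT = fdom" "trg CAT = fcod" "dom2 CAT = ndom" "cod2 CAT = ncod" "id1 CAT = fnct_id"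
 "comp1 CAT = fnct_comp" "id2 CAT = ntr_id" "vcomp CAT = ntr_vcomp" "hcomp CAT = ntr_hcomp"
 by (simp_all add: CAT_def)

lemma fnct_id_simps [simp]:
 "fdom (fnct_id C) = C" "fcod (fnct_id C) = C" "x \<in> Obj C ==> fobj (fnct_id C) x = x"
 "f \<in> Arr C ==> farr (fnct_id C) f = f"
 by (simp_all add: fnct_id_def)

lemma fnct_comp_simps [simp]:
 "fdom (fnct_comp G F) = fdom F" "fcod (fnct_comp G F) = fcod G"
 "x \<in> Obj (fdom F) ==> fobj (fnct_comp G F) x = fobj G (fobj F x)"
 "f \<in> Arr (fdom F) ==> farr (fnct_comp G F) f = farr G (farr F f)"
 by (simp_all add: fnct_comp_def)

lemma ntr_simps [simp]:
 "ndom (ntr_id F) = F" "ncod (ntr_id F) = F"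
 "x \<in> Obj (fdom F) ==> ncmp (ntr_id F) x = Idn (fcod F) (fobj F x)"
 "ndom (ntr_vcomp \<tau> si) = ndom si" "ncod (ntr_vcomp \<tau> si) = ncod \<tau>"
 "x \<in> Obj (fdom (ndom si)) ==> ncmp (ntr_vcomp \<tau> si) x = Cmp (fcod (ndom si)) (ncmp \<tau> x) (ncmp si x)"
 "ndom (ntr_hcomp \<tau> si) = fnct_comp (ndom \<tau>) (ndom si)"
 "ncod (ntr_hcomp \<tau> si) = fnct_comp (ncod \<tau>) (ncod si)"
 "x \<in> Obj (fdom (ndom si)) ==> ncmp (ntr_hcomp \<tau> si) x =
  Cmp (fcod (ndom \<tau>)) (ncmp \<tau> (fobj (ncod si) x)) (farr (ndom \<tau>) (ncmp si x))"
 by (simp_all add: ntr_id_def ntr_vcomp_def ntr_hcomp_def)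

declare (in category) Dom_Obj [simp] Cod_Obj [simp] Idn_Arr [simp] Dom_Idn [simp] Cod_Idn [simp]
 Cmp_Arr [simp] Dom_Cmp [simp] Cod_Cmp [simp]

lemma (in category) Cmp_Idn [simp]:
 "f \<in> Arr C ==> Dom C f = x ==> Cmp C f (Idn C x) = f"
 "f \<in> Arr C ==> Cod C f = x ==> Cmp C (Idn C x) f = f"
 using Cmp_Idn_right Cmp_Idn_left by auto

sublocale fnctr \<subseteq> D: category "fdom F" by (rule category_fdom)
sublocale fnctr \<subseteq> C: category "fcod F" by (rule category_fcod)

declare (in fnctr) fobj_Obj [simp] farr_Arr [simp] Dom_farr [simp] Cod_farr [simp] farr_Idn [simp]
 farr_Cmp [simp]

sublocale nat_trans \<subseteq> F: fnctr "ndom \<tau>" by (rule fnctr_ndom)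
sublocale nat_trans \<subseteq> G: fnctr "ncod \<tau>" by (rule fnctr_ncod)

declare (in nat_trans) fdom_ncod [simp] fcod_ncod [simp] ncmp_Arr [simp] Dom_ncmp [simp] Cod_ncmp [simp]

lemma fnct_eqI:
 assumes "fnctr F" "fnctr G" "fdom F = fdom G" "fcod F = fcod G"
  and "!!x. x \<in> Obj (fdom G) ==> fobj F x = fobj G x"
  and "!!x. x \<in> Arr (fdom G) ==> farr F x = farr G x"
 shows "F = G"
proof -
 interpret F: fnctr F by fact
 interpret G: fnctr G by fact
 have "fobj F = fobj G" using F.fobj_ext G.fobj_ext assms by (metis extensionalityI)
 moreover have "farr F = farr G" using F.farr_ext G.farr_ext assms by (metis extensionalityI)
 ultimately show ?thesis using assms by simp
qed

lemma ntr_eqI: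
 assumes "nat_trans si" "nat_trans \<tau>" "ndom si = ndom \<tau>" "ncod si = ncod \<tau>"
  and "!!x. x \<in> Obj (fdom (ndom \<tau>)) ==> ncmp si x = ncmp \<tau> x"
 shows "si = \<tau>"
proof -
 interpret F: nat_trans si by fact
 interpret G: nat_trans \<tau> by fact
 have "ncmp si = ncmp \<tau>" using F.ncmp_ext G.ncmp_ext assms by (metis extensionalityI)
 then show ?thesis using assms by simp
qed

lemma fnctr_fnct_id [simp]: "category C ==> fnctr (fnct_id C)"
proof -
 assume "category C"
 then interpret category C .
 show ?thesis by unfold_locales (auto simp: fnct_id_def Cmp_assoc)
qed

lemma fnctr_fnct_comp [simp]:
 assumes "fnctr F" "fnctr G" "fdom G = fcod F" shows "fnctr (fnct_comp G F)"
proof -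
 interpret F: fnctr F by fact
 interpret G: fnctr G by fact
 have [simp]: "!!x. x \<in> Obj (fdom F) ==> fobj F x \<in> Obj (fdom G)"
  "!!f. f \<in> Arr (fdom F) ==> farr F f \<in> Arr (fdom G)"
  "!!f. f \<in> Arr (fdom F) ==> Dom (fdom G) (farr F f) = fobj F (Dom (fdom F) f)"
  "!!f. f \<in> Arr (fdom F) ==> Cod (fdom G) (farr F f) = fobj F (Cod (fdom F) f)"
  using F.fobj_Obj F.farr_Arr F.Dom_farr F.Cod_farr by (simp_all add: assms(3))
 show ?thesis
  by (rule fnctr.intro) (auto simp: assms(3)[symmetric] F.category_fdom G.category_fcod,
   auto simp: fnct_comp_def assms(3)[symmetric] G.category_fcod)
qed

lemma nat_trans_ntr_id [simp]: "fnctr F ==> nat_trans (ntr_id F)"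
proof -
 assume "fnctr F"
 then interpret fnctr F .
 show ?thesis by (rule nat_trans.intro) (auto simp: C.Cmp_assoc fnctr_axioms, auto simp: ntr_id_def)
qed

lemma nat_trans_ntr_vcomp [simp]:
 assumes "nat_trans si" "nat_trans \<tau>" "ndom \<tau> = ncod si" shows "nat_trans (ntr_vcomp \<tau> si)"
proof -
 interpret s: nat_trans si by fact
 interpret t: nat_trans \<tau> by fact
 have [simp]: "fdom (ncod \<tau>) = fdom (ndom si)" "fcod (ncod \<tau>) = fcod (ndom si)"
  by (simp_all add: assms)
 have e: "!!x. x \<in> Obj (fdom (ndom si)) ==> ncmp \<tau> x \<in> Arr (fcod (ndom si))"
   "!!x. x \<in> Obj (fdom (ndom si)) ==> Dom (fcod (ndom si)) (ncmp \<tau> x) = fobj (ncod si) x"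
   "!!x. x \<in> Obj (fdom (ndom si)) ==> Cod (fcod (ndom si)) (ncmp \<tau> x) = fobj (ncod \<tau>) x"
  using t.ncmp_Arr t.Dom_ncmp t.Cod_ncmp by (simp_all add: assms)
 have g: "!!f. f \<in> Arr (fdom (ndom si)) ==> farr (ncod si) f \<in> Arr (fcod (ndom si))"
  "!!f. f \<in> Arr (fdom (ndom si)) ==> Dom (fcod (ndom si)) (farr (ncod si) f) = fobj (ncod si) (Dom (fdom (ndom si)) f)"
  "!!f. f \<in> Arr (fdom (ndom si)) ==> Cod (fcod (ndom si)) (farr (ncod si) f) = fobj (ncod si) (Cod (fdom (ndom si)) f)"
  using s.G.farr_Arr s.G.Dom_farr s.G.Cod_farr by simp_all
 have h: "!!f. f \<in> Arr (fdom (ndom si)) ==> farr (ncod \<tau>) f \<in> Arr (fcod (ndom si))"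
  "!!f. f \<in> Arr (fdom (ndom si)) ==> Dom (fcod (ndom si)) (farr (ncod \<tau>) f) = fobj (ncod \<tau>) (Dom (fdom (ndom si)) f)"
  "!!f. f \<in> Arr (fdom (ndom si)) ==> Cod (fcod (ndom si)) (farr (ncod \<tau>) f) = fobj (ncod \<tau>) (Cod (fdom (ndom si)) f)"
  using t.G.farr_Arr t.G.Dom_farr t.G.Cod_farr by (simp_all add: assms)
 show ?thesis
 proof (rule nat_trans.intro, goal_cases)
  case (9 f)
  let ?C = "fcod (ndom si)" and ?D = "fdom (ndom si)"
  have f: "f \<in> Arr ?D" using 9 by simp
  have "Cmp ?C (Cmp ?C (ncmp \<tau> (Cod ?D f)) (ncmp si (Cod ?D f))) (farr (ndom si) f)
   = Cmp ?C (ncmp \<tau> (Cod ?D f)) (Cmp ?C (farr (ncod si) f) (ncmp si (Dom ?D f)))"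
   using f by (simp add: s.F.C.Cmp_assoc s.ncmp_natural e)
  also have "... = Cmp ?C (Cmp ?C (farr (ncod \<tau>) f) (ncmp \<tau> (Dom ?D f))) (ncmp si (Dom ?D f))"
   using f t.ncmp_natural[of f] by (simp add: s.F.C.Cmp_assoc[symmetric] e g assms)
  also have "... = Cmp ?C (farr (ncod \<tau>) f) (Cmp ?C (ncmp \<tau> (Dom ?D f)) (ncmp si (Dom ?D f)))"
   using f by (simp add: s.F.C.Cmp_assoc e h)
  finally show ?case using f by simp
 qed (auto simp: assms s.fnctr_ndom t.fnctr_ncod e, auto simp: ntr_vcomp_def)
qed

lemma nat_trans_ntr_hcomp [simp]:
 assumes "nat_trans si" "nat_trans \<tau>" "fdom (ndom \<tau>) = fcod (ndom si)" shows "nat_trans (ntr_hcomp \<tau> si)"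
proof -
 interpret s: nat_trans si by fact
 interpret t: nat_trans \<tau> by fact
 have fd [simp]: "fcod (ndom si) = fdom (ndom \<tau>)" using assms by simp
 have g [simp]: "!!f. f \<in> Obj (fdom (ndom si)) ==> fobj (ncod si) f \<in> Obj (fdom (ndom \<tau>))"
  "!!f. f \<in> Obj (fdom (ndom si)) ==> fobj (ndom si) f \<in> Obj (fdom (ndom \<tau>))"
  "!!f. f \<in> Arr (fdom (ndom si)) ==> farr (ndom si) f \<in> Arr (fdom (ndom \<tau>))"
  "!!f. f \<in> Arr (fdom (ndom si)) ==> farr (ncod si) f \<in> Arr (fdom (ndom \<tau>))"
  "!!f. f \<in> Obj (fdom (ndom si)) ==> ncmp si f \<in> Arr (fdom (ndom \<tau>))"
  "!!f. f \<in> Obj (fdom (ndom si)) ==> Dom (fdom (ndom \<tau>)) (ncmp si f) = fobj (ndom si) f"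
  "!!f. f \<in> Obj (fdom (ndom si)) ==> Cod (fdom (ndom \<tau>)) (ncmp si f) = fobj (ncod si) f"
  "!!f. f \<in> Arr (fdom (ndom si)) ==> Dom (fdom (ndom \<tau>)) (farr (ndom si) f) = fobj (ndom si) (Dom (fdom (ndom si)) f)"
  "!!f. f \<in> Arr (fdom (ndom si)) ==> Cod (fdom (ndom \<tau>)) (farr (ndom si) f) = fobj (ndom si) (Cod (fdom (ndom si)) f)"
  "!!f. f \<in> Arr (fdom (ndom si)) ==> Dom (fdom (ndom \<tau>)) (farr (ncod si) f) = fobj (ncod si) (Dom (fdom (ndom si)) f)"
  "!!f. f \<in> Arr (fdom (ndom si)) ==> Cod (fdom (ndom \<tau>)) (farr (ncod si) f) = fobj (ncod si) (Cod (fdom (ndom si)) f)"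
  using s.F.farr_Arr s.F.Dom_farr s.F.Cod_farr s.F.fobj_Obj
   s.G.farr_Arr s.G.Dom_farr s.G.Cod_farr s.G.fobj_Obj s.ncmp_Arr s.Dom_ncmp s.Cod_ncmp by simp_all
 have h [simp]: "!!f. f \<in> Arr (fdom (ndom \<tau>)) ==> farr (ncod \<tau>) f \<in> Arr (fcod (ndom \<tau>))"
  "!!f. f \<in> Arr (fdom (ndom \<tau>)) ==> Dom (fcod (ndom \<tau>)) (farr (ncod \<tau>) f) = fobj (ncod \<tau>) (Dom (fdom (ndom \<tau>)) f)"
  "!!f. f \<in> Arr (fdom (ndom \<tau>)) ==> Cod (fcod (ndom \<tau>)) (farr (ncod \<tau>) f) = fobj (ncod \<tau>) (Cod (fdom (ndom \<tau>)) f)"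
  using t.G.farr_Arr t.G.Dom_farr t.G.Cod_farr by simp_all
 show ?thesis
 proof (rule nat_trans.intro, goal_cases)
  case (9 f)
  let ?C = "fcod (ndom \<tau>)" and ?D = "fdom (ndom si)"
  have f [simp]: "f \<in> Arr ?D" using 9 by simp
  have n: "Cmp (fdom (ndom \<tau>)) (ncmp si (Cod ?D f)) (farr (ndom si) f) =
   Cmp (fdom (ndom \<tau>)) (farr (ncod si) f) (ncmp si (Dom ?D f))"
   using s.ncmp_natural[of f] by simp
  have "Cmp ?C (Cmp ?C (ncmp \<tau> (fobj (ncod si) (Cod ?D f))) (farr (ndom \<tau>) (ncmp si (Cod ?D f))))
    (farr (ndom \<tau>) (farr (ndom si) f))
   = Cmp ?C (ncmp \<tau> (fobj (ncod si) (Cod ?D f)))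
     (farr (ndom \<tau>) (Cmp (fdom (ndom \<tau>)) (ncmp si (Cod ?D f)) (farr (ndom si) f)))"
   by (simp add: t.F.C.Cmp_assoc)
  also have "... = Cmp ?C (Cmp ?C (ncmp \<tau> (fobj (ncod si) (Cod ?D f))) (farr (ndom \<tau>) (farr (ncod si) f)))
    (farr (ndom \<tau>) (ncmp si (Dom ?D f)))"
   unfolding n by (simp add: t.F.C.Cmp_assoc)
  also have "Cmp ?C (ncmp \<tau> (fobj (ncod si) (Cod ?D f))) (farr (ndom \<tau>) (farr (ncod si) f)) =
    Cmp ?C (farr (ncod \<tau>) (farr (ncod si) f)) (ncmp \<tau> (fobj (ncod si) (Dom ?D f)))"
   using t.ncmp_natural[of "farr (ncod si) f"] by simp
  also have "Cmp ?C (Cmp ?C (farr (ncod \<tau>) (farr (ncod si) f)) (ncmp \<tau> (fobj (ncod si) (Dom ?D f))))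
     (farr (ndom \<tau>) (ncmp si (Dom ?D f)))
    = Cmp ?C (farr (ncod \<tau>) (farr (ncod si) f)) (Cmp ?C (ncmp \<tau> (fobj (ncod si) (Dom ?D f)))
     (farr (ndom \<tau>) (ncmp si (Dom ?D f))))"
   by (simp add: t.F.C.Cmp_assoc)
  finally show ?case by simp
 qed (auto simp: s.fnctr_ndom t.fnctr_ncod s.fnctr_ncod t.fnctr_ndom, auto simp: ntr_hcomp_def)
qed

lemma two_category_CAT: "two_category CAT"
proof (rule two_categoryI, goal_cases)
 case (29 al al' be be')
 interpret a: nat_trans al using 29 by simp
 interpret a': nat_trans al' using 29 by simp
 interpret b: nat_trans be using 29 by simp
 interpret b': nat_trans be' using 29 by simp
 have [simp]: "ndom al' = ncod al" "ndom be' = ncod be" "fdom (ndom be) = fcod (ndom al)" using 29 by auto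
 have [simp]: "fdom (ncod be') = fcod (ndom al)" "fcod (ncod be') = fcod (ndom be)"
  "fdom (ncod al') = fdom (ndom al)" "fcod (ncod al') = fcod (ndom al)"
  using b'.fdom_ncod b'.fcod_ncod a'.fdom_ncod a'.fcod_ncod by simp_all
 \<comment> \<open>The typing of \<open>be\<close>, \<open>be'\<close> and \<open>al'\<close> is
   restated over the carriers of \<open>al\<close> and \<open>be\<close>, so that all side
   conditions of the calculation speak of the same few categories.\<close>
 have x: "x \<in> Obj (fcod (ndom al)) ==> ncmp be x \<in> Arr (fcod (ndom be))"
  "x \<in> Obj (fcod (ndom al)) ==> ncmp be' x \<in> Arr (fcod (ndom be))"
  "x \<in> Obj (fcod (ndom al)) ==> Dom (fcod (ndom be)) (ncmp be x) = fobj (ndom be) x"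
  "x \<in> Obj (fcod (ndom al)) ==> Cod (fcod (ndom be)) (ncmp be x) = fobj (ncod be) x"
  "x \<in> Obj (fcod (ndom al)) ==> Dom (fcod (ndom be)) (ncmp be' x) = fobj (ncod be) x" for x
  using b.ncmp_Arr[of x] b'.ncmp_Arr[of x] b.Dom_ncmp[of x] b.Cod_ncmp[of x] b'.Dom_ncmp[of x] by simp_all
 have y: "x \<in> Obj (fdom (ndom al)) ==> ncmp al' x \<in> Arr (fcod (ndom al))"
  "x \<in> Obj (fdom (ndom al)) ==> fobj (ncod al') x \<in> Obj (fcod (ndom al))"
  "x \<in> Obj (fdom (ndom al)) ==> fobj (ncod al) x \<in> Obj (fcod (ndom al))"
  "x \<in> Obj (fdom (ndom al)) ==> Dom (fcod (ndom al)) (ncmp al' x) = fobj (ncod al) x"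
  "x \<in> Obj (fdom (ndom al)) ==> Cod (fcod (ndom al)) (ncmp al' x) = fobj (ncod al') x" for x
  using a'.ncmp_Arr[of x] a'.G.fobj_Obj[of x] a'.F.fobj_Obj[of x] a'.Dom_ncmp[of x] a'.Cod_ncmp[of x] by simp_all
 have z: "f \<in> Arr (fcod (ndom al)) ==> farr (ndom be) f \<in> Arr (fcod (ndom be))"
  "f \<in> Arr (fcod (ndom al)) ==> farr (ncod be) f \<in> Arr (fcod (ndom be))"
  "f \<in> Arr (fcod (ndom al)) ==> Dom (fcod (ndom be)) (farr (ndom be) f) = fobj (ndom be) (Dom (fcod (ndom al)) f)"
  "f \<in> Arr (fcod (ndom al)) ==> Cod (fcod (ndom be)) (farr (ndom be) f) = fobj (ndom be) (Cod (fcod (ndom al)) f)"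
  "f \<in> Arr (fcod (ndom al)) ==> Dom (fcod (ndom be)) (farr (ncod be) f) = fobj (ncod be) (Dom (fcod (ndom al)) f)"
  "f \<in> Arr (fcod (ndom al)) ==> Cod (fcod (ndom be)) (farr (ncod be) f) = fobj (ncod be) (Cod (fcod (ndom al)) f)"
   for f
  using b.F.farr_Arr[of f] b.F.Dom_farr[of f] b.F.Cod_farr[of f]
   b.G.farr_Arr[of f] b.G.Dom_farr[of f] b.G.Cod_farr[of f] by simp_all
 have bc: "!!f g. f \<in> Arr (fcod (ndom al)) ==> g \<in> Arr (fcod (ndom al)) ==> Dom (fcod (ndom al)) g = Cod (fcod (ndom al)) f
   ==> farr (ndom be) (Cmp (fcod (ndom al)) g f) = Cmp (fcod (ndom be)) (farr (ndom be) g) (farr (ndom be) f)"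
  using b.F.farr_Cmp by simp
 let ?C = "fcod (ndom be)"
 note as = b.F.C.Cmp_assoc
 \<comment> \<open>The one use of naturality in the interchange law: the square of \<open>be\<close>
   at the arrow \<open>ncmp al' x\<close>, with a tail \<open>w\<close> because composites are kept
   right-nested.\<close>
 have nat: "Cmp ?C (ncmp be (fobj (ncod al') x)) (Cmp ?C (farr (ndom be) (ncmp al' x)) w) =
   Cmp ?C (farr (ncod be) (ncmp al' x)) (Cmp ?C (ncmp be (fobj (ncod al) x)) w)"
  if "x \<in> Obj (fdom (ndom al))" "w \<in> Arr ?C" "Cod ?C w = fobj (ndom be) (fobj (ncod al) x)" for x w
  using b.ncmp_natural[of "ncmp al' x"] that by (simp add: as[symmetric] x y z)
 show ?case
 proof (rule ntr_eqI, goal_cases)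
  case (5 u)
  then have u [simp]: "u \<in> Obj (fdom (ndom al))" by simp
  show ?case
   by (simp add: as x y z bc nat)
 qed (use 29 in auto)
next
 case (32 al be ga)
 interpret a: nat_trans al using 32 by simp
 interpret b: nat_trans be using 32 by simp
 interpret c: nat_trans ga using 32 by simp
 have [simp]: "fdom (ndom be) = fcod (ndom al)" "fdom (ndom ga) = fcod (ndom be)" using 32 by auto
 have e: "x \<in> Obj (fcod (ndom al)) ==> fobj (ndom be) x \<in> Obj (fcod (ndom be))"
  "x \<in> Obj (fcod (ndom al)) ==> fobj (ncod be) x \<in> Obj (fcod (ndom be))"
  "f \<in> Arr (fcod (ndom al)) ==> farr (ndom be) f \<in> Arr (fcod (ndom be))"
  "f \<in> Arr (fcod (ndom al)) ==> farr (ncod be) f \<in> Arr (fcod (ndom be))"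
  "f \<in> Arr (fcod (ndom al)) ==> Dom (fcod (ndom be)) (farr (ndom be) f) = fobj (ndom be) (Dom (fcod (ndom al)) f)"
  "f \<in> Arr (fcod (ndom al)) ==> Cod (fcod (ndom be)) (farr (ndom be) f) = fobj (ndom be) (Cod (fcod (ndom al)) f)"
  "x \<in> Obj (fcod (ndom al)) ==> ncmp be x \<in> Arr (fcod (ndom be))"
  "x \<in> Obj (fcod (ndom al)) ==> Dom (fcod (ndom be)) (ncmp be x) = fobj (ndom be) x"
  "x \<in> Obj (fcod (ndom al)) ==> Cod (fcod (ndom be)) (ncmp be x) = fobj (ncod be) x" for x f
  using b.F.fobj_Obj[of x] b.F.farr_Arr[of f] b.ncmp_Arr[of x] b.Dom_ncmp[of x] b.Cod_ncmp[of x]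
   b.F.Dom_farr[of f] b.F.Cod_farr[of f] b.G.fobj_Obj[of x] b.G.farr_Arr[of f] by simp_all
 have e': "x \<in> Obj (fcod (ndom be)) ==> fobj (ndom ga) x \<in> Obj (fcod (ndom ga))"
  "x \<in> Obj (fdom (ndom al)) ==> fobj (ncod al) x \<in> Obj (fcod (ndom al))"
  "f \<in> Arr (fcod (ndom be)) ==> farr (ndom ga) f \<in> Arr (fcod (ndom ga))"
  "f \<in> Arr (fcod (ndom be)) ==> Dom (fcod (ndom ga)) (farr (ndom ga) f) = fobj (ndom ga) (Dom (fcod (ndom be)) f)"
  "f \<in> Arr (fcod (ndom be)) ==> Cod (fcod (ndom ga)) (farr (ndom ga) f) = fobj (ndom ga) (Cod (fcod (ndom be)) f)"
  "x \<in> Obj (fcod (ndom be)) ==> ncmp ga x \<in> Arr (fcod (ndom ga))"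
  "x \<in> Obj (fcod (ndom be)) ==> Dom (fcod (ndom ga)) (ncmp ga x) = fobj (ndom ga) x"
  "x \<in> Obj (fcod (ndom be)) ==> Cod (fcod (ndom ga)) (ncmp ga x) = fobj (ncod ga) x" for x f
  using c.F.fobj_Obj[of x] c.F.farr_Arr[of f] c.ncmp_Arr[of x] c.Dom_ncmp[of x] c.Cod_ncmp[of x]
   c.F.Dom_farr[of f] c.F.Cod_farr[of f] a.G.fobj_Obj[of x] by simp_all
 have bc: "!!f g. f \<in> Arr (fcod (ndom be)) ==> g \<in> Arr (fcod (ndom be)) ==> Dom (fcod (ndom be)) g = Cod (fcod (ndom be)) f
   ==> farr (ndom ga) (Cmp (fcod (ndom be)) g f) = Cmp (fcod (ndom ga)) (farr (ndom ga) g) (farr (ndom ga) f)"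
  using c.F.farr_Cmp by simp
 show ?case
 proof (rule ntr_eqI, goal_cases)
  case (3)
  show ?case by (simp, rule fnct_eqI)
   (use 32 a.fnctr_ndom b.fnctr_ndom c.fnctr_ndom in \<open>auto simp: e\<close>)
 next
  case (4)
  show ?case by (simp, rule fnct_eqI)
   (use 32 a.fnctr_ncod b.fnctr_ncod c.fnctr_ncod a.G.fobj_Obj a.G.farr_Arr in \<open>auto simp: e\<close>)
 next
  case (5 u)
  then have u [simp]: "u \<in> Obj (fdom (ndom al))" by simp
  show ?case
   by (simp add: c.F.C.Cmp_assoc e e' bc)
 qed (use 32 in auto)
next
 case (15 f g h)
 interpret f: fnctr f using 15 by simp
 interpret g: fnctr g using 15 by simp
 interpret h: fnctr h using 15 by simp
 have [simp]: "fcod f = fdom g" using 15 by simp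
 show ?case
  by (simp, rule fnct_eqI) (use 15 f.fobj_Obj f.farr_Arr in auto)
next
 case (28 f g)
 interpret f: fnctr f using 28 by simp
 interpret g: fnctr g using 28 by simp
 have [simp]: "fdom g = fcod f" using 28 by simp
 have [simp]: "x \<in> Obj (fcod f) ==> fobj g x \<in> Obj (fcod g)" for x using g.fobj_Obj[of x] by simp
 have [simp]: "x \<in> Obj (fcod f) ==> farr g (Idn (fcod f) x) = Idn (fcod g) (fobj g x)" for x using g.farr_Idn[of x] by simp
 show ?case
  by (simp, rule ntr_eqI) (use 28 in auto)
next
 case (13 f)
 then interpret fnctr f by simp
 show ?case by (simp, rule fnct_eqI) (use 13 category_fdom in auto)
next
 case (14 f)
 then interpret fnctr f by simp
 show ?case by (simp, rule fnct_eqI) (use 14 category_fcod in auto)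
next
 case (22 f)
 then interpret nat_trans f by simp
 show ?case by (simp, rule ntr_eqI) (use 22 fnctr_ndom in auto)
next
 case (23 f)
 then interpret nat_trans f by simp
 show ?case by (simp, rule ntr_eqI) (use 23 fnctr_ncod in auto)
next
 case (30 f)
 then interpret nat_trans f by simp
 have [simp]: "fnct_comp (ndom f) (fnct_id (fdom (ndom f))) = ndom f"
  by (rule fnct_eqI) (use 30 F.category_fdom in \<open>auto simp: fnctr_ndom\<close>)
 have [simp]: "fnct_comp (ncod f) (fnct_id (fdom (ndom f))) = ncod f"
  by (rule fnct_eqI) (use 30 F.category_fdom in \<open>auto simp: fnctr_ncod\<close>)
 show ?case by (simp, rule ntr_eqI) (use 30 F.category_fdom in auto)
next
 case (31 f)
 then interpret nat_trans f by simp
 have [simp]: "fnct_comp (fnct_id (fcod (ndom f))) (ndom f) = ndom f"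
  by (rule fnct_eqI) (use 31 F.category_fcod in \<open>auto simp: fnctr_ndom\<close>)
 have [simp]: "fnct_comp (fnct_id (fcod (ndom f))) (ncod f) = ncod f"
  by (rule fnct_eqI) (use 31 F.category_fcod G.fobj_Obj G.farr_Arr in \<open>auto simp: fnctr_ncod\<close>)
 show ?case by (simp, rule ntr_eqI) (use 31 F.category_fcod G.fobj_Obj in auto)
next
 case (24 al be ga)
 interpret a: nat_trans al using 24 by simp
 interpret b: nat_trans be using 24 by simp
 interpret c: nat_trans ga using 24 by simp
 have [simp]: "ndom be = ncod al" "ndom ga = ncod be" using 24 by auto
 have [simp]: "fdom (ncod be) = fdom (ndom al)" "fcod (ncod be) = fcod (ndom al)"
  using b.fdom_ncod b.fcod_ncod by simp_all
 have e: "x \<in> Obj (fdom (ndom al)) ==> ncmp be x \<in> Arr (fcod (ndom al))"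
   "x \<in> Obj (fdom (ndom al)) ==> ncmp ga x \<in> Arr (fcod (ndom al))"
   "x \<in> Obj (fdom (ndom al)) ==> Dom (fcod (ndom al)) (ncmp be x) = fobj (ncod al) x"
   "x \<in> Obj (fdom (ndom al)) ==> Dom (fcod (ndom al)) (ncmp ga x) = fobj (ncod be) x"
   "x \<in> Obj (fdom (ndom al)) ==> Cod (fcod (ndom al)) (ncmp be x) = fobj (ncod be) x" for x
  using b.ncmp_Arr[of x] c.ncmp_Arr[of x] b.Dom_ncmp[of x] c.Dom_ncmp[of x] b.Cod_ncmp[of x] by simp_all
 show ?case by (simp, rule ntr_eqI) (use 24 in \<open>auto simp: a.F.C.Cmp_assoc e\<close>)
qed (auto intro: fnctr.category_fdom fnctr.category_fcod nat_trans.fnctr_ndom nat_trans.fnctr_ncod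
  simp: nat_trans.fdom_ncod nat_trans.fcod_ncod)

section \<open>Pseudofunctors, transformations, modifications and the 2-category
  \<open>PS\<close>\<close>

sublocale pseudofunctor \<subseteq> A: two_category A by (rule two_category_A)
sublocale pseudofunctor \<subseteq> H: two_category H by (rule two_category_H)

declare (in pseudofunctor) psf0_Ob [simp] psf1_Mor [simp] src_psf1 [simp] trg_psf1 [simp]
 psf2_Cell [simp] dom2_psf2 [simp] cod2_psf2 [simp] psf2_id2 [simp] psfc_iso [simp]
 dom2_psfc [simp] cod2_psfc [simp] psfu_iso [simp] dom2_psfu [simp] cod2_psfu [simp]

lemma (in pseudofunctor) psf_Cell [simp]:
 "composable A g f ==> psfc F g f \<in> Cell H" "a \<in> Ob A ==> psfu F a \<in> Cell H"
 using H.iso2_Cell by auto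

lemma (in pseudofunctor) psf2_vcomp' [simp]:
 "vseq A y x ==> psf2 F (y #{A} x) = psf2 F y #{H} psf2 F x"
 by (simp add: vseq_def psf2_vcomp)

lemma (in pseudofunctor) psf2_iso [simp]:
 assumes "iso2 A x" shows "iso2 H (psf2 F x)" "psf2 F (inv2 A x) = inv2 H (psf2 F x)" (is "PROP ?C1")
proof -
 have x: "x \<in> Cell A" using assms A.iso2_Cell by blast
 have e: "psf2 F (inv2 A x) #{H} psf2 F x = id2 H (psf1 F (dom2 A x))"
  "psf2 F x #{H} psf2 F (inv2 A x) = id2 H (psf1 F (cod2 A x))"
  using assms x by (simp_all add: psf2_vcomp'[symmetric])
 show "iso2 H (psf2 F x)" by (rule H.iso2I[of "psf2 F (inv2 A x)"]) (use assms x e in auto)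
 show "PROP ?C1"
  by (rule H.inv2_unique[symmetric]) (use assms x e in auto)
qed

sublocale pseudonatural \<subseteq> F: pseudofunctor A H "pdom \<alpha>" by (rule pseudofunctor_pdom)
sublocale pseudonatural \<subseteq> G: pseudofunctor A H "pcod \<alpha>" by (rule pseudofunctor_pcod)

declare (in pseudonatural) pnt1_Mor [simp] src_pnt1 [simp] trg_pnt1 [simp] pnt2_iso [simp]
 dom2_pnt2 [simp] cod2_pnt2 [simp]

lemma (in pseudonatural) pnt2_Cell [simp]: "f \<in> Mor A ==> pnt2 \<alpha> f \<in> Cell H"
 using F.H.iso2_Cell by auto

lemma pseudonatural_two_category:
 "pseudonatural A H al ==> two_category A" "pseudonatural A H al ==> two_category H"
 using pseudonatural.pseudofunctor_pdom pseudofunctor.two_category_A pseudofunctor.two_category_H by blast+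

lemma modification_two_category:
 "modification A H Ga ==> two_category A" "modification A H Ga ==> two_category H"
 using modification.pseudonatural_mdom pseudonatural_two_category by blast+

sublocale modification \<subseteq> a: pseudonatural A H "mdom \<Gamma>" by (rule pseudonatural_mdom)
sublocale modification \<subseteq> b: pseudonatural A H "mcod \<Gamma>" by (rule pseudonatural_mcod)

declare (in modification) pdom_mcod [simp] pcod_mcod [simp] mdf2_Cell [simp] dom2_mdf2 [simp]
 cod2_mdf2 [simp]

lemma PS_simps [simp]:
 "F \<in> Ob (PS A H) \<longleftrightarrow> pseudofunctor A H F" "al \<in> Mor (PS A H) \<longleftrightarrow> pseudonatural A H al"
 "Ga \<in> Cell (PS A H) \<longleftrightarrow> modification A H Ga"
 "src (PS A H) = pdom" "trg (PS A H) = pcod" "dom2 (PS A H) = mdom" "cod2 (PS A H) = mcod"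
 "id1 (PS A H) = pnt_id A H" "comp1 (PS A H) = pnt_comp A H" "id2 (PS A H) = mdf_id A H"
 "vcomp (PS A H) = mdf_vcomp A H" "hcomp (PS A H) = mdf_hcomp A H"
 by (simp_all add: PS_def)

lemma pnt_simps [simp]:
 "pdom (pnt_id A H F) = F" "pcod (pnt_id A H F) = F"
 "a \<in> Ob A ==> pnt1 (pnt_id A H F) a = id1 H (psf0 F a)"
 "f \<in> Mor A ==> pnt2 (pnt_id A H F) f = id2 H (psf1 F f)"
 "pdom (pnt_comp A H be al) = pdom al" "pcod (pnt_comp A H be al) = pcod be"
 "a \<in> Ob A ==> pnt1 (pnt_comp A H be al) a = pnt1 be a o{H} pnt1 al a"
 "f \<in> Mor A ==> pnt2 (pnt_comp A H be al) f = (id2 H (pnt1 be (trg A f)) *{H} pnt2 al f) #{H}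
            (pnt2 be f *{H} id2 H (pnt1 al (src A f)))"
 by (simp_all add: pnt_id_def pnt_comp_def)

lemma mdf_simps [simp]:
 "mdom (mdf_id A H al) = al" "mcod (mdf_id A H al) = al"
 "a \<in> Ob A ==> mdf2 (mdf_id A H al) a = id2 H (pnt1 al a)"
 "mdom (mdf_vcomp A H De Ga) = mdom Ga" "mcod (mdf_vcomp A H De Ga) = mcod De"
 "a \<in> Ob A ==> mdf2 (mdf_vcomp A H De Ga) a = mdf2 De a #{H} mdf2 Ga a"
 "mdom (mdf_hcomp A H De Ga) = pnt_comp A H (mdom De) (mdom Ga)"
 "mcod (mdf_hcomp A H De Ga) = pnt_comp A H (mcod De) (mcod Ga)"
 "a \<in> Ob A ==> mdf2 (mdf_hcomp A H De Ga) a = mdf2 De a *{H} mdf2 Ga a"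
 by (simp_all add: mdf_id_def mdf_vcomp_def mdf_hcomp_def)

lemma psf_eqI:
 assumes "pseudofunctor A H F" "pseudofunctor A H G"
  and "!!a. a \<in> Ob A ==> psf0 F a = psf0 G a" "!!f. f \<in> Mor A ==> psf1 F f = psf1 G f"
  and "!!x. x \<in> Cell A ==> psf2 F x = psf2 G x"
  and "!!g f. composable A g f ==> psfc F g f = psfc G g f"
  and "!!a. a \<in> Ob A ==> psfu F a = psfu G a"
 shows "F = G"
proof -
 interpret F: pseudofunctor A H F by fact
 interpret G: pseudofunctor A H G by fact
 have "psf0 F = psf0 G" using F.psf0_ext G.psf0_ext assms(3) by (rule extensionalityI)
 moreover have "psf1 F = psf1 G" using F.psf1_ext G.psf1_ext assms(4) by (rule extensionalityI)
 moreover have "psf2 F = psf2 G" using F.psf2_ext G.psf2_ext assms(5) by (rule extensionalityI)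
 moreover have "psfu F = psfu G" using F.psfu_ext G.psfu_ext assms(7) by (rule extensionalityI)
 moreover have "psfc F = psfc G" using F.psfc_ext G.psfc_ext assms(6) by (intro ext) metis
 ultimately show ?thesis by simp
qed

lemma pnt_eqI:
 assumes "pseudonatural A H al" "pseudonatural A H be" "pdom al = pdom be" "pcod al = pcod be"
  and "!!a. a \<in> Ob A ==> pnt1 al a = pnt1 be a" "!!f. f \<in> Mor A ==> pnt2 al f = pnt2 be f"
 shows "al = be"
proof -
 interpret F: pseudonatural A H al by fact
 interpret G: pseudonatural A H be by fact
 have "pnt1 al = pnt1 be" using F.pnt1_ext G.pnt1_ext assms(5) by (rule extensionalityI)
 moreover have "pnt2 al = pnt2 be" using F.pnt2_ext G.pnt2_ext assms(6) by (rule extensionalityI)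
 ultimately show ?thesis using assms(3,4) by simp
qed

lemma mdf_eqI:
 assumes "modification A H Ga" "modification A H De" "mdom Ga = mdom De" "mcod Ga = mcod De"
  and "!!a. a \<in> Ob A ==> mdf2 Ga a = mdf2 De a"
 shows "Ga = De"
proof -
 interpret F: modification A H Ga by fact
 interpret G: modification A H De by fact
 have "mdf2 Ga = mdf2 De" using F.mdf2_ext G.mdf2_ext assms(5) by (rule extensionalityI)
 then show ?thesis using assms(3,4) by simp
qed

lemma pseudonatural_pnt_id [simp]:
 assumes "pseudofunctor A H F" shows "pseudonatural A H (pnt_id A H F)"
proof -
 interpret pseudofunctor A H F by fact
 show ?thesis
  by (rule pseudonatural.intro) (simp_all add: assms composable_def, simp_all add: pnt_id_def)
qed

text \<open>Each axiom pastes the axiom of \<open>be\<close>, whiskered on the right by a component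
  of \<open>al\<close>, with the axiom of \<open>al\<close>, whiskered on the left by a component of
  \<open>be\<close>. For composites of 1-cells one square is left over, in which
  \<open>pnt2 be g\<close> and \<open>pnt2 al f\<close> change order.\<close>

lemma pseudonatural_pnt_comp [simp]:
 assumes "pseudonatural A H al" "pseudonatural A H be" "pdom be = pcod al"
 shows "pseudonatural A H (pnt_comp A H be al)"
proof -
 interpret A: two_category A using assms(1) by (rule pseudonatural_two_category)
 interpret H: two_category H using assms(1) by (rule pseudonatural_two_category)
 interpret a: pseudonatural A H al by fact
 interpret b: pseudonatural A H be by fact
 have [simp]: "src H (pnt1 be x) = psf0 (pcod al) x" if "x \<in> Ob A" for x
  using b.src_pnt1[OF that] assms by simp
 have [simp]: "cod2 H (pnt2 be f) = pnt1 be (trg A f) o{H} psf1 (pcod al) f" if "f \<in> Mor A" for f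
  using b.cod2_pnt2[OF that] assms by simp
 show ?thesis
 proof (rule pseudonatural.intro, goal_cases)
  case (11 x)
  then have x [simp]: "x \<in> Cell A" .
  let ?f = "dom2 A x" and ?g = "cod2 A x" and ?s = "src A (dom2 A x)" and ?t = "trg A (dom2 A x)"
  have 1: "(pnt2 be ?g *{H} id2 H (pnt1 al ?s)) #{H} (psf2 (pcod be) x *{H} id2 H (pnt1 be ?s o{H} pnt1 al ?s))
   = (id2 H (pnt1 be ?t) *{H} (psf2 (pcod al) x *{H} id2 H (pnt1 al ?s))) #{H} (pnt2 be ?f *{H} id2 H (pnt1 al ?s))"
   using arg_cong[OF b.pnt2_natural[OF x], of "%z. z *{H} id2 H (pnt1 al ?s)"]
   by (simp add: H.pasting assms)
  have 2: "(id2 H (pnt1 be ?t) *{H} pnt2 al ?g) #{H} (id2 H (pnt1 be ?t) *{H} (psf2 (pcod al) x *{H} id2 H (pnt1 al ?s)))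
   = (id2 H (pnt1 be ?t o{H} pnt1 al ?t) *{H} psf2 (pdom al) x) #{H} (id2 H (pnt1 be ?t) *{H} pnt2 al ?f)"
   using arg_cong[OF a.pnt2_natural[OF x], of "%z. id2 H (pnt1 be ?t) *{H} z"]
   by (simp add: H.pasting assms)
  show ?case
   by (simp add: H.pasting 1 2 H.vcomp_pre[OF 2] assms)
 next
  case (12 g f)
  then have c [simp]: "f \<in> Mor A" "g \<in> Mor A" "src A g = trg A f"
   and cc: "composable A g f" by (auto simp: composable_def)
  let ?a = "src A f" and ?b = "trg A f" and ?c = "trg A g"
  note * = arg_cong[OF b.pnt2_comp1[OF cc], of "%z. z *{H} id2 H (pnt1 al ?a)"]
    arg_cong[OF a.pnt2_comp1[OF cc], of "%z. id2 H (pnt1 be ?c) *{H} z"]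
    H.exchange(1)[of "pnt2 be g" "pnt2 al f"]
  have 1: "(pnt2 be (g o{A} f) *{H} id2 H (pnt1 al ?a)) #{H} (psfc (pcod be) g f *{H} id2 H (pnt1 be ?a o{H} pnt1 al ?a)) =
   (id2 H (pnt1 be ?c) *{H} (psfc (pcod al) g f *{H} id2 H (pnt1 al ?a))) #{H}
   (pnt2 be g *{H} id2 H (psf1 (pcod al) f o{H} pnt1 al ?a)) #{H}
   (id2 H (psf1 (pcod be) g) *{H} (pnt2 be f *{H} id2 H (pnt1 al ?a)))"
   using *(1) by (simp add: H.pasting assms)
  have 2: "(id2 H (pnt1 be ?c) *{H} pnt2 al (g o{A} f)) #{H} (id2 H (pnt1 be ?c) *{H} (psfc (pcod al) g f *{H} id2 H (pnt1 al ?a))) =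
   (id2 H (pnt1 be ?c o{H} pnt1 al ?c) *{H} psfc (pdom al) g f) #{H}
   (id2 H (pnt1 be ?c) *{H} (pnt2 al g *{H} id2 H (psf1 (pdom al) f))) #{H}
   (id2 H (pnt1 be ?c o{H} psf1 (pcod al) g) *{H} pnt2 al f)"
   using *(2) by (simp add: H.pasting assms)
  have 3: "(id2 H (pnt1 be ?c o{H} psf1 (pcod al) g) *{H} pnt2 al f) #{H} (pnt2 be g *{H} id2 H (psf1 (pcod al) f o{H} pnt1 al ?a))
   = (pnt2 be g *{H} id2 H (pnt1 al ?b o{H} psf1 (pdom al) f)) #{H}
    (id2 H (psf1 (pcod be) g o{H} pnt1 be ?b) *{H} pnt2 al f)"
   using *(3) by (simp add: H.pasting assms)
  show ?case
   by (simp add: H.pasting 1 H.vcomp_pre[OF 2] H.vcomp_pre[OF 3] assms)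
 next
  case (13 x)
  then have x [simp]: "x \<in> Ob A" .
  have 1: "(pnt2 be (id1 A x) *{H} id2 H (pnt1 al x)) #{H} (psfu (pcod be) x *{H} id2 H (pnt1 be x o{H} pnt1 al x)) =
   id2 H (pnt1 be x) *{H} (psfu (pcod al) x *{H} id2 H (pnt1 al x))"
   using arg_cong[OF b.pnt2_id1[OF x], of "%z. z *{H} id2 H (pnt1 al x)"]
   by (simp add: H.pasting assms)
  show ?case
   using arg_cong[OF a.pnt2_id1[OF x], of "%z. id2 H (pnt1 be x) *{H} z"]
   by (simp add: H.pasting 1 assms)
 qed (simp_all add: a.pseudofunctor_pdom b.pseudofunctor_pcod assms H.comp1_assoc', simp_all add: pnt_comp_def assms)
qed

lemma modification_mdf_id [simp]:
 assumes "pseudonatural A H al" shows "modification A H (mdf_id A H al)"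
proof -
 interpret pseudonatural A H al by fact
 show ?thesis
  by (rule modification.intro) (simp_all add: assms, simp_all add: mdf_id_def)
qed

lemma modification_mdf_vcomp [simp]:
 assumes "modification A H Ga" "modification A H De" "mdom De = mcod Ga"
 shows "modification A H (mdf_vcomp A H De Ga)"
proof -
 interpret A: two_category A using assms(1) by (rule modification_two_category)
 interpret H: two_category H using assms(1) by (rule modification_two_category)
 interpret a: modification A H Ga by fact
 interpret b: modification A H De by fact
 have [simp]: "dom2 H (mdf2 De x) = pnt1 (mcod Ga) x" if "x \<in> Ob A" for x
  using b.dom2_mdf2[OF that] assms by simp
 show ?thesis
 proof (rule modification.intro, goal_cases)
  case (9 f)
  then have x [simp]: "f \<in> Mor A" .
  have "src H (pnt1 (mcod De) (src A f)) = psf0 (pdom (mdom Ga)) (src A f)"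
    "trg H (pnt1 (mcod De) (src A f)) = psf0 (pcod (mdom Ga)) (src A f)"
    "src H (pnt1 (mcod De) (trg A f)) = psf0 (pdom (mdom Ga)) (trg A f)"
    "trg H (pnt1 (mcod De) (trg A f)) = psf0 (pcod (mdom Ga)) (trg A f)"
   using b.b.src_pnt1[of "src A f"] b.b.trg_pnt1[of "src A f"]
    b.b.src_pnt1[of "trg A f"] b.b.trg_pnt1[of "trg A f"] assms(3) by simp_all
  note [simp] = this
  have [simp]: "dom2 H (pnt2 (mcod De) f) = psf1 (pcod (mdom Ga)) f o{H} pnt1 (mcod De) (src A f)"
    "cod2 H (pnt2 (mcod De) f) = pnt1 (mcod De) (trg A f) o{H} psf1 (pdom (mdom Ga)) f"
   using b.b.dom2_pnt2[OF x] b.b.cod2_pnt2[OF x] assms(3) by simp_all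
  have 1: "pnt2 (mcod De) f #{H} (id2 H (psf1 (pcod (mdom Ga)) f) *{H} mdf2 De (src A f))
    = (mdf2 De (trg A f) *{H} id2 H (psf1 (pdom (mdom Ga)) f)) #{H} pnt2 (mcod Ga) f"
   using b.mdf2_natural[OF x] assms(3) by simp
  show ?case
   by (simp add: H.pasting H.vcomp_pre[OF 1] a.mdf2_natural assms)
 qed (simp_all add: a.pseudonatural_mdom b.pseudonatural_mcod, simp_all add: mdf_vcomp_def assms)
qed

lemma modification_mdf_hcomp [simp]:
 assumes "modification A H Ga" "modification A H De" "pdom (mdom De) = pcod (mdom Ga)"
 shows "modification A H (mdf_hcomp A H De Ga)"
proof -
 interpret A: two_category A using assms(1) by (rule modification_two_category)
 interpret H: two_category H using assms(1) by (rule modification_two_category)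
 interpret a: modification A H Ga by fact
 interpret b: modification A H De by fact
 show ?thesis
 proof (rule modification.intro, goal_cases)
  case (9 f)
  then have x [simp]: "f \<in> Mor A" .
  let ?s = "src A f" and ?t = "trg A f"
  let ?al = "mdom Ga" and ?al' = "mcod Ga" and ?be = "mdom De" and ?be' = "mcod De"
  note [simp] = assms(3)
  have 0: "pnt2 ?be' f #{H} (id2 H (psf1 (pcod ?be) f) *{H} mdf2 De ?s)
    = (mdf2 De ?t *{H} id2 H (psf1 (pcod ?al) f)) #{H} pnt2 ?be f"
   using b.mdf2_natural[OF x] by simp
  have [simp]: "src H (pnt1 ?al' ?s) = psf0 (pdom ?al) ?s" "trg H (pnt1 ?al' ?s) = psf0 (pcod ?al) ?s"
    "src H (pnt1 ?be' ?s) = psf0 (pcod ?al) ?s" "trg H (pnt1 ?be' ?s) = psf0 (pcod ?be) ?s"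
    "src H (pnt1 ?al' ?t) = psf0 (pdom ?al) ?t" "trg H (pnt1 ?al' ?t) = psf0 (pcod ?al) ?t"
    "src H (pnt1 ?be' ?t) = psf0 (pcod ?al) ?t" "trg H (pnt1 ?be' ?t) = psf0 (pcod ?be) ?t"
   by simp_all
  have [simp]: "dom2 H (pnt2 ?be' f) = psf1 (pcod ?be) f o{H} pnt1 ?be' ?s"
    "cod2 H (pnt2 ?be' f) = pnt1 ?be' ?t o{H} psf1 (pcod ?al) f"
    "dom2 H (pnt2 ?al' f) = psf1 (pcod ?al) f o{H} pnt1 ?al' ?s"
    "cod2 H (pnt2 ?al' f) = pnt1 ?al' ?t o{H} psf1 (pdom ?al) f"
   by simp_all
  \<comment> \<open>Interchange permits either order. With \<open>De\<close> outermost at the source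
    of \<open>f\<close> and \<open>Ga\<close> outermost at the target, the axiom of
    \<open>De\<close> and then that of \<open>Ga\<close> carry the cells across
    \<open>f\<close>.\<close>
  have ex: "mdf2 De ?s *{H} mdf2 Ga ?s = (mdf2 De ?s *{H} id2 H (pnt1 ?al' ?s)) #{H} (id2 H (pnt1 ?be ?s) *{H} mdf2 Ga ?s)"
   "mdf2 De ?t *{H} mdf2 Ga ?t = (id2 H (pnt1 ?be' ?t) *{H} mdf2 Ga ?t) #{H} (mdf2 De ?t *{H} id2 H (pnt1 ?al ?t))"
   using H.exchange(2)[of "mdf2 De ?s" "mdf2 Ga ?s"] H.exchange(3)[of "mdf2 De ?t" "mdf2 Ga ?t"] by simp_all
  have 1: "(pnt2 ?be' f *{H} id2 H (pnt1 ?al' ?s)) #{H} (id2 H (psf1 (pcod ?be) f) *{H} (mdf2 De ?s *{H} id2 H (pnt1 ?al' ?s)))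
    = (mdf2 De ?t *{H} id2 H (psf1 (pcod ?al) f o{H} pnt1 ?al' ?s)) #{H} (pnt2 ?be f *{H} id2 H (pnt1 ?al' ?s))"
   using arg_cong[OF 0, of "%z. z *{H} id2 H (pnt1 ?al' ?s)"] by (simp add: H.pasting)
  have 2: "(pnt2 ?be f *{H} id2 H (pnt1 ?al' ?s)) #{H} (id2 H (psf1 (pcod ?be) f o{H} pnt1 ?be ?s) *{H} mdf2 Ga ?s)
   = (id2 H (pnt1 ?be ?t o{H} psf1 (pcod ?al) f) *{H} mdf2 Ga ?s) #{H} (pnt2 ?be f *{H} id2 H (pnt1 ?al ?s))"
   using H.exchange(1)[of "pnt2 ?be f" "mdf2 Ga ?s"] by simp
  have 3: "(mdf2 De ?t *{H} id2 H (psf1 (pcod ?al) f o{H} pnt1 ?al' ?s)) #{H} (id2 H (pnt1 ?be ?t o{H} psf1 (pcod ?al) f) *{H} mdf2 Ga ?s)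
   = (id2 H (pnt1 ?be' ?t o{H} psf1 (pcod ?al) f) *{H} mdf2 Ga ?s) #{H} (mdf2 De ?t *{H} id2 H (psf1 (pcod ?al) f o{H} pnt1 ?al ?s))"
   using H.exchange(1)[of "mdf2 De ?t" "id2 H (psf1 (pcod ?al) f) *{H} mdf2 Ga ?s"] by (simp add: H.pasting)
  have 4: "(id2 H (pnt1 ?be' ?t) *{H} pnt2 ?al' f) #{H} (id2 H (pnt1 ?be' ?t o{H} psf1 (pcod ?al) f) *{H} mdf2 Ga ?s)
    = (id2 H (pnt1 ?be' ?t) *{H} (mdf2 Ga ?t *{H} id2 H (psf1 (pdom ?al) f))) #{H} (id2 H (pnt1 ?be' ?t) *{H} pnt2 ?al f)"
   using arg_cong[OF a.mdf2_natural[OF x], of "%z. id2 H (pnt1 ?be' ?t) *{H} z"] by (simp add: H.pasting)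
  have 5: "(id2 H (pnt1 ?be' ?t) *{H} pnt2 ?al f) #{H} (mdf2 De ?t *{H} id2 H (psf1 (pcod ?al) f o{H} pnt1 ?al ?s)) =
   (mdf2 De ?t *{H} id2 H (pnt1 ?al ?t o{H} psf1 (pdom ?al) f)) #{H} (id2 H (pnt1 ?be ?t) *{H} pnt2 ?al f)"
   using H.exchange(1)[of "mdf2 De ?t" "pnt2 ?al f"] by simp
  show ?case
   by (simp add: ex) (simp add: H.pasting H.vcomp_pre[OF 1] 2 H.vcomp_pre[OF 3] H.vcomp_pre[OF 4] H.vcomp_pre[OF 5])
 qed (simp_all add: a.pseudonatural_mdom b.pseudonatural_mdom a.pseudonatural_mcod b.pseudonatural_mcod assms,
    simp_all add: mdf_hcomp_def assms)
qed

text \<open>All laws are checked componentwise, since transformations and modifications are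
  extensional. The unit and associativity laws for horizontal composition of modifications also rest
  on the same laws for their domains and codomains.\<close>

lemma two_category_PS [simp]:
 assumes "two_category A" "two_category H" shows "two_category (PS A H)"
proof -
 interpret A: two_category A by fact
 interpret H: two_category H by fact
 show ?thesis
 proof (rule two_categoryI, goal_cases)
  case (13 f)
  then interpret pseudonatural A H f by simp
  show ?case by (simp, rule pnt_eqI[of A H]) (use 13 in \<open>simp_all add: pseudofunctor_pdom\<close>)
 next
  case (14 f)
  then interpret pseudonatural A H f by simp
  show ?case by (simp, rule pnt_eqI[of A H]) (use 14 in \<open>simp_all add: pseudofunctor_pcod\<close>)
 next
  case (15 f g h)
  interpret f: pseudonatural A H f using 15 by simp
  interpret g: pseudonatural A H g using 15 by simp
  interpret h: pseudonatural A H h using 15 by simp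
  show ?case by (simp, rule pnt_eqI[of A H]) (use 15 in \<open>simp_all add: H.pasting\<close>)
 next
  case (22 f)
  then interpret modification A H f by simp
  show ?case by (simp, rule mdf_eqI[of A H]) (use 22 in \<open>simp_all add: pseudonatural_mdom\<close>)
 next
  case (23 f)
  then interpret modification A H f by simp
  show ?case by (simp, rule mdf_eqI[of A H]) (use 23 in \<open>simp_all add: pseudonatural_mcod\<close>)
 next
  case (24 f g h)
  interpret f: modification A H f using 24 by simp
  interpret g: modification A H g using 24 by simp
  interpret h: modification A H h using 24 by simp
  show ?case by (simp, rule mdf_eqI[of A H]) (use 24 in \<open>simp_all add: H.pasting\<close>)
 next
  case (28 f g)
  interpret f: pseudonatural A H f using 28 by simp
  interpret g: pseudonatural A H g using 28 by simp
  show ?case by (simp, rule mdf_eqI[of A H]) (use 28 in \<open>simp_all\<close>)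
 next
  case (29 f f' g g')
  interpret f: modification A H f using 29 by simp
  interpret g: modification A H g using 29 by simp
  interpret f': modification A H f' using 29 by simp
  interpret g': modification A H g' using 29 by simp
  have e: "pdom (mdom f') = pdom (mdom f)" "pcod (mdom f') = pcod (mdom f)"
    "pdom (mdom g') = pdom (mdom g)" "pcod (mdom g') = pcod (mdom g)"
   using 29 by simp_all
  show ?case by (simp, rule mdf_eqI[of A H]) (use 29 in \<open>simp_all add: H.interchange' e\<close>)
 next
  case (30 f)
  then interpret modification A H f by simp
  have [simp]: "pnt_comp A H (mdom f) (pnt_id A H (pdom (mdom f))) = mdom f"
   by (rule pnt_eqI[of A H]) (simp_all add: pseudonatural_mdom a.pseudofunctor_pdom)
  have [simp]: "pnt_comp A H (mcod f) (pnt_id A H (pdom (mdom f))) = mcod f"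
   by (rule pnt_eqI[of A H]) (simp_all add: pseudonatural_mcod a.pseudofunctor_pdom)
  show ?case by (simp, rule mdf_eqI[of A H]) (use 30 in \<open>simp_all add: a.pseudofunctor_pdom\<close>)
 next
  case (31 f)
  then interpret modification A H f by simp
  have [simp]: "pnt_comp A H (pnt_id A H (pcod (mdom f))) (mdom f) = mdom f"
   by (rule pnt_eqI[of A H]) (simp_all add: pseudonatural_mdom a.pseudofunctor_pcod)
  have [simp]: "pnt_comp A H (pnt_id A H (pcod (mdom f))) (mcod f) = mcod f"
   by (rule pnt_eqI[of A H]) (simp_all add: pseudonatural_mcod a.pseudofunctor_pcod)
  show ?case by (simp, rule mdf_eqI[of A H]) (use 31 in \<open>simp_all add: a.pseudofunctor_pcod\<close>)
 next
  case (32 f g h)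
  interpret f: modification A H f using 32 by simp
  interpret g: modification A H g using 32 by simp
  interpret h: modification A H h using 32 by simp
  have [simp]: "pnt_comp A H (pnt_comp A H (mdom h) (mdom g)) (mdom f) = pnt_comp A H (mdom h) (pnt_comp A H (mdom g) (mdom f))"
   by (rule pnt_eqI[of A H]) (use 32 f.pseudonatural_mdom g.pseudonatural_mdom h.pseudonatural_mdom in \<open>simp_all add: H.pasting\<close>)
  have [simp]: "pnt_comp A H (pnt_comp A H (mcod h) (mcod g)) (mcod f) = pnt_comp A H (mcod h) (pnt_comp A H (mcod g) (mcod f))"
   by (rule pnt_eqI[of A H]) (use 32 f.pseudonatural_mcod g.pseudonatural_mcod h.pseudonatural_mcod in \<open>simp_all add: H.pasting\<close>)
  show ?case by (simp, rule mdf_eqI[of A H]) (use 32 in \<open>simp_all add: H.pasting\<close>)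
 qed (auto intro: pseudonatural.pseudofunctor_pdom pseudonatural.pseudofunctor_pcod
    modification.pseudonatural_mdom modification.pseudonatural_mcod
    simp: modification.pdom_mcod modification.pcod_mcod)
qed

section \<open>Strict 2-functors, composition, pre- and postcomposition\<close>

text \<open>Representables, the Yoneda embedding, relabelling, pre- and postcomposition are all
  strict. Treating them in one locale makes their coherence cells identities, so that composites
  with a pseudofunctor have the explicit structure cells of
  \<open>psf_comp_strict_psfc\<close>.\<close>

locale strict_functor = A: two_category A + H: two_category H
 for A :: "('o, 'm, 'c) twocat" and H :: "('p, 'n, 'd) twocat" +
 fixes F0 :: "'o => 'p" and F1 :: "'m => 'n" and F2 :: "'c => 'd"
 assumes F0_Ob [simp]: "a \<in> Ob A ==> F0 a \<in> Ob H"
  and F1_Mor [simp]: "f \<in> Mor A ==> F1 f \<in> Mor H"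
  and F1_src [simp]: "f \<in> Mor A ==> src H (F1 f) = F0 (src A f)"
  and F1_trg [simp]: "f \<in> Mor A ==> trg H (F1 f) = F0 (trg A f)"
  and F2_Cell [simp]: "x \<in> Cell A ==> F2 x \<in> Cell H"
  and F2_dom2 [simp]: "x \<in> Cell A ==> dom2 H (F2 x) = F1 (dom2 A x)"
  and F2_cod2 [simp]: "x \<in> Cell A ==> cod2 H (F2 x) = F1 (cod2 A x)"
  and F1_id1 [simp]: "a \<in> Ob A ==> F1 (id1 A a) = id1 H (F0 a)"
  and F1_comp1 [simp]: "composable A g f ==> F1 (g o{A} f) = F1 g o{H} F1 f"
  and F2_id2 [simp]: "f \<in> Mor A ==> F2 (id2 A f) = id2 H (F1 f)"
  and F2_vcomp [simp]: "vseq A y x ==> F2 (y #{A} x) = F2 y #{H} F2 x"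
  and F2_hcomp [simp]: "hseq A y x ==> F2 (y *{A} x) = F2 y *{H} F2 x"

lemma strict_psf_simps [simp]:
 "a \<in> Ob A ==> psf0 (strict_psf A H F0 F1 F2) a = F0 a"
 "f \<in> Mor A ==> psf1 (strict_psf A H F0 F1 F2) f = F1 f"
 "x \<in> Cell A ==> psf2 (strict_psf A H F0 F1 F2) x = F2 x"
 "composable A g f ==> psfc (strict_psf A H F0 F1 F2) g f = id2 H (F1 (g o{A} f))"
 "a \<in> Ob A ==> psfu (strict_psf A H F0 F1 F2) a = id2 H (F1 (id1 A a))"
 by (simp_all add: strict_psf_def)

lemma psf_comp_simps [simp]:
 "a \<in> Ob A ==> psf0 (psf_comp A K G F) a = psf0 G (psf0 F a)"
 "f \<in> Mor A ==> psf1 (psf_comp A K G F) f = psf1 G (psf1 F f)"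
 "x \<in> Cell A ==> psf2 (psf_comp A K G F) x = psf2 G (psf2 F x)"
 by (simp_all add: psf_comp_def)

lemma psf_comp_psfc:
 "composable A g f ==> psfc (psf_comp A K G F) g f = psf2 G (psfc F g f) #{K} psfc G (psf1 F g) (psf1 F f)"
 "a \<in> Ob A ==> psfu (psf_comp A K G F) a = psf2 G (psfu F a) #{K} psfu G (psf0 F a)"
 by (simp_all add: psf_comp_def)

context strict_functor
begin

lemma pseudofunctor_strict: "pseudofunctor A H (strict_psf A H F0 F1 F2)"
 by (rule pseudofunctor.intro)
  (simp_all add: A.two_category_axioms H.two_category_axioms vseq_def[symmetric] hseq_def[symmetric]
   H.pasting A.comp1_assoc' H.interchange' composable_def, auto simp: strict_psf_def composable_def)

lemma F2_iso2:
 assumes "iso2 A x" shows "iso2 H (F2 x)" "F2 (inv2 A x) = inv2 H (F2 x)"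
 using pseudofunctor.psf2_iso[OF pseudofunctor_strict assms] A.iso2_Cell[OF assms] assms by simp_all

end

text \<open>A structure cell of the composite is G applied to one of F, preceded by one of G. Each
  coherence law therefore splits into the law of F under \<open>psf2 G\<close>, naturality of
  \<open>psfc G\<close> at a structure cell of F, and the law of G.\<close>

lemma pseudofunctor_psf_comp:
 assumes "pseudofunctor A H F" "pseudofunctor H K G"
 shows "pseudofunctor A K (psf_comp A K G F)"
proof -
 interpret A: two_category A using assms(1) by (rule pseudofunctor.two_category_A)
 interpret H: two_category H using assms(1) by (rule pseudofunctor.two_category_H)
 interpret K: two_category K using assms(2) by (rule pseudofunctor.two_category_H)
 interpret F: pseudofunctor A H F by fact
 interpret G: pseudofunctor H K G by fact
 show ?thesis
 proof (rule pseudofunctor.intro, goal_cases)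
  case (23 x y)
  then have [simp]: "x \<in> Cell A" "y \<in> Cell A" "src A (dom2 A y) = trg A (dom2 A x)" by auto
  have 1: "psf2 G (psf2 F (y *{A} x)) #{K} psf2 G (psfc F (dom2 A y) (dom2 A x)) =
   psf2 G (psfc F (cod2 A y) (cod2 A x)) #{K} psf2 G (psf2 F y *{H} psf2 F x)"
   using arg_cong[OF F.psfc_natural[of x y], of "psf2 G"] by simp
  show ?case using G.psfc_natural[of "psf2 F x" "psf2 F y"]
   by (simp add: psf_comp_psfc K.pasting K.vcomp_pre[OF 1])
 next
  case (24 g f h)
  then have [simp]: "f \<in> Mor A" "g \<in> Mor A" "h \<in> Mor A" "src A g = trg A f" "src A h = trg A g"
   by (auto simp: composable_def)
  have 1: "psf2 G (psfc F (h o{A} g) f) #{K} psf2 G (psfc F h g *{H} id2 H (psf1 F f)) =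
   psf2 G (psfc F h (g o{A} f)) #{K} psf2 G (id2 H (psf1 F h) *{H} psfc F g f)"
   using arg_cong[OF F.psfc_assoc[of g f h], of "psf2 G"] by simp
  have 2: "psfc G (psf1 F (h o{A} g)) (psf1 F f) #{K} (psf2 G (psfc F h g) *{K} id2 K (psf1 G (psf1 F f)))
   = psf2 G (psfc F h g *{H} id2 H (psf1 F f)) #{K} psfc G (psf1 F h o{H} psf1 F g) (psf1 F f)"
   using G.psfc_natural[of "id2 H (psf1 F f)" "psfc F h g"] by simp
  have 3: "psfc G (psf1 F h) (psf1 F (g o{A} f)) #{K} (id2 K (psf1 G (psf1 F h)) *{K} psf2 G (psfc F g f))
   = psf2 G (id2 H (psf1 F h) *{H} psfc F g f) #{K} psfc G (psf1 F h) (psf1 F g o{H} psf1 F f)"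
   using G.psfc_natural[of "psfc F g f" "id2 H (psf1 F h)"] by simp
  have 4: "psfc G (psf1 F h o{H} psf1 F g) (psf1 F f) #{K} (psfc G (psf1 F h) (psf1 F g) *{K} id2 K (psf1 G (psf1 F f)))
    = psfc G (psf1 F h) (psf1 F g o{H} psf1 F f) #{K} (id2 K (psf1 G (psf1 F h)) *{K} psfc G (psf1 F g) (psf1 F f))"
   using G.psfc_assoc[of "psf1 F g" "psf1 F f" "psf1 F h"] by simp
  show ?case
   by (simp add: psf_comp_psfc K.pasting K.vcomp_pre[OF 1] K.vcomp_pre[OF 2] K.vcomp_pre[OF 3] 4 A.comp1_assoc' H.comp1_assoc')
 next
  case (25 f)
  then have [simp]: "f \<in> Mor A" .
  have 1: "psf2 G (psfc F f (id1 A (src A f))) #{K} psf2 G (id2 H (psf1 F f) *{H} psfu F (src A f)) = id2 K (psf1 G (psf1 F f))"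
   using arg_cong[OF F.psfc_unit_right[of f], of "psf2 G"] by simp
  have 2: "psfc G (psf1 F f) (psf1 F (id1 A (src A f))) #{K} (id2 K (psf1 G (psf1 F f)) *{K} psf2 G (psfu F (src A f)))
   = psf2 G (id2 H (psf1 F f) *{H} psfu F (src A f)) #{K} psfc G (psf1 F f) (id1 H (psf0 F (src A f)))"
   using G.psfc_natural[of "psfu F (src A f)" "id2 H (psf1 F f)"] by simp
  show ?case using G.psfc_unit_right[of "psf1 F f"]
   by (simp add: psf_comp_psfc K.pasting 1 K.vcomp_pre[OF 1] K.vcomp_pre[OF 2])
 next
  case (26 f)
  then have [simp]: "f \<in> Mor A" .
  have 1: "psf2 G (psfc F (id1 A (trg A f)) f) #{K} psf2 G (psfu F (trg A f) *{H} id2 H (psf1 F f)) = id2 K (psf1 G (psf1 F f))"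
   using arg_cong[OF F.psfc_unit_left[of f], of "psf2 G"] by simp
  have 2: "psfc G (psf1 F (id1 A (trg A f))) (psf1 F f) #{K} (psf2 G (psfu F (trg A f)) *{K} id2 K (psf1 G (psf1 F f)))
   = psf2 G (psfu F (trg A f) *{H} id2 H (psf1 F f)) #{K} psfc G (id1 H (psf0 F (trg A f))) (psf1 F f)"
   using G.psfc_natural[of "id2 H (psf1 F f)" "psfu F (trg A f)"] by simp
  show ?case using G.psfc_unit_left[of "psf1 F f"]
   by (simp add: psf_comp_psfc K.pasting 1 K.vcomp_pre[OF 1] K.vcomp_pre[OF 2])
 qed (simp_all add: A.two_category_axioms K.two_category_axioms vseq_def[symmetric] psf_comp_psfc composable_def,
    auto simp: psf_comp_def composable_def)
qed

lemma psf_op_simps [simp]: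
 "psf0 (psf_op F) = psf0 F" "psf1 (psf_op F) = psf1 F" "psf2 (psf_op F) = psf2 F"
 "psfc (psf_op F) g f = psfc F f g" "psfu (psf_op F) = psfu F"
 by (simp_all add: psf_op_def)

lemma pseudofunctor_psf_op [simp]:
 assumes "pseudofunctor A H F" shows "pseudofunctor (op2 A) (op2 H) (psf_op F)"
proof -
 interpret pseudofunctor A H F by fact
 show ?thesis
  by (rule pseudofunctor.intro)
   (simp_all add: A.two_category_op2 H.two_category_op2 psf0_ext psf1_ext psf2_ext psfc_ext psfu_ext
    psfc_natural psfc_assoc psfc_unit_left psfc_unit_right vseq_def[symmetric])
qed

context strict_functor
begin

abbreviation "K \<equiv> strict_psf A H F0 F1 F2"

lemma psf_comp_strict_psfc [simp]:
 assumes "pseudofunctor D A F"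
 shows "composable D g f ==> psfc (psf_comp D H K F) g f = F2 (psfc F g f)" (is "PROP ?C0")
 "a \<in> Ob D ==> psfu (psf_comp D H K F) a = F2 (psfu F a)" (is "PROP ?C1")
proof -
 interpret F: pseudofunctor D A F by fact
 show "PROP ?C0"
 "PROP ?C1"
  by (simp_all add: psf_comp_psfc composable_def)
qed

lemma pseudofunctor_psf_comp_strict [simp]:
 "pseudofunctor D A F ==> pseudofunctor D H (psf_comp D H K F)"
 by (rule pseudofunctor_psf_comp[OF _ pseudofunctor_strict])

lemma pnt_post_simps [simp]:
 "pdom (pnt_post D H K al) = psf_comp D H K (pdom al)"
 "pcod (pnt_post D H K al) = psf_comp D H K (pcod al)"
 by (simp_all add: pnt_post_def)

lemma pnt_post_simps2 [simp]:
 assumes "pseudonatural D A al"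
 shows "a \<in> Ob D ==> pnt1 (pnt_post D H K al) a = F1 (pnt1 al a)" (is "PROP ?C0")
 "f \<in> Mor D ==> pnt2 (pnt_post D H K al) f = F2 (pnt2 al f)" (is "PROP ?C1")
proof -
 interpret pseudonatural D A al by fact
 show "PROP ?C0"
 "PROP ?C1"
  by (simp_all add: pnt_post_def)
qed

lemma mdf_post_simps [simp]:
 "mdom (mdf_post D H K Ga) = pnt_post D H K (mdom Ga)"
 "mcod (mdf_post D H K Ga) = pnt_post D H K (mcod Ga)"
 "modification D A Ga ==> a \<in> Ob D ==> mdf2 (mdf_post D H K Ga) a = F2 (mdf2 Ga a)"
 using modification.mdf2_Cell by (fastforce simp: mdf_post_def)+

lemma pseudonatural_pnt_post [simp]:
 assumes "pseudonatural D A al" shows "pseudonatural D H (pnt_post D H K al)"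
proof -
 interpret pseudonatural D A al by fact
 note p [simp] = pseudofunctor_pdom pseudofunctor_pcod pseudofunctor_strict
 show ?thesis
 proof (rule pseudonatural.intro, goal_cases)
  case (11 x)
  then show ?case using arg_cong[OF pnt2_natural[of x], of F2] assms by simp
 next
  case (12 g f)
  then show ?case using arg_cong[OF pnt2_comp1[of g f], of F2] assms by (simp add: composable_def A.comp1_assoc')
 next
  case (13 x)
  then show ?case using arg_cong[OF pnt2_id1[of x], of F2] assms by simp
 qed (simp_all add: assms F2_iso2, simp_all add: pnt_post_def)
qed

lemma modification_mdf_post [simp]:
 assumes "modification D A Ga" shows "modification D H (mdf_post D H K Ga)"
proof -
 interpret modification D A Ga by fact
 note p [simp] = pseudonatural_mdom pseudonatural_mcod
 show ?thesis
 proof (rule modification.intro, goal_cases)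
  case (9 f)
  then show ?case using arg_cong[OF mdf2_natural[of f], of F2] assms by simp
 qed (simp_all add: assms, simp_all add: mdf_post_def)
qed

text \<open>Strictness is what lets \<open>pnt_post\<close> apply the functor to structure cells
  directly, with no comparison cell to insert; the composition laws then hold as equations.\<close>

lemma strict_functor_post:
 assumes "two_category D"
 shows "strict_functor (PS D A) (PS D H) (psf_comp D H K) (pnt_post D H K) (mdf_post D H K)"
proof -
 interpret D: two_category D by fact
 note p [simp] = pseudofunctor_strict D.two_category_axioms A.two_category_axioms H.two_category_axioms
 have id: "pnt_post D H K (pnt_id D A F) = pnt_id D H (psf_comp D H K F)" if "pseudofunctor D A F" for F
 proof -
  interpret F: pseudofunctor D A F by fact
  show ?thesis by (rule pnt_eqI[of D H]) (simp_all add: that)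
 qed
 have comp: "pnt_post D H K (pnt_comp D A be al) = pnt_comp D H (pnt_post D H K be) (pnt_post D H K al)"
  if *: "pseudonatural D A al" "pseudonatural D A be" "pdom be = pcod al" for al be
 proof -
  interpret a: pseudonatural D A al by fact
  interpret b: pseudonatural D A be by fact
  show ?thesis by (rule pnt_eqI[of D H]) (simp_all add: * A.comp1_assoc')
 qed
 interpret PA: two_category "PS D A" by simp
 interpret PH: two_category "PS D H" by simp
 show ?thesis
 proof (rule strict_functor.intro[OF _ _ strict_functor_axioms.intro], goal_cases)
  case (10 a) then show ?case by (simp add: id)
 next
  case (11 g f) then show ?case by (auto simp: composable_def comp)
 next
  case (12 f)
  then interpret pseudonatural D A f by simp
  show ?case by (simp, rule mdf_eqI[of D H]) (use 12 in simp_all)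
 next
  case (13 y x)
  then have [simp]: "modification D A x" "modification D A y" "mdom y = mcod x" by (auto simp: vseq_def)
  interpret x: modification D A x by simp
  interpret y: modification D A y by simp
  show ?case by (simp, rule mdf_eqI[of D H]) simp_all
 next
  case (14 y x)
  then have [simp]: "modification D A x" "modification D A y" "pdom (mdom y) = pcod (mdom x)" by (auto simp: hseq_def)
  interpret x: modification D A x by simp
  interpret y: modification D A y by simp
  have [simp]: "pseudonatural D A (mdom x)" "pseudonatural D A (mcod x)" "pseudonatural D A (mdom y)" "pseudonatural D A (mcod y)"
   by (simp_all add: x.pseudonatural_mdom x.pseudonatural_mcod y.pseudonatural_mdom y.pseudonatural_mcod)
  show ?case by (simp, rule mdf_eqI[of D H]) (simp_all add: comp)
 qed (auto simp: modification.pdom_mcod modification.pcod_mcod pseudonatural.pseudofunctor_pdom pseudonatural.pseudofunctor_pcod)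
qed

end

lemma pnt_pre_simps [simp]:
 "pdom (pnt_pre A H t al) = psf_comp A H (pdom al) t"
 "pcod (pnt_pre A H t al) = psf_comp A H (pcod al) t"
 "a \<in> Ob A ==> pnt1 (pnt_pre A H t al) a = pnt1 al (psf0 t a)"
 "f \<in> Mor A ==> pnt2 (pnt_pre A H t al) f = pnt2 al (psf1 t f)"
 "mdom (mdf_pre A H t Ga) = pnt_pre A H t (mdom Ga)"
 "mcod (mdf_pre A H t Ga) = pnt_pre A H t (mcod Ga)"
 "a \<in> Ob A ==> mdf2 (mdf_pre A H t Ga) a = mdf2 Ga (psf0 t a)"
 by (simp_all add: pnt_pre_def mdf_pre_def)

text \<open>The structure cells of a composite with \<open>t\<close> contain images of those of
  \<open>t\<close>. Naturality of \<open>pnt2 al\<close> at the 2-cells \<open>psfc t\<close> and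
  \<open>psfu t\<close> moves these across, after which the axioms of \<open>al\<close> at the
  images of the 1-cells finish.\<close>

lemma pseudonatural_pnt_pre:
 assumes "pseudofunctor A B t" "pseudonatural B H al" shows "pseudonatural A H (pnt_pre A H t al)"
proof -
 interpret A: two_category A using assms(1) by (rule pseudofunctor.two_category_A)
 interpret B: two_category B using assms(1) by (rule pseudofunctor.two_category_H)
 interpret H: two_category H using assms(2) by (rule pseudonatural_two_category)
 interpret t: pseudofunctor A B t by fact
 interpret pseudonatural B H al by fact
 note p [simp] = pseudofunctor_pdom pseudofunctor_pcod
 show ?thesis
 proof (rule pseudonatural.intro, goal_cases)
  case (11 x)
  then show ?case using pnt2_natural[of "psf2 t x"] by simp
 next
  case (12 g f)
  then have [simp]: "f \<in> Mor A" "g \<in> Mor A" "src A g = trg A f" by (auto simp: composable_def)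
  have 1: "pnt2 al (psf1 t (g o{A} f)) #{H} (psf2 (pcod al) (psfc t g f) *{H} id2 H (pnt1 al (psf0 t (src A f))))
   = (id2 H (pnt1 al (psf0 t (trg A g))) *{H} psf2 (pdom al) (psfc t g f)) #{H} pnt2 al (psf1 t g o{B} psf1 t f)"
   using pnt2_natural[of "psfc t g f"] by simp
  have 2: "pnt2 al (psf1 t g o{B} psf1 t f) #{H} (psfc (pcod al) (psf1 t g) (psf1 t f) *{H} id2 H (pnt1 al (psf0 t (src A f))))
    = (id2 H (pnt1 al (psf0 t (trg A g))) *{H} psfc (pdom al) (psf1 t g) (psf1 t f)) #{H}
     (pnt2 al (psf1 t g) *{H} id2 H (psf1 (pdom al) (psf1 t f))) #{H}
     (id2 H (psf1 (pcod al) (psf1 t g)) *{H} pnt2 al (psf1 t f))"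
   using pnt2_comp1[of "psf1 t g" "psf1 t f"] by simp
  show ?case
   by (simp add: psf_comp_psfc H.pasting H.vcomp_pre[OF 1] 2)
 next
  case (13 x)
  then have [simp]: "x \<in> Ob A" .
  have 1: "pnt2 al (psf1 t (id1 A x)) #{H} (psf2 (pcod al) (psfu t x) *{H} id2 H (pnt1 al (psf0 t x)))
   = (id2 H (pnt1 al (psf0 t x)) *{H} psf2 (pdom al) (psfu t x)) #{H} pnt2 al (id1 B (psf0 t x))"
   using pnt2_natural[of "psfu t x"] by simp
  show ?case using pnt2_id1[of "psf0 t x"]
   by (simp add: psf_comp_psfc H.pasting H.vcomp_pre[OF 1])
 qed (simp_all add: pseudofunctor_psf_comp[OF assms(1)], simp_all add: pnt_pre_def)
qed

lemma modification_mdf_pre: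
 assumes "pseudofunctor A B t" "modification B H Ga" shows "modification A H (mdf_pre A H t Ga)"
proof -
 interpret t: pseudofunctor A B t by fact
 interpret modification B H Ga by fact
 note p [simp] = pseudonatural_mdom pseudonatural_mcod
 show ?thesis
 proof (rule modification.intro, goal_cases)
  case (1) show ?case using pseudonatural_pnt_pre[OF assms(1) pseudonatural_mdom] by simp
 next
  case (2) show ?case using pseudonatural_pnt_pre[OF assms(1) pseudonatural_mcod] by simp
 next
  case (9 f)
  then show ?case using mdf2_natural[of "psf1 t f"] by simp
 qed (simp_all add: assms, simp_all add: mdf_pre_def)
qed

text \<open>Precomposition is strict even along a pseudofunctor \<open>t\<close>: composites in
  \<open>PS\<close> are formed componentwise, and \<open>t\<close> only selects the objects and
  1-cells at which they are evaluated.\<close>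

lemma strict_functor_pre:
 assumes "pseudofunctor A B t" "two_category H"
 shows "strict_functor (PS B H) (PS A H) (%F. psf_comp A H F t) (pnt_pre A H t) (mdf_pre A H t)"
proof -
 interpret A: two_category A using assms(1) by (rule pseudofunctor.two_category_A)
 interpret B: two_category B using assms(1) by (rule pseudofunctor.two_category_H)
 interpret H: two_category H by fact
 interpret t: pseudofunctor A B t by fact
 note p [simp] = assms A.two_category_axioms B.two_category_axioms
 have m: "pseudonatural A H (pnt_pre A H t al)" if "pseudonatural B H al" for al
  using pseudonatural_pnt_pre[OF assms(1) that] .
 have m2: "modification A H (mdf_pre A H t al)" if "modification B H al" for al
  using modification_mdf_pre[OF assms(1) that] .
 have m0: "pseudofunctor A H (psf_comp A H F t)" if "pseudofunctor B H F" for F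
  using pseudofunctor_psf_comp[OF assms(1) that] .
 have id: "pnt_pre A H t (pnt_id B H F) = pnt_id A H (psf_comp A H F t)" if "pseudofunctor B H F" for F
 proof -
  interpret F: pseudofunctor B H F by fact
  show ?thesis by (rule pnt_eqI[of A H]) (simp_all add: that m m0)
 qed
 have comp: "pnt_pre A H t (pnt_comp B H be al) = pnt_comp A H (pnt_pre A H t be) (pnt_pre A H t al)"
  if *: "pseudonatural B H al" "pseudonatural B H be" "pdom be = pcod al" for al be
 proof -
  interpret a: pseudonatural B H al by fact
  interpret b: pseudonatural B H be by fact
  show ?thesis by (rule pnt_eqI[of A H]) (simp_all add: * m)
 qed
 interpret PA: two_category "PS A H" by simp
 interpret PH: two_category "PS B H" by simp
 show ?thesis
 proof (rule strict_functor.intro[OF _ _ strict_functor_axioms.intro], goal_cases)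
  case (10 a) then show ?case by (simp add: id)
 next
  case (11 g f) then show ?case by (auto simp: composable_def comp)
 next
  case (12 f)
  then interpret pseudonatural B H f by simp
  show ?case by (simp, rule mdf_eqI[of A H]) (use 12 in \<open>simp_all add: m m2\<close>)
 next
  case (13 y x)
  then have [simp]: "modification B H x" "modification B H y" "mdom y = mcod x" by (auto simp: vseq_def)
  interpret x: modification B H x by simp
  interpret y: modification B H y by simp
  show ?case by (simp, rule mdf_eqI[of A H]) (simp_all add: m2)
 next
  case (14 y x)
  then have [simp]: "modification B H x" "modification B H y" "pdom (mdom y) = pcod (mdom x)" by (auto simp: hseq_def)
  interpret x: modification B H x by simp
  interpret y: modification B H y by simp
  have [simp]: "pseudonatural B H (mdom x)" "pseudonatural B H (mcod x)" "pseudonatural B H (mdom y)" "pseudonatural B H (mcod y)"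
   by (simp_all add: x.pseudonatural_mdom x.pseudonatural_mcod y.pseudonatural_mdom y.pseudonatural_mcod)
  show ?case by (simp, rule mdf_eqI[of A H]) (simp_all add: comp m2)
 qed (auto simp: modification.pdom_mcod modification.pcod_mcod pseudonatural.pseudofunctor_pdom pseudonatural.pseudofunctor_pcod m m0 m2)
qed

section \<open>Representables and the Yoneda 2-functor\<close>

lemmas CAT_vcomp_id [simp] = two_category.vcomp_id2[OF two_category_CAT, simplified]
lemmas CAT_comp1_id [simp] = two_category.comp1_id1[OF two_category_CAT, simplified]
lemmas CAT_hcomp_id [simp] = two_category.hcomp_id1[OF two_category_CAT, simplified]
lemmas CAT_comp1_assoc = two_category.comp1_assoc[OF two_category_CAT, simplified]

lemma CAT_hcomp_id2 [simp]: "fnctr f ==> fnctr g ==> fdom g = fcod f ==> ntr_hcomp (ntr_id g) (ntr_id f) = ntr_id (fnct_comp g f)"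
 using two_category.hcomp_id2[OF two_category_CAT] by simp

lemmas CAT_iso2_id [simp] = two_category.iso2_id2[OF two_category_CAT, simplified]

lemma rep_fnct_simps [simp]:
 "fdom (rep_fnct K X g) = homcat K X (src K g)" "fcod (rep_fnct K X g) = homcat K X (trg K g)"
 "h \<in> Obj (homcat K X (src K g)) ==> fobj (rep_fnct K X g) h = g o{K} h"
 "th \<in> Arr (homcat K X (src K g)) ==> farr (rep_fnct K X g) th = id2 K g *{K} th"
 by (simp_all add: rep_fnct_def)

lemma rep_ntr_simps [simp]:
 "ndom (rep_ntr K X xi) = rep_fnct K X (dom2 K xi)" "ncod (rep_ntr K X xi) = rep_fnct K X (cod2 K xi)"
 "h \<in> Obj (homcat K X (src K (dom2 K xi))) ==> ncmp (rep_ntr K X xi) h = xi *{K} id2 K h"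
 by (simp_all add: rep_ntr_def)

lemma yon_fnct_simps [simp]:
 "fdom (yon_fnct K f Y) = homcat K (trg K f) Y" "fcod (yon_fnct K f Y) = homcat K (src K f) Y"
 "h \<in> Obj (homcat K (trg K f) Y) ==> fobj (yon_fnct K f Y) h = h o{K} f"
 "th \<in> Arr (homcat K (trg K f) Y) ==> farr (yon_fnct K f Y) th = th *{K} id2 K f"
 by (simp_all add: yon_fnct_def)

lemma yon_ntr_simps [simp]:
 "ndom (yon_ntr K xi Y) = yon_fnct K (dom2 K xi) Y" "ncod (yon_ntr K xi Y) = yon_fnct K (cod2 K xi) Y"
 "h \<in> Obj (homcat K (trg K (dom2 K xi)) Y) ==> ncmp (yon_ntr K xi Y) h = id2 K h *{K} xi"
 by (simp_all add: yon_ntr_def)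

lemma yon_pnt_simps [simp]:
 "pdom (yon_pnt K f) = rep K (trg K f)" "pcod (yon_pnt K f) = rep K (src K f)"
 "Y \<in> Ob K ==> pnt1 (yon_pnt K f) Y = yon_fnct K f Y"
 "g \<in> Mor K ==> pnt2 (yon_pnt K f) g = ntr_id (fnct_comp (rep_fnct K (src K f) g) (yon_fnct K f (src K g)))"
 "mdom (yon_mdf K xi) = yon_pnt K (dom2 K xi)" "mcod (yon_mdf K xi) = yon_pnt K (cod2 K xi)"
 "Y \<in> Ob K ==> mdf2 (yon_mdf K xi) Y = yon_ntr K xi Y"
 by (simp_all add: yon_pnt_def yon_mdf_def)

context two_category
begin

lemma fnctr_rep [simp]: "g \<in> Mor H ==> X \<in> Ob H ==> fnctr (rep_fnct H X g)"
 by (rule fnctr.intro) (auto simp: homcat whisker_vcomp_left, auto simp: rep_fnct_def)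

lemma nat_trans_rep [simp]: "xi \<in> Cell H ==> X \<in> Ob H ==> nat_trans (rep_ntr H X xi)"
 by (rule nat_trans.intro) (auto simp: exchange(1), auto simp: rep_ntr_def)

lemma fnctr_yon [simp]: "f \<in> Mor H ==> Y \<in> Ob H ==> fnctr (yon_fnct H f Y)"
 by (rule fnctr.intro) (auto simp: homcat whisker_vcomp_right, auto simp: yon_fnct_def)

lemma nat_trans_yon [simp]: "xi \<in> Cell H ==> Y \<in> Ob H ==> nat_trans (yon_ntr H xi Y)"
 by (rule nat_trans.intro) (auto simp: exchange(1), auto simp: yon_ntr_def)

lemma strict_functor_rep:
 assumes X: "X \<in> Ob H" shows "strict_functor H CAT (homcat H X) (rep_fnct H X) (rep_ntr H X)"
proof (rule strict_functor.intro[OF _ _ strict_functor_axioms.intro], goal_cases)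
 case (10 a) then show ?case using X by (auto intro!: fnct_eqI simp: homcat)
next
 case (11 g f) then show ?case using X
  by (auto intro!: fnct_eqI simp: homcat composable_def comp1_assoc' pasting)
next
 case (12 f) then show ?case using X by (auto intro!: ntr_eqI simp: homcat)
next
 case (13 y x) then show ?case using X by (auto intro!: ntr_eqI simp: vseq_def whisker_vcomp_right)
next
 case (14 y x)
 then have [simp]: "x \<in> Cell H" "y \<in> Cell H" "src H (dom2 H y) = trg H (dom2 H x)" by (auto simp: hseq_def)
 have c: "fnct_comp (rep_fnct H X (dom2 H y)) (rep_fnct H X (dom2 H x)) = rep_fnct H X (dom2 H y \<odot> dom2 H x)"
   "fnct_comp (rep_fnct H X (cod2 H y)) (rep_fnct H X (cod2 H x)) = rep_fnct H X (cod2 H y \<odot> cod2 H x)"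
  using X by (auto intro!: fnct_eqI simp: pasting)
 have e: "y \<star> (x \<star> id2 H u) = (y \<star> id2 H (cod2 H x \<odot> u)) \<bullet> (id2 H (dom2 H y) \<star> (x \<star> id2 H u))"
  if "u \<in> Mor H" "trg H u = src H (dom2 H x)" for u
  using exchange(2)[of y "x \<star> id2 H u"] that by simp
 show ?case using X by (auto intro!: ntr_eqI simp: c hcomp_assoc' e)
qed (use X in \<open>simp_all add: two_category_CAT two_category_axioms homcat\<close>)

lemma rep_simps [simp]:
 "Y \<in> Ob H ==> psf0 (rep H X) Y = homcat H X Y"
 "g \<in> Mor H ==> psf1 (rep H X) g = rep_fnct H X g"
 "xi \<in> Cell H ==> psf2 (rep H X) xi = rep_ntr H X xi"
 "composable H g f ==> psfc (rep H X) g f = ntr_id (rep_fnct H X (g \<odot> f))"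
 "a \<in> Ob H ==> psfu (rep H X) a = ntr_id (rep_fnct H X (id1 H a))"
 by (simp_all add: rep_def)

lemma pseudofunctor_rep [simp]: "X \<in> Ob H ==> pseudofunctor H CAT (rep H X)"
 unfolding rep_def by (intro strict_functor.pseudofunctor_strict strict_functor_rep)

text \<open>Composition of 1-cells is strictly associative, so acting by \<open>f\<close> on one
  side commutes with acting by \<open>g\<close> on the other on the nose. This is why
  \<open>yon_pnt\<close> can have identities as structure cells.\<close>

lemma yon_fnct_rep_fnct:
 assumes "f \<in> Mor H" "g \<in> Mor H"
 shows "fnct_comp (yon_fnct H f (trg H g)) (rep_fnct H (trg H f) g) =
  fnct_comp (rep_fnct H (src H f) g) (yon_fnct H f (src H g))"
 using assms by (auto intro!: fnct_eqI simp: comp1_assoc' hcomp_assoc')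

lemma pseudonatural_yon_pnt [simp]:
 assumes [simp]: "f \<in> Mor H" shows "pseudonatural H CAT (yon_pnt H f)"
proof (rule pseudonatural.intro, goal_cases)
 case (11 x)
 then have [simp]: "x \<in> Cell H" .
 have [simp]: "fnct_comp (yon_fnct H f (trg H (dom2 H x))) (rep_fnct H (trg H f) (cod2 H x)) =
   fnct_comp (rep_fnct H (src H f) (cod2 H x)) (yon_fnct H f (src H (dom2 H x)))"
  using yon_fnct_rep_fnct[of f "cod2 H x"] by simp
 show ?case
  by (auto intro!: ntr_eqI simp: yon_fnct_rep_fnct hcomp_assoc' comp1_assoc')
next
 case (12 g h)
 then have [simp]: "h \<in> Mor H" "g \<in> Mor H" "src H g = trg H h" by (auto simp: composable_def)
 note y = yon_fnct_rep_fnct[of f h, simplified]  yon_fnct_rep_fnct[of f "g \<odot> h", simplified] yon_fnct_rep_fnct[of f g, simplified]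
 have e: "rep_fnct H X (g \<odot> h) = fnct_comp (rep_fnct H X g) (rep_fnct H X h)" if "X \<in> Ob H" for X
  using strict_functor.F1_comp1[OF strict_functor_rep[OF that], of g h] by simp
 have a: "fnct_comp (fnct_comp (rep_fnct H (src H f) g) (rep_fnct H (src H f) h)) (yon_fnct H f (src H h)) =
   fnct_comp (rep_fnct H (src H f) g) (fnct_comp (rep_fnct H (src H f) h) (yon_fnct H f (src H h)))"
  by (rule CAT_comp1_assoc) simp_all
 have b: "fnct_comp (yon_fnct H f (trg H g)) (fnct_comp (rep_fnct H (trg H f) g) (rep_fnct H (trg H f) h)) =
   fnct_comp (fnct_comp (rep_fnct H (src H f) g) (yon_fnct H f (src H g))) (rep_fnct H (trg H f) h)"
  by (subst CAT_comp1_assoc[symmetric]) (simp_all add: y)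
 have c: "fnct_comp (fnct_comp (rep_fnct H (src H f) g) (yon_fnct H f (trg H h))) (rep_fnct H (trg H f) h) =
   fnct_comp (rep_fnct H (src H f) g) (fnct_comp (yon_fnct H f (trg H h)) (rep_fnct H (trg H f) h))"
  by (rule CAT_comp1_assoc) simp_all
 show ?case by (simp add: a b e y c)
next
 case (13 a)
 then show ?case using yon_fnct_rep_fnct[of f "id1 H a", simplified] by simp
qed (simp_all add: two_category_CAT two_category.iso2_id2[OF two_category_CAT] yon_fnct_rep_fnct, simp_all add: yon_pnt_def)

lemma modification_yon_mdf [simp]:
 assumes [simp]: "xi \<in> Cell H" shows "modification H CAT (yon_mdf H xi)"
proof (rule modification.intro, goal_cases)
 case (9 g)
 then show ?case
  by (auto intro!: ntr_eqI simp: yon_fnct_rep_fnct yon_fnct_rep_fnct[of "dom2 H xi" g, simplified]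
    yon_fnct_rep_fnct[of "cod2 H xi" g, simplified] hcomp_id2_id2 comp1_assoc')
qed (simp_all, simp_all add: yon_mdf_def)

text \<open>Precomposition reverses 1-cells, hence the domain \<open>op2 H\<close>. As all structure
  cells are identity transformations, the content is that composites of \<open>yon_fnct\<close> and
  \<open>rep_fnct\<close> reassociate correctly.\<close>

lemma strict_functor_yon: "strict_functor (op2 H) (PS H CAT) (rep H) (yon_pnt H) (yon_mdf H)"
proof -
 interpret P: two_category "PS H CAT" by (simp add: two_category_CAT two_category_axioms)
 have m: "pseudonatural H CAT (pnt_id H CAT (rep H X))" if "X \<in> Ob H" for X using that by simp
 have comp: "yon_pnt H (f \<odot> g) = pnt_comp H CAT (yon_pnt H g) (yon_pnt H f)"
  if "composable H f g" for f g
 proof (rule pnt_eqI[of H CAT], goal_cases)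
  have [simp]: "f \<in> Mor H" "g \<in> Mor H" "src H f = trg H g" using that by (auto simp: composable_def)
  {
   case (5 a)
   then show ?case by (auto intro!: fnct_eqI simp: pasting)
  next
   case (6 h)
   then have [simp]: "h \<in> Mor H" .
   have e: "yon_fnct H (f \<odot> g) X = fnct_comp (yon_fnct H g X) (yon_fnct H f X)" if "X \<in> Ob H" for X
    using that by (auto intro!: fnct_eqI simp: pasting)
   have b: "fnct_comp (yon_fnct H g (trg H h)) (fnct_comp (rep_fnct H (trg H g) h) (yon_fnct H f (src H h))) =
     fnct_comp (fnct_comp (rep_fnct H (src H g) h) (yon_fnct H g (src H h))) (yon_fnct H f (src H h))"
    by (subst CAT_comp1_assoc[symmetric]) (simp_all add: yon_fnct_rep_fnct)
   have c: "fnct_comp (fnct_comp (rep_fnct H (src H g) h) (yon_fnct H g (src H h))) (yon_fnct H f (src H h)) =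
     fnct_comp (rep_fnct H (src H g) h) (fnct_comp (yon_fnct H g (src H h)) (yon_fnct H f (src H h)))"
    by (rule CAT_comp1_assoc) simp_all
   show ?case by (simp add: e b c)
  }
 qed (use that in \<open>auto simp: composable_def\<close>)
 show ?thesis
 proof (rule strict_functor.intro[OF _ _ strict_functor_axioms.intro], goal_cases)
  case (10 a)
  then show ?case by (auto intro!: pnt_eqI[of H CAT] fnct_eqI simp: homcat)
    (auto intro!: arg_cong[of _ _ ntr_id] fnct_eqI simp: comp1_assoc')
 next
  case (11 g f)
  then show ?case by (simp add: comp)
 next
  case (12 f)
  then show ?case by (auto intro!: mdf_eqI[of H CAT] ntr_eqI)
 next
  case (13 y x)
  then show ?case by (auto intro!: mdf_eqI[of H CAT] ntr_eqI simp: vseq_def whisker_vcomp_left)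
 next
  case (14 y x)
  then have [simp]: "x \<in> Cell H" "y \<in> Cell H" "src H (dom2 H x) = trg H (dom2 H y)" by (auto simp: hseq_def)
  show ?case
  proof (simp, rule mdf_eqI[of H CAT], goal_cases)
   case (5 a)
   have c: "fnct_comp (yon_fnct H (dom2 H y) a) (yon_fnct H (dom2 H x) a) = yon_fnct H (dom2 H x \<odot> dom2 H y) a"
    "fnct_comp (yon_fnct H (cod2 H y) a) (yon_fnct H (cod2 H x) a) = yon_fnct H (cod2 H x \<odot> cod2 H y) a"
    using 5 by (auto intro!: fnct_eqI simp: pasting)
   have e: "id2 H u \<star> (x \<star> y) = (id2 H (u \<odot> cod2 H x) \<star> y) \<bullet> (id2 H u \<star> (x \<star> id2 H (dom2 H y)))"
    if "u \<in> Mor H" "src H u = trg H (dom2 H x)" for u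
    using exchange(3)[of "id2 H u \<star> x" y] that by (simp add: hcomp_assoc')
   show ?case using 5 by (auto intro!: ntr_eqI simp: c hcomp_assoc' e)
  qed (simp_all add: comp)
 qed (auto simp: two_category_op2 P.two_category_axioms)
qed

end

section \<open>Relabelling and the embeddings into the sum copy of CAT\<close>

lemma relabel_cat_simps [simp]:
 assumes "inj i" "inj j"
 shows "Obj (relabel_cat i j C) = i ` Obj C" "Arr (relabel_cat i j C) = j ` Arr C"
 "Dom (relabel_cat i j C) (j f) = i (Dom C f)" "Cod (relabel_cat i j C) (j f) = i (Cod C f)"
 "Idn (relabel_cat i j C) (i x) = j (Idn C x)" "Cmp (relabel_cat i j C) (j g) (j f) = j (Cmp C g f)"
 using assms by (simp_all add: relabel_cat_def)

lemma relabel_fnct_simps [simp]: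
 "fdom (relabel_fnct i j F) = relabel_cat i j (fdom F)"
 "fcod (relabel_fnct i j F) = relabel_cat i j (fcod F)"
 "inj i ==> x \<in> Obj (fdom F) ==> fobj (relabel_fnct i j F) (i x) = i (fobj F x)"
 "inj j ==> f \<in> Arr (fdom F) ==> farr (relabel_fnct i j F) (j f) = j (farr F f)"
 by (auto simp: relabel_fnct_def)

lemma relabel_ntr_simps [simp]:
 "ndom (relabel_ntr i j \<tau>) = relabel_fnct i j (ndom \<tau>)"
 "ncod (relabel_ntr i j \<tau>) = relabel_fnct i j (ncod \<tau>)"
 "inj i ==> x \<in> Obj (fdom (ndom \<tau>)) ==> ncmp (relabel_ntr i j \<tau>) (i x) = j (ncmp \<tau> x)"
 by (auto simp: relabel_ntr_def)

lemma category_relabel [simp]: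
 assumes [simp]: "inj i" "inj j" and "category C" shows "category (relabel_cat i j C)"
proof -
 interpret category C by fact
 show ?thesis by (rule category.intro) (auto simp: Cmp_assoc inj_eq)
qed

lemma fnctr_relabel [simp]:
 assumes [simp]: "inj i" "inj j" and "fnctr F" shows "fnctr (relabel_fnct i j F)"
proof -
 interpret fnctr F by fact
 show ?thesis by (rule fnctr.intro) (auto simp: category_fdom category_fcod inj_eq, auto simp: relabel_fnct_def inj_eq)
qed

lemma nat_trans_relabel [simp]:
 assumes [simp]: "inj i" "inj j" and "nat_trans \<tau>" shows "nat_trans (relabel_ntr i j \<tau>)"
proof -
 interpret nat_trans \<tau> by fact
 have [simp]: "!!f. f \<in> Arr (fdom (ndom \<tau>)) ==> farr (ncod \<tau>) f \<in> Arr (fcod (ndom \<tau>))" using G.farr_Arr by simp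
 show ?thesis by (rule nat_trans.intro) (auto simp: fnctr_ndom fnctr_ncod ncmp_natural inj_eq, auto simp: relabel_ntr_def)
qed

text \<open>Injectivity makes \<open>inv i\<close> and \<open>inv j\<close> recover the original
  cell, so every operation can be computed on relabelled elements and agrees with the original
  one.\<close>

lemma strict_functor_relabel:
 assumes [simp]: "inj i" "inj j"
 shows "strict_functor CAT CAT (relabel_cat i j) (relabel_fnct i j) (relabel_ntr i j)"
proof (rule strict_functor.intro[OF _ _ strict_functor_axioms.intro], goal_cases)
 case (10 a) then show ?case by (auto intro!: fnct_eqI)
next
 case (11 g f)
 then interpret f: fnctr f + g: fnctr g by (auto simp: composable_def)
 have [simp]: "fdom g = fcod f" "fnctr f" "fnctr g" using 11 by (auto simp: composable_def)
 have "!!x. x \<in> Arr (fdom f) ==> farr f x \<in> Arr (fdom g)"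
  "!!x. x \<in> Obj (fdom f) ==> fobj f x \<in> Obj (fdom g)" by simp_all
 then show ?case by (auto intro!: fnct_eqI)
next
 case (12 f)
 then interpret f: fnctr f by auto
 show ?case using 12 by (auto intro!: ntr_eqI)
next
 case (13 y x)
 then have [simp]: "nat_trans x" "nat_trans y" "ndom y = ncod x" by (auto simp: vseq_def)
 interpret x: nat_trans x by simp
 interpret y: nat_trans y by simp
 have "!!u. u \<in> Obj (fdom (ndom x)) ==> u \<in> Obj (fdom (ndom y))" by simp
 then show ?case by (auto intro!: ntr_eqI)
next
 case (14 y x)
 then have [simp]: "nat_trans x" "nat_trans y" "fdom (ndom y) = fcod (ndom x)" by (auto simp: hseq_def)
 interpret x: nat_trans x by simp
 interpret y: nat_trans y by simp
 have a: "!!u. u \<in> Obj (fdom (ndom x)) ==> fobj (ncod x) u \<in> Obj (fdom (ndom y))"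
  "!!u. u \<in> Arr (fdom (ndom x)) ==> farr (ncod x) u \<in> Arr (fdom (ndom y))" using x.G.fobj_Obj x.G.farr_Arr by simp_all
 have [simp]: "fnctr (ndom x)" "fnctr (ndom y)" "fnctr (ncod x)" "fnctr (ncod y)"
  by (rule x.fnctr_ndom y.fnctr_ndom x.fnctr_ncod y.fnctr_ncod)+
 have "fnct_comp (relabel_fnct i j (ndom y)) (relabel_fnct i j (ndom x)) = relabel_fnct i j (fnct_comp (ndom y) (ndom x))"
  "fnct_comp (relabel_fnct i j (ncod y)) (relabel_fnct i j (ncod x)) = relabel_fnct i j (fnct_comp (ncod y) (ncod x))"
  by (auto intro!: fnct_eqI simp: a[simplified])
 then show ?case by (auto intro!: ntr_eqI simp: a[simplified])
qed (auto simp: two_category_CAT nat_trans.fdom_ncod nat_trans.fcod_ncod fnctr.category_fdom fnctr.category_fcod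
  nat_trans.fnctr_ndom nat_trans.fnctr_ncod)

lemma pseudofunctor_relabel [simp]:
 "pseudofunctor CAT CAT in_left" "pseudofunctor CAT CAT in_right"
 unfolding in_left_def in_right_def relabel_def
 by (simp_all add: strict_functor.pseudofunctor_strict strict_functor_relabel)

lemma psf_comp_in [simp]:
 assumes F: "pseudofunctor K CAT F"
 shows "pseudofunctor K CAT (psf_comp K CAT in_left F)" (is "PROP ?C0") "pseudofunctor K CAT (psf_comp K CAT in_right F)" (is "PROP ?C1")
  "X \<in> Ob K ==> psf0 (psf_comp K CAT in_left F) X = relabel_cat Inl Inl (psf0 F X)" (is "PROP ?C2")
  "X \<in> Ob K ==> psf0 (psf_comp K CAT in_right F) X = relabel_cat Inr Inr (psf0 F X)" (is "PROP ?C3")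
  "f \<in> Mor K ==> psf1 (psf_comp K CAT in_left F) f = relabel_fnct Inl Inl (psf1 F f)" (is "PROP ?C4")
  "f \<in> Mor K ==> psf1 (psf_comp K CAT in_right F) f = relabel_fnct Inr Inr (psf1 F f)" (is "PROP ?C5")
  "x \<in> Cell K ==> psf2 (psf_comp K CAT in_left F) x = relabel_ntr Inl Inl (psf2 F x)" (is "PROP ?C6")
  "x \<in> Cell K ==> psf2 (psf_comp K CAT in_right F) x = relabel_ntr Inr Inr (psf2 F x)" (is "PROP ?C7")
  "composable K g f ==> psfc (psf_comp K CAT in_left F) g f = relabel_ntr Inl Inl (psfc F g f)" (is "PROP ?C8")
  "composable K g f ==> psfc (psf_comp K CAT in_right F) g f = relabel_ntr Inr Inr (psfc F g f)" (is "PROP ?C9")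
  "X \<in> Ob K ==> psfu (psf_comp K CAT in_left F) X = relabel_ntr Inl Inl (psfu F X)" (is "PROP ?C10")
  "X \<in> Ob K ==> psfu (psf_comp K CAT in_right F) X = relabel_ntr Inr Inr (psfu F X)" (is "PROP ?C11")
proof -
 interpret pseudofunctor K CAT F by fact
 have [simp]: "X \<in> Ob K ==> category (psf0 F X)" "f \<in> Mor K ==> fnctr (psf1 F f)" "x \<in> Cell K ==> nat_trans (psf2 F x)"
   for X f x using psf0_Ob[of X] psf1_Mor[of f] psf2_Cell[of x] by simp_all
 note i = in_left_def in_right_def relabel_def
 show "PROP ?C0" "PROP ?C1"
  using F by (auto intro: pseudofunctor_psf_comp)
 show "PROP ?C2"
  "PROP ?C3"
  "PROP ?C4"
  "PROP ?C5"
  "PROP ?C6"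
  "PROP ?C7"
  by (simp_all add: i)
 show "PROP ?C8"
  "PROP ?C9"
  "PROP ?C10"
  "PROP ?C11"
  by (simp_all add: i strict_functor.psf_comp_strict_psfc[OF strict_functor_relabel F])
qed

lemma (in two_category) yon_simps [simp]:
 "X \<in> Ob H ==> psf0 (yon H) X = rep H X"
 "f \<in> Mor H ==> psf1 (yon H) f = yon_pnt H f"
 "xi \<in> Cell H ==> psf2 (yon H) xi = yon_mdf H xi"
 "pseudofunctor (op2 H) (PS H CAT) (yon H)"
 by (simp_all add: yon_def strict_functor.pseudofunctor_strict strict_functor_yon)

section \<open>Invertible 2-cells and whiskering in CAT\<close>

definition iso_in :: "('o, 'a) cat => 'a => bool" where
 "iso_in C f \<longleftrightarrow> f \<in> Arr C & (\<exists>g \<in> Arr C. Dom C g = Cod C f & Cod C g = Dom C f &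
   Cmp C g f = Idn C (Dom C f) & Cmp C f g = Idn C (Cod C f))"

lemma iso_in_relabel [simp]:
 assumes "inj i" "inj j" shows "iso_in (relabel_cat i j C) (j f) = iso_in C f"
 using assms by (auto simp: iso_in_def inj_eq)

lemma iso_in_Arr: "iso_in C f ==> f \<in> Arr C"
 by (simp add: iso_in_def)

lemma (in category) iso_inI:
 assumes "f \<in> Arr C" "g \<in> Arr C" "Dom C g = Cod C f" "Cod C g = Dom C f"
  "Cmp C g f = Idn C (Dom C f)" "Cmp C f g = Idn C (Cod C f)"
 shows "iso_in C f" using assms unfolding iso_in_def by blast

lemma (in category) iso_in_Idn [simp]: "x \<in> Obj C ==> iso_in C (Idn C x)"
 by (rule iso_inI[of _ "Idn C x"]) auto

lemma (in two_category) iso_in_homcat: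
 assumes "al \<in> Cell H" "src H (dom2 H al) = X" "trg H (dom2 H al) = Y"
 shows "iso_in (homcat H X Y) al \<longleftrightarrow> iso2 H al"
 using assms unfolding iso_in_def iso2_def by fastforce

text \<open>Pointwise inverses of a natural transformation are automatically natural: conjugating
  the square of \<tau> at \<open>f\<close> by them gives the square at \<open>f\<close> of the
  inverse family.\<close>

lemma iso2_CAT: "iso2 CAT \<tau> \<longleftrightarrow> nat_trans \<tau> & (\<forall>x \<in> Obj (fdom (ndom \<tau>)). iso_in (fcod (ndom \<tau>)) (ncmp \<tau> x))"
proof safe
 assume i: "iso2 CAT \<tau>"
 then obtain si where s: "nat_trans \<tau>" "nat_trans si" "ndom si = ncod \<tau>" "ncod si = ndom \<tau>"
  "ntr_vcomp si \<tau> = ntr_id (ndom \<tau>)" "ntr_vcomp \<tau> si = ntr_id (ncod \<tau>)"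
  unfolding iso2_def by auto
 show "nat_trans \<tau>" by fact
 interpret t: nat_trans \<tau> by fact
 interpret s: nat_trans si by fact
 fix x assume x: "x \<in> Obj (fdom (ndom \<tau>))"
 have "Cmp (fcod (ndom \<tau>)) (ncmp si x) (ncmp \<tau> x) = Idn (fcod (ndom \<tau>)) (fobj (ndom \<tau>) x)"
  "Cmp (fcod (ndom \<tau>)) (ncmp \<tau> x) (ncmp si x) = Idn (fcod (ndom \<tau>)) (fobj (ncod \<tau>) x)"
  using arg_cong[OF s(5), of "%z. ncmp z x"] arg_cong[OF s(6), of "%z. ncmp z x"] s(1-4) x by simp_all
 then show "iso_in (fcod (ndom \<tau>)) (ncmp \<tau> x)"
  using s.ncmp_Arr[of x] s.Dom_ncmp[of x] s.Cod_ncmp[of x] x s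
  by (intro t.F.C.iso_inI[of _ "ncmp si x"]) simp_all
next
 assume "nat_trans \<tau>" and i: "\<forall>x \<in> Obj (fdom (ndom \<tau>)). iso_in (fcod (ndom \<tau>)) (ncmp \<tau> x)"
 interpret t: nat_trans \<tau> by fact
 let ?C = "fcod (ndom \<tau>)" and ?D = "fdom (ndom \<tau>)"
 from i obtain s where s: "!!x. x \<in> Obj ?D ==> s x \<in> Arr ?C & Dom ?C (s x) = fobj (ncod \<tau>) x &
   Cod ?C (s x) = fobj (ndom \<tau>) x & Cmp ?C (s x) (ncmp \<tau> x) = Idn ?C (fobj (ndom \<tau>) x) &
   Cmp ?C (ncmp \<tau> x) (s x) = Idn ?C (fobj (ncod \<tau>) x)"
  unfolding iso_in_def by simp metis
 define si where "si = \<lparr>ndom = ncod \<tau>, ncod = ndom \<tau>, ncmp = restrict s (Obj ?D)\<rparr>"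
 have [simp]: "ndom si = ncod \<tau>" "ncod si = ndom \<tau>" "!!x. x \<in> Obj ?D ==> ncmp si x = s x"
  by (simp_all add: si_def)
 have g [simp]: "!!f. f \<in> Arr ?D ==> farr (ncod \<tau>) f \<in> Arr ?C"
  "!!f. f \<in> Arr ?D ==> Dom ?C (farr (ncod \<tau>) f) = fobj (ncod \<tau>) (Dom ?D f)"
  "!!f. f \<in> Arr ?D ==> Cod ?C (farr (ncod \<tau>) f) = fobj (ncod \<tau>) (Cod ?D f)"
  using t.G.farr_Arr t.G.Dom_farr t.G.Cod_farr by simp_all
 have "nat_trans si"
 proof (rule nat_trans.intro, goal_cases)
  case (9 f)
  then have f [simp]: "f \<in> Arr ?D" by simp
  let ?c = "Cod ?D f" and ?d = "Dom ?D f"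
  have kc: "Cmp ?C (s ?c) (Cmp ?C (ncmp \<tau> ?c) w) = w" if "w \<in> Arr ?C" "Cod ?C w = fobj (ndom \<tau>) ?c" for w
   using t.F.C.Cmp_assoc[of w "ncmp \<tau> ?c" "s ?c"] s[of ?c] that by simp
  have "Cmp ?C (s ?c) (farr (ncod \<tau>) f) = Cmp ?C (s ?c) (Cmp ?C (farr (ncod \<tau>) f) (Cmp ?C (ncmp \<tau> ?d) (s ?d)))"
   using s[of ?d] by simp
  also have "... = Cmp ?C (s ?c) (Cmp ?C (Cmp ?C (farr (ncod \<tau>) f) (ncmp \<tau> ?d)) (s ?d))"
   using s[of ?d] s[of ?c] by (simp add: t.F.C.Cmp_assoc)
  also have "Cmp ?C (farr (ncod \<tau>) f) (ncmp \<tau> ?d) = Cmp ?C (ncmp \<tau> ?c) (farr (ndom \<tau>) f)"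
   by (simp add: t.ncmp_natural)
  also have "Cmp ?C (s ?c) (Cmp ?C (Cmp ?C (ncmp \<tau> ?c) (farr (ndom \<tau>) f)) (s ?d)) = Cmp ?C (farr (ndom \<tau>) f) (s ?d)"
   using s[of ?d] s[of ?c] by (simp add: t.F.C.Cmp_assoc kc)
  finally show ?case by simp
 qed (use s in \<open>auto simp: t.fnctr_ndom t.fnctr_ncod\<close>, simp add: si_def)
 then show "iso2 CAT \<tau>" unfolding iso2_def using s
  by (auto intro!: bexI[of _ si] ntr_eqI simp: t.nat_trans_axioms t.fnctr_ndom t.fnctr_ncod)
qed

text \<open>The general formula for \<open>ntr_hcomp\<close> leaves a composite with an identity
  arrow when one factor is an identity. Almost every horizontal composite below is such a
  whiskering, so these forms replace \<open>ntr_simps(9)\<close> as simplification rules from here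
  on.\<close>

lemma ntr_whisker [simp]:
 "nat_trans si ==> fnctr G ==> fdom G = fcod (ndom si) ==> x \<in> Obj (fdom (ndom si)) ==>
  ncmp (ntr_hcomp (ntr_id G) si) x = farr G (ncmp si x)"
 "nat_trans \<tau> ==> fnctr F ==> fdom (ndom \<tau>) = fcod F ==> x \<in> Obj (fdom F) ==>
  ncmp (ntr_hcomp \<tau> (ntr_id F)) x = ncmp \<tau> (fobj F x)"
proof -
 assume a: "nat_trans si" "fnctr G" "fdom G = fcod (ndom si)" "x \<in> Obj (fdom (ndom si))"
 interpret s: nat_trans si by fact
 interpret G: fnctr G by fact
 have "fobj (ncod si) x \<in> Obj (fdom G)" "ncmp si x \<in> Arr (fdom G)" "Cod (fdom G) (ncmp si x) = fobj (ncod si) x"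
  using s.G.fobj_Obj[of x] a s.ncmp_Arr[of x] s.Cod_ncmp[of x] by simp_all
 then show "ncmp (ntr_hcomp (ntr_id G) si) x = farr G (ncmp si x)"
  using a(4) by simp
next
 assume a: "nat_trans \<tau>" "fnctr F" "fdom (ndom \<tau>) = fcod F" "x \<in> Obj (fdom F)"
 interpret s: nat_trans \<tau> by fact
 interpret F: fnctr F by fact
 have x: "fobj F x \<in> Obj (fdom (ndom \<tau>))" using a by simp
 then show "ncmp (ntr_hcomp \<tau> (ntr_id F)) x = ncmp \<tau> (fobj F x)"
  using a(4) s.F.farr_Idn[OF x] s.ncmp_Arr[OF x] s.Dom_ncmp[OF x] a(3) by simp
qed

declare ntr_simps(9) [simp del]

lemma in_simps [simp]:
 "category C ==> psf0 in_left C = relabel_cat Inl Inl C" "category C' ==> psf0 in_right C' = relabel_cat Inr Inr C'"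
 "fnctr F ==> psf1 in_left F = relabel_fnct Inl Inl F" "fnctr F' ==> psf1 in_right F' = relabel_fnct Inr Inr F'"
 "nat_trans \<tau> ==> psf2 in_left \<tau> = relabel_ntr Inl Inl \<tau>" "nat_trans \<tau>' ==> psf2 in_right \<tau>' = relabel_ntr Inr Inr \<tau>'"
 by (simp_all add: in_left_def in_right_def relabel_def)

lemma relabel_fnct_comp [simp]:
 "inj i ==> inj j ==> fnctr f ==> fnctr g ==> fdom g = fcod f ==>
  relabel_fnct i j (fnct_comp g f) = fnct_comp (relabel_fnct i j g) (relabel_fnct i j f)"
 using strict_functor.F1_comp1[OF strict_functor_relabel, of i j g f] by (simp add: composable_def)

section \<open>Transformations between functors into different copies of CAT\<close>

lemma category_ty:
 assumes "category C"
 shows "y \<in> Arr C ==> Dom C y \<in> Obj C" (is "PROP ?C0") "y \<in> Arr C ==> Cod C y \<in> Obj C" (is "PROP ?C1")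
  "x \<in> Obj C ==> Idn C x \<in> Arr C" (is "PROP ?C2") "x \<in> Obj C ==> Dom C (Idn C x) = x" (is "PROP ?C3") "x \<in> Obj C ==> Cod C (Idn C x) = x" (is "PROP ?C4")
  "y \<in> Arr C ==> y' \<in> Arr C ==> Dom C y' = Cod C y ==> Cmp C y' y \<in> Arr C" (is "PROP ?C5")
  "y \<in> Arr C ==> y' \<in> Arr C ==> Dom C y' = Cod C y ==> Dom C (Cmp C y' y) = Dom C y" (is "PROP ?C6")
  "y \<in> Arr C ==> y' \<in> Arr C ==> Dom C y' = Cod C y ==> Cod C (Cmp C y' y) = Cod C y'" (is "PROP ?C7")
proof -
 interpret category C by fact
 show "PROP ?C0" "PROP ?C1"
  "PROP ?C2" "PROP ?C3" "PROP ?C4"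
  "PROP ?C5"
  "PROP ?C6"
  "PROP ?C7" by simp_all
qed

text \<open>Tag-free form of a pseudonatural transformation from P to Q whose values lie in copies
  of CAT over different types: \<open>ro\<close> and \<open>ra\<close> are the object and arrow
  parts of the component functors, and \<open>n f x\<close> goes from the image of
  \<open>ro x\<close> under \<open>Q f\<close> to \<open>ro\<close> of the image of \<open>x\<close>
  under \<open>P f\<close>. Calculations with the given equivalences take place in this
  form.\<close>

locale hpnt = P: pseudofunctor K CAT P + Q: pseudofunctor K CAT Q
 for K :: "('o, 'm, 'c) twocat"
  and P :: "('o, 'm, 'c, ('u, 'v) cat, ('u, 'v) fnct, ('u, 'v) ntr) psf"
  and Q :: "('o, 'm, 'c, ('w, 'z) cat, ('w, 'z) fnct, ('w, 'z) ntr) psf" +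
 fixes ro :: "'o => 'u => 'w" and ra :: "'o => 'v => 'z" and n :: "'m => 'u => 'z"
 assumes ro_Obj: "X \<in> Ob K ==> x \<in> Obj (psf0 P X) ==> ro X x \<in> Obj (psf0 Q X)"
  and ra_Arr: "X \<in> Ob K ==> y \<in> Arr (psf0 P X) ==> ra X y \<in> Arr (psf0 Q X)"
  and ra_Dom: "X \<in> Ob K ==> y \<in> Arr (psf0 P X) ==> Dom (psf0 Q X) (ra X y) = ro X (Dom (psf0 P X) y)"
  and ra_Cod: "X \<in> Ob K ==> y \<in> Arr (psf0 P X) ==> Cod (psf0 Q X) (ra X y) = ro X (Cod (psf0 P X) y)"
  and ra_Idn: "X \<in> Ob K ==> x \<in> Obj (psf0 P X) ==> ra X (Idn (psf0 P X) x) = Idn (psf0 Q X) (ro X x)"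
  and ra_Cmp: "X \<in> Ob K ==> y \<in> Arr (psf0 P X) ==> y' \<in> Arr (psf0 P X) ==> Dom (psf0 P X) y' = Cod (psf0 P X) y ==>
   ra X (Cmp (psf0 P X) y' y) = Cmp (psf0 Q X) (ra X y') (ra X y)"
  and n_iso: "f \<in> Mor K ==> x \<in> Obj (psf0 P (src K f)) ==> iso_in (psf0 Q (trg K f)) (n f x)"
  and n_Dom: "f \<in> Mor K ==> x \<in> Obj (psf0 P (src K f)) ==>
   Dom (psf0 Q (trg K f)) (n f x) = fobj (psf1 Q f) (ro (src K f) x)"
  and n_Cod: "f \<in> Mor K ==> x \<in> Obj (psf0 P (src K f)) ==>
   Cod (psf0 Q (trg K f)) (n f x) = ro (trg K f) (fobj (psf1 P f) x)"
  and n_nat: "f \<in> Mor K ==> y \<in> Arr (psf0 P (src K f)) ==>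
   Cmp (psf0 Q (trg K f)) (n f (Cod (psf0 P (src K f)) y)) (farr (psf1 Q f) (ra (src K f) y)) =
   Cmp (psf0 Q (trg K f)) (ra (trg K f) (farr (psf1 P f) y)) (n f (Dom (psf0 P (src K f)) y))"
  and n_cell: "xi \<in> Cell K ==> x \<in> Obj (psf0 P (src K (dom2 K xi))) ==>
   Cmp (psf0 Q (trg K (dom2 K xi))) (n (cod2 K xi) x) (ncmp (psf2 Q xi) (ro (src K (dom2 K xi)) x)) =
   Cmp (psf0 Q (trg K (dom2 K xi))) (ra (trg K (dom2 K xi)) (ncmp (psf2 P xi) x)) (n (dom2 K xi) x)"
  and n_comp: "composable K g f ==> x \<in> Obj (psf0 P (src K f)) ==>
   Cmp (psf0 Q (trg K g)) (n (g o{K} f) x) (ncmp (psfc Q g f) (ro (src K f) x)) =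
   Cmp (psf0 Q (trg K g)) (ra (trg K g) (ncmp (psfc P g f) x))
    (Cmp (psf0 Q (trg K g)) (n g (fobj (psf1 P f) x)) (farr (psf1 Q g) (n f x)))"
  and n_id: "X \<in> Ob K ==> x \<in> Obj (psf0 P X) ==>
   Cmp (psf0 Q X) (n (id1 K X) x) (ncmp (psfu Q X) (ro X x)) = ra X (ncmp (psfu P X) x)"

definition hfnct where
 "hfnct C D o1 a1 = \<lparr>fdom = relabel_cat Inl Inl C, fcod = relabel_cat Inr Inr D,
  fobj = (\<lambda>x \<in> Inl ` Obj C. Inr (o1 (projl x))), farr = (\<lambda>x \<in> Inl ` Arr C. Inr (a1 (projl x)))\<rparr>"

text \<open>The way back from \<open>hpnt\<close> data: the tags \<open>Inl\<close> and
  \<open>Inr\<close> are put on again, so that the result lives in the common copy of CAT.\<close>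

definition mk_pnt where
 "mk_pnt K P Q ro ra n = \<lparr>pdom = psf_comp K CAT in_left P, pcod = psf_comp K CAT in_right Q,
  pnt1 = (\<lambda>X \<in> Ob K. hfnct (psf0 P X) (psf0 Q X) (ro X) (ra X)),
  pnt2 = (\<lambda>f \<in> Mor K. \<lparr>
   ndom = fnct_comp (relabel_fnct Inr Inr (psf1 Q f)) (hfnct (psf0 P (src K f)) (psf0 Q (src K f)) (ro (src K f)) (ra (src K f))),
   ncod = fnct_comp (hfnct (psf0 P (trg K f)) (psf0 Q (trg K f)) (ro (trg K f)) (ra (trg K f))) (relabel_fnct Inl Inl (psf1 P f)),
   ncmp = (\<lambda>x \<in> Inl ` Obj (psf0 P (src K f)). Inr (n f (projl x)))\<rparr>)\<rparr>"

lemma hfnct_simps [simp]: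
 "fdom (hfnct C D o1 a1) = relabel_cat Inl Inl C" "fcod (hfnct C D o1 a1) = relabel_cat Inr Inr D"
 "x \<in> Obj C ==> fobj (hfnct C D o1 a1) (Inl x) = Inr (o1 x)"
 "y \<in> Arr C ==> farr (hfnct C D o1 a1) (Inl y) = Inr (a1 y)"
 by (simp_all add: hfnct_def)

lemma mk_pnt_simps [simp]:
 "pdom (mk_pnt K P Q ro ra n) = psf_comp K CAT in_left P"
 "pcod (mk_pnt K P Q ro ra n) = psf_comp K CAT in_right Q"
 "X \<in> Ob K ==> pnt1 (mk_pnt K P Q ro ra n) X = hfnct (psf0 P X) (psf0 Q X) (ro X) (ra X)"
 "f \<in> Mor K ==> ndom (pnt2 (mk_pnt K P Q ro ra n) f) =
   fnct_comp (relabel_fnct Inr Inr (psf1 Q f)) (hfnct (psf0 P (src K f)) (psf0 Q (src K f)) (ro (src K f)) (ra (src K f)))"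
 "f \<in> Mor K ==> ncod (pnt2 (mk_pnt K P Q ro ra n) f) =
   fnct_comp (hfnct (psf0 P (trg K f)) (psf0 Q (trg K f)) (ro (trg K f)) (ra (trg K f))) (relabel_fnct Inl Inl (psf1 P f))"
 "f \<in> Mor K ==> x \<in> Obj (psf0 P (src K f)) ==> ncmp (pnt2 (mk_pnt K P Q ro ra n) f) (Inl x) = Inr (n f x)"
 by (simp_all add: mk_pnt_def)

lemma psf_CAT_simps:
 assumes "pseudofunctor K CAT P"
 shows "X \<in> Ob K ==> category (psf0 P X)" (is "PROP ?C0")
  and "f \<in> Mor K ==> fnctr (psf1 P f)" (is "PROP ?C1") "f \<in> Mor K ==> fdom (psf1 P f) = psf0 P (src K f)" (is "PROP ?C2")
   "f \<in> Mor K ==> fcod (psf1 P f) = psf0 P (trg K f)" (is "PROP ?C3")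
  and "xi \<in> Cell K ==> nat_trans (psf2 P xi)" (is "PROP ?C4") "xi \<in> Cell K ==> ndom (psf2 P xi) = psf1 P (dom2 K xi)" (is "PROP ?C5")
   "xi \<in> Cell K ==> ncod (psf2 P xi) = psf1 P (cod2 K xi)" (is "PROP ?C6")
  and "composable K g f ==> nat_trans (psfc P g f)" (is "PROP ?C7")
   "composable K g f ==> ndom (psfc P g f) = fnct_comp (psf1 P g) (psf1 P f)" (is "PROP ?C8")
   "composable K g f ==> ncod (psfc P g f) = psf1 P (g o{K} f)" (is "PROP ?C9")
  and "X \<in> Ob K ==> nat_trans (psfu P X)" (is "PROP ?C10") "X \<in> Ob K ==> ndom (psfu P X) = fnct_id (psf0 P X)" (is "PROP ?C11")
   "X \<in> Ob K ==> ncod (psfu P X) = psf1 P (id1 K X)" (is "PROP ?C12")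
proof -
 interpret pseudofunctor K CAT P by fact
 show "PROP ?C0"
  and "PROP ?C1" "PROP ?C2"
   "PROP ?C3"
  and "PROP ?C4" "PROP ?C5"
   "PROP ?C6"
  and "PROP ?C7"
   "PROP ?C8"
   "PROP ?C9"
  and "PROP ?C10" "PROP ?C11"
   "PROP ?C12"
  using psf0_Ob[of X] psf1_Mor[of f] src_psf1[of f] trg_psf1[of f] psf2_Cell[of xi] dom2_psf2[of xi] cod2_psf2[of xi]
   psf_Cell(1)[of g f] dom2_psfc[of g f] cod2_psfc[of g f] psf_Cell(2)[of X] dom2_psfu[of X] cod2_psfu[of X]
  by simp_all
qed

text \<open>The rules of \<open>fnctr\<close> with the carriers as parameters fixed by equations, so
  that \<open>fdom F\<close> and \<open>fcod F\<close> appear as the known categories when a goal is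
  simplified.\<close>

lemma fnctr_ty:
 assumes "fnctr F" "fdom F = C" "fcod F = D"
 shows "x \<in> Obj C ==> fobj F x \<in> Obj D" "y \<in> Arr C ==> farr F y \<in> Arr D"
  "y \<in> Arr C ==> Dom D (farr F y) = fobj F (Dom C y)" "y \<in> Arr C ==> Cod D (farr F y) = fobj F (Cod C y)"
  "x \<in> Obj C ==> farr F (Idn C x) = Idn D (fobj F x)"
  "y \<in> Arr C ==> y' \<in> Arr C ==> Dom C y' = Cod C y ==> farr F (Cmp C y' y) = Cmp D (farr F y') (farr F y)"
 using assms(2,3) fnctr.fobj_Obj[OF assms(1)] fnctr.farr_Arr[OF assms(1)] fnctr.Dom_farr[OF assms(1)]
  fnctr.Cod_farr[OF assms(1)] fnctr.farr_Idn[OF assms(1)] fnctr.farr_Cmp[OF assms(1)] by auto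

lemma ntr_ty:
 assumes "nat_trans \<tau>" "ndom \<tau> = F" "ncod \<tau> = G" "fdom F = C" "fcod F = D"
 shows "x \<in> Obj C ==> ncmp \<tau> x \<in> Arr D" "x \<in> Obj C ==> Dom D (ncmp \<tau> x) = fobj F x"
  "x \<in> Obj C ==> Cod D (ncmp \<tau> x) = fobj G x"
  "y \<in> Arr C ==> Cmp D (ncmp \<tau> (Cod C y)) (farr F y) = Cmp D (farr G y) (ncmp \<tau> (Dom C y))"
 using assms(2-) nat_trans.ncmp_Arr[OF assms(1)] nat_trans.Dom_ncmp[OF assms(1)]
  nat_trans.Cod_ncmp[OF assms(1)] nat_trans.ncmp_natural[OF assms(1)] by auto

context hpnt
begin

lemmas PC [simp] = psf_CAT_simps[OF P.pseudofunctor_axioms]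
lemmas QC [simp] = psf_CAT_simps[OF Q.pseudofunctor_axioms]

lemmas P0 [simp] = category_ty[OF PC(1)]
lemmas Q0 [simp] = category_ty[OF QC(1)]
lemmas P1 [simp] = fnctr_ty[OF PC(2) PC(3) PC(4)]
lemmas Q1 [simp] = fnctr_ty[OF QC(2) QC(3) QC(4)]

lemma P2 [simp]:
 "xi \<in> Cell K ==> x \<in> Obj (psf0 P (src K (dom2 K xi))) ==> ncmp (psf2 P xi) x \<in> Arr (psf0 P (trg K (dom2 K xi)))"
 "composable K g f ==> x \<in> Obj (psf0 P (src K f)) ==> ncmp (psfc P g f) x \<in> Arr (psf0 P (trg K g))"
 "X \<in> Ob K ==> x \<in> Obj (psf0 P X) ==> ncmp (psfu P X) x \<in> Arr (psf0 P X)"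
 using ntr_ty(1)[OF PC(5,6,7), of xi "psf0 P (src K (dom2 K xi))" "psf0 P (trg K (dom2 K xi))" x]
  ntr_ty(1)[OF PC(8-10), of g f "psf0 P (src K f)" "psf0 P (trg K g)" x]
  ntr_ty(1)[OF PC(11-13), of X "psf0 P X" "psf0 P X" x]
 by (auto simp: composable_def)

lemma Q2 [simp]:
 "xi \<in> Cell K ==> x \<in> Obj (psf0 Q (src K (dom2 K xi))) ==> ncmp (psf2 Q xi) x \<in> Arr (psf0 Q (trg K (dom2 K xi)))"
 "composable K g f ==> x \<in> Obj (psf0 Q (src K f)) ==> ncmp (psfc Q g f) x \<in> Arr (psf0 Q (trg K g))"
 "X \<in> Ob K ==> x \<in> Obj (psf0 Q X) ==> ncmp (psfu Q X) x \<in> Arr (psf0 Q X)"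
 using ntr_ty(1)[OF QC(5,6,7), of xi "psf0 Q (src K (dom2 K xi))" "psf0 Q (trg K (dom2 K xi))" x]
  ntr_ty(1)[OF QC(8-10), of g f "psf0 Q (src K f)" "psf0 Q (trg K g)" x]
  ntr_ty(1)[OF QC(11-13), of X "psf0 Q X" "psf0 Q X" x]
 by (auto simp: composable_def)

declare ro_Obj [simp] ra_Arr [simp] ra_Dom [simp] ra_Cod [simp] ra_Idn [simp] ra_Cmp [simp] n_iso [simp]
 n_Dom [simp] n_Cod [simp]

lemma n_Arr [simp]: "f \<in> Mor K ==> x \<in> Obj (psf0 P (src K f)) ==> n f x \<in> Arr (psf0 Q (trg K f))"
 by (rule iso_in_Arr) simp

lemma fnctr_hfnct [simp]: "X \<in> Ob K ==> fnctr (hfnct (psf0 P X) (psf0 Q X) (ro X) (ra X))"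
 by (rule fnctr.intro) (auto, auto simp: hfnct_def category.Cmp_Arr category.Idn_Arr)

lemma nat_trans_pnt2 [simp]:
 assumes [simp]: "f \<in> Mor K" shows "nat_trans (pnt2 (mk_pnt K P Q ro ra n) f)"
 by (rule nat_trans.intro) (auto simp: n_nat[OF assms], auto simp: mk_pnt_def)

lemma pseudonatural_mk_pnt: "pseudonatural K CAT (mk_pnt K P Q ro ra n)"
proof (rule pseudonatural.intro, goal_cases)
 case (1) show ?case by (simp add: P.pseudofunctor_axioms)
next
 case (2) show ?case by (simp add: Q.pseudofunctor_axioms)
next
 case (11 x)
 then have [simp]: "x \<in> Cell K" .
 show ?case
  by (simp add: P.pseudofunctor_axioms Q.pseudofunctor_axioms, rule ntr_eqI)
   (auto intro!: fnct_eqI simp: n_cell)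
next
 case (12 g f)
 then have [simp]: "f \<in> Mor K" "g \<in> Mor K" "src K g = trg K f" by (auto simp: composable_def)
 show ?case
  by (simp add: P.pseudofunctor_axioms Q.pseudofunctor_axioms, rule ntr_eqI)
   (auto intro!: fnct_eqI simp: n_comp CAT_comp1_assoc)
next
 case (13 X)
 then have [simp]: "X \<in> Ob K" .
 show ?case
  by (simp add: P.pseudofunctor_axioms Q.pseudofunctor_axioms, rule ntr_eqI)
   (auto intro!: fnct_eqI simp: n_id)
qed (simp_all add: P.pseudofunctor_axioms Q.pseudofunctor_axioms, auto simp: iso2_CAT, auto simp: mk_pnt_def)

end

text \<open>Tags are removed with \<open>projr\<close>. The values are meaningful because whatever
  lands in a category relabelled along \<open>Inr\<close> has that form; \<open>ho_fobj\<close>,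
  \<open>ha_farr\<close> and \<open>hn_ncmp\<close> record this.\<close>

definition ho where "ho ph X x = projr (fobj (pnt1 ph X) (Inl x))"
definition ha where "ha ph X y = projr (farr (pnt1 ph X) (Inl y))"
definition hn where "hn ph f x = projr (ncmp (pnt2 ph f) (Inl x))"
definition hm where "hm Ga X x = projr (ncmp (mdf2 Ga X) (Inl x))"

lemma projr_Inr: "y \<in> Inr ` S ==> y = Inr (projr y) & projr y \<in> S"
 by auto

locale hetero_pnt = ph: pseudonatural K CAT ph + P: pseudofunctor K CAT P + Q: pseudofunctor K CAT Q
 for K :: "('o, 'm, 'c) twocat"
  and P :: "('o, 'm, 'c, ('u, 'v) cat, ('u, 'v) fnct, ('u, 'v) ntr) psf"
  and Q :: "('o, 'm, 'c, ('w, 'z) cat, ('w, 'z) fnct, ('w, 'z) ntr) psf"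
  and ph :: "('o, 'm, 'c, ('u + 'w, 'v + 'z) cat, ('u + 'w, 'v + 'z) fnct, ('u + 'w, 'v + 'z) ntr) pnt" +
 assumes pdom_left [simp]: "pdom ph = psf_comp K CAT in_left P"
  and pcod_right [simp]: "pcod ph = psf_comp K CAT in_right Q"
begin

lemmas PC [simp] = psf_CAT_simps[OF P.pseudofunctor_axioms]
lemmas QC [simp] = psf_CAT_simps[OF Q.pseudofunctor_axioms]
lemmas P0 [simp] = category_ty[OF PC(1)]
lemmas Q0 [simp] = category_ty[OF QC(1)]
lemmas P1 [simp] = fnctr_ty[OF PC(2) PC(3) PC(4)]
lemmas Q1 [simp] = fnctr_ty[OF QC(2) QC(3) QC(4)]

lemma P2 [simp]:
 "xi \<in> Cell K ==> x \<in> Obj (psf0 P (src K (dom2 K xi))) ==> ncmp (psf2 P xi) x \<in> Arr (psf0 P (trg K (dom2 K xi)))"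
 "composable K g f ==> x \<in> Obj (psf0 P (src K f)) ==> ncmp (psfc P g f) x \<in> Arr (psf0 P (trg K g))"
 "X \<in> Ob K ==> x \<in> Obj (psf0 P X) ==> ncmp (psfu P X) x \<in> Arr (psf0 P X)"
 using ntr_ty(1)[OF PC(5,6,7), of xi "psf0 P (src K (dom2 K xi))" "psf0 P (trg K (dom2 K xi))" x]
  ntr_ty(1)[OF PC(8-10), of g f "psf0 P (src K f)" "psf0 P (trg K g)" x]
  ntr_ty(1)[OF PC(11-13), of X "psf0 P X" "psf0 P X" x]
 by (auto simp: composable_def)

lemma Q2 [simp]:
 "xi \<in> Cell K ==> x \<in> Obj (psf0 Q (src K (dom2 K xi))) ==> ncmp (psf2 Q xi) x \<in> Arr (psf0 Q (trg K (dom2 K xi)))"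
 "composable K g f ==> x \<in> Obj (psf0 Q (src K f)) ==> ncmp (psfc Q g f) x \<in> Arr (psf0 Q (trg K g))"
 "X \<in> Ob K ==> x \<in> Obj (psf0 Q X) ==> ncmp (psfu Q X) x \<in> Arr (psf0 Q X)"
 using ntr_ty(1)[OF QC(5,6,7), of xi "psf0 Q (src K (dom2 K xi))" "psf0 Q (trg K (dom2 K xi))" x]
  ntr_ty(1)[OF QC(8-10), of g f "psf0 Q (src K f)" "psf0 Q (trg K g)" x]
  ntr_ty(1)[OF QC(11-13), of X "psf0 Q X" "psf0 Q X" x]
 by (auto simp: composable_def)

lemma pnt1_fnctr [simp]:
 assumes "X \<in> Ob K"
 shows "fnctr (pnt1 ph X)" "fdom (pnt1 ph X) = relabel_cat Inl Inl (psf0 P X)"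
  "fcod (pnt1 ph X) = relabel_cat Inr Inr (psf0 Q X)"
 using ph.pnt1_Mor[OF assms] ph.src_pnt1[OF assms] ph.trg_pnt1[OF assms] assms
 by (simp_all add: P.pseudofunctor_axioms Q.pseudofunctor_axioms)

lemma ho_fobj [simp]:
 assumes "X \<in> Ob K" "x \<in> Obj (psf0 P X)"
 shows "fobj (pnt1 ph X) (Inl x) = Inr (ho ph X x)" "ho ph X x \<in> Obj (psf0 Q X)"
 using fnctr_ty(1)[OF pnt1_fnctr, OF assms(1) assms(1) assms(1), of "Inl x"] assms(2) projr_Inr
 by (auto simp: ho_def)

lemma ha_farr [simp]:
 assumes "X \<in> Ob K" "y \<in> Arr (psf0 P X)"
 shows "farr (pnt1 ph X) (Inl y) = Inr (ha ph X y)" "ha ph X y \<in> Arr (psf0 Q X)"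
 using fnctr_ty(2)[OF pnt1_fnctr, OF assms(1) assms(1) assms(1), of "Inl y"] assms(2) projr_Inr
 by (auto simp: ha_def)

lemma pnt2_ntr [simp]:
 assumes "f \<in> Mor K"
 shows "nat_trans (pnt2 ph f)" "ndom (pnt2 ph f) = fnct_comp (relabel_fnct Inr Inr (psf1 Q f)) (pnt1 ph (src K f))"
  "ncod (pnt2 ph f) = fnct_comp (pnt1 ph (trg K f)) (relabel_fnct Inl Inl (psf1 P f))"
 using ph.pnt2_Cell[OF assms] ph.dom2_pnt2[OF assms] ph.cod2_pnt2[OF assms] assms
 by (simp_all add: P.pseudofunctor_axioms Q.pseudofunctor_axioms)

lemma hn_ncmp [simp]:
 assumes "f \<in> Mor K" "x \<in> Obj (psf0 P (src K f))"
 shows "ncmp (pnt2 ph f) (Inl x) = Inr (hn ph f x)" "hn ph f x \<in> Arr (psf0 Q (trg K f))"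
 using ntr_ty(1)[OF pnt2_ntr refl refl, OF assms(1) assms(1) assms(1), of "Inl x"] assms projr_Inr
 by (auto simp: hn_def)

text \<open>Each law is an equation in the sum copy of CAT, evaluated at a tagged object or arrow;
  injectivity of the tags then removes them.\<close>

lemma hpnt: "hpnt K P Q (ho ph) (ha ph) (hn ph)"
proof (rule hpnt.intro[OF P.pseudofunctor_axioms Q.pseudofunctor_axioms hpnt_axioms.intro], goal_cases)
 case (3 X y)
 then show ?case using fnctr_ty(3)[OF pnt1_fnctr, of X "Inl y"] by simp
next
 case (4 X y)
 then show ?case using fnctr_ty(4)[OF pnt1_fnctr, of X "Inl y"] by simp
next
 case (5 X x)
 then show ?case using fnctr_ty(5)[OF pnt1_fnctr, of X "Inl x"] by simp
next
 case (6 X y y')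
 then show ?case using fnctr_ty(6)[OF pnt1_fnctr, of X "Inl y" "Inl y'"] by simp
next
 case (7 f x)
 then show ?case using ph.pnt2_iso[OF 7(1), unfolded iso2_CAT] by auto
next
 case (8 f x)
 then show ?case using ntr_ty(2)[OF pnt2_ntr refl refl, of f "Inl x"] by simp
next
 case (9 f x)
 then show ?case using ntr_ty(3)[OF pnt2_ntr refl refl, of f "Inl x"] by simp
next
 case (10 f y)
 then show ?case using ntr_ty(4)[OF pnt2_ntr refl refl, of f "Inl y"] by simp
next
 case (11 xi x)
 then show ?case using arg_cong[OF ph.pnt2_natural[OF 11(1)], of "%z. ncmp z (Inl x)"]
  by (simp add: P.pseudofunctor_axioms Q.pseudofunctor_axioms)
next
 case (12 g f x)
 then have [simp]: "f \<in> Mor K" "g \<in> Mor K" "src K g = trg K f" by (auto simp: composable_def)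
 show ?case using arg_cong[OF ph.pnt2_comp1[OF 12(1)], of "%z. ncmp z (Inl x)"] 12
  by (simp add: P.pseudofunctor_axioms Q.pseudofunctor_axioms CAT_comp1_assoc)
next
 case (13 X x)
 then show ?case using arg_cong[OF ph.pnt2_id1[OF 13(1)], of "%z. ncmp z (Inl x)"]
  by (simp add: P.pseudofunctor_axioms Q.pseudofunctor_axioms)
qed simp_all

end

lemma (in hpnt) hetero_mk_pnt: "hetero_pnt K P Q (mk_pnt K P Q ro ra n)"
 by (simp add: hetero_pnt_def hetero_pnt_axioms_def pseudonatural_mk_pnt P.pseudofunctor_axioms Q.pseudofunctor_axioms)

lemma mk_pnt_h [simp]:
 "X \<in> Ob K ==> x \<in> Obj (psf0 P X) ==> ho (mk_pnt K P Q ro ra n) X x = ro X x"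
 "X \<in> Ob K ==> y \<in> Arr (psf0 P X) ==> ha (mk_pnt K P Q ro ra n) X y = ra X y"
 "f \<in> Mor K ==> x \<in> Obj (psf0 P (src K f)) ==> hn (mk_pnt K P Q ro ra n) f x = n f x"
 by (simp_all add: ho_def ha_def hn_def)

text \<open>The counterpart of \<open>hpnt\<close> for modifications: \<open>m_nat\<close> says that
  each component is a natural transformation, and \<open>m_mdf\<close> is the modification
  axiom.\<close>

locale hmdf = a: hetero_pnt K P Q al + b: hetero_pnt K P Q be
 for K :: "('o, 'm, 'c) twocat"
  and P :: "('o, 'm, 'c, ('u, 'v) cat, ('u, 'v) fnct, ('u, 'v) ntr) psf"
  and Q :: "('o, 'm, 'c, ('w, 'z) cat, ('w, 'z) fnct, ('w, 'z) ntr) psf" and al be +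
 fixes m :: "'o => 'u => 'z"
 assumes m_Arr: "X \<in> Ob K ==> x \<in> Obj (psf0 P X) ==> m X x \<in> Arr (psf0 Q X)"
  and m_Dom: "X \<in> Ob K ==> x \<in> Obj (psf0 P X) ==> Dom (psf0 Q X) (m X x) = ho al X x"
  and m_Cod: "X \<in> Ob K ==> x \<in> Obj (psf0 P X) ==> Cod (psf0 Q X) (m X x) = ho be X x"
  and m_nat: "X \<in> Ob K ==> y \<in> Arr (psf0 P X) ==>
   Cmp (psf0 Q X) (m X (Cod (psf0 P X) y)) (ha al X y) = Cmp (psf0 Q X) (ha be X y) (m X (Dom (psf0 P X) y))"
  and m_mdf: "f \<in> Mor K ==> x \<in> Obj (psf0 P (src K f)) ==>
   Cmp (psf0 Q (trg K f)) (hn be f x) (farr (psf1 Q f) (m (src K f) x)) =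
   Cmp (psf0 Q (trg K f)) (m (trg K f) (fobj (psf1 P f) x)) (hn al f x)"

definition mk_mdf where
 "mk_mdf K P al be m = \<lparr>mdom = al, mcod = be,
  mdf2 = (\<lambda>X \<in> Ob K. \<lparr>ndom = pnt1 al X, ncod = pnt1 be X,
   ncmp = (\<lambda>x \<in> Inl ` Obj (psf0 P X). Inr (m X (projl x)))\<rparr>)\<rparr>"

lemma mk_mdf_simps [simp]:
 "mdom (mk_mdf K P al be m) = al" "mcod (mk_mdf K P al be m) = be"
 "X \<in> Ob K ==> ndom (mdf2 (mk_mdf K P al be m) X) = pnt1 al X"
 "X \<in> Ob K ==> ncod (mdf2 (mk_mdf K P al be m) X) = pnt1 be X"
 "X \<in> Ob K ==> x \<in> Obj (psf0 P X) ==> ncmp (mdf2 (mk_mdf K P al be m) X) (Inl x) = Inr (m X x)"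
 "X \<in> Ob K ==> x \<in> Obj (psf0 P X) ==> hm (mk_mdf K P al be m) X x = m X x"
 by (simp_all add: mk_mdf_def hm_def)

lemma (in hmdf) modification_mk_mdf: "modification K CAT (mk_mdf K P al be m)"
proof -
 note [simp] = m_Arr m_Dom m_Cod m_mdf
 have nt [simp]: "X \<in> Ob K ==> nat_trans (mdf2 (mk_mdf K P al be m) X)" for X
  by (rule nat_trans.intro) (auto simp: m_nat, auto simp: mk_mdf_def)
 show ?thesis
 proof (rule modification.intro, goal_cases)
  case (9 f)
  then show ?case
   by (simp add: a.P.pseudofunctor_axioms a.Q.pseudofunctor_axioms, intro ntr_eqI) auto
 qed (simp_all add: a.ph.pseudonatural_axioms b.ph.pseudonatural_axioms, simp_all add: mk_mdf_def)
qed

lemma hmdf_modification: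
 assumes "hetero_pnt K P Q al" "hetero_pnt K P Q be" "modification K CAT Ga" "mdom Ga = al" "mcod Ga = be"
 shows "hmdf K P Q al be (hm Ga)" (is "PROP ?C0")
  and "X \<in> Ob K ==> x \<in> Obj (psf0 P X) ==> ncmp (mdf2 Ga X) (Inl x) = Inr (hm Ga X x)" (is "PROP ?C1")
proof -
 interpret a: hetero_pnt K P Q al by fact
 interpret b: hetero_pnt K P Q be by fact
 interpret modification K CAT Ga by fact
 have t [simp]: "nat_trans (mdf2 Ga X)" "ndom (mdf2 Ga X) = pnt1 al X" "ncod (mdf2 Ga X) = pnt1 be X" if "X \<in> Ob K" for X
  using mdf2_Cell[OF that] dom2_mdf2[OF that] cod2_mdf2[OF that] assms by simp_all
 note T = ntr_ty[OF t a.pnt1_fnctr(2,3)]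
 have n [simp]: "ncmp (mdf2 Ga X) (Inl x) = Inr (hm Ga X x)" "hm Ga X x \<in> Arr (psf0 Q X)" if "X \<in> Ob K" "x \<in> Obj (psf0 P X)" for X x
  using T(1)[OF that(1) that(1) that(1) that(1) that(1), of "Inl x"] that projr_Inr
  by (auto simp: hm_def)
 show "PROP ?C1"
  by simp
 show "PROP ?C0"
 proof (rule hmdf.intro[OF assms(1,2)], rule hmdf_axioms.intro, goal_cases)
  case (2 X x)
  then show ?case using T(2)[of X "Inl x"] by simp
 next
  case (3 X x)
  then show ?case using T(3)[of X "Inl x"] by simp
 next
  case (4 X y)
  then show ?case using T(4)[of X "Inl y"] by simp
 next
  case (5 f x)
  then show ?case using arg_cong[OF mdf2_natural[OF 5(1)], of "%z. ncmp z (Inl x)"]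
   by (simp add: a.P.pseudofunctor_axioms a.Q.pseudofunctor_axioms assms(4,5))
 qed simp_all
qed

section \<open>Componentwise criteria for isomorphisms and equivalences in \<open>PS\<close>\<close>

text \<open>Rotates a square along two invertible sides; this is how naturality of a family passes
  to the family of its inverses.\<close>

lemma (in two_category) iso2_conjugate:
 assumes "iso2 H x" "iso2 H y" "vseq H x p" "vseq H q y" "x \<bullet> p = q \<bullet> y"
 shows "p \<bullet> inv2 H y = inv2 H x \<bullet> q"
proof -
 have c: "x \<in> Cell H" "p \<in> Cell H" "q \<in> Cell H" "y \<in> Cell H" "dom2 H x = cod2 H p" "dom2 H q = cod2 H y"
  using assms(3,4) by (auto simp: vseq_def)
 have d: "dom2 H p = dom2 H y" "cod2 H q = cod2 H x"
  using vcomp_typing(2,3)[OF assms(3)] vcomp_typing(2,3)[OF assms(4)] assms(5) by simp_all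
 have "p \<bullet> inv2 H y = (inv2 H x \<bullet> (x \<bullet> p)) \<bullet> inv2 H y" using c assms(1) by simp
 also have "... = inv2 H x \<bullet> q"
  unfolding assms(5) using c d assms(1,2) by (simp add: vcomp_assoc)
 finally show ?thesis .
qed

text \<open>The family of inverses is a modification, by rotating the axiom of \<open>Ga\<close>
  along its invertible whiskered components.\<close>

lemma mdf_iso2:
 assumes "modification A H Ga" "!!a. a \<in> Ob A ==> iso2 H (mdf2 Ga a)"
 shows "iso2 (PS A H) Ga"
proof -
 interpret A: two_category A using assms(1) by (rule modification_two_category)
 interpret H: two_category H using assms(1) by (rule modification_two_category)
 interpret modification A H Ga by fact
 define De where "De = \<lparr>mdom = mcod Ga, mcod = mdom Ga, mdf2 = (\<lambda>a \<in> Ob A. inv2 H (mdf2 Ga a))\<rparr>"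
 have D [simp]: "mdom De = mcod Ga" "mcod De = mdom Ga" "!!a. a \<in> Ob A ==> mdf2 De a = inv2 H (mdf2 Ga a)"
  by (simp_all add: De_def)
 have m: "modification A H De"
 proof (rule modification.intro, goal_cases)
  case (9 f)
  then have f [simp]: "f \<in> Mor A" .
  note [simp] = assms(2)
  define x where "x = mdf2 Ga (trg A f) *{H} id2 H (psf1 (pdom (mdom Ga)) f)"
  define y where "y = id2 H (psf1 (pcod (mdom Ga)) f) *{H} mdf2 Ga (src A f)"
  have i: "inv2 H x = inv2 H (mdf2 Ga (trg A f)) *{H} id2 H (psf1 (pdom (mdom Ga)) f)"
   "inv2 H y = id2 H (psf1 (pcod (mdom Ga)) f) *{H} inv2 H (mdf2 Ga (src A f))"
   by (simp_all add: H.inv2_hcomp x_def y_def)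
  have "pnt2 (mdom Ga) f #{H} inv2 H y = inv2 H x #{H} pnt2 (mcod Ga) f"
   by (rule H.iso2_conjugate) (simp_all add: mdf2_natural x_def y_def)
  then show ?case by (simp add: i)
 qed (simp_all add: pseudonatural_mcod pseudonatural_mdom assms(2), simp add: De_def)
 show ?thesis unfolding iso2_def
  by (auto intro!: bexI[of _ De] mdf_eqI[of A H] simp: m assms modification_axioms pseudonatural_mcod pseudonatural_mdom)
qed

lemma iso2_PS:
 "iso2 (PS A H) Ga \<longleftrightarrow> modification A H Ga & (\<forall>a\<in>Ob A. iso2 H (mdf2 Ga a))"
proof safe
 assume "iso2 (PS A H) Ga"
 then obtain De where d: "modification A H Ga" "modification A H De" "mdom De = mcod Ga" "mcod De = mdom Ga"
  "mdf_vcomp A H De Ga = mdf_id A H (mdom Ga)" "mdf_vcomp A H Ga De = mdf_id A H (mcod Ga)"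
  unfolding iso2_def by auto
 then show "modification A H Ga" by simp
 interpret H: two_category H using d(1) by (rule modification_two_category)
 interpret modification A H Ga by fact
 interpret d: modification A H De by fact
 fix a assume a: "a \<in> Ob A"
 show "iso2 H (mdf2 Ga a)"
  by (rule H.iso2I[of "mdf2 De a"])
   (use arg_cong[OF d(5), of "%z. mdf2 z a"] arg_cong[OF d(6), of "%z. mdf2 z a"] d(3,4) a in simp_all)
qed (rule mdf_iso2, auto)

text \<open>
 A pseudonatural transformation is lifted along \<open>al\<close> componentwise; its structure 2-cells are
 determined by the requirement that the given isomorphisms form a modification, and their
 coherence is inherited because whiskering with the components of \<open>al\<close> is faithful.
\<close>

lemma lift_through_fully_faithful:
 assumes al: "pseudonatural B M al" and \<zeta>: "pseudonatural B M \<zeta>" and cod: "pcod \<zeta> = pcod al"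
  and ff: "!!b. b \<in> Ob B ==> fully_faithful1 M (pnt1 al b)"
  and u: "!!b. b \<in> Ob B ==> u b \<in> Mor M" "!!b. b \<in> Ob B ==> src M (u b) = psf0 (pdom \<zeta>) b"
   "!!b. b \<in> Ob B ==> trg M (u b) = psf0 (pdom al) b"
  and e: "!!b. b \<in> Ob B ==> iso2 M (e b)" "!!b. b \<in> Ob B ==> dom2 M (e b) = pnt1 al b o{M} u b"
   "!!b. b \<in> Ob B ==> cod2 M (e b) = pnt1 \<zeta> b"
 shows "\<exists>be. pseudonatural B M be & pdom be = pdom \<zeta> & pcod be = pdom al &
  isomorphic1 (PS B M) (pnt_comp B M al be) \<zeta>"
proof -
 interpret B: two_category B using al by (rule pseudonatural_two_category)
 interpret M: two_category M using al by (rule pseudonatural_two_category)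
 interpret al: pseudonatural B M al by fact
 interpret \<zeta>: pseudonatural B M \<zeta> by fact
 let ?R = "pdom al" and ?D = "pcod al" and ?S = "pdom \<zeta>"
 note [simp] = u e cod
 have ec [simp]: "b \<in> Ob B ==> e b \<in> Cell M" for b using M.iso2_Cell by simp
 have z [simp]: "trg M (pnt1 \<zeta> b) = psf0 ?D b" "src M (pnt1 \<zeta> b) = psf0 ?S b" if "b \<in> Ob B" for b
  using that by simp_all
 have zf [simp]: "dom2 M (pnt2 \<zeta> f) = psf1 ?D f o{M} pnt1 \<zeta> (src B f)"
  "cod2 M (pnt2 \<zeta> f) = pnt1 \<zeta> (trg B f) o{M} psf1 ?S f" if "f \<in> Mor B" for f
  using that by simp_all
 \<comment> \<open>The axiom that \<open>e\<close> has to satisfy as a modification is an equation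
   for \<open>al \<star> be g\<close> in which the other factors next to it are invertible; the
   right-hand side is its solution, and \<open>beta\<close> below is the axiom itself.\<close>
 have "\<exists>be. be \<in> Cell M & dom2 M be = psf1 ?R g o{M} u (src B g) & cod2 M be = u (trg B g) o{M} psf1 ?S g &
  id2 M (pnt1 al (trg B g)) *{M} be = inv2 M (e (trg B g) *{M} id2 M (psf1 ?S g)) #{M} pnt2 \<zeta> g #{M}
   (id2 M (psf1 ?D g) *{M} e (src B g)) #{M} inv2 M (pnt2 al g *{M} id2 M (u (src B g)))" if [simp]: "g \<in> Mor B" for g
  by (rule M.fully_faithful1_ex[OF ff]) (simp_all add: M.comp1_assoc')
 then obtain be where b [simp]: "!!g. g \<in> Mor B ==> be g \<in> Cell M"
  "!!g. g \<in> Mor B ==> dom2 M (be g) = psf1 ?R g o{M} u (src B g)"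
  "!!g. g \<in> Mor B ==> cod2 M (be g) = u (trg B g) o{M} psf1 ?S g"
  and b_eq: "!!g. g \<in> Mor B ==> id2 M (pnt1 al (trg B g)) *{M} be g = inv2 M (e (trg B g) *{M} id2 M (psf1 ?S g)) #{M} pnt2 \<zeta> g #{M}
   (id2 M (psf1 ?D g) *{M} e (src B g)) #{M} inv2 M (pnt2 al g *{M} id2 M (u (src B g)))"
  by metis
 have bi [simp]: "iso2 M (be g)" if [simp]: "g \<in> Mor B" for g
  by (rule M.fully_faithful1_iso2[OF ff, of "trg B g"]) (simp_all add: b_eq M.comp1_assoc')
 have beta: "(e (trg B g) *{M} id2 M (psf1 ?S g)) #{M} (id2 M (pnt1 al (trg B g)) *{M} be g) #{M} (pnt2 al g *{M} id2 M (u (src B g)))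
  = pnt2 \<zeta> g #{M} (id2 M (psf1 ?D g) *{M} e (src B g))" if [simp]: "g \<in> Mor B" for g
  unfolding b_eq[OF that] by (simp add: M.vcomp_assoc M.comp1_assoc')
 define Z where "Z = \<lparr>pdom = ?S, pcod = ?R, pnt1 = restrict u (Ob B), pnt2 = restrict be (Mor B)\<rparr>"
 have Z [simp]: "pdom Z = ?S" "pcod Z = ?R" "!!a. a \<in> Ob B ==> pnt1 Z a = u a" "!!f. f \<in> Mor B ==> pnt2 Z f = be f"
  by (simp_all add: Z_def)
 have pZ: "pseudonatural B M Z"
 proof (rule pseudonatural.intro, goal_cases)
  case (11 x)
  then have x [simp]: "x \<in> Cell B" .
  let ?f = "dom2 B x" and ?g = "cod2 B x" and ?s = "src B (dom2 B x)" and ?t = "trg B (dom2 B x)"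
  have bg: "(e ?t *{M} id2 M (psf1 ?S ?g)) #{M} (id2 M (pnt1 al ?t) *{M} be ?g) #{M} (pnt2 al ?g *{M} id2 M (u ?s))
   = pnt2 \<zeta> ?g #{M} (id2 M (psf1 ?D ?g) *{M} e ?s)" using beta[of ?g] by simp
  have 1: "(pnt2 al ?g *{M} id2 M (u ?s)) #{M} (psf2 ?D x *{M} id2 M (pnt1 al ?s o{M} u ?s))
    = (id2 M (pnt1 al ?t) *{M} (psf2 ?R x *{M} id2 M (u ?s))) #{M} (pnt2 al ?f *{M} id2 M (u ?s))"
   using arg_cong[OF al.pnt2_natural[OF x], of "%z. z *{M} id2 M (u ?s)"] by (simp add: M.pasting)
  have 2: "(id2 M (psf1 ?D ?g) *{M} e ?s) #{M} (psf2 ?D x *{M} id2 M (pnt1 al ?s o{M} u ?s))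
    = (psf2 ?D x *{M} id2 M (pnt1 \<zeta> ?s)) #{M} (id2 M (psf1 ?D ?f) *{M} e ?s)"
   using M.exchange(1)[of "psf2 ?D x" "e ?s"] by simp
  have 3: "(e ?t *{M} id2 M (psf1 ?S ?g)) #{M} (id2 M (pnt1 al ?t o{M} u ?t) *{M} psf2 ?S x) =
   (id2 M (pnt1 \<zeta> ?t) *{M} psf2 ?S x) #{M} (e ?t *{M} id2 M (psf1 ?S ?f))"
   using M.exchange(1)[of "e ?t" "psf2 ?S x"] by simp
  have nz: "pnt2 \<zeta> ?g #{M} (psf2 ?D x *{M} id2 M (pnt1 \<zeta> ?s)) = (id2 M (pnt1 \<zeta> ?t) *{M} psf2 ?S x) #{M} pnt2 \<zeta> ?f"
   using \<zeta>.pnt2_natural[OF x] by simp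
  let ?l = "be ?g #{M} (psf2 ?R x *{M} id2 M (u ?s))" and ?r = "(id2 M (u ?t) *{M} psf2 ?S x) #{M} be ?f"
  \<comment> \<open>Both sides are compared after whiskering with \<open>al\<close> and pasting with
    \<open>e\<close>, where \<open>beta\<close> and the axioms of \<zeta> and \<open>al\<close>
    apply; then the invertible factors and finally \<open>al\<close> are cancelled. The two
    remaining laws follow the same pattern.\<close>
  have "(e ?t *{M} id2 M (psf1 ?S ?g)) #{M} (id2 M (pnt1 al ?t) *{M} ?l) #{M} (pnt2 al ?f *{M} id2 M (u ?s)) =
    ((e ?t *{M} id2 M (psf1 ?S ?g)) #{M} (id2 M (pnt1 al ?t) *{M} be ?g) #{M} (pnt2 al ?g *{M} id2 M (u ?s)))
     #{M} (psf2 ?D x *{M} id2 M (pnt1 al ?s o{M} u ?s))"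
   by (simp add: M.pasting 1)
  also have "... = (id2 M (pnt1 \<zeta> ?t) *{M} psf2 ?S x) #{M} (pnt2 \<zeta> ?f #{M} (id2 M (psf1 ?D ?f) *{M} e ?s))"
   unfolding bg by (simp add: M.pasting 2 M.vcomp_pre[OF nz])
  also have "... = (e ?t *{M} id2 M (psf1 ?S ?g)) #{M} (id2 M (pnt1 al ?t) *{M} ?r) #{M} (pnt2 al ?f *{M} id2 M (u ?s))"
   unfolding beta[OF B.dom2_Mor[OF x], symmetric] by (simp add: M.pasting M.vcomp_pre[OF 3])
  finally have "(id2 M (pnt1 al ?t) *{M} ?l) #{M} (pnt2 al ?f *{M} id2 M (u ?s)) = (id2 M (pnt1 al ?t) *{M} ?r) #{M} (pnt2 al ?f *{M} id2 M (u ?s))"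
   by (rule M.iso2_cancel_left[rotated]) (simp_all add: M.comp1_assoc')
  then have "id2 M (pnt1 al ?t) *{M} ?l = id2 M (pnt1 al ?t) *{M} ?r"
   by (rule M.iso2_cancel_right[rotated]) (simp_all add: M.comp1_assoc')
  then have "?l = ?r"
   by (rule M.fully_faithful1_unique[OF ff, rotated -1]) (simp_all add: M.comp1_assoc')
  then show ?case by simp
 next
  case (12 h g)
  then have c [simp]: "g \<in> Mor B" "h \<in> Mor B" "src B h = trg B g"
   and cc: "composable B h g" by (auto simp: composable_def)
  let ?a = "src B g" and ?b = "trg B g" and ?c = "trg B h"
  have gh: "h o{B} g \<in> Mor B" by simp
  have b1: "(e ?c *{M} id2 M (psf1 ?S (h o{B} g))) #{M} (id2 M (pnt1 al ?c) *{M} be (h o{B} g)) #{M} (pnt2 al (h o{B} g) *{M} id2 M (u ?a))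
   = pnt2 \<zeta> (h o{B} g) #{M} (id2 M (psf1 ?D (h o{B} g)) *{M} e ?a)" using beta[OF gh] by simp
  have b2: "(e ?c *{M} id2 M (psf1 ?S h o{M} psf1 ?S g)) #{M} (id2 M (pnt1 al ?c) *{M} (be h *{M} id2 M (psf1 ?S g))) #{M} (pnt2 al h *{M} id2 M (u ?b o{M} psf1 ?S g))
   = (pnt2 \<zeta> h *{M} id2 M (psf1 ?S g)) #{M} (id2 M (psf1 ?D h) *{M} (e ?b *{M} id2 M (psf1 ?S g)))"
   using arg_cong[OF beta[of h], of "%z. z *{M} id2 M (psf1 ?S g)"] by (simp add: M.pasting)
  have b3: "(id2 M (psf1 ?D h) *{M} (e ?b *{M} id2 M (psf1 ?S g))) #{M} (id2 M (psf1 ?D h o{M} pnt1 al ?b) *{M} be g) #{M} (id2 M (psf1 ?D h) *{M} (pnt2 al g *{M} id2 M (u ?a)))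
   = (id2 M (psf1 ?D h) *{M} pnt2 \<zeta> g) #{M} (id2 M (psf1 ?D h o{M} psf1 ?D g) *{M} e ?a)"
   using arg_cong[OF beta[of g], of "%z. id2 M (psf1 ?D h) *{M} z"] by (simp add: M.pasting)
  have x1: "(pnt2 al (h o{B} g) *{M} id2 M (u ?a)) #{M} (psfc ?D h g *{M} id2 M (pnt1 al ?a o{M} u ?a))
    = (id2 M (pnt1 al ?c) *{M} (psfc ?R h g *{M} id2 M (u ?a))) #{M} (pnt2 al h *{M} id2 M (psf1 ?R g o{M} u ?a)) #{M}
     (id2 M (psf1 ?D h) *{M} (pnt2 al g *{M} id2 M (u ?a)))"
   using arg_cong[OF al.pnt2_comp1[OF cc], of "%z. z *{M} id2 M (u ?a)"] by (simp add: M.pasting)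
  have x2: "(id2 M (psf1 ?D (h o{B} g)) *{M} e ?a) #{M} (psfc ?D h g *{M} id2 M (pnt1 al ?a o{M} u ?a)) =
   (psfc ?D h g *{M} id2 M (pnt1 \<zeta> ?a)) #{M} (id2 M (psf1 ?D h o{M} psf1 ?D g) *{M} e ?a)"
   using M.exchange(1)[of "psfc ?D h g" "e ?a"] by simp
  have x3: "(id2 M (pnt1 \<zeta> ?c) *{M} psfc ?S h g) #{M} (e ?c *{M} id2 M (psf1 ?S h o{M} psf1 ?S g)) =
    (e ?c *{M} id2 M (psf1 ?S (h o{B} g))) #{M} (id2 M (pnt1 al ?c o{M} u ?c) *{M} psfc ?S h g)"
   using M.exchange(1)[of "e ?c" "psfc ?S h g"] by simp
  have x4: "(pnt2 al h *{M} id2 M (u ?b o{M} psf1 ?S g)) #{M} (id2 M (psf1 ?D h o{M} pnt1 al ?b) *{M} be g)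
    = (id2 M (pnt1 al ?c o{M} psf1 ?R h) *{M} be g) #{M} (pnt2 al h *{M} id2 M (psf1 ?R g o{M} u ?a))"
   using M.exchange(1)[of "pnt2 al h" "be g"] by simp
  have zc: "pnt2 \<zeta> (h o{B} g) #{M} (psfc ?D h g *{M} id2 M (pnt1 \<zeta> ?a))
    = (id2 M (pnt1 \<zeta> ?c) *{M} psfc ?S h g) #{M} (pnt2 \<zeta> h *{M} id2 M (psf1 ?S g)) #{M} (id2 M (psf1 ?D h) *{M} pnt2 \<zeta> g)"
   using \<zeta>.pnt2_comp1[OF cc] by simp
  let ?l = "be (h o{B} g) #{M} (psfc ?R h g *{M} id2 M (u ?a))"
   and ?r = "(id2 M (u ?c) *{M} psfc ?S h g) #{M} (be h *{M} id2 M (psf1 ?S g)) #{M} (id2 M (psf1 ?R h) *{M} be g)"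
   and ?p = "(pnt2 al h *{M} id2 M (psf1 ?R g o{M} u ?a)) #{M} (id2 M (psf1 ?D h) *{M} (pnt2 al g *{M} id2 M (u ?a)))"
  have "(e ?c *{M} id2 M (psf1 ?S (h o{B} g))) #{M} (id2 M (pnt1 al ?c) *{M} ?l) #{M} ?p =
    ((e ?c *{M} id2 M (psf1 ?S (h o{B} g))) #{M} (id2 M (pnt1 al ?c) *{M} be (h o{B} g)) #{M} (pnt2 al (h o{B} g) *{M} id2 M (u ?a)))
    #{M} (psfc ?D h g *{M} id2 M (pnt1 al ?a o{M} u ?a))"
   by (simp add: M.pasting x1)
  also have "... = (id2 M (pnt1 \<zeta> ?c) *{M} psfc ?S h g) #{M} (pnt2 \<zeta> h *{M} id2 M (psf1 ?S g)) #{M}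
    ((id2 M (psf1 ?D h) *{M} pnt2 \<zeta> g) #{M} (id2 M (psf1 ?D h o{M} psf1 ?D g) *{M} e ?a))"
   unfolding b1 by (simp add: M.pasting x2 M.vcomp_pre[OF zc])
  also have "... = (id2 M (pnt1 \<zeta> ?c) *{M} psfc ?S h g) #{M} ((pnt2 \<zeta> h *{M} id2 M (psf1 ?S g)) #{M}
    (id2 M (psf1 ?D h) *{M} (e ?b *{M} id2 M (psf1 ?S g)))) #{M} (id2 M (psf1 ?D h o{M} pnt1 al ?b) *{M} be g) #{M} (id2 M (psf1 ?D h) *{M} (pnt2 al g *{M} id2 M (u ?a)))"
   unfolding b3[symmetric] by (simp add: M.pasting)
  also have "... = (e ?c *{M} id2 M (psf1 ?S (h o{B} g))) #{M} (id2 M (pnt1 al ?c) *{M} ?r) #{M} ?p"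
   unfolding b2[symmetric] by (simp add: M.pasting M.vcomp_pre[OF x3] M.vcomp_pre[OF x4])
  finally have "(id2 M (pnt1 al ?c) *{M} ?l) #{M} ?p = (id2 M (pnt1 al ?c) *{M} ?r) #{M} ?p"
   by (rule M.iso2_cancel_left[rotated]) (simp_all add: M.comp1_assoc')
  then have "id2 M (pnt1 al ?c) *{M} ?l = id2 M (pnt1 al ?c) *{M} ?r"
   by (rule M.iso2_cancel_right[rotated]) (simp_all add: M.comp1_assoc')
  then have "?l = ?r"
   by (rule M.fully_faithful1_unique[OF ff, rotated -1]) (simp_all add: M.comp1_assoc')
  then show ?case by simp
 next
  case (13 a)
  then have a [simp]: "a \<in> Ob B" .
  have b1: "(e a *{M} id2 M (psf1 ?S (id1 B a))) #{M} (id2 M (pnt1 al a) *{M} be (id1 B a)) #{M} (pnt2 al (id1 B a) *{M} id2 M (u a))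
   = pnt2 \<zeta> (id1 B a) #{M} (id2 M (psf1 ?D (id1 B a)) *{M} e a)" using beta[of "id1 B a"] by simp
  have 1: "(pnt2 al (id1 B a) *{M} id2 M (u a)) #{M} (psfu ?D a *{M} id2 M (pnt1 al a o{M} u a)) = id2 M (pnt1 al a) *{M} (psfu ?R a *{M} id2 M (u a))"
   using arg_cong[OF al.pnt2_id1[OF a], of "%z. z *{M} id2 M (u a)"] by (simp add: M.pasting)
  have 2: "(id2 M (psf1 ?D (id1 B a)) *{M} e a) #{M} (psfu ?D a *{M} id2 M (pnt1 al a o{M} u a)) = (psfu ?D a *{M} id2 M (pnt1 \<zeta> a)) #{M} e a"
   using M.exchange(1)[of "psfu ?D a" "e a"] by simp
  have 3: "(e a *{M} id2 M (psf1 ?S (id1 B a))) #{M} (id2 M (pnt1 al a o{M} u a) *{M} psfu ?S a) = (id2 M (pnt1 \<zeta> a) *{M} psfu ?S a) #{M} e a"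
   using M.exchange(1)[of "e a" "psfu ?S a"] by simp
  have zc: "pnt2 \<zeta> (id1 B a) #{M} (psfu ?D a *{M} id2 M (pnt1 \<zeta> a)) = id2 M (pnt1 \<zeta> a) *{M} psfu ?S a"
   using \<zeta>.pnt2_id1[OF a] by simp
  let ?l = "be (id1 B a) #{M} (psfu ?R a *{M} id2 M (u a))" and ?r = "id2 M (u a) *{M} psfu ?S a"
  have "(e a *{M} id2 M (psf1 ?S (id1 B a))) #{M} (id2 M (pnt1 al a) *{M} ?l) =
   ((e a *{M} id2 M (psf1 ?S (id1 B a))) #{M} (id2 M (pnt1 al a) *{M} be (id1 B a)) #{M} (pnt2 al (id1 B a) *{M} id2 M (u a)))
    #{M} (psfu ?D a *{M} id2 M (pnt1 al a o{M} u a))" by (simp add: M.pasting 1)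
  also have "... = (e a *{M} id2 M (psf1 ?S (id1 B a))) #{M} (id2 M (pnt1 al a) *{M} ?r)"
   unfolding b1 by (simp add: M.pasting 2 3 M.vcomp_pre[OF zc])
  finally have "id2 M (pnt1 al a) *{M} ?l = id2 M (pnt1 al a) *{M} ?r"
   by (rule M.iso2_cancel_left[rotated]) (simp_all add: M.comp1_assoc')
  then have "?l = ?r"
   by (rule M.fully_faithful1_unique[OF ff, rotated -1]) (simp_all add: M.comp1_assoc')
  then show ?case by simp
 qed (simp_all add: al.pseudofunctor_pdom \<zeta>.pseudofunctor_pdom, simp_all add: Z_def)
 define E where "E = \<lparr>mdom = pnt_comp B M al Z, mcod = \<zeta>, mdf2 = restrict e (Ob B)\<rparr>"
 have "modification B M E"
  by (rule modification.intro) (simp_all add: E_def pZ al \<zeta> beta M.vcomp_assoc M.comp1_assoc')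
 then have "iso2 (PS B M) E" by (simp add: iso2_PS E_def)
 then have "isomorphic1 (PS B M) (pnt_comp B M al Z) \<zeta>"
  unfolding isomorphic1_def by (intro exI[of _ E]) (simp add: E_def)
 then show ?thesis using pZ Z by blast
qed

text \<open>Inverses are unique up to isomorphism: f \<cong> f (g h) = (f g) h \<cong> h, hence g f
  \<cong> g h \<cong> 1. It lets a construction that only produces right inverses be applied
  twice.\<close>

lemma (in two_category) equivalence1I_two_sided:
 assumes "f \<in> Mor H" "g \<in> Mor H" "h \<in> Mor H" "src H g = trg H f" "trg H g = src H f" "src H h = trg H g" "trg H h = src H g"
  and fg: "isomorphic1 H (f \<odot> g) (id1 H (trg H f))" and gh: "isomorphic1 H (g \<odot> h) (id1 H (src H f))"
 shows "equivalence1 H f (src H f) (trg H f)"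
proof -
 have "isomorphic1 H (f \<odot> (g \<odot> h)) (f \<odot> id1 H (src H f))"
  using isomorphic1_comp1[OF gh isomorphic1_refl[of f]] assms by simp
 moreover have "isomorphic1 H ((f \<odot> g) \<odot> h) (id1 H (trg H f) \<odot> h)"
  using isomorphic1_comp1[OF isomorphic1_refl[of h] fg] assms by simp
 ultimately have "isomorphic1 H (f \<odot> g \<odot> h) f" "isomorphic1 H (f \<odot> g \<odot> h) h"
  using assms by (simp_all add: comp1_assoc')
 then have "isomorphic1 H f h" using isomorphic1_sym isomorphic1_trans by blast
 then have "isomorphic1 H (g \<odot> f) (g \<odot> h)"
  using isomorphic1_comp1[OF _ isomorphic1_refl[of g]] assms by simp
 then have "isomorphic1 H (g \<odot> f) (id1 H (src H f))" using gh isomorphic1_trans by blast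
 then show ?thesis unfolding equivalence1_def using assms by auto
qed

lemma isomorphic1_PS_components:
 assumes "isomorphic1 (PS B M) al be" "b \<in> Ob B" shows "isomorphic1 M (pnt1 al b) (pnt1 be b)"
proof -
 obtain Ga where G: "iso2 (PS B M) Ga" "mdom Ga = al" "mcod Ga = be"
  using assms(1) unfolding isomorphic1_def by auto
 then have "modification B M Ga" "iso2 M (mdf2 Ga b)" using assms(2) by (simp_all add: iso2_PS)
 then show ?thesis
  using modification.dom2_mdf2[of B M Ga b] modification.cod2_mdf2[of B M Ga b] assms(2) G(2,3)
  unfolding isomorphic1_def by auto
qed

lemma equivalence1_components:
 assumes "equivalence1 (PS B M) al F G" "b \<in> Ob B"
 shows "equivalence1 M (pnt1 al b) (psf0 F b) (psf0 G b)"
proof -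
 obtain be where a: "pseudonatural B M al" "pdom al = F" "pcod al = G" "pseudonatural B M be" "pdom be = G" "pcod be = F"
  and i: "isomorphic1 (PS B M) (pnt_comp B M be al) (pnt_id B M F)" "isomorphic1 (PS B M) (pnt_comp B M al be) (pnt_id B M G)"
  using assms unfolding equivalence1_def by auto
 interpret a: pseudonatural B M al by fact
 interpret b: pseudonatural B M be by fact
 have "isomorphic1 M (pnt1 be b o{M} pnt1 al b) (id1 M (psf0 F b))" "isomorphic1 M (pnt1 al b o{M} pnt1 be b) (id1 M (psf0 G b))"
  using isomorphic1_PS_components[OF i(1) assms(2)] isomorphic1_PS_components[OF i(2) assms(2)] assms(2) by simp_all
 then show ?thesis using assms(2) a unfolding equivalence1_def by (auto intro!: bexI[of _ "pnt1 be b"])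
qed

text \<open>Lifting the identity through \<open>al\<close> yields a pseudonatural right inverse
  \<open>be\<close>. The components of \<open>be\<close> are again equivalences, so
  \<open>be\<close> has a right inverse as well, and \<open>equivalence1I_two_sided\<close>
  applies.\<close>

lemma equivalence1_PS:
 assumes al: "pseudonatural B M al" and eq: "!!b. b \<in> Ob B ==> \<exists>X Y. equivalence1 M (pnt1 al b) X Y"
 shows "equivalence1 (PS B M) al (pdom al) (pcod al)"
proof -
 interpret B: two_category B using al by (rule pseudonatural_two_category)
 interpret M: two_category M using al by (rule pseudonatural_two_category)
 interpret PS: two_category "PS B M" by (simp add: B.two_category_axioms M.two_category_axioms)
 have inverse: "\<exists>be. pseudonatural B M be & pdom be = pcod al & pcod be = pdom al &
   isomorphic1 (PS B M) (pnt_comp B M al be) (pnt_id B M (pcod al)) & (\<forall>b\<in>Ob B. \<exists>X Y. equivalence1 M (pnt1 be b) X Y)"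
  if al: "pseudonatural B M al" and eq: "!!b. b \<in> Ob B ==> \<exists>X Y. equivalence1 M (pnt1 al b) X Y" for al
 proof -
  interpret al: pseudonatural B M al by fact
  have "\<exists>u. u \<in> Mor M & src M u = psf0 (pcod al) b & trg M u = psf0 (pdom al) b &
    isomorphic1 M (pnt1 al b o{M} u) (id1 M (psf0 (pcod al) b))" if "b \<in> Ob B" for b
   using eq[OF that] that unfolding equivalence1_def by auto
  then obtain u where u: "!!b. b \<in> Ob B ==> u b \<in> Mor M" "!!b. b \<in> Ob B ==> src M (u b) = psf0 (pcod al) b" "!!b. b \<in> Ob B ==> trg M (u b) = psf0 (pdom al) b"
   "!!b. b \<in> Ob B ==> isomorphic1 M (pnt1 al b o{M} u b) (id1 M (psf0 (pcod al) b))"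
   by metis
  then obtain e where e: "!!b. b \<in> Ob B ==> iso2 M (e b)" "!!b. b \<in> Ob B ==> dom2 M (e b) = pnt1 al b o{M} u b" "!!b. b \<in> Ob B ==> cod2 M (e b) = id1 M (psf0 (pcod al) b)"
   unfolding isomorphic1_def by metis
  note ue = u(1-3) e
  have ff: "fully_faithful1 M (pnt1 al b)" if "b \<in> Ob B" for b
   using eq[OF that] M.equivalence1_fully_faithful by blast
  have "\<exists>be. pseudonatural B M be & pdom be = pdom (pnt_id B M (pcod al)) & pcod be = pdom al &
   isomorphic1 (PS B M) (pnt_comp B M al be) (pnt_id B M (pcod al))"
   by (rule lift_through_fully_faithful[where u = u and e = e])
    (use ue ff in \<open>auto simp: al al.pseudofunctor_pcod\<close>)
  then obtain be where be: "pseudonatural B M be" "pdom be = pcod al" "pcod be = pdom al"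
   "isomorphic1 (PS B M) (pnt_comp B M al be) (pnt_id B M (pcod al))" by auto
  interpret b: pseudonatural B M be by fact
  have G: "isomorphic1 M (pnt1 al b o{M} pnt1 be b) (id1 M (psf0 (pcod al) b))" if "b \<in> Ob B" for b
   using isomorphic1_PS_components[OF be(4) that] that by simp
  have "\<exists>X Y. equivalence1 M (pnt1 be b) X Y" if b: "b \<in> Ob B" for b
  proof -
   \<comment> \<open>At \<open>b\<close>, \<open>be\<close> is a right inverse and \<open>g\<close>
     a left inverse of the component of \<open>al\<close>; so the two are isomorphic, and
     \<open>be\<close> is a left inverse too.\<close>
   obtain g where g: "g \<in> Mor M" "src M g = psf0 (pcod al) b" "trg M g = psf0 (pdom al) b"
    "isomorphic1 M (g o{M} pnt1 al b) (id1 M (psf0 (pdom al) b))"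
    using eq[OF b] b unfolding equivalence1_def by auto
   have "isomorphic1 M (g o{M} (pnt1 al b o{M} pnt1 be b)) (g o{M} id1 M (psf0 (pcod al) b))"
    using M.isomorphic1_comp1[OF G[OF b] M.isomorphic1_refl[OF g(1)]] b g be(1-3) by simp
   moreover have "isomorphic1 M ((g o{M} pnt1 al b) o{M} pnt1 be b) (id1 M (psf0 (pdom al) b) o{M} pnt1 be b)"
    using M.isomorphic1_comp1[OF M.isomorphic1_refl g(4), of "pnt1 be b"] b g be by simp
   ultimately have "isomorphic1 M (g o{M} pnt1 al b o{M} pnt1 be b) g" "isomorphic1 M (g o{M} pnt1 al b o{M} pnt1 be b) (pnt1 be b)"
    using g b be by (simp_all add: M.comp1_assoc')
   then have "isomorphic1 M g (pnt1 be b)" using M.isomorphic1_sym M.isomorphic1_trans by blast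
   then have "isomorphic1 M (pnt1 be b o{M} pnt1 al b) (g o{M} pnt1 al b)"
    using M.isomorphic1_comp1[OF M.isomorphic1_refl M.isomorphic1_sym, of "pnt1 al b" g "pnt1 be b"] b g be by simp
   then have "isomorphic1 M (pnt1 be b o{M} pnt1 al b) (id1 M (psf0 (pdom al) b))"
    using M.isomorphic1_trans g by blast
   then show ?thesis unfolding equivalence1_def using b G[OF b] be
    by (auto intro!: exI bexI[of _ "pnt1 al b"])
  qed
  then show ?thesis using be by blast
 qed
 obtain be where be: "pseudonatural B M be" "pdom be = pcod al" "pcod be = pdom al"
   "isomorphic1 (PS B M) (pnt_comp B M al be) (pnt_id B M (pcod al))" "!!b. b \<in> Ob B ==> \<exists>X Y. equivalence1 M (pnt1 be b) X Y"
  using inverse[OF al eq] by blast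
 obtain ga where "pseudonatural B M ga" "pdom ga = pcod be" "pcod ga = pdom be"
   "isomorphic1 (PS B M) (pnt_comp B M be ga) (pnt_id B M (pcod be))"
  using inverse[OF be(1) be(5)] by blast
 then show ?thesis using PS.equivalence1I_two_sided[of al be ga] be al by simp
qed

section \<open>Transporting a pseudofunctor along universal 1-cells\<close>

text \<open>\<open>ph b\<close> is a biuniversal 1-cell from the strict 2-functor F to
  \<open>G b\<close>: composing with it identifies the 1-cells X \<rightarrow> \<open>l b\<close> of
  H, with their 2-cells, with the 1-cells F X \<rightarrow> \<open>G b\<close>, up to isomorphism.
  This is the bicategorical setting in which objectwise universal arrows assemble into a functor;
  below, F is a Yoneda embedding.\<close>

locale transport = strict_functor H M F0 F1 F2 + G: pseudofunctor B M G
 for H :: "('p, 'n, 'd) twocat" and M :: "('q, 'k, 'e) twocat" and F0 F1 F2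
  and B :: "('o, 'm, 'c) twocat" and G +
 fixes l :: "'o => 'p" and ph :: "'o => 'k"
 assumes l_Ob [simp]: "b \<in> Ob B ==> l b \<in> Ob H"
  and phi [simp]: "b \<in> Ob B ==> ph b \<in> Mor M" "b \<in> Ob B ==> src M (ph b) = F0 (l b)"
   "b \<in> Ob B ==> trg M (ph b) = psf0 G b"
  and ff_ex: "[|b \<in> Ob B; u \<in> Mor H; v \<in> Mor H; src H u = src H v; trg H u = l b; trg H v = l b; \<tau> \<in> Cell M;
    dom2 M \<tau> = ph b o{M} F1 u; cod2 M \<tau> = ph b o{M} F1 v|] ==>
    \<exists>th. th \<in> Cell H & dom2 H th = u & cod2 H th = v & id2 M (ph b) *{M} F2 th = \<tau>"
  and ff_unique: "[|b \<in> Ob B; th \<in> Cell H; th' \<in> Cell H; dom2 H th = dom2 H th'; cod2 H th = cod2 H th';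
    trg H (dom2 H th) = l b; id2 M (ph b) *{M} F2 th = id2 M (ph b) *{M} F2 th'|] ==> th = th'"
  and eso: "[|b \<in> Ob B; X \<in> Ob H; k \<in> Mor M; src M k = F0 X; trg M k = psf0 G b|] ==>
    \<exists>u. u \<in> Mor H & src H u = X & trg H u = l b & isomorphic1 M k (ph b o{M} F1 u)"
begin

lemma ff_iso2:
 assumes b [simp]: "b \<in> Ob B" and th [simp]: "th \<in> Cell H" "trg H (dom2 H th) = l b"
  and i [simp]: "iso2 M (id2 M (ph b) *{M} F2 th)"
 shows "iso2 H th"
proof -
 let ?i = "inv2 M (id2 M (ph b) *{M} F2 th)"
 obtain th' where t [simp]: "th' \<in> Cell H" "dom2 H th' = cod2 H th" "cod2 H th' = dom2 H th" "id2 M (ph b) *{M} F2 th' = ?i"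
  using ff_ex[OF b, of "cod2 H th" "dom2 H th" ?i] by auto
 have "th' #{H} th = id2 H (dom2 H th)"
  by (rule ff_unique[OF b]) (auto simp: H.whisker_vcomp_left)
 moreover have "th #{H} th' = id2 H (cod2 H th)"
  by (rule ff_unique[OF b]) (auto simp: H.whisker_vcomp_left)
 ultimately show ?thesis by (intro A.iso2I[of th']) auto
qed

lemma exists_transport:
 "\<exists>L Ph. pseudofunctor B H L & (\<forall>b\<in>Ob B. psf0 L b = l b) & pseudonatural B M Ph &
   pdom Ph = psf_comp B M K L & pcod Ph = G & (\<forall>b\<in>Ob B. pnt1 Ph b = ph b)"
proof -
 \<comment> \<open>\<open>L1 g\<close> is the 1-cell classified by \<open>G g \<odot> ph\<close>,
   and \<open>P g\<close> below is the invertible square that witnesses this.\<close>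
 have "\<exists>u. u \<in> Mor H & src H u = l (src B g) & trg H u = l (trg B g) & isomorphic1 M (psf1 G g o{M} ph (src B g)) (ph (trg B g) o{M} F1 u)"
  if "g \<in> Mor B" for g
  using that by (intro eso) simp_all
 then obtain L1 where L1 [simp]: "!!g. g \<in> Mor B ==> L1 g \<in> Mor H" "!!g. g \<in> Mor B ==> src H (L1 g) = l (src B g)" "!!g. g \<in> Mor B ==> trg H (L1 g) = l (trg B g)"
  and ex: "!!g. g \<in> Mor B ==> isomorphic1 M (psf1 G g o{M} ph (src B g)) (ph (trg B g) o{M} F1 (L1 g))" by metis
 from ex obtain P where P [simp]: "!!g. g \<in> Mor B ==> iso2 M (P g)" "!!g. g \<in> Mor B ==> dom2 M (P g) = psf1 G g o{M} ph (src B g)"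
  "!!g. g \<in> Mor B ==> cod2 M (P g) = ph (trg B g) o{M} F1 (L1 g)"
  unfolding isomorphic1_def by metis
 have PC [simp]: "g \<in> Mor B ==> P g \<in> Cell M" for g using H.iso2_Cell by simp
 \<comment> \<open>\<open>L2\<close>, and then \<open>Lc\<close> and \<open>Lu\<close>, are forced:
   each is the unique solution of the pseudonaturality law that \<open>P\<close> has to satisfy with
   respect to it, namely \<open>L2P\<close>, \<open>LcP\<close> and \<open>LuP\<close>.\<close>
 have "\<exists>th. th \<in> Cell H & dom2 H th = L1 (dom2 B x) & cod2 H th = L1 (cod2 B x) & id2 M (ph (trg B (dom2 B x))) *{M} F2 th =
   P (cod2 B x) #{M} (psf2 G x *{M} id2 M (ph (src B (dom2 B x)))) #{M} inv2 M (P (dom2 B x))" if [simp]: "x \<in> Cell B" for x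
  by (rule ff_ex) simp_all
 then obtain L2 where L2 [simp]: "!!x. x \<in> Cell B ==> L2 x \<in> Cell H" "!!x. x \<in> Cell B ==> dom2 H (L2 x) = L1 (dom2 B x)"
  "!!x. x \<in> Cell B ==> cod2 H (L2 x) = L1 (cod2 B x)"
  and L2_eq: "!!x. x \<in> Cell B ==> id2 M (ph (trg B (dom2 B x))) *{M} F2 (L2 x) =
   P (cod2 B x) #{M} (psf2 G x *{M} id2 M (ph (src B (dom2 B x)))) #{M} inv2 M (P (dom2 B x))"
  by metis
 have L2P: "(id2 M (ph (trg B (dom2 B x))) *{M} F2 (L2 x)) #{M} P (dom2 B x) = P (cod2 B x) #{M} (psf2 G x *{M} id2 M (ph (src B (dom2 B x))))"
  if "x \<in> Cell B" for x using that by (simp add: L2_eq H.vcomp_assoc)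
 have "\<exists>th. th \<in> Cell H & dom2 H th = L1 h o{H} L1 g & cod2 H th = L1 (h o{B} g) & id2 M (ph (trg B h)) *{M} F2 th =
   P (h o{B} g) #{M} (psfc G h g *{M} id2 M (ph (src B g))) #{M} inv2 M ((P h *{M} id2 M (F1 (L1 g))) #{M} (id2 M (psf1 G h) *{M} P g))"
  if "composable B h g" for h g
 proof -
  have [simp]: "g \<in> Mor B" "h \<in> Mor B" "src B h = trg B g" using that by (auto simp: composable_def)
  show ?thesis by (rule ff_ex) (simp_all add: H.comp1_assoc')
 qed
 then obtain Lc where Lc: "!!h g. composable B h g ==> Lc h g \<in> Cell H" "!!h g. composable B h g ==> dom2 H (Lc h g) = L1 h o{H} L1 g"
  "!!h g. composable B h g ==> cod2 H (Lc h g) = L1 (h o{B} g)"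
  and Lc_eq: "!!h g. composable B h g ==> id2 M (ph (trg B h)) *{M} F2 (Lc h g) =
   P (h o{B} g) #{M} (psfc G h g *{M} id2 M (ph (src B g))) #{M} inv2 M ((P h *{M} id2 M (F1 (L1 g))) #{M} (id2 M (psf1 G h) *{M} P g))"
  by metis
 note [simp] = Lc
 have LcP: "(id2 M (ph (trg B h)) *{M} F2 (Lc h g)) #{M} (P h *{M} id2 M (F1 (L1 g))) #{M} (id2 M (psf1 G h) *{M} P g) =
   P (h o{B} g) #{M} (psfc G h g *{M} id2 M (ph (src B g)))"
  if "composable B h g" for h g
 proof -
  have [simp]: "g \<in> Mor B" "h \<in> Mor B" "src B h = trg B g" using that by (auto simp: composable_def)
  let ?p = "(P h *{M} id2 M (F1 (L1 g))) #{M} (id2 M (psf1 G h) *{M} P g)"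
  have "inv2 M ?p #{M} ?p = id2 M (dom2 M ?p)" by (rule H.inv2_typing) (simp add: H.comp1_assoc')
  moreover have "dom2 M ?p = psf1 G h o{M} psf1 G g o{M} ph (src B g)" by (simp add: H.comp1_assoc')
  moreover have "iso2 M ?p" by (simp add: H.comp1_assoc')
  ultimately show ?thesis
   unfolding Lc_eq[OF that] by (subst H.vcomp_assoc, simp_all add: H.comp1_assoc' H.vcomp_assoc)
 qed
 have "\<exists>th. th \<in> Cell H & dom2 H th = id1 H (l a) & cod2 H th = L1 (id1 B a) & id2 M (ph a) *{M} F2 th =
   P (id1 B a) #{M} (psfu G a *{M} id2 M (ph a))" if [simp]: "a \<in> Ob B" for a
  by (rule ff_ex) simp_all
 then obtain Lu where Lu [simp]: "!!a. a \<in> Ob B ==> Lu a \<in> Cell H" "!!a. a \<in> Ob B ==> dom2 H (Lu a) = id1 H (l a)"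
  "!!a. a \<in> Ob B ==> cod2 H (Lu a) = L1 (id1 B a)"
  and LuP: "!!a. a \<in> Ob B ==> id2 M (ph a) *{M} F2 (Lu a) = P (id1 B a) #{M} (psfu G a *{M} id2 M (ph a))"
  by metis
 \<comment> \<open>The test behind the coherence laws of L: parallel 2-cells into \<open>l b\<close>
   agree once they agree after F, \<open>ph b\<close> and an invertible cell \<open>p\<close>, which
   is always a pasting of squares \<open>P\<close> over the common domain.\<close>
 have unique: "th = th'" if "b \<in> Ob B" "th \<in> Cell H" "th' \<in> Cell H" "dom2 H th = dom2 H th'" "cod2 H th = cod2 H th'"
    "trg H (dom2 H th) = l b" "iso2 M p" "cod2 M p = ph b o{M} F1 (dom2 H th)"
    "(id2 M (ph b) *{M} F2 th) #{M} p = (id2 M (ph b) *{M} F2 th') #{M} p" for b th th' p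
 proof (rule ff_unique)
  have "p \<in> Cell M" using that H.iso2_Cell by blast
  then show "id2 M (ph b) *{M} F2 th = id2 M (ph b) *{M} F2 th'"
   using that by (intro H.iso2_cancel_right[OF that(7) that(9)]) simp_all
 qed (use that in simp_all)
 define L where "L = \<lparr>psf0 = restrict l (Ob B), psf1 = restrict L1 (Mor B), psf2 = restrict L2 (Cell B),
  psfc = (%h g. if composable B h g then Lc h g else undefined), psfu = restrict Lu (Ob B)\<rparr>"
 have L [simp]: "!!a. a \<in> Ob B ==> psf0 L a = l a" "!!f. f \<in> Mor B ==> psf1 L f = L1 f" "!!x. x \<in> Cell B ==> psf2 L x = L2 x"
  "!!h g. composable B h g ==> psfc L h g = Lc h g" "!!a. a \<in> Ob B ==> psfu L a = Lu a"
  by (simp_all add: L_def)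
 have pL: "pseudofunctor B H L"
 proof (rule pseudofunctor.intro, goal_cases)
  case (15 f)
  then show ?case using L2P[of "id2 B f"]
   by (simp, intro unique[of "trg B f" _ _ "P f"]) simp_all
 next
  case (16 x y)
  then have [simp]: "x \<in> Cell B" "y \<in> Cell B" "dom2 B y = cod2 B x" by auto
  have 1: "(id2 M (ph (trg B (dom2 B x))) *{M} F2 (L2 y)) #{M} P (cod2 B x) = P (cod2 B y) #{M} (psf2 G y *{M} id2 M (ph (src B (dom2 B x))))"
   using L2P[of y] by simp
  show ?case using L2P[of "y #{B} x"] L2P[of x]
   by (simp, intro unique[of "trg B (dom2 B x)" _ _ "P (dom2 B x)"]) (simp_all add: H.pasting H.vcomp_pre[OF 1])
 next
  case (17 h g)
  then have [simp]: "g \<in> Mor B" "h \<in> Mor B" "src B h = trg B g" by (auto simp: composable_def)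
  have "iso2 M (id2 M (ph (trg B h)) *{M} F2 (Lc h g))"
   using 17 by (subst Lc_eq) (simp_all add: H.comp1_assoc')
  then show ?case using 17 by (simp, intro ff_iso2[of "trg B h"]) simp_all
 next
  case (20 a)
  have "iso2 M (id2 M (ph a) *{M} F2 (Lu a))" using 20 by (subst LuP) simp_all
  then show ?case using 20 by (simp, intro ff_iso2[of a]) simp_all
 next
  case (23 x y)
  then have [simp]: "x \<in> Cell B" "y \<in> Cell B" "src B (dom2 B y) = trg B (dom2 B x)" by auto
  let ?g = "dom2 B x" and ?g' = "cod2 B x" and ?h = "dom2 B y" and ?h' = "cod2 B y"
   and ?a = "src B (dom2 B x)" and ?b = "trg B (dom2 B x)" and ?c = "trg B (dom2 B y)"
  let ?p = "(P ?h *{M} id2 M (F1 (L1 ?g))) #{M} (id2 M (psf1 G ?h) *{M} P ?g)"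
  have l1: "(id2 M (ph ?c) *{M} F2 (Lc ?h ?g)) #{M} (P ?h *{M} id2 M (F1 (L1 ?g))) #{M} (id2 M (psf1 G ?h) *{M} P ?g) =
   P (?h o{B} ?g) #{M} (psfc G ?h ?g *{M} id2 M (ph ?a))" using LcP[of ?h ?g] by simp
  have l1': "(id2 M (ph ?c) *{M} F2 (Lc ?h' ?g')) #{M} ((P ?h' *{M} id2 M (F1 (L1 ?g'))) #{M} (id2 M (psf1 G ?h') *{M} P ?g')) =
   P (?h' o{B} ?g') #{M} (psfc G ?h' ?g' *{M} id2 M (ph ?a))" using LcP[of ?h' ?g'] by simp
  have l2: "(id2 M (ph ?c) *{M} F2 (L2 (y *{B} x))) #{M} P (?h o{B} ?g) = P (?h' o{B} ?g') #{M} (psf2 G (y *{B} x) *{M} id2 M (ph ?a))"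
   using L2P[of "y *{B} x"] by simp
  have n: "(psf2 G (y *{B} x) *{M} id2 M (ph ?a)) #{M} (psfc G ?h ?g *{M} id2 M (ph ?a)) =
   (psfc G ?h' ?g' *{M} id2 M (ph ?a)) #{M} (psf2 G y *{M} id2 M (psf1 G ?g' o{M} ph ?a)) #{M} (id2 M (psf1 G ?h) *{M} (psf2 G x *{M} id2 M (ph ?a)))"
   using arg_cong[OF G.psfc_natural[of x y], of "%z. z *{M} id2 M (ph ?a)"] H.exchange(2)[of "psf2 G y" "psf2 G x"]
   by (simp add: H.whisker_vcomp_right H.hcomp_assoc' H.comp1_assoc')
  have e: "F2 (L2 y) *{M} F2 (L2 x) = (F2 (L2 y) *{M} id2 M (F1 (L1 ?g'))) #{M} (id2 M (F1 (L1 ?h)) *{M} F2 (L2 x))"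
   using H.exchange(2)[of "F2 (L2 y)" "F2 (L2 x)"] by simp
  have x1: "(id2 M (ph ?c o{M} F1 (L1 ?h)) *{M} F2 (L2 x)) #{M} (P ?h *{M} id2 M (F1 (L1 ?g))) =
    (P ?h *{M} id2 M (F1 (L1 ?g'))) #{M} (id2 M (psf1 G ?h o{M} ph ?b) *{M} F2 (L2 x))"
   using H.exchange(1)[of "P ?h" "F2 (L2 x)"] by simp
  have x2: "(id2 M (ph ?c) *{M} (F2 (L2 y) *{M} id2 M (F1 (L1 ?g')))) #{M} (P ?h *{M} id2 M (F1 (L1 ?g'))) =
    (P ?h' *{M} id2 M (F1 (L1 ?g'))) #{M} (psf2 G y *{M} id2 M (ph ?b o{M} F1 (L1 ?g')))"
   using arg_cong[OF L2P[of y], of "%z. z *{M} id2 M (F1 (L1 ?g'))"] by (simp add: H.pasting)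
  have x3: "(id2 M (psf1 G ?h o{M} ph ?b) *{M} F2 (L2 x)) #{M} (id2 M (psf1 G ?h) *{M} P ?g) =
   (id2 M (psf1 G ?h) *{M} P ?g') #{M} (id2 M (psf1 G ?h) *{M} (psf2 G x *{M} id2 M (ph ?a)))"
   using arg_cong[OF L2P[of x], of "%z. id2 M (psf1 G ?h) *{M} z"] by (simp add: H.pasting)
  have x4: "(psf2 G y *{M} id2 M (ph ?b o{M} F1 (L1 ?g'))) #{M} (id2 M (psf1 G ?h) *{M} P ?g') =
    (id2 M (psf1 G ?h') *{M} P ?g') #{M} (psf2 G y *{M} id2 M (psf1 G ?g' o{M} ph ?a))"
   using H.exchange(1)[of "psf2 G y" "P ?g'"] by simp
  have "(id2 M (ph ?c) *{M} F2 (L2 (y *{B} x) #{H} Lc ?h ?g)) #{M} ?p = (id2 M (ph ?c) *{M} F2 (L2 (y *{B} x))) #{M}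
   ((id2 M (ph ?c) *{M} F2 (Lc ?h ?g)) #{M} (P ?h *{M} id2 M (F1 (L1 ?g))) #{M} (id2 M (psf1 G ?h) *{M} P ?g))"
   by (simp add: H.pasting)
  also have "... = (P (?h' o{B} ?g') #{M} (psfc G ?h' ?g' *{M} id2 M (ph ?a))) #{M} (psf2 G y *{M} id2 M (psf1 G ?g' o{M} ph ?a)) #{M} (id2 M (psf1 G ?h) *{M} (psf2 G x *{M} id2 M (ph ?a)))"
   unfolding l1 by (simp add: H.vcomp_assoc H.comp1_assoc' H.vcomp_pre[OF l2] n)
  also have "... = (id2 M (ph ?c) *{M} F2 (Lc ?h' ?g' #{H} (L2 y *{H} L2 x))) #{M} ?p"
   unfolding l1'[symmetric]
   by (simp add: e) (simp add: H.pasting H.vcomp_pre[OF x1] H.vcomp_pre[OF x2] x3 H.vcomp_pre[OF x4])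
  finally show ?case
   by (simp, intro unique[of ?c _ _ ?p]) (simp_all add: H.comp1_assoc')
 next
  case (24 g h k)
  then have [simp]: "g \<in> Mor B" "h \<in> Mor B" "k \<in> Mor B" "src B g = trg B h" "src B k = trg B g"
   by (auto simp: composable_def)
  note [simp] = G.A.comp1_assoc' A.comp1_assoc' H.comp1_assoc'
  \<comment> \<open>Three squares \<open>P\<close> stacked over the composite. Each use of
    \<open>LcP\<close> merges two of them, and the two ways of merging all three differ by
    associativity of \<open>psfc G\<close>.\<close>
  let ?p = "(P k *{M} id2 M (F1 (L1 g) o{M} F1 (L1 h))) #{M} (id2 M (psf1 G k) *{M} (P g *{M} id2 M (F1 (L1 h)))) #{M} (id2 M (psf1 G k o{M} psf1 G g) *{M} P h)"
  let ?a = "src B h" and ?d = "trg B k"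
  have l1: "(id2 M (ph ?d) *{M} (F2 (Lc k g) *{M} id2 M (F1 (L1 h)))) #{M} ((P k *{M} id2 M (F1 (L1 g) o{M} F1 (L1 h))) #{M} (id2 M (psf1 G k) *{M} (P g *{M} id2 M (F1 (L1 h)))))
   = (P (k o{B} g) *{M} id2 M (F1 (L1 h))) #{M} (psfc G k g *{M} id2 M (ph (trg B h) o{M} F1 (L1 h)))"
   using arg_cong[OF LcP[of k g], of "%z. z *{M} id2 M (F1 (L1 h))"] by (simp add: H.pasting)
  have x1: "(psfc G k g *{M} id2 M (ph (trg B h) o{M} F1 (L1 h))) #{M} (id2 M (psf1 G k o{M} psf1 G g) *{M} P h)
   = (id2 M (psf1 G (k o{B} g)) *{M} P h) #{M} (psfc G k g *{M} id2 M (psf1 G h o{M} ph ?a))"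
   using H.exchange(1)[of "psfc G k g" "P h"] by simp
  have l2: "(id2 M (ph ?d) *{M} F2 (Lc (k o{B} g) h)) #{M} ((P (k o{B} g) *{M} id2 M (F1 (L1 h))) #{M} (id2 M (psf1 G (k o{B} g)) *{M} P h)) =
   P (k o{B} g o{B} h) #{M} (psfc G (k o{B} g) h *{M} id2 M (ph ?a))"
   using LcP[of "k o{B} g" h] by simp
  have as: "(psfc G (k o{B} g) h *{M} id2 M (ph ?a)) #{M} (psfc G k g *{M} id2 M (psf1 G h o{M} ph ?a)) =
   (psfc G k (g o{B} h) *{M} id2 M (ph ?a)) #{M} (id2 M (psf1 G k) *{M} (psfc G g h *{M} id2 M (ph ?a)))"
   using arg_cong[OF G.psfc_assoc[of g h k], of "%z. z *{M} id2 M (ph ?a)"] by (simp add: H.pasting)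
  have x2: "(id2 M (ph ?d o{M} F1 (L1 k)) *{M} F2 (Lc g h)) #{M} (P k *{M} id2 M (F1 (L1 g) o{M} F1 (L1 h))) =
    (P k *{M} id2 M (F1 (L1 (g o{B} h)))) #{M} (id2 M (psf1 G k o{M} ph (trg B g)) *{M} F2 (Lc g h))"
   using H.exchange(1)[of "P k" "F2 (Lc g h)"] by simp
  have l3: "(id2 M (psf1 G k o{M} ph (trg B g)) *{M} F2 (Lc g h)) #{M} (id2 M (psf1 G k) *{M} (P g *{M} id2 M (F1 (L1 h)))) #{M} (id2 M (psf1 G k o{M} psf1 G g) *{M} P h)
   = (id2 M (psf1 G k) *{M} P (g o{B} h)) #{M} (id2 M (psf1 G k) *{M} (psfc G g h *{M} id2 M (ph ?a)))"
   using arg_cong[OF LcP[of g h], of "%z. id2 M (psf1 G k) *{M} z"] by (simp add: H.pasting)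
  have l4: "(id2 M (ph ?d) *{M} F2 (Lc k (g o{B} h))) #{M} ((P k *{M} id2 M (F1 (L1 (g o{B} h)))) #{M} (id2 M (psf1 G k) *{M} P (g o{B} h))) =
   P (k o{B} g o{B} h) #{M} (psfc G k (g o{B} h) *{M} id2 M (ph ?a))"
   using LcP[of k "g o{B} h"] by simp
  have "(id2 M (ph ?d) *{M} F2 (Lc (k o{B} g) h #{H} (Lc k g *{H} id2 H (L1 h)))) #{M} ?p
   = (id2 M (ph ?d) *{M} F2 (Lc (k o{B} g) h)) #{M} ((id2 M (ph ?d) *{M} (F2 (Lc k g) *{M} id2 M (F1 (L1 h)))) #{M} ((P k *{M} id2 M (F1 (L1 g) o{M} F1 (L1 h))) #{M} (id2 M (psf1 G k) *{M} (P g *{M} id2 M (F1 (L1 h))))))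
    #{M} (id2 M (psf1 G k o{M} psf1 G g) *{M} P h)"
   by (simp add: H.pasting)
  also have "... = ((id2 M (ph ?d) *{M} F2 (Lc (k o{B} g) h)) #{M} ((P (k o{B} g) *{M} id2 M (F1 (L1 h))) #{M} (id2 M (psf1 G (k o{B} g)) *{M} P h)))
    #{M} (psfc G k g *{M} id2 M (psf1 G h o{M} ph ?a))"
   unfolding l1 by (simp add: H.pasting x1)
  also have "... = (P (k o{B} g o{B} h) #{M} (psfc G k (g o{B} h) *{M} id2 M (ph ?a))) #{M} (id2 M (psf1 G k) *{M} (psfc G g h *{M} id2 M (ph ?a)))"
   unfolding l2 by (simp add: H.vcomp_assoc as)
  also have "... = (id2 M (ph ?d) *{M} F2 (Lc k (g o{B} h) #{H} (id2 H (L1 k) *{H} Lc g h))) #{M} ?p"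
   unfolding l4[symmetric] by (simp add: H.pasting H.vcomp_pre[OF x2] l3)
  finally show ?case
   by (simp, intro unique[of ?d _ _ ?p]) simp_all
 next
  case (25 g)
  then have [simp]: "g \<in> Mor B" by simp
  let ?a = "src B g" and ?b = "trg B g"
  have x1: "(id2 M (ph ?b o{M} F1 (L1 g)) *{M} F2 (Lu ?a)) #{M} P g = (P g *{M} id2 M (F1 (L1 (id1 B ?a)))) #{M} (id2 M (psf1 G g o{M} ph ?a) *{M} F2 (Lu ?a))"
   using H.exchange(1)[of "P g" "F2 (Lu ?a)"] by simp
  have x2: "id2 M (psf1 G g o{M} ph ?a) *{M} F2 (Lu ?a) = (id2 M (psf1 G g) *{M} P (id1 B ?a)) #{M} (id2 M (psf1 G g) *{M} (psfu G ?a *{M} id2 M (ph ?a)))"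
   using arg_cong[OF LuP[of ?a], of "%z. id2 M (psf1 G g) *{M} z"] by (simp add: H.pasting)
  have l1: "(id2 M (ph ?b) *{M} F2 (Lc g (id1 B ?a))) #{M} ((P g *{M} id2 M (F1 (L1 (id1 B ?a)))) #{M} (id2 M (psf1 G g) *{M} P (id1 B ?a))) =
    P g #{M} (psfc G g (id1 B ?a) *{M} id2 M (ph ?a))"
   using LcP[of g "id1 B ?a"] by simp
  have n: "(psfc G g (id1 B ?a) *{M} id2 M (ph ?a)) #{M} (id2 M (psf1 G g) *{M} (psfu G ?a *{M} id2 M (ph ?a))) = id2 M (psf1 G g o{M} ph ?a)"
   using arg_cong[OF G.psfc_unit_right[of g], of "%z. z *{M} id2 M (ph ?a)"] by (simp add: H.pasting)
  have "(id2 M (ph ?b) *{M} F2 (Lc g (id1 B ?a) #{H} (id2 H (L1 g) *{H} Lu ?a))) #{M} P g =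
    ((id2 M (ph ?b) *{M} F2 (Lc g (id1 B ?a))) #{M} ((P g *{M} id2 M (F1 (L1 (id1 B ?a)))) #{M} (id2 M (psf1 G g) *{M} P (id1 B ?a))))
    #{M} (id2 M (psf1 G g) *{M} (psfu G ?a *{M} id2 M (ph ?a)))"
   by (simp add: H.pasting x1 x2)
  also have "... = P g" unfolding l1 by (simp add: H.vcomp_assoc H.comp1_assoc' n)
  finally show ?case
   by (simp, intro unique[of ?b _ _ "P g"]) simp_all
 next
  case (26 g)
  then have [simp]: "g \<in> Mor B" by simp
  let ?a = "src B g" and ?b = "trg B g"
  have x1: "(id2 M (ph ?b) *{M} (F2 (Lu ?b) *{M} id2 M (F1 (L1 g)))) = (P (id1 B ?b) *{M} id2 M (F1 (L1 g))) #{M} (psfu G ?b *{M} id2 M (ph ?b o{M} F1 (L1 g)))"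
   using arg_cong[OF LuP[of ?b], of "%z. z *{M} id2 M (F1 (L1 g))"] by (simp add: H.pasting)
  have x2: "(psfu G ?b *{M} id2 M (ph ?b o{M} F1 (L1 g))) #{M} P g = (id2 M (psf1 G (id1 B ?b)) *{M} P g) #{M} (psfu G ?b *{M} id2 M (psf1 G g o{M} ph ?a))"
   using H.exchange(1)[of "psfu G ?b" "P g"] by simp
  have l1: "(id2 M (ph ?b) *{M} F2 (Lc (id1 B ?b) g)) #{M} ((P (id1 B ?b) *{M} id2 M (F1 (L1 g))) #{M} (id2 M (psf1 G (id1 B ?b)) *{M} P g)) =
    P g #{M} (psfc G (id1 B ?b) g *{M} id2 M (ph ?a))"
   using LcP[of "id1 B ?b" g] by simp
  have n: "(psfc G (id1 B ?b) g *{M} id2 M (ph ?a)) #{M} (psfu G ?b *{M} id2 M (psf1 G g o{M} ph ?a)) = id2 M (psf1 G g o{M} ph ?a)"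
   using arg_cong[OF G.psfc_unit_left[of g], of "%z. z *{M} id2 M (ph ?a)"] by (simp add: H.pasting)
  have "(id2 M (ph ?b) *{M} F2 (Lc (id1 B ?b) g #{H} (Lu ?b *{H} id2 H (L1 g)))) #{M} P g =
    ((id2 M (ph ?b) *{M} F2 (Lc (id1 B ?b) g)) #{M} ((P (id1 B ?b) *{M} id2 M (F1 (L1 g))) #{M} (id2 M (psf1 G (id1 B ?b)) *{M} P g)))
    #{M} (psfu G ?b *{M} id2 M (psf1 G g o{M} ph ?a))"
   by (simp add: H.pasting x1 x2)
  also have "... = P g" unfolding l1 by (simp add: H.vcomp_assoc H.comp1_assoc' n)
  finally show ?case
   by (simp, intro unique[of ?b _ _ "P g"]) simp_all
 qed (simp_all add: G.two_category_A A.two_category_axioms composable_def, auto simp: L_def composable_def)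
 define Ph where "Ph = \<lparr>pdom = psf_comp B M K L, pcod = G, pnt1 = restrict ph (Ob B), pnt2 = restrict P (Mor B)\<rparr>"
 have F [simp]: "pdom Ph = psf_comp B M K L" "pcod Ph = G" "!!a. a \<in> Ob B ==> pnt1 Ph a = ph a" "!!f. f \<in> Mor B ==> pnt2 Ph f = P f"
  by (simp_all add: Ph_def)
 have "pseudonatural B M Ph"
 proof (rule pseudonatural.intro, goal_cases)
  case (11 x)
  then show ?case using L2P[of x] by simp
 next
  case (12 g f)
  then show ?case using LcP[of g f] by (auto simp: composable_def pL)
 next
  case (13 a)
  then show ?case using LuP[of a] by (simp add: pL)
 qed (simp_all add: pL G.pseudofunctor_axioms, simp_all add: Ph_def)
 then show ?thesis using pL F L by blast
qed

end

section \<open>The Yoneda lemma for pseudonatural transformations\<close>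

lemma op2_op2 [simp]: "op2 (op2 H) = H"
 by (simp add: op2_def)

lemma pnt_post_in [simp]:
 "pdom (pnt_post D CAT in_left al) = psf_comp D CAT in_left (pdom al)"
 "pcod (pnt_post D CAT in_left al) = psf_comp D CAT in_left (pcod al)"
 "pdom (pnt_post D CAT in_right al') = psf_comp D CAT in_right (pdom al')"
 "pcod (pnt_post D CAT in_right al') = psf_comp D CAT in_right (pcod al')"
 by (simp_all add: pnt_post_def)

lemma pnt_post_in2 [simp]:
 "pseudonatural D CAT al ==> pseudonatural D CAT (pnt_post D CAT in_left al)"
 "pseudonatural D CAT al ==> a \<in> Ob D ==> pnt1 (pnt_post D CAT in_left al) a = relabel_fnct Inl Inl (pnt1 al a)"
 "pseudonatural D CAT al ==> f \<in> Mor D ==> pnt2 (pnt_post D CAT in_left al) f = relabel_ntr Inl Inl (pnt2 al f)"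
 "pseudonatural D CAT al' ==> pseudonatural D CAT (pnt_post D CAT in_right al')"
 "pseudonatural D CAT al' ==> a \<in> Ob D ==> pnt1 (pnt_post D CAT in_right al') a = relabel_fnct Inr Inr (pnt1 al' a)"
 "pseudonatural D CAT al' ==> f \<in> Mor D ==> pnt2 (pnt_post D CAT in_right al') f = relabel_ntr Inr Inr (pnt2 al' f)"
 unfolding in_left_def in_right_def relabel_def
 by (simp_all add: strict_functor.pnt_post_simps2[OF strict_functor_relabel] strict_functor.pseudonatural_pnt_post[OF strict_functor_relabel])

lemma mdf_post_in [simp]:
 "modification D CAT Ga ==> modification D CAT (mdf_post D CAT in_left Ga)"
 "mdom (mdf_post D CAT in_left Ga) = pnt_post D CAT in_left (mdom Ga)"
 "mcod (mdf_post D CAT in_left Ga) = pnt_post D CAT in_left (mcod Ga)"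
 "modification D CAT Ga ==> a \<in> Ob D ==> mdf2 (mdf_post D CAT in_left Ga) a = relabel_ntr Inl Inl (mdf2 Ga a)"
 "modification D CAT Ga' ==> modification D CAT (mdf_post D CAT in_right Ga')"
 "mdom (mdf_post D CAT in_right Ga') = pnt_post D CAT in_right (mdom Ga')"
 "mcod (mdf_post D CAT in_right Ga') = pnt_post D CAT in_right (mcod Ga')"
 "modification D CAT Ga' ==> a \<in> Ob D ==> mdf2 (mdf_post D CAT in_right Ga') a = relabel_ntr Inr Inr (mdf2 Ga' a)"
 unfolding in_left_def in_right_def relabel_def
 by (simp_all add: strict_functor.mdf_post_simps[OF strict_functor_relabel] strict_functor.modification_mdf_post[OF strict_functor_relabel])

text \<open>The Yoneda 2-functor followed by \<open>in_left\<close>, because the representables are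
  the left-hand sides of the given equivalences.\<close>

abbreviation repl where "repl K X \<equiv> psf_comp K CAT in_left (rep K X)"
abbreviation yonl where "yonl K u \<equiv> pnt_post K CAT in_left (yon_pnt K u)"
abbreviation yonl2 where "yonl2 K xi \<equiv> mdf_post K CAT in_left (yon_mdf K xi)"

lemma inj_Inl_Inr [simp]: "inj Inl" "inj Inr" by simp_all

context two_category
begin

text \<open>A modification is determined by its value \<open>th\<close> at the identity of the
  target of \<open>u\<close>: its axiom at a 1-cell \<open>h\<close>, evaluated there, forces its
  component at \<open>h\<close> to be \<open>h \<star> th\<close>.\<close>

lemma yoneda_full:
 assumes u [simp]: "u \<in> Mor H" and v [simp]: "v \<in> Mor H" "src H v = src H u" "trg H v = trg H u"
  and s: "modification H CAT si" and sd [simp]: "mdom si = yonl H u" "mcod si = yonl H v"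
 shows "\<exists>th. th \<in> Cell H & dom2 H th = u & cod2 H th = v & yonl2 H th = si"
proof -
 interpret si: modification H CAT si by fact
 let ?X = "trg H u"
 have n: "nat_trans (mdf2 si Z)" "ndom (mdf2 si Z) = relabel_fnct Inl Inl (yon_fnct H u Z)"
  "ncod (mdf2 si Z) = relabel_fnct Inl Inl (yon_fnct H v Z)" if "Z \<in> Ob H" for Z
  using si.mdf2_Cell[OF that] si.dom2_mdf2[OF that] si.cod2_mdf2[OF that] that by simp_all
 have c: "ncmp (mdf2 si ?X) (Inl (id1 H ?X)) \<in> Inl ` {th \<in> Cell H. dom2 H th = u & cod2 H th = v}"
  using ntr_ty(1-3)[OF n refl refl, of ?X "Inl (id1 H ?X)"] by auto
 then obtain th where th: "ncmp (mdf2 si ?X) (Inl (id1 H ?X)) = Inl th" and t [simp]: "th \<in> Cell H" "dom2 H th = u" "cod2 H th = v"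
  by auto
 have "yonl2 H th = si"
 proof (rule mdf_eqI[of H CAT], goal_cases)
  case (5 Z)
  then have Z [simp]: "Z \<in> Ob H" .
  note [simp] = n
  show ?case
  proof (rule ntr_eqI, goal_cases)
   case (5 x)
   then obtain h where x: "x = Inl h" and h [simp]: "h \<in> Mor H" "src H h = ?X" "trg H h = Z" by auto
   have "ncmp (mdf2 si Z) (Inl h) \<in> Inl ` Cell H"
    using ntr_ty(1)[OF n refl refl, of Z "Inl h"] by force
   then obtain w where w: "ncmp (mdf2 si Z) (Inl h) = Inl w" and [simp]: "w \<in> Cell H" by blast
   have [simp]: "dom2 H w = h \<odot> u" "cod2 H w = h \<odot> v"
    using ntr_ty(2,3)[OF n refl refl, of Z "Inl h"] w by simp_all
   have "id2 H h \<star> th = w"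
    using arg_cong[OF si.mdf2_natural[OF h(1)], of "%z. ncmp z (Inl (id1 H ?X))"]
    by (simp add: th w)
   then show ?case by (simp add: x w)
  qed simp_all
 qed (simp_all add: s)
 then show ?thesis using t by blast
qed

lemma yoneda_faithful:
 assumes "th \<in> Cell H" "th' \<in> Cell H" "dom2 H th = dom2 H th'" "cod2 H th = cod2 H th'" "yonl2 H th = yonl2 H th'"
 shows "th = th'"
proof -
 let ?X = "trg H (dom2 H th)"
 show ?thesis using arg_cong[OF assms(5), of "%z. ncmp (mdf2 z ?X) (Inl (id1 H ?X))"] assms(1-4) by simp
qed

lemma yon_rep_relabel:
 "f \<in> Mor H ==> g \<in> Mor H ==>
  fnct_comp (relabel_fnct Inl Inl (yon_fnct H f (trg H g))) (relabel_fnct Inl Inl (rep_fnct H (trg H f) g)) =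
  fnct_comp (relabel_fnct Inl Inl (rep_fnct H (src H f) g)) (relabel_fnct Inl Inl (yon_fnct H f (src H g)))"
 by (subst (1 2) relabel_fnct_comp[symmetric]) (simp_all add: yon_fnct_rep_fnct del: relabel_fnct_comp)

text \<open>\<open>u\<close> is the value of \<open>k\<close> at the identity of X. Since
  \<open>k\<close> is only pseudonatural, \<open>k h\<close> and \<open>h \<odot> u\<close> agree up
  to the structure cell of \<open>k\<close> at \<open>h\<close>, evaluated at the identity; these
  cells \<open>n h\<close> are the components of the required isomorphism.\<close>

lemma yoneda_eso:
 assumes k: "pseudonatural H CAT k" and kd [simp]: "pdom k = repl H X" "pcod k = repl H Y"
  and X [simp]: "X \<in> Ob H" and Y [simp]: "Y \<in> Ob H"
 shows "\<exists>u. u \<in> Mor H & src H u = Y & trg H u = X & isomorphic1 (PS H CAT) k (yonl H u)"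
proof -
 interpret k: pseudonatural H CAT k by fact
 have f: "fnctr (pnt1 k Z)" "fdom (pnt1 k Z) = relabel_cat Inl Inl (homcat H X Z)"
   "fcod (pnt1 k Z) = relabel_cat Inl Inl (homcat H Y Z)" if "Z \<in> Ob H" for Z
  using k.pnt1_Mor[OF that] k.src_pnt1[OF that] k.trg_pnt1[OF that] that by (simp_all add: homcat)
 have "fobj (pnt1 k X) (Inl (id1 H X)) \<in> Inl ` {u \<in> Mor H. src H u = Y & trg H u = X}"
  using fnctr_ty(1)[OF f, of X "Inl (id1 H X)"] by auto
 then obtain u where ku: "fobj (pnt1 k X) (Inl (id1 H X)) = Inl u" and u [simp]: "u \<in> Mor H" "src H u = Y" "trg H u = X"
  by auto
 have p: "nat_trans (pnt2 k h)" "ndom (pnt2 k h) = fnct_comp (relabel_fnct Inl Inl (rep_fnct H Y h)) (pnt1 k (src H h))"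
  "ncod (pnt2 k h) = fnct_comp (pnt1 k (trg H h)) (relabel_fnct Inl Inl (rep_fnct H X h))" if "h \<in> Mor H" for h
  using k.pnt2_Cell[OF that] k.dom2_pnt2[OF that] k.cod2_pnt2[OF that] that by simp_all
 define n where "n h = projl (ncmp (pnt2 k h) (Inl (id1 H X)))" for h
 have kf: "fobj (pnt1 k Z) (Inl h) \<in> Inl ` {h \<in> Mor H. src H h = Y & trg H h = Z}" if "h \<in> Mor H" "src H h = X" "trg H h = Z" "Z \<in> Ob H" for Z h
  using fnctr_ty(1)[OF f, of Z "Inl h"] that by auto
 have n: "ncmp (pnt2 k h) (Inl (id1 H X)) = Inl (n h)" "n h \<in> Cell H" "dom2 H (n h) = h \<odot> u"
  "Inl (cod2 H (n h)) = fobj (pnt1 k (trg H h)) (Inl h)" if [simp]: "h \<in> Mor H" "src H h = X" for h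
 proof -
  have "ncmp (pnt2 k h) (Inl (id1 H X)) \<in> Inl ` Cell H"
   using ntr_ty(1)[OF p refl refl, of h "Inl (id1 H X)"] by (simp add: f) blast
  then obtain w where w: "ncmp (pnt2 k h) (Inl (id1 H X)) = Inl w" and wc [simp]: "w \<in> Cell H" by blast
  have "dom2 H w = h \<odot> u" "Inl (cod2 H w) = fobj (pnt1 k (trg H h)) (Inl h)"
   using ntr_ty(2,3)[OF p refl refl, of h "Inl (id1 H X)"] w ku by (simp_all add: f)
  then show "ncmp (pnt2 k h) (Inl (id1 H X)) = Inl (n h)" "n h \<in> Cell H" "dom2 H (n h) = h \<odot> u"
    "Inl (cod2 H (n h)) = fobj (pnt1 k (trg H h)) (Inl h)"
   using w wc by (simp_all add: n_def)
 qed
 have iso: "iso2 H (n h)" if [simp]: "h \<in> Mor H" "src H h = X" for h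
 proof -
  have "iso2 CAT (pnt2 k h)" by simp
  then have "iso_in (fcod (ndom (pnt2 k h))) (ncmp (pnt2 k h) (Inl (id1 H X)))"
   unfolding iso2_CAT by (rule conjunct2[THEN bspec]) (simp add: p f)
  then have "iso_in (relabel_cat Inl Inl (homcat H Y (trg H h))) (Inl (n h))"
   using n(1)[of h] by (simp add: p)
  then show ?thesis using iso_in_homcat[of "n h" Y "trg H h"] n[of h] by simp
 qed
 define E where "E = \<lparr>mdom = yonl H u, mcod = k, mdf2 = (\<lambda>Z \<in> Ob H.
  \<lparr>ndom = relabel_fnct Inl Inl (yon_fnct H u Z), ncod = pnt1 k Z, ncmp = (\<lambda>x \<in> Inl ` Obj (homcat H X Z). Inl (n (projl x)))\<rparr>)\<rparr>"
 have E [simp]: "mdom E = yonl H u" "mcod E = k"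
  "!!Z. Z \<in> Ob H ==> ndom (mdf2 E Z) = relabel_fnct Inl Inl (yon_fnct H u Z)"
  "!!Z. Z \<in> Ob H ==> ncod (mdf2 E Z) = pnt1 k Z"
  "!!Z h. Z \<in> Ob H ==> h \<in> Mor H ==> src H h = X ==> trg H h = Z ==> ncmp (mdf2 E Z) (Inl h) = Inl (n h)"
  by (simp_all add: E_def)
 have nt: "nat_trans (mdf2 E Z)" if [simp]: "Z \<in> Ob H" for Z
 proof (rule nat_trans.intro, goal_cases)
  case (5)
  then show ?case by (simp add: E_def)
 next
  case (9 x)
  then obtain th where x: "x = Inl th" and h [simp]: "th \<in> Cell H" "src H (dom2 H th) = X" "trg H (dom2 H th) = Z" by auto
  show ?case using arg_cong[OF k.pnt2_natural[of th], of "%z. ncmp z (Inl (id1 H X))"]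
   by (simp add: x p f n ku)
 qed (auto simp: f n)
 have "modification H CAT E"
 proof (rule modification.intro, goal_cases)
  case (9 g)
  then have g [simp]: "g \<in> Mor H" .
  have [simp]: "nat_trans (mdf2 E (src H g))" "nat_trans (mdf2 E (trg H g))" using nt by simp_all
  show ?case
  proof (rule ntr_eqI, goal_cases)
   case (5 x)
   then obtain h where x: "x = Inl h" and h [simp]: "h \<in> Mor H" "src H h = X" "trg H h = src H g" by (auto simp: p)
   have cs: "fobj (pnt1 k (src H g)) (Inl h) = Inl (cod2 H (n h))" "fobj (pnt1 k (trg H g)) (Inl (g \<odot> h)) = Inl (cod2 H (n (g \<odot> h)))"
    using n(4)[of h] n(4)[of "g \<odot> h"] by simp_all
   have tn [simp]: "src H (cod2 H (n h)) = Y" "trg H (cod2 H (n h)) = src H g" using n(2,3)[of h] by simp_all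
   have "ncmp (pnt2 k g) (Inl h) \<in> Inl ` Cell H"
    using ntr_ty(1)[OF p refl refl, of g "Inl h"] by (simp add: f) blast
   then obtain w where w: "ncmp (pnt2 k g) (Inl h) = Inl w" and wc [simp]: "w \<in> Cell H" by blast
   have wd [simp]: "dom2 H w = g \<odot> cod2 H (n h)" "cod2 H w = cod2 H (n (g \<odot> h))"
    using ntr_ty(2,3)[OF p refl refl, of g "Inl h"] w by (simp_all add: f cs n(2)[of h])
   have fid: "farr (pnt1 k (trg H g)) (Inl (id2 H (g \<odot> h))) = Inl (id2 H (cod2 H (n (g \<odot> h))))"
    using fnctr_ty(5)[OF f, of "trg H g" "Inl (g \<odot> h)"] by (simp add: cs)
   have [simp]: "n h \<in> Cell H" "dom2 H (n h) = h \<odot> u" "n (g \<odot> h) \<in> Cell H" "dom2 H (n (g \<odot> h)) = g \<odot> h \<odot> u"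
    using n[of h] n[of "g \<odot> h"] by (simp_all add: comp1_assoc')
   have "composable H g h" by simp
   \<comment> \<open>The composition law of \<open>k\<close> at \<open>g\<close> and
     \<open>h\<close>, evaluated at the identity, is the modification axiom for
     \<open>E\<close>.\<close>
   from arg_cong[OF k.pnt2_comp1[OF this], of "%z. ncmp z (Inl (id1 H X))"]
   have "n (g \<odot> h) = w \<bullet> (id2 H g \<star> n h)"
    by (simp add: p f n(1)[of h] n(1)[of "g \<odot> h"] ku w fid comp1_assoc')
   then show ?case
    by (simp add: x p f n(1)[of h] n(1)[of "g \<odot> h"] ku w)
  qed (simp_all add: p f yon_rep_relabel[of u g, simplified])
 qed (simp_all add: k nt, simp_all add: E_def)
 then have "iso2 (PS H CAT) E"
  by (auto simp: iso2_PS iso2_CAT nt iso n iso_in_homcat)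
 then have "isomorphic1 (PS H CAT) (yonl H u) k"
  unfolding isomorphic1_def by (intro exI[of _ E]) simp
 then show ?thesis
  using two_category.isomorphic1_sym[OF two_category_PS[OF two_category_axioms two_category_CAT]] u by blast
qed

end

lemma strict_functor_comp:
 assumes F: "strict_functor A H F0 F1 F2" and G: "strict_functor H K G0 G1 G2"
 shows "strict_functor A K (G0 \<circ> F0) (G1 \<circ> F1) (G2 \<circ> F2)"
proof -
 interpret F: strict_functor A H F0 F1 F2 by fact
 interpret G: strict_functor H K G0 G1 G2 by fact
 show ?thesis
  by (intro strict_functor.intro strict_functor_axioms.intro F.A.two_category_axioms G.H.two_category_axioms)
   (simp_all add: vseq_def hseq_def composable_def)
qed

text \<open>Two strict layers after a pseudofunctor L collapse to one, which leaves the structure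
  cells of L as the only source of coherence cells.\<close>

lemma psf_comp_strict_strict:
 assumes F: "strict_functor A H F0 F1 F2" and G: "strict_functor H K G0 G1 G2" and L: "pseudofunctor D A L"
 shows "psf_comp D K (strict_psf H K G0 G1 G2) (psf_comp D H (strict_psf A H F0 F1 F2) L) =
  psf_comp D K (strict_psf A K (G0 \<circ> F0) (G1 \<circ> F1) (G2 \<circ> F2)) L"
proof -
 interpret F: strict_functor A H F0 F1 F2 by fact
 interpret G: strict_functor H K G0 G1 G2 by fact
 interpret GF: strict_functor A K "G0 \<circ> F0" "G1 \<circ> F1" "G2 \<circ> F2" using F G by (rule strict_functor_comp)
 interpret L: pseudofunctor D A L by fact
 have p: "pseudofunctor D H (psf_comp D H F.K L)" by (simp add: L)
 show ?thesis
  by (rule psf_eqI[of D K]) (simp_all add: p L composable_def)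
qed

lemma strict_functor_in:
 "strict_functor CAT CAT (relabel_cat Inl Inl) (relabel_fnct Inl Inl) (relabel_ntr Inl Inl)"
 "strict_functor CAT CAT (relabel_cat Inr Inr) (relabel_fnct Inr Inr) (relabel_ntr Inr Inr)"
 by (simp_all add: strict_functor_relabel)

lemma strict_functor_postcomp:
 assumes "two_category A"
 shows "strict_functor (PS A CAT) (PS A CAT) (psf_comp A CAT in_left) (pnt_post A CAT in_left) (mdf_post A CAT in_left)"
  "strict_functor (PS A CAT) (PS A CAT) (psf_comp A CAT in_right) (pnt_post A CAT in_right) (mdf_post A CAT in_right)"
 using strict_functor.strict_functor_post[OF strict_functor_in(1) assms]
  strict_functor.strict_functor_post[OF strict_functor_in(2) assms]
 by (simp_all add: in_left_def in_right_def relabel_def)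

context two_category
begin

lemma strict_functor_yonl:
 "strict_functor (op2 H) (PS H CAT) (repl H) (yonl H) (yonl2 H)"
 using strict_functor_comp[OF strict_functor_yon strict_functor_postcomp(1)[OF two_category_axioms]] by (simp add: comp_def)

lemma yonl_comp:
 assumes "pseudofunctor B (op2 H) L"
 shows "psf_comp B (PS H CAT) (postcomp_strict H CAT CAT in_left) (psf_comp B (PS H CAT) (yon H) L) =
  psf_comp B (PS H CAT) (strict_psf (op2 H) (PS H CAT) (repl H) (yonl H) (yonl2 H)) L"
 using psf_comp_strict_strict[OF strict_functor_yon strict_functor_postcomp(1)[OF two_category_axioms] assms]
 by (simp add: comp_def yon_def postcomp_strict_def)

text \<open>Full faithfulness combines that of the equivalence \<open>ph b\<close> with that of the
  Yoneda embedding. For essential surjectivity, a weak inverse of \<open>ph b\<close> turns a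
  transformation into \<open>G b\<close> into one between representables, to which
  \<open>yoneda_eso\<close> applies.\<close>

lemma transport_yoneda:
 assumes G: "pseudofunctor B (PS H CAT) G"
  and l: "!!b. b \<in> Ob B ==> l b \<in> Ob H"
  and eq: "!!b. b \<in> Ob B ==> equivalence1 (PS H CAT) (ph b) (repl H (l b)) (psf0 G b)"
 shows "transport (op2 H) (PS H CAT) (repl H) (yonl H) (yonl2 H) B G l ph"
proof -
 interpret Y: strict_functor "op2 H" "PS H CAT" "repl H" "yonl H" "yonl2 H" by (rule strict_functor_yonl)
 interpret G: pseudofunctor B "PS H CAT" G by fact
 interpret P: two_category "PS H CAT" by (simp add: two_category_axioms two_category_CAT)
 have ff: "fully_faithful1 (PS H CAT) (ph b)" if "b \<in> Ob B" for b
  using P.equivalence1_fully_faithful eq[OF that] by blast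
 have e: "ph b \<in> Mor (PS H CAT)" "src (PS H CAT) (ph b) = repl H (l b)" "trg (PS H CAT) (ph b) = psf0 G b" if "b \<in> Ob B" for b
  using eq[OF that] unfolding equivalence1_def by auto
 show ?thesis
 proof (rule transport.intro[OF strict_functor_yonl G transport_axioms.intro], goal_cases)
  case (5 b u v \<tau>)
  then have uv: "u \<in> Mor H" "v \<in> Mor H" "src H v = src H u" "trg H v = trg H u" "l b = src H u" by auto
  obtain si where "si \<in> Cell (PS H CAT)" "dom2 (PS H CAT) si = yonl H u" "cod2 (PS H CAT) si = yonl H v"
    "id2 (PS H CAT) (ph b) *{PS H CAT} si = \<tau>"
   using P.fully_faithful1_ex[OF ff[OF 5(1)], of "yonl H u" "yonl H v" \<tau>] 5 uv e[OF 5(1)] by (auto simp: composable_def)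
  moreover then obtain th where "th \<in> Cell H" "dom2 H th = u" "cod2 H th = v" "yonl2 H th = si"
   using yoneda_full[OF uv(1,2,3,4), of si] by auto
  ultimately show ?case by auto
 next
  case (6 b th th')
  show ?case
   by (rule yoneda_faithful[OF _ _ _ _ P.fully_faithful1_unique[OF ff[OF 6(1)]]]) (use 6 e[OF 6(1)] in simp_all)
 next
  case (7 b X k)
  obtain \<psi> where psi: "\<psi> \<in> Mor (PS H CAT)" "src (PS H CAT) \<psi> = psf0 G b" "trg (PS H CAT) \<psi> = repl H (l b)"
   and i: "isomorphic1 (PS H CAT) (ph b o{PS H CAT} \<psi>) (id1 (PS H CAT) (psf0 G b))"
   using eq[OF 7(1)] unfolding equivalence1_def by auto
  have "\<psi> o{PS H CAT} k \<in> Mor (PS H CAT)" "src (PS H CAT) (\<psi> o{PS H CAT} k) = repl H X" "trg (PS H CAT) (\<psi> o{PS H CAT} k) = repl H (l b)"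
   using 7 psi by simp_all
  then obtain u where u: "u \<in> Mor H" "src H u = l b" "trg H u = X" "isomorphic1 (PS H CAT) (\<psi> o{PS H CAT} k) (yonl H u)"
   using yoneda_eso[of "\<psi> o{PS H CAT} k" X "l b"] 7 l by auto
  have "isomorphic1 (PS H CAT) (ph b o{PS H CAT} (\<psi> o{PS H CAT} k)) (ph b o{PS H CAT} yonl H u)"
   by (rule P.isomorphic1_comp1[OF u(4) P.isomorphic1_refl]) (use 7 psi e[OF 7(1)] in simp_all)
  moreover have "isomorphic1 (PS H CAT) ((ph b o{PS H CAT} \<psi>) o{PS H CAT} k) (id1 (PS H CAT) (psf0 G b) o{PS H CAT} k)"
   by (rule P.isomorphic1_comp1[OF P.isomorphic1_refl i]) (use 7 psi in simp_all)
  moreover have "(ph b o{PS H CAT} \<psi>) o{PS H CAT} k = ph b o{PS H CAT} (\<psi> o{PS H CAT} k)"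
   by (rule P.comp1_assoc) (use 7 psi e[OF 7(1)] in simp_all)
  moreover have "id1 (PS H CAT) (psf0 G b) o{PS H CAT} k = k" using P.comp1_id1(2)[of k] 7 by simp
  ultimately have "isomorphic1 (PS H CAT) k (ph b o{PS H CAT} yonl H u)"
   using P.isomorphic1_sym P.isomorphic1_trans by metis
  then show ?case using u by auto
 qed (use l e in simp_all)
qed

text \<open>The transported transformation has the given equivalences as components, so
  \<open>equivalence1_PS\<close> makes it an equivalence of pseudofunctors on B.\<close>

lemma exists_transport_yoneda:
 assumes G: "pseudofunctor B (PS H CAT) G"
  and l: "!!b. b \<in> Ob B ==> l b \<in> Ob H"
  and eq: "!!b. b \<in> Ob B ==> equivalence1 (PS H CAT) (ph b) (repl H (l b)) (psf0 G b)"
 shows "\<exists>L Ph. pseudofunctor B (op2 H) L & (\<forall>b\<in>Ob B. psf0 L b = l b & pnt1 Ph b = ph b) &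
  equivalence1 (PS B (PS H CAT)) Ph (psf_comp B (PS H CAT) (postcomp_strict H CAT CAT in_left) (psf_comp B (PS H CAT) (yon H) L)) G"
proof -
 interpret transport "op2 H" "PS H CAT" "repl H" "yonl H" "yonl2 H" B G l ph
  using assms by (rule transport_yoneda)
 obtain L Ph where L: "pseudofunctor B (op2 H) L" "\<forall>b\<in>Ob B. psf0 L b = l b" "pseudonatural B (PS H CAT) Ph"
   "pdom Ph = psf_comp B (PS H CAT) K L" "pcod Ph = G" "\<forall>b\<in>Ob B. pnt1 Ph b = ph b"
  using exists_transport by blast
 have "equivalence1 (PS B (PS H CAT)) Ph (pdom Ph) (pcod Ph)"
 proof (rule equivalence1_PS[OF L(3)])
  fix b assume "b \<in> Ob B"
  then show "\<exists>X Y. equivalence1 (PS H CAT) (pnt1 Ph b) X Y" using eq[of b] L(6) by auto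
 qed
 then show ?thesis using L by (intro exI[of _ L] exI[of _ Ph]) (auto simp: yonl_comp[OF L(1)])
qed

end

section \<open>The cone pseudofunctors and the bilimit pseudofunctor\<close>

lemma pseudofunctor_yon_along:
 assumes "pseudofunctor A H \<A>"
 shows "pseudofunctor (op2 H) (PS A CAT) (yon_along A H \<A>)"
proof -
 interpret pseudofunctor A H \<A> by fact
 show ?thesis unfolding yon_along_def precomp_def
  by (intro pseudofunctor_psf_comp[OF H.yon_simps(4)] strict_functor.pseudofunctor_strict strict_functor_pre assms two_category_CAT)
qed

lemma pseudofunctor_hom_along:
 assumes "pseudofunctor A H \<A>"
 shows "pseudofunctor (op2 H) (PS A CAT) (hom_along A H \<A>)"
proof -
 interpret pseudofunctor A H \<A> by fact
 show ?thesis unfolding hom_along_def postcomp_strict_def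
  by (intro pseudofunctor_psf_comp[OF pseudofunctor_yon_along[OF assms]] strict_functor.pseudofunctor_strict strict_functor_postcomp A.two_category_axioms)
qed

lemma pseudofunctor_cones_family:
 assumes "pseudofunctor A H \<A>" "pseudofunctor (op2 B) (PS A CAT) \<V>"
 shows "pseudofunctor B (PS (op2 H) CAT) (cones_family A B H \<V> \<A>)"
proof -
 interpret pseudofunctor A H \<A> by fact
 interpret PA: two_category "PS A CAT" by (simp add: A.two_category_axioms two_category_CAT)
 have "pseudofunctor (op2 B) (PS A CAT) (psf_comp (op2 B) (PS A CAT) (postcomp_strict A CAT CAT in_left) \<V>)"
  unfolding postcomp_strict_def
  by (intro pseudofunctor_psf_comp[OF assms(2)] strict_functor.pseudofunctor_strict strict_functor_postcomp A.two_category_axioms)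
 from pseudofunctor_psf_op[OF this]
 have W: "pseudofunctor B (op2 (PS A CAT)) (psf_op (psf_comp (op2 B) (PS A CAT) (postcomp_strict A CAT CAT in_left) \<V>))" by simp
 show ?thesis unfolding cones_family_def Let_def precomp_def
  by (intro pseudofunctor_psf_comp[OF pseudofunctor_psf_comp[OF W PA.yon_simps(4)]] strict_functor.pseudofunctor_strict
   strict_functor_pre two_category_CAT pseudofunctor_hom_along assms)
qed

lemma yon_along_0:
 assumes "pseudofunctor A B t" "b \<in> Ob B"
 shows "psf0 (yon_along A B t) b = psf_comp A CAT (rep B b) t"
proof -
 interpret pseudofunctor A B t by fact
 show ?thesis using assms(2) by (simp add: yon_along_def precomp_def)
qed

text \<open>Links the hypothesis, which treats each weight separately, with the family in which the
  weight varies.\<close>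

lemma cones_family_0:
 assumes "pseudofunctor A H \<A>" "pseudofunctor (op2 B) (PS A CAT) \<V>" "b \<in> Ob B"
 shows "psf0 (cones_family A B H \<V> \<A>) b = cones A H (psf0 \<V> b) \<A>"
proof -
 interpret pseudofunctor A H \<A> by fact
 interpret V: pseudofunctor "op2 B" "PS A CAT" \<V> by fact
 interpret PA: two_category "PS A CAT" by (simp add: A.two_category_axioms two_category_CAT)
 have [simp]: "pseudofunctor A CAT (psf0 \<V> b)" using V.psf0_Ob[of b] assms(3) by simp
 show ?thesis using assms(3)
  by (simp add: cones_family_def Let_def precomp_def postcomp_strict_def cones_def)
qed

text \<open>Cones depend contravariantly on the vertex, so the transport uses the Yoneda embedding
  of \<open>op2 H\<close>; it produces a pseudofunctor into \<open>op2 (op2 H)\<close>, which is H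
  itself.\<close>

lemma weighted_bilimit_psf_exists:
 assumes \<A>: "pseudofunctor A H \<A>" and t: "pseudofunctor A B t"
  and w: "!!b. b \<in> Ob B ==> weighted_bilimit A H (psf_comp A CAT (rep B b) t) \<A> (bilim b) (ph b)"
 shows "\<exists>L Ph. weighted_bilimit_psf A B H (yon_along A B t) \<A> L Ph & (\<forall>b \<in> Ob B. psf0 L b = bilim b & pnt1 Ph b = ph b)"
proof -
 interpret \<A>: pseudofunctor A H \<A> by fact
 interpret t: pseudofunctor A B t by fact
 interpret op: two_category "op2 H" by (rule \<A>.H.two_category_op2)
 note V = pseudofunctor_yon_along[OF t]
 let ?C = "cones_family A B H (yon_along A B t) \<A>"
 let ?G = "psf_comp B (PS (op2 H) CAT) (postcomp_strict (op2 H) CAT CAT in_right) ?C"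
 have C: "pseudofunctor B (PS (op2 H) CAT) ?C" by (rule pseudofunctor_cones_family[OF \<A> V])
 have G: "pseudofunctor B (PS (op2 H) CAT) ?G"
  unfolding postcomp_strict_def
  by (intro pseudofunctor_psf_comp[OF C] strict_functor.pseudofunctor_strict strict_functor_postcomp op.two_category_axioms)
 have G0: "psf0 ?G b = psf_comp (op2 H) CAT in_right (cones A H (psf_comp A CAT (rep B b) t) \<A>)" if "b \<in> Ob B" for b
  using that pseudofunctor.psf0_Ob[OF C, of b]
  by (simp add: postcomp_strict_def cones_family_0[OF \<A> V] yon_along_0[OF t])
 have "\<exists>L Ph. pseudofunctor B (op2 (op2 H)) L & (\<forall>b\<in>Ob B. psf0 L b = bilim b & pnt1 Ph b = ph b) &
  equivalence1 (PS B (PS (op2 H) CAT)) Ph (psf_comp B (PS (op2 H) CAT) (postcomp_strict (op2 H) CAT CAT in_left) (psf_comp B (PS (op2 H) CAT) (yon (op2 H)) L)) ?G"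
  by (rule op.exists_transport_yoneda[OF G])
   (use w in \<open>simp_all add: weighted_bilimit_def pseudonatural_equivalence_CAT_def G0 del: psf_comp_simps\<close>)
 then show ?thesis unfolding weighted_bilimit_psf_def op2_op2 by blast
qed

text \<open>Composites of strict 2-functors are equal, as records, to strict 2-functors with
  composed actions. This gives \<open>hom_along\<close>, \<open>cones\<close> and
  \<open>cones_family\<close> closed forms whose structure cells are visible to the
  simplifier.\<close>

lemma psf_comp_strict_psf:
 assumes F: "strict_functor A H F0 F1 F2" and G: "strict_functor H K G0 G1 G2"
 shows "psf_comp A K (strict_psf H K G0 G1 G2) (strict_psf A H F0 F1 F2) = strict_psf A K (G0 \<circ> F0) (G1 \<circ> F1) (G2 \<circ> F2)"
proof -
 interpret F: strict_functor A H F0 F1 F2 by fact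
 interpret G: strict_functor H K G0 G1 G2 by fact
 interpret GF: strict_functor A K "G0 \<circ> F0" "G1 \<circ> F1" "G2 \<circ> F2" using F G by (rule strict_functor_comp)
 show ?thesis
  by (rule psf_eqI[of A K]) (simp_all add: F.pseudofunctor_strict GF.pseudofunctor_strict composable_def)
qed

lemma psf_op_strict_psf:
 "psf_op (strict_psf (op2 A) H F0 F1 F2) = strict_psf A (op2 H) F0 F1 F2"
 by (auto simp: psf_op_def strict_psf_def fun_eq_iff)

lemma strict_functor_op2:
 assumes "strict_functor (op2 A) H F0 F1 F2" "two_category A" shows "strict_functor A (op2 H) F0 F1 F2"
proof -
 interpret F: strict_functor "op2 A" H F0 F1 F2 by fact
 have h: "hseq (op2 A) x y = hseq A y x" if "two_category A" for x y
 proof -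
  interpret two_category A by fact
  show ?thesis by (auto simp: hseq_def)
 qed
 show ?thesis
  by (intro strict_functor.intro strict_functor_axioms.intro assms(2) F.H.two_category_op2)
   (use F.F1_comp1 F.F2_hcomp F.F2_vcomp F.F1_id1 F.F2_id2 in \<open>auto simp: h[OF assms(2)]\<close>)
qed

section \<open>Weighted cones and their morphisms in terms of cells of H\<close>

text \<open>Serves both ends of a cone: the weight \<open>B(b, t -)\<close> and the target
  \<open>H(X, \<A> -)\<close>.\<close>

locale rep_along = pseudofunctor A H \<A>
 for A :: "('a0, 'a1, 'a2) twocat" and H :: "('h0, 'h1, 'h2) twocat" and \<A> +
 fixes X assumes X_Ob [simp]: "X \<in> Ob H"
begin

abbreviation "Q \<equiv> psf_comp A CAT (rep H X) \<A>"

lemma Q_simps [simp]: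
 "pseudofunctor A CAT Q"
 "composable A g f ==> psfc Q g f = rep_ntr H X (psfc \<A> g f)"
 "a \<in> Ob A ==> psfu Q a = rep_ntr H X (psfu \<A> a)"
 using strict_functor.psf_comp_strict_psfc[OF H.strict_functor_rep[OF X_Ob] pseudofunctor_axioms]
  pseudofunctor_psf_comp[OF pseudofunctor_axioms H.pseudofunctor_rep[OF X_Ob]]
 by (simp_all add: rep_def)

end

text \<open>A cone with weight W and vertex X, read in H: an object \<open>f\<close> of
  \<open>W a\<close> gives the leg \<open>ho c a f\<close> from X to \<open>\<A> a\<close>, an arrow
  of \<open>W a\<close> gives a 2-cell between legs, and \<open>hn c u f\<close> is the invertible
  2-cell comparing legs along a 1-cell \<open>u\<close> of A.\<close>

locale cone_in = r: rep_along A H \<A> X + hetero_pnt A W "psf_comp A CAT (rep H X) \<A>" c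
 for A :: "('a0, 'a1, 'a2) twocat" and H :: "('h0, 'h1, 'h2) twocat" and \<A> X
  and W :: "('a0, 'a1, 'a2, ('u, 'v) cat, ('u, 'v) fnct, ('u, 'v) ntr) psf" and c
begin

lemma cone_simps [simp]:
 "a \<in> Ob A ==> f \<in> Obj (psf0 W a) ==> ho c a f \<in> Mor H"
 "a \<in> Ob A ==> f \<in> Obj (psf0 W a) ==> src H (ho c a f) = X"
 "a \<in> Ob A ==> f \<in> Obj (psf0 W a) ==> trg H (ho c a f) = psf0 \<A> a"
 using ho_fobj(2)[of a f] by simp_all

lemma cone_simps2 [simp]:
 "a \<in> Ob A ==> xi \<in> Arr (psf0 W a) ==> ha c a xi \<in> Cell H"
 "a \<in> Ob A ==> xi \<in> Arr (psf0 W a) ==> dom2 H (ha c a xi) = ho c a (Dom (psf0 W a) xi)"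
 "a \<in> Ob A ==> xi \<in> Arr (psf0 W a) ==> cod2 H (ha c a xi) = ho c a (Cod (psf0 W a) xi)"
 "u \<in> Mor A ==> f \<in> Obj (psf0 W (src A u)) ==> hn c u f \<in> Cell H"
 "u \<in> Mor A ==> f \<in> Obj (psf0 W (src A u)) ==> dom2 H (hn c u f) = psf1 \<A> u o{H} ho c (src A u) f"
 "u \<in> Mor A ==> f \<in> Obj (psf0 W (src A u)) ==> cod2 H (hn c u f) = ho c (trg A u) (fobj (psf1 W u) f)"
 using ha_farr(2)[of a xi] hn_ncmp(2)[of u f] hpnt.ra_Dom[OF hpnt, of a xi] hpnt.ra_Cod[OF hpnt, of a xi]
  hpnt.n_Dom[OF hpnt, of u f] hpnt.n_Cod[OF hpnt, of u f] by simp_all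

lemma cone_iso [simp]: "u \<in> Mor A ==> f \<in> Obj (psf0 W (src A u)) ==> iso2 H (hn c u f)"
 using hpnt.n_iso[OF hpnt, of u f] r.H.iso_in_homcat[of "hn c u f" X "psf0 \<A> (trg A u)"] by simp

lemma cone_eqs:
 "a \<in> Ob A ==> f \<in> Obj (psf0 W a) ==> ha c a (Idn (psf0 W a) f) = id2 H (ho c a f)" (is "PROP ?C0")
 "a \<in> Ob A ==> y \<in> Arr (psf0 W a) ==> y' \<in> Arr (psf0 W a) ==> Dom (psf0 W a) y' = Cod (psf0 W a) y ==>
  ha c a (Cmp (psf0 W a) y' y) = ha c a y' #{H} ha c a y" (is "PROP ?C1")
 "u \<in> Mor A ==> xi \<in> Arr (psf0 W (src A u)) ==>
  hn c u (Cod (psf0 W (src A u)) xi) #{H} (id2 H (psf1 \<A> u) *{H} ha c (src A u) xi) =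
  ha c (trg A u) (farr (psf1 W u) xi) #{H} hn c u (Dom (psf0 W (src A u)) xi)" (is "PROP ?C2")
 "x \<in> Cell A ==> f \<in> Obj (psf0 W (src A (dom2 A x))) ==>
  hn c (cod2 A x) f #{H} (psf2 \<A> x *{H} id2 H (ho c (src A (dom2 A x)) f)) =
  ha c (trg A (dom2 A x)) (ncmp (psf2 W x) f) #{H} hn c (dom2 A x) f" (is "PROP ?C3")
 "composable A v u ==> f \<in> Obj (psf0 W (src A u)) ==>
  hn c (v o{A} u) f #{H} (psfc \<A> v u *{H} id2 H (ho c (src A u) f)) =
  ha c (trg A v) (ncmp (psfc W v u) f) #{H} hn c v (fobj (psf1 W u) f) #{H} (id2 H (psf1 \<A> v) *{H} hn c u f)"
 "a \<in> Ob A ==> f \<in> Obj (psf0 W a) ==>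
  hn c (id1 A a) f #{H} (psfu \<A> a *{H} id2 H (ho c a f)) = ha c a (ncmp (psfu W a) f)" (is "PROP ?C5")
proof -
 interpret h: hpnt A W r.Q "ho c" "ha c" "hn c" by (rule hpnt)
 show "PROP ?C0"
  using h.ra_Idn[of a f] by simp
 show "PROP ?C1"
  using h.ra_Cmp[of a y y'] by simp
 show "PROP ?C2"
  using h.n_nat[of u xi] by simp
 show "PROP ?C3"
  using h.n_cell[of x f] by simp
 show "hn c (v o{A} u) f #{H} (psfc \<A> v u *{H} id2 H (ho c (src A u) f)) =
  ha c (trg A v) (ncmp (psfc W v u) f) #{H} hn c v (fobj (psf1 W u) f) #{H} (id2 H (psf1 \<A> v) *{H} hn c u f)"
  if "composable A v u" "f \<in> Obj (psf0 W (src A u))"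
 proof -
  have [simp]: "u \<in> Mor A" "v \<in> Mor A" "src A v = trg A u" using that by (auto simp: composable_def)
  show ?thesis using h.n_comp[OF that] that by simp
 qed
 show "PROP ?C5"
  using h.n_id[of a f] by simp
qed

end

text \<open>A morphism of cones, read in H as the family of 2-cells \<open>hm Ga a f\<close> between
  corresponding legs.\<close>

locale cone_mdf = c: cone_in A H \<A> X W c + d: cone_in A H \<A> X W d + modification A CAT Ga
 for A :: "('a0, 'a1, 'a2) twocat" and H :: "('h0, 'h1, 'h2) twocat" and \<A> X
  and W :: "('a0, 'a1, 'a2, ('u, 'v) cat, ('u, 'v) fnct, ('u, 'v) ntr) psf" and c d Ga +
 assumes mdom_c [simp]: "mdom Ga = c" and mcod_d [simp]: "mcod Ga = d"
begin

lemma hmdf: "hmdf A W (psf_comp A CAT (rep H X) \<A>) c d (hm Ga)"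
 by (rule hmdf_modification) (simp_all add: c.hetero_pnt_axioms d.hetero_pnt_axioms modification_axioms)

lemma hm_ncmp: "a \<in> Ob A ==> f \<in> Obj (psf0 W a) ==> ncmp (mdf2 Ga a) (Inl f) = Inr (hm Ga a f)"
 by (rule hmdf_modification(2)[OF c.hetero_pnt_axioms d.hetero_pnt_axioms modification_axioms]) simp_all

lemma mdf2_ntr [simp]: "a \<in> Ob A ==> nat_trans (mdf2 Ga a)" "a \<in> Ob A ==> ndom (mdf2 Ga a) = pnt1 c a"
 "a \<in> Ob A ==> ncod (mdf2 Ga a) = pnt1 d a"
 using mdf2_Cell[of a] dom2_mdf2[of a] cod2_mdf2[of a] by simp_all

lemma mdf_simps [simp]:
 "a \<in> Ob A ==> f \<in> Obj (psf0 W a) ==> hm Ga a f \<in> Cell H"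
 "a \<in> Ob A ==> f \<in> Obj (psf0 W a) ==> dom2 H (hm Ga a f) = ho c a f"
 "a \<in> Ob A ==> f \<in> Obj (psf0 W a) ==> cod2 H (hm Ga a f) = ho d a f"
 using hmdf.m_Arr[OF hmdf, of a f] hmdf.m_Dom[OF hmdf, of a f] hmdf.m_Cod[OF hmdf, of a f] by simp_all

lemma mdf_eqs:
 "a \<in> Ob A ==> xi \<in> Arr (psf0 W a) ==>
  hm Ga a (Cod (psf0 W a) xi) #{H} ha c a xi = ha d a xi #{H} hm Ga a (Dom (psf0 W a) xi)"
 "u \<in> Mor A ==> f \<in> Obj (psf0 W (src A u)) ==>
  hn d u f #{H} (id2 H (psf1 \<A> u) *{H} hm Ga (src A u) f) = hm Ga (trg A u) (fobj (psf1 W u) f) #{H} hn c u f"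
 using hmdf.m_nat[OF hmdf, of a xi] hmdf.m_mdf[OF hmdf, of u f] by simp_all

lemma hm_iso:
 assumes "iso2 (PS A CAT) Ga" "a \<in> Ob A" "f \<in> Obj (psf0 W a)" shows "iso2 H (hm Ga a f)"
proof -
 have "iso2 CAT (mdf2 Ga a)" using assms by (simp add: iso2_PS)
 then have "iso_in (fcod (ndom (mdf2 Ga a))) (ncmp (mdf2 Ga a) (Inl f))"
  unfolding iso2_CAT by (rule conjunct2[THEN bspec]) (simp add: assms)
 then show ?thesis using assms c.r.H.iso_in_homcat[of "hm Ga a f" X "psf0 \<A> a"] by (simp add: hm_ncmp)
qed

end

text \<open>\<open>hpost\<close> restricts the vertex of cones along a 1-cell of H, and
  \<open>hpre\<close> reindexes the weight along a 1-cell of B; both are taken into the common copy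
  of CAT.\<close>

abbreviation hpost where "hpost A \<A> H k \<equiv> pnt_post A CAT in_right (pnt_pre A CAT \<A> (yon_pnt H k))"
abbreviation hpre where "hpre A t B g \<equiv> pnt_post A CAT in_left (pnt_pre A CAT t (yon_pnt B g))"

abbreviation hpost2 where "hpost2 A \<A> H xi \<equiv> mdf_post A CAT in_right (mdf_pre A CAT \<A> (yon_mdf H xi))"
abbreviation hpre2 where "hpre2 A t B x \<equiv> mdf_post A CAT in_left (mdf_pre A CAT t (yon_mdf B x))"

context pseudofunctor
begin

lemma yon_pre [simp]:
 "k \<in> Mor H ==> pseudonatural A CAT (pnt_pre A CAT F (yon_pnt H k))"
 "xi \<in> Cell H ==> modification A CAT (mdf_pre A CAT F (yon_mdf H xi))"
 by (auto intro!: pseudonatural_pnt_pre[OF pseudofunctor_axioms] modification_mdf_pre[OF pseudofunctor_axioms])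

end

context cone_in
begin

lemma cone_in_hpost:
 assumes k [simp]: "k \<in> Mor H" "trg H k = X"
 shows "cone_in A H \<A> (src H k) W (pnt_comp A CAT (hpost A \<A> H k) c)"
proof -
 interpret k: rep_along A H \<A> "src H k" by unfold_locales simp
 have "pseudonatural A CAT (pnt_comp A CAT (hpost A \<A> H k) c)"
  by (rule pseudonatural_pnt_comp) (simp_all add: ph.pseudonatural_axioms)
 then show ?thesis
  by (simp add: cone_in_def hetero_pnt_def hetero_pnt_axioms_def P.pseudofunctor_axioms k.rep_along_axioms)
qed

lemma hpost_simps [simp]:
 assumes k [simp]: "k \<in> Mor H" "trg H k = X"
 shows "a \<in> Ob A ==> f \<in> Obj (psf0 W a) ==> ho (pnt_comp A CAT (hpost A \<A> H k) c) a f = ho c a f o{H} k"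
  "a \<in> Ob A ==> xi \<in> Arr (psf0 W a) ==> ha (pnt_comp A CAT (hpost A \<A> H k) c) a xi = ha c a xi *{H} id2 H k"
  "u \<in> Mor A ==> f \<in> Obj (psf0 W (src A u)) ==> hn (pnt_comp A CAT (hpost A \<A> H k) c) u f = hn c u f *{H} id2 H k"
 by (simp_all add: ho_def[of "pnt_comp _ _ _ _"] ha_def[of "pnt_comp _ _ _ _"] hn_def[of "pnt_comp _ _ _ _"] r.H.comp1_assoc')

lemma hpost2_simps [simp]:
 assumes [simp]: "xi \<in> Cell H" "trg H (dom2 H xi) = X"
 shows "a \<in> Ob A ==> f \<in> Obj (psf0 W a) ==> hm (mdf_hcomp A CAT (hpost2 A \<A> H xi) (mdf_id A CAT c)) a f = id2 H (ho c a f) *{H} xi"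
 by (simp add: hm_def)

end

lemma (in cone_mdf) hpost_mdf [simp]:
 assumes k [simp]: "k \<in> Mor H" "trg H k = X"
 shows "a \<in> Ob A ==> f \<in> Obj (psf0 W a) ==> hm (mdf_hcomp A CAT (mdf_id A CAT (hpost A \<A> H k)) Ga) a f = hm Ga a f *{H} id2 H k"
 by (simp add: hm_def[of "mdf_hcomp _ _ _ _"] hm_ncmp)

lemma hm_vcomp:
 assumes "cone_mdf A H \<A> X W c d Ga" "cone_mdf A H \<A> X W d e De" "a \<in> Ob A" "f \<in> Obj (psf0 W a)"
 shows "hm (mdf_vcomp A CAT De Ga) a f = hm De a f #{H} hm Ga a f"
proof -
 interpret g: cone_mdf A H \<A> X W c d Ga by fact
 interpret d: cone_mdf A H \<A> X W d e De by fact
 show ?thesis using assms(3,4) by (simp add: hm_def[of "mdf_vcomp _ _ _ _"] g.hm_ncmp d.hm_ncmp)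
qed

locale cone_pre = b: rep_along A B t "src B g" + b': rep_along A B t "trg B g" +
 cone_in A H \<A> X "psf_comp A CAT (rep B (src B g)) t" c
 for A :: "('a0, 'a1, 'a2) twocat" and H :: "('h0, 'h1, 'h2) twocat" and \<A> X
  and B :: "('b0, 'b1, 'b2) twocat" and t g c +
 assumes g_Mor [simp]: "g \<in> Mor B"
begin

lemma cone_in_hpre: "cone_in A H \<A> X (psf_comp A CAT (rep B (trg B g)) t) (pnt_comp A CAT c (hpre A t B g))"
proof -
 have "pseudonatural A CAT (pnt_comp A CAT c (hpre A t B g))"
  by (rule pseudonatural_pnt_comp) (simp_all add: ph.pseudonatural_axioms)
 then show ?thesis
  by (simp add: cone_in_def hetero_pnt_def hetero_pnt_axioms_def r.rep_along_axioms)
qed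

lemma hpre_simps [simp]:
 "a \<in> Ob A ==> f \<in> Mor B ==> src B f = trg B g ==> trg B f = psf0 t a ==> ho (pnt_comp A CAT c (hpre A t B g)) a f = ho c a (f o{B} g)"
 "a \<in> Ob A ==> xi \<in> Cell B ==> src B (dom2 B xi) = trg B g ==> trg B (dom2 B xi) = psf0 t a ==>
   ha (pnt_comp A CAT c (hpre A t B g)) a xi = ha c a (xi *{B} id2 B g)"
 "u \<in> Mor A ==> f \<in> Mor B ==> src B f = trg B g ==> trg B f = psf0 t (src A u) ==>
   hn (pnt_comp A CAT c (hpre A t B g)) u f = hn c u (f o{B} g)"
 using cone_eqs(1)[of "trg A u" "psf1 t u o{B} f o{B} g"]
 by (simp_all add: ho_def[of "pnt_comp _ _ _ _"] ha_def[of "pnt_comp _ _ _ _"] hn_def[of "pnt_comp _ _ _ _"] b.H.comp1_assoc')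

lemma hpre2_simps [simp]:
 assumes [simp]: "xi \<in> Cell B" "dom2 B xi = g"
 shows "a \<in> Ob A ==> f \<in> Mor B ==> src B f = trg B g ==> trg B f = psf0 t a ==>
  hm (mdf_hcomp A CAT (mdf_id A CAT c) (hpre2 A t B xi)) a f = ha c a (id2 B f *{B} xi)"
 by (simp add: hm_def)

end

locale cone_mdf_pre = c: cone_pre A H \<A> X B t g c + d: cone_pre A H \<A> X B t g d +
 cone_mdf A H \<A> X "psf_comp A CAT (rep B (src B g)) t" c d Ga
 for A :: "('a0, 'a1, 'a2) twocat" and H :: "('h0, 'h1, 'h2) twocat" and \<A> X
  and B :: "('b0, 'b1, 'b2) twocat" and t g c d Ga
begin

lemma hpre_mdf [simp]:
 "a \<in> Ob A ==> f \<in> Mor B ==> src B f = trg B g ==> trg B f = psf0 t a ==>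
  hm (mdf_hcomp A CAT Ga (mdf_id A CAT (hpre A t B g))) a f = hm Ga a (f o{B} g)"
 by (simp add: hm_def[of "mdf_hcomp _ _ _ _"] hm_ncmp)

end

lemma hom_along_strict:
 assumes "pseudofunctor A H \<A>"
 shows "strict_functor (op2 H) (PS A CAT) (%X. psf_comp A CAT in_right (psf_comp A CAT (rep H X) \<A>)) (hpost A \<A> H) (hpost2 A \<A> H)" (is "PROP ?C0")
  "hom_along A H \<A> = strict_psf (op2 H) (PS A CAT) (%X. psf_comp A CAT in_right (psf_comp A CAT (rep H X) \<A>)) (hpost A \<A> H) (hpost2 A \<A> H)" (is "PROP ?C1")
proof -
 interpret pseudofunctor A H \<A> by fact
 note 1 = H.strict_functor_yon
 note 2 = strict_functor_pre[OF assms two_category_CAT]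
 note 3 = strict_functor_postcomp(2)[OF A.two_category_axioms]
 show "PROP ?C0"
  using strict_functor_comp[OF strict_functor_comp[OF 1 2] 3] by (simp add: comp_def)
 show "PROP ?C1"
  using psf_comp_strict_psf[OF 1 2] psf_comp_strict_psf[OF strict_functor_comp[OF 1 2] 3]
  by (simp add: comp_def hom_along_def yon_along_def yon_def precomp_def postcomp_strict_def)
qed

lemma weights_strict:
 assumes "pseudofunctor A B t"
 shows "strict_functor (op2 B) (PS A CAT) (%X. psf_comp A CAT in_left (psf_comp A CAT (rep B X) t)) (hpre A t B) (hpre2 A t B)" (is "PROP ?C0")
  "psf_comp (op2 B) (PS A CAT) (postcomp_strict A CAT CAT in_left) (yon_along A B t)
   = strict_psf (op2 B) (PS A CAT) (%X. psf_comp A CAT in_left (psf_comp A CAT (rep B X) t)) (hpre A t B) (hpre2 A t B)" (is "PROP ?C1")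
proof -
 interpret pseudofunctor A B t by fact
 note 1 = H.strict_functor_yon
 note 2 = strict_functor_pre[OF assms two_category_CAT]
 note 3 = strict_functor_postcomp(1)[OF A.two_category_axioms]
 show "PROP ?C0"
  using strict_functor_comp[OF strict_functor_comp[OF 1 2] 3] by (simp add: comp_def)
 show "PROP ?C1"
  using psf_comp_strict_psf[OF 1 2] psf_comp_strict_psf[OF strict_functor_comp[OF 1 2] 3]
  by (simp add: comp_def yon_along_def yon_def precomp_def postcomp_strict_def)
qed

lemma cones_strict:
 assumes \<A>: "pseudofunctor A H \<A>" and W: "pseudofunctor A CAT W"
 defines "PA \<equiv> PS A CAT" and "W' \<equiv> psf_comp A CAT in_left W"
 shows "strict_functor (op2 H) CAT (%X. homcat PA W' (psf_comp A CAT in_right (psf_comp A CAT (rep H X) \<A>)))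
   (%k. rep_fnct PA W' (hpost A \<A> H k)) (%xi. rep_ntr PA W' (hpost2 A \<A> H xi))" (is "PROP ?C0")
  "cones A H W \<A> = strict_psf (op2 H) CAT (%X. homcat PA W' (psf_comp A CAT in_right (psf_comp A CAT (rep H X) \<A>)))
   (%k. rep_fnct PA W' (hpost A \<A> H k)) (%xi. rep_ntr PA W' (hpost2 A \<A> H xi))" (is "PROP ?C1")
proof -
 interpret pseudofunctor A H \<A> by fact
 interpret PA: two_category PA unfolding PA_def by (simp add: A.two_category_axioms two_category_CAT)
 have w: "W' \<in> Ob PA" using W by (simp add: PA_def W'_def)
 note 1 = hom_along_strict[OF \<A>]
 note 2 = PA.strict_functor_rep[OF w, unfolded PA_def W'_def]
 show "PROP ?C0"
  using strict_functor_comp[OF 1(1) 2] by (simp add: comp_def PA_def W'_def)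
 show "PROP ?C1"
  using psf_comp_strict_psf[OF 1(1) 2] by (simp add: comp_def cones_def 1(2) rep_def PA_def W'_def)
qed

lemma cones_family_strict:
 assumes \<A>: "pseudofunctor A H \<A>" and t: "pseudofunctor A B t"
 defines "PA \<equiv> PS A CAT" and "PH \<equiv> PS (op2 H) CAT" and "W \<equiv> %X. psf_comp A CAT in_left (psf_comp A CAT (rep B X) t)"
  and "HA \<equiv> hom_along A H \<A>"
 shows "strict_functor B PH (%b. psf_comp (op2 H) CAT (rep PA (W b)) HA) (%g. pnt_pre (op2 H) CAT HA (yon_pnt PA (hpre A t B g)))
   (%x. mdf_pre (op2 H) CAT HA (yon_mdf PA (hpre2 A t B x)))" (is "PROP ?C0")
  "cones_family A B H (yon_along A B t) \<A> = strict_psf B PH (%b. psf_comp (op2 H) CAT (rep PA (W b)) HA)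
   (%g. pnt_pre (op2 H) CAT HA (yon_pnt PA (hpre A t B g))) (%x. mdf_pre (op2 H) CAT HA (yon_mdf PA (hpre2 A t B x)))" (is "PROP ?C1")
proof -
 interpret \<A>: pseudofunctor A H \<A> by fact
 interpret t: pseudofunctor A B t by fact
 interpret PA: two_category PA unfolding PA_def by (simp add: \<A>.A.two_category_axioms two_category_CAT)
 note 1 = weights_strict[OF t]
 note 2 = strict_functor_op2[OF 1(1) t.H.two_category_axioms]
 note 3 = PA.strict_functor_yon[unfolded PA_def]
 have ha: "pseudofunctor (op2 H) PA HA" unfolding HA_def PA_def by (rule pseudofunctor_hom_along[OF \<A>])
 note 4 = strict_functor_pre[OF ha[unfolded PA_def HA_def] two_category_CAT]
 show "PROP ?C0"
  using strict_functor_comp[OF strict_functor_comp[OF 2 3] 4] by (simp add: comp_def PA_def PH_def HA_def W_def)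
 show "PROP ?C1"
  using psf_comp_strict_psf[OF 2 3] psf_comp_strict_psf[OF strict_functor_comp[OF 2 3] 4]
  by (simp add: comp_def cones_family_def Let_def 1(2) psf_op_strict_psf yon_def precomp_def PA_def PH_def HA_def W_def)
qed

section \<open>Equivalences in CAT as full, faithful, essentially surjective functors\<close>

text \<open>The argument for fully faithful 1-cells, now for single arrows: a preimage of
  \<open>g\<close> is the conjugate of \<open>G g\<close> by \<eta>, and faithfulness of the inverse
  functor G shows that it maps to \<open>g\<close>.\<close>

lemma CAT_equivalenceD:
 assumes "equivalence1 CAT F C D"
 shows "!!x y g. [|x \<in> Obj C; y \<in> Obj C; g \<in> Arr D; Dom D g = fobj F x; Cod D g = fobj F y|] ==>
   \<exists>f. f \<in> Arr C & Dom C f = x & Cod C f = y & farr F f = g"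
  and "!!f f'. [|f \<in> Arr C; f' \<in> Arr C; Dom C f = Dom C f'; Cod C f = Cod C f'; farr F f = farr F f'|] ==> f = f'"
  and "!!d. d \<in> Obj D ==> \<exists>x i. x \<in> Obj C & iso_in D i & Dom D i = fobj F x & Cod D i = d"
proof -
 obtain G \<eta> ep where F: "fnctr F" "fdom F = C" "fcod F = D" and G: "fnctr G" "fdom G = D" "fcod G = C"
  and \<eta>: "iso2 CAT \<eta>" "ndom \<eta> = fnct_comp G F" "ncod \<eta> = fnct_id C"
  and ep: "iso2 CAT ep" "ndom ep = fnct_comp F G" "ncod ep = fnct_id D"
  using assms unfolding equivalence1_def isomorphic1_def by auto
 interpret F: fnctr F by fact
 interpret G: fnctr G by fact
 interpret C: category C using F.category_fdom F by simp
 interpret D: category D using F.category_fcod F by simp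
 note ty [simp] = fnctr_ty[OF F] fnctr_ty[OF G]
 have en: "nat_trans \<eta>" "nat_trans ep" and ei: "!!x. x \<in> Obj C ==> iso_in C (ncmp \<eta> x)" "!!x. x \<in> Obj D ==> iso_in D (ncmp ep x)"
  using \<eta> ep by (auto simp: iso2_CAT F G)
 have eta [simp]: "x \<in> Obj C ==> ncmp \<eta> x \<in> Arr C" "x \<in> Obj C ==> Dom C (ncmp \<eta> x) = fobj G (fobj F x)"
   "x \<in> Obj C ==> Cod C (ncmp \<eta> x) = x" for x
  using ntr_ty(1-3)[OF en(1) \<eta>(2,3), of C C x] F G by simp_all
 have etan: "y \<in> Arr C ==> Cmp C (ncmp \<eta> (Cod C y)) (farr G (farr F y)) = Cmp C y (ncmp \<eta> (Dom C y))" for y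
  using ntr_ty(4)[OF en(1) \<eta>(2,3), of C C y] F G by simp
 have eps [simp]: "x \<in> Obj D ==> ncmp ep x \<in> Arr D" "x \<in> Obj D ==> Dom D (ncmp ep x) = fobj F (fobj G x)"
   "x \<in> Obj D ==> Cod D (ncmp ep x) = x" for x
  using ntr_ty(1-3)[OF en(2) ep(2,3), of D D x] F G by simp_all
 have epsn: "y \<in> Arr D ==> Cmp D (ncmp ep (Cod D y)) (farr F (farr G y)) = Cmp D y (ncmp ep (Dom D y))" for y
  using ntr_ty(4)[OF en(2) ep(2,3), of D D y] F G by simp
 have isoC: "\<exists>j. j \<in> Arr C & Dom C j = x & Cod C j = fobj G (fobj F x) & Cmp C j (ncmp \<eta> x) = Idn C (fobj G (fobj F x)) & Cmp C (ncmp \<eta> x) j = Idn C x"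
  if "x \<in> Obj C" for x using ei(1)[OF that] that unfolding iso_in_def by auto
 have isoD: "\<exists>j. j \<in> Arr D & Dom D j = x & Cod D j = fobj F (fobj G x) & Cmp D (ncmp ep x) j = Idn D x"
  if "x \<in> Obj D" for x using ei(2)[OF that] that unfolding iso_in_def by auto
 show faith: "f = f'" if f: "f \<in> Arr C" "f' \<in> Arr C" "Dom C f = Dom C f'" "Cod C f = Cod C f'" "farr F f = farr F f'" for f f'
 proof -
  obtain j where j: "j \<in> Arr C" "Dom C j = Dom C f" "Cod C j = fobj G (fobj F (Dom C f))" "Cmp C (ncmp \<eta> (Dom C f)) j = Idn C (Dom C f)"
   using isoC[of "Dom C f"] f by auto
  have "Cmp C (Cmp C f (ncmp \<eta> (Dom C f))) j = Cmp C (Cmp C f' (ncmp \<eta> (Dom C f))) j"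
   using etan[of f] etan[of f'] f by simp
  then show ?thesis using f j by (simp add: C.Cmp_assoc)
 qed
 have faithG: "g = g'" if f: "g \<in> Arr D" "g' \<in> Arr D" "Dom D g = Dom D g'" "Cod D g = Cod D g'" "farr G g = farr G g'" for g g'
 proof -
  obtain j where j: "j \<in> Arr D" "Dom D j = Dom D g" "Cod D j = fobj F (fobj G (Dom D g))" "Cmp D (ncmp ep (Dom D g)) j = Idn D (Dom D g)"
   using isoD[of "Dom D g"] f by auto
  have "Cmp D (Cmp D g (ncmp ep (Dom D g))) j = Cmp D (Cmp D g' (ncmp ep (Dom D g))) j"
   using epsn[of g] epsn[of g'] f by simp
  then show ?thesis using f j by (simp add: D.Cmp_assoc)
 qed
 show "\<exists>f. f \<in> Arr C & Dom C f = x & Cod C f = y & farr F f = g"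
  if g: "x \<in> Obj C" "y \<in> Obj C" "g \<in> Arr D" "Dom D g = fobj F x" "Cod D g = fobj F y" for x y g
 proof -
  obtain j where j: "j \<in> Arr C" "Dom C j = x" "Cod C j = fobj G (fobj F x)" "Cmp C j (ncmp \<eta> x) = Idn C (fobj G (fobj F x))"
   using isoC[of x] g by auto
  obtain k where k: "k \<in> Arr C" "Dom C k = y" "Cod C k = fobj G (fobj F y)" "Cmp C k (ncmp \<eta> y) = Idn C (fobj G (fobj F y))"
   using isoC[of y] g by auto
  define f where "f = Cmp C (ncmp \<eta> y) (Cmp C (farr G g) j)"
  have f: "f \<in> Arr C" "Dom C f = x" "Cod C f = y" unfolding f_def using g j by simp_all
  have "Cmp C (ncmp \<eta> y) (farr G (farr F f)) = Cmp C (ncmp \<eta> y) (farr G g)"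
   using etan[of f] f g j by (simp add: f_def C.Cmp_assoc)
  then have e: "Cmp C k (Cmp C (ncmp \<eta> y) (farr G (farr F f))) = Cmp C k (Cmp C (ncmp \<eta> y) (farr G g))" by simp
  have "Cmp C k (Cmp C (ncmp \<eta> y) w) = w" if "w \<in> Arr C" "Cod C w = fobj G (fobj F y)" for w
   using C.Cmp_assoc[of w "ncmp \<eta> y" k] k that g by simp
  then have "farr G (farr F f) = farr G g" using e f g by simp
  then have "farr F f = g" using faithG[of "farr F f" g] f g by simp
  then show ?thesis using f by blast
 qed
 show "\<exists>x i. x \<in> Obj C & iso_in D i & Dom D i = fobj F x & Cod D i = d" if "d \<in> Obj D" for d
  using that ei(2)[OF that] by (intro exI[of _ "fobj G d"] exI[of _ "ncmp ep d"]) simp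
qed

text \<open>The inverse functor sends \<open>d\<close> to a chosen \<open>p d\<close> with an
  isomorphism \<open>i d\<close> from \<open>F (p d)\<close> to \<open>d\<close>, and an arrow to
  the preimage of its conjugate by these. The other isomorphism consists of the preimages
  \<open>h x\<close> of \<open>i (F x)\<close>. Functoriality and naturality follow by
  faithfulness.\<close>

lemma CAT_equivalenceI:
 assumes F: "fnctr F" "fdom F = C" "fcod F = D"
  and full: "!!x y g. [|x \<in> Obj C; y \<in> Obj C; g \<in> Arr D; Dom D g = fobj F x; Cod D g = fobj F y|] ==>
   \<exists>f. f \<in> Arr C & Dom C f = x & Cod C f = y & farr F f = g"
  and faithful: "!!f f'. [|f \<in> Arr C; f' \<in> Arr C; Dom C f = Dom C f'; Cod C f = Cod C f'; farr F f = farr F f'|] ==> f = f'"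
  and eso: "!!d. d \<in> Obj D ==> \<exists>x i. x \<in> Obj C & iso_in D i & Dom D i = fobj F x & Cod D i = d"
 shows "equivalence1 CAT F C D"
proof -
 interpret F: fnctr F by fact
 interpret C: category C using F.category_fdom F by simp
 interpret D: category D using F.category_fcod F by simp
 note ty [simp] = fnctr_ty[OF F]
 from eso obtain p i where p [simp]: "!!d. d \<in> Obj D ==> p d \<in> Obj C" and i: "!!d. d \<in> Obj D ==> iso_in D (i d)"
  and id [simp]: "!!d. d \<in> Obj D ==> Dom D (i d) = fobj F (p d)" "!!d. d \<in> Obj D ==> Cod D (i d) = d" by metis
 have iA [simp]: "d \<in> Obj D ==> i d \<in> Arr D" for d using i iso_in_Arr by metis
 have "\<exists>j. j \<in> Arr D & Dom D j = d & Cod D j = fobj F (p d) & Cmp D j (i d) = Idn D (fobj F (p d)) & Cmp D (i d) j = Idn D d"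
  if "d \<in> Obj D" for d using i[OF that] that unfolding iso_in_def by auto
 then obtain j where j [simp]: "!!d. d \<in> Obj D ==> j d \<in> Arr D" "!!d. d \<in> Obj D ==> Dom D (j d) = d" "!!d. d \<in> Obj D ==> Cod D (j d) = fobj F (p d)"
  "!!d. d \<in> Obj D ==> Cmp D (j d) (i d) = Idn D (fobj F (p d))" "!!d. d \<in> Obj D ==> Cmp D (i d) (j d) = Idn D d" by metis
 have ji: "d \<in> Obj D ==> iso_in D (j d)" for d by (rule D.iso_inI[of _ "i d"]) simp_all
 have c: "Cmp D (i d) (Cmp D (j d) w) = w" "d' \<in> Obj D ==> Cod D w' = fobj F (p d') ==> w' \<in> Arr D ==> Cmp D (j d') (Cmp D (i d') w') = w'"
  if "d \<in> Obj D" "w \<in> Arr D" "Cod D w = d" for d w d' w'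
  using that by (simp_all add: D.Cmp_assoc[symmetric])
 have "\<exists>f. f \<in> Arr C & Dom C f = p (Dom D m) & Cod C f = p (Cod D m) & farr F f = Cmp D (j (Cod D m)) (Cmp D m (i (Dom D m)))" if "m \<in> Arr D" for m
  by (rule full) (use that in simp_all)
 then obtain q where q [simp]: "!!m. m \<in> Arr D ==> q m \<in> Arr C" "!!m. m \<in> Arr D ==> Dom C (q m) = p (Dom D m)" "!!m. m \<in> Arr D ==> Cod C (q m) = p (Cod D m)"
  "!!m. m \<in> Arr D ==> farr F (q m) = Cmp D (j (Cod D m)) (Cmp D m (i (Dom D m)))" by metis
 define G where "G = \<lparr>fdom = D, fcod = C, fobj = restrict p (Obj D), farr = restrict q (Arr D)\<rparr>"
 have G [simp]: "fdom G = D" "fcod G = C" "!!d. d \<in> Obj D ==> fobj G d = p d" "!!m. m \<in> Arr D ==> farr G m = q m" by (simp_all add: G_def)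
 have Gf: "fnctr G"
 proof (rule fnctr.intro, goal_cases)
  case (9 x)
  then have [simp]: "x \<in> Obj D" by simp
  show ?case by (simp, rule faithful) simp_all
 next
  case (10 f g)
  then have [simp]: "f \<in> Arr D" "g \<in> Arr D" "Dom D g = Cod D f" by simp_all
  show ?case
   by (simp, rule faithful) (simp_all add: D.Cmp_assoc c[of "Cod D f" _ ])
 qed (simp_all add: C.category_axioms D.category_axioms, simp_all add: G_def)
 define ep where "ep = \<lparr>ndom = fnct_comp F G, ncod = fnct_id D, ncmp = restrict i (Obj D)\<rparr>"
 have e: "nat_trans ep"
  by (rule nat_trans.intro) (simp_all add: ep_def F Gf D.category_axioms c)
 then have e1: "isomorphic1 CAT (fnct_comp F G) (fnct_id D)"
  unfolding isomorphic1_def by (intro exI[of _ ep]) (auto simp: iso2_CAT ep_def F i)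
 have "\<exists>f. f \<in> Arr C & Dom C f = p (fobj F x) & Cod C f = x & farr F f = i (fobj F x)" if "x \<in> Obj C" for x
  by (rule full) (use that in simp_all)
 then obtain h where h [simp]: "!!x. x \<in> Obj C ==> h x \<in> Arr C" "!!x. x \<in> Obj C ==> Dom C (h x) = p (fobj F x)" "!!x. x \<in> Obj C ==> Cod C (h x) = x"
   "!!x. x \<in> Obj C ==> farr F (h x) = i (fobj F x)" by metis
 have hi: "iso_in C (h x)" if [simp]: "x \<in> Obj C" for x
 proof -
  obtain k where k: "k \<in> Arr C" "Dom C k = x" "Cod C k = p (fobj F x)" "farr F k = j (fobj F x)"
   using full[of x "p (fobj F x)" "j (fobj F x)"] by auto
  have "Cmp C k (h x) = Idn C (p (fobj F x))" by (rule faithful) (use k in simp_all)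
  moreover have "Cmp C (h x) k = Idn C x" by (rule faithful) (use k in simp_all)
  ultimately show ?thesis by (intro C.iso_inI[of _ k]) (use k in simp_all)
 qed
 define \<eta> where "\<eta> = \<lparr>ndom = fnct_comp G F, ncod = fnct_id C, ncmp = restrict h (Obj C)\<rparr>"
 have n: "nat_trans \<eta>"
 proof (rule nat_trans.intro, goal_cases)
  case (9 f)
  then have [simp]: "f \<in> Arr C" by (simp add: \<eta>_def F)
  have "Cmp C (h (Cod C f)) (q (farr F f)) = Cmp C f (h (Dom C f))"
   by (rule faithful) (simp_all add: c[of "fobj F (Cod C f)"])
  then show ?case by (simp add: \<eta>_def F)
 qed (simp_all add: \<eta>_def F Gf C.category_axioms)
 then have "isomorphic1 CAT (fnct_comp G F) (fnct_id C)"
  unfolding isomorphic1_def by (intro exI[of _ \<eta>]) (auto simp: iso2_CAT \<eta>_def F hi)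
 then show ?thesis unfolding equivalence1_def using e1 F Gf by (auto intro!: bexI[of _ G])
qed

section \<open>Universal cones indexed by the 1-cells from b to t a\<close>

text \<open>
 A family of cones \<open>lam a f : L (src f) \<rightarrow> \<A> a\<close> for \<open>f : b \<rightarrow> t a\<close>, compatible with
 morphisms \<open>u\<close> of \<open>A\<close> and with precomposition by morphisms \<open>g\<close> of \<open>B\<close>.
\<close>

locale bimodule_cone = \<A>: pseudofunctor A H \<A> + t: pseudofunctor A B t + L: pseudofunctor B H L
 for A :: "('a0, 'a1, 'a2) twocat" and H :: "('h0, 'h1, 'h2) twocat" and \<A>
  and B :: "('b0, 'b1, 'b2) twocat" and t L +
 fixes lam :: "'a0 => 'b1 => 'h1" and lam2 :: "'a0 => 'b2 => 'h2" and lamu :: "'a1 => 'b1 => 'h2"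
  and lamg :: "'a0 => 'b1 => 'b1 => 'h2"
 assumes lam_typing [simp]:
   "[|a \<in> Ob A; f \<in> Mor B; trg B f = psf0 t a|] ==> lam a f \<in> Mor H"
   "[|a \<in> Ob A; f \<in> Mor B; trg B f = psf0 t a|] ==> src H (lam a f) = psf0 L (src B f)"
   "[|a \<in> Ob A; f \<in> Mor B; trg B f = psf0 t a|] ==> trg H (lam a f) = psf0 \<A> a"
  and lam2_typing [simp]:
   "[|a \<in> Ob A; xi \<in> Cell B; trg B (dom2 B xi) = psf0 t a|] ==> lam2 a xi \<in> Cell H"
   "[|a \<in> Ob A; xi \<in> Cell B; trg B (dom2 B xi) = psf0 t a|] ==> dom2 H (lam2 a xi) = lam a (dom2 B xi)"
   "[|a \<in> Ob A; xi \<in> Cell B; trg B (dom2 B xi) = psf0 t a|] ==> cod2 H (lam2 a xi) = lam a (cod2 B xi)"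
  and lam2_id2 [simp]: "[|a \<in> Ob A; f \<in> Mor B; trg B f = psf0 t a|] ==> lam2 a (id2 B f) = id2 H (lam a f)"
  and lam2_vcomp: "[|a \<in> Ob A; xi \<in> Cell B; xi' \<in> Cell B; trg B (dom2 B xi) = psf0 t a; dom2 B xi' = cod2 B xi|] ==>
   lam2 a (xi' #{B} xi) = lam2 a xi' #{H} lam2 a xi"
  and lamu_typing [simp]:
   "[|u \<in> Mor A; f \<in> Mor B; trg B f = psf0 t (src A u)|] ==> iso2 H (lamu u f)"
   "[|u \<in> Mor A; f \<in> Mor B; trg B f = psf0 t (src A u)|] ==> lamu u f \<in> Cell H"
   "[|u \<in> Mor A; f \<in> Mor B; trg B f = psf0 t (src A u)|] ==> dom2 H (lamu u f) = psf1 \<A> u o{H} lam (src A u) f"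
   "[|u \<in> Mor A; f \<in> Mor B; trg B f = psf0 t (src A u)|] ==> cod2 H (lamu u f) = lam (trg A u) (psf1 t u o{B} f)"
  and lamu_natural: "[|u \<in> Mor A; xi \<in> Cell B; trg B (dom2 B xi) = psf0 t (src A u)|] ==>
   lamu u (cod2 B xi) #{H} (id2 H (psf1 \<A> u) *{H} lam2 (src A u) xi) = lam2 (trg A u) (id2 B (psf1 t u) *{B} xi) #{H} lamu u (dom2 B xi)"
  and lamu_cell: "[|x \<in> Cell A; f \<in> Mor B; trg B f = psf0 t (src A (dom2 A x))|] ==>
   lamu (cod2 A x) f #{H} (psf2 \<A> x *{H} id2 H (lam (src A (dom2 A x)) f)) =
   lam2 (trg A (dom2 A x)) (psf2 t x *{B} id2 B f) #{H} lamu (dom2 A x) f"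
  and lamu_comp: "[|u \<in> Mor A; v \<in> Mor A; src A v = trg A u; f \<in> Mor B; trg B f = psf0 t (src A u)|] ==>
   lamu (v o{A} u) f #{H} (psfc \<A> v u *{H} id2 H (lam (src A u) f)) =
   lam2 (trg A v) (psfc t v u *{B} id2 B f) #{H} lamu v (psf1 t u o{B} f) #{H} (id2 H (psf1 \<A> v) *{H} lamu u f)"
  and lamu_unit: "[|a \<in> Ob A; f \<in> Mor B; trg B f = psf0 t a|] ==>
   lamu (id1 A a) f #{H} (psfu \<A> a *{H} id2 H (lam a f)) = lam2 a (psfu t a *{B} id2 B f)"
  and lamg_typing [simp]:
   "[|a \<in> Ob A; f \<in> Mor B; g \<in> Mor B; src B f = trg B g; trg B f = psf0 t a|] ==> iso2 H (lamg a f g)"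
   "[|a \<in> Ob A; f \<in> Mor B; g \<in> Mor B; src B f = trg B g; trg B f = psf0 t a|] ==> lamg a f g \<in> Cell H"
   "[|a \<in> Ob A; f \<in> Mor B; g \<in> Mor B; src B f = trg B g; trg B f = psf0 t a|] ==> dom2 H (lamg a f g) = lam a f o{H} psf1 L g"
   "[|a \<in> Ob A; f \<in> Mor B; g \<in> Mor B; src B f = trg B g; trg B f = psf0 t a|] ==> cod2 H (lamg a f g) = lam a (f o{B} g)"
  and lamg_natural: "[|a \<in> Ob A; xi \<in> Cell B; xi' \<in> Cell B; src B (dom2 B xi) = trg B (dom2 B xi'); trg B (dom2 B xi) = psf0 t a|] ==>
   lamg a (cod2 B xi) (cod2 B xi') #{H} (lam2 a xi *{H} psf2 L xi') = lam2 a (xi *{B} xi') #{H} lamg a (dom2 B xi) (dom2 B xi')"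
  and lamg_assoc: "[|a \<in> Ob A; f \<in> Mor B; g \<in> Mor B; g' \<in> Mor B; src B f = trg B g'; src B g' = trg B g; trg B f = psf0 t a|] ==>
   lamg a f (g' o{B} g) #{H} (id2 H (lam a f) *{H} psfc L g' g) = lamg a (f o{B} g') g #{H} (lamg a f g' *{H} id2 H (psf1 L g))"
  and lamg_unit: "[|a \<in> Ob A; f \<in> Mor B; trg B f = psf0 t a|] ==>
   lamg a f (id1 B (src B f)) #{H} (id2 H (lam a f) *{H} psfu L (src B f)) = id2 H (lam a f)"
  and lamu_lamg: "[|u \<in> Mor A; f \<in> Mor B; g \<in> Mor B; src B f = trg B g; trg B f = psf0 t (src A u)|] ==>
   lamu u (f o{B} g) #{H} (id2 H (psf1 \<A> u) *{H} lamg (src A u) f g) =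
   lamg (trg A u) (psf1 t u o{B} f) g #{H} (lamu u f *{H} id2 H (psf1 L g))"
begin

text \<open>Fixing the domain \<open>b\<close> of \<open>f\<close> leaves a cone of weight
  \<open>B(b, t -)\<close> with vertex \<open>L b\<close>, to which the pointwise universal property
  applies.\<close>

lemma cone_hpnt:
 assumes b [simp]: "b \<in> Ob B"
 shows "hpnt A (psf_comp A CAT (rep B b) t) (psf_comp A CAT (rep H (psf0 L b)) \<A>) lam lam2 lamu"
proof -
 interpret W: rep_along A B t b by unfold_locales simp
 interpret Q: rep_along A H \<A> "psf0 L b" by unfold_locales simp
 show ?thesis
  by (rule hpnt.intro[OF W.Q_simps(1) Q.Q_simps(1)], rule hpnt_axioms.intro)
   (auto simp: lam2_vcomp lamu_natural lamu_cell lamu_comp lamu_unit \<A>.H.iso_in_homcat composable_def)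
qed

end

text \<open>The equivalence between H(X, L b) and the cones with vertex X, made explicit as h
  \<mapsto> \<open>lam a f \<odot> h\<close>: it is full and faithful on 2-cells, and every cone is
  isomorphic to one of this form. The first two conditions are stated purely in H; a cone enters the
  third only through its \<open>hpnt\<close> data.\<close>

locale universal_cone = bimodule_cone +
 assumes full: "[|b \<in> Ob B; h \<in> Mor H; h' \<in> Mor H; src H h' = src H h; trg H h = psf0 L b; trg H h' = psf0 L b;
   !!a f. [|a \<in> Ob A; f \<in> Mor B; src B f = b; trg B f = psf0 t a|] ==>
     m a f \<in> Cell H & dom2 H (m a f) = lam a f o{H} h & cod2 H (m a f) = lam a f o{H} h';
   !!a xi. [|a \<in> Ob A; xi \<in> Cell B; src B (dom2 B xi) = b; trg B (dom2 B xi) = psf0 t a|] ==>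
     m a (cod2 B xi) #{H} (lam2 a xi *{H} id2 H h) = (lam2 a xi *{H} id2 H h') #{H} m a (dom2 B xi);
   !!u f. [|u \<in> Mor A; f \<in> Mor B; src B f = b; trg B f = psf0 t (src A u)|] ==>
     (lamu u f *{H} id2 H h') #{H} (id2 H (psf1 \<A> u) *{H} m (src A u) f) = m (trg A u) (psf1 t u o{B} f) #{H} (lamu u f *{H} id2 H h)|] ==>
   \<exists>th. th \<in> Cell H & dom2 H th = h & cod2 H th = h' &
    (\<forall>a\<in>Ob A. \<forall>f\<in>Mor B. src B f = b & trg B f = psf0 t a --> m a f = id2 H (lam a f) *{H} th)"
  and faithful: "[|b \<in> Ob B; th \<in> Cell H; th' \<in> Cell H; dom2 H th = dom2 H th'; cod2 H th = cod2 H th'; trg H (dom2 H th) = psf0 L b;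
   !!a f. [|a \<in> Ob A; f \<in> Mor B; src B f = b; trg B f = psf0 t a|] ==> id2 H (lam a f) *{H} th = id2 H (lam a f) *{H} th'|] ==>
   th = th'"
  and representable: "[|b \<in> Ob B; X \<in> Ob H; hpnt A (psf_comp A CAT (rep B b) t) (psf_comp A CAT (rep H X) \<A>) x x2 xu|] ==>
   \<exists>h k. h \<in> Mor H & src H h = X & trg H h = psf0 L b &
    (\<forall>a\<in>Ob A. \<forall>f\<in>Mor B. src B f = b & trg B f = psf0 t a --> iso2 H (k a f) & dom2 H (k a f) = lam a f o{H} h & cod2 H (k a f) = x a f) &
    (\<forall>a\<in>Ob A. \<forall>xi\<in>Cell B. src B (dom2 B xi) = b & trg B (dom2 B xi) = psf0 t a -->
     k a (cod2 B xi) #{H} (lam2 a xi *{H} id2 H h) = x2 a xi #{H} k a (dom2 B xi)) &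
    (\<forall>u\<in>Mor A. \<forall>f\<in>Mor B. src B f = b & trg B f = psf0 t (src A u) -->
     xu u f #{H} (id2 H (psf1 \<A> u) *{H} k (src A u) f) = k (trg A u) (psf1 t u o{B} f) #{H} (lamu u f *{H} id2 H h))"

section \<open>A single bilimit: cones classified by 1-cells\<close>

locale bilim_cone = \<A>: pseudofunctor A H \<A> + W: pseudofunctor A CAT W +
 ph: hetero_pnt "op2 H" "rep (op2 H) l" "cones A H W \<A>" ph
 for A :: "('a0, 'a1, 'a2) twocat" and H :: "('h0, 'h1, 'h2) twocat" and \<A>
  and W :: "('a0, 'a1, 'a2, ('u, 'v) cat, ('u, 'v) fnct, ('u, 'v) ntr) psf" and l ph +
 assumes l_Ob [simp]: "l \<in> Ob H"
begin

sublocale op: two_category "op2 H" by (rule \<A>.H.two_category_op2)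
sublocale P: two_category "PS A CAT" by (simp add: \<A>.A.two_category_axioms two_category_CAT)

text \<open>\<open>c h\<close> is the cone that the transformation \<open>ph\<close> assigns to
  \<open>h\<close>, \<open>T th\<close> the morphism of cones it assigns to a 2-cell, and
  \<open>K k h\<close> the invertible comparison from \<open>c h\<close>, restricted along
  \<open>k\<close>, to \<open>c (h \<odot> k)\<close>.\<close>

abbreviation "c h \<equiv> ho ph (src H h) h"
abbreviation "T th \<equiv> ha ph (src H (dom2 H th)) th"
abbreviation "K k h \<equiv> hn ph k h"

abbreviation "Q X \<equiv> psf_comp A CAT (rep H X) \<A>"
abbreviation "CC X \<equiv> homcat (PS A CAT) (psf_comp A CAT in_left W) (psf_comp A CAT in_right (Q X))"

lemma cones_simps [simp]:
 "X \<in> Ob H ==> psf0 (cones A H W \<A>) X = CC X"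
 "k \<in> Mor H ==> psf1 (cones A H W \<A>) k = rep_fnct (PS A CAT) (psf_comp A CAT in_left W) (hpost A \<A> H k)"
 "xi \<in> Cell H ==> psf2 (cones A H W \<A>) xi = rep_ntr (PS A CAT) (psf_comp A CAT in_left W) (hpost2 A \<A> H xi)"
 "k \<in> Mor H ==> k' \<in> Mor H ==> trg H k' = src H k ==> psfc (cones A H W \<A>) k' k =
   ntr_id (rep_fnct (PS A CAT) (psf_comp A CAT in_left W) (hpost A \<A> H (k o{H} k')))"
 "X \<in> Ob H ==> psfu (cones A H W \<A>) X = ntr_id (rep_fnct (PS A CAT) (psf_comp A CAT in_left W) (hpost A \<A> H (id1 H X)))"
 using cones_strict(2)[OF \<A>.pseudofunctor_axioms W.pseudofunctor_axioms] by simp_all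

lemma rep_along_X: "X \<in> Ob H ==> rep_along A H \<A> X"
 by unfold_locales simp

lemma cone_in_c: assumes [simp]: "h \<in> Mor H" "trg H h = l" "src H h = X" shows "cone_in A H \<A> X W (c h)"
proof -
 have X: "X \<in> Ob H" using \<A>.H.src_Ob[of h] by simp
 have "c h \<in> Obj (CC (src H h))" using ph.ho_fobj(2)[of "src H h" h] by (simp add: X)
 then show ?thesis using X
  by (simp add: cone_in_def hetero_pnt_def hetero_pnt_axioms_def rep_along_X W.pseudofunctor_axioms rep_along.Q_simps)
qed

lemma cone_mdf_T:
 assumes [simp]: "th \<in> Cell H" "trg H (dom2 H th) = l" "src H h = X" "dom2 H th = h" "cod2 H th = h'"
 shows "cone_mdf A H \<A> X W (c h) (c h') (T th)"
proof -
 have X: "X \<in> Ob H" using \<A>.H.src_Ob[of h] \<A>.H.dom2_Mor[of th] by simp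
 have h [simp]: "h \<in> Mor H" "h' \<in> Mor H" "src H h = X" "src H h' = X" "trg H h = l" "trg H h' = l"
  using assms \<A>.H.dom2_Mor[of th] \<A>.H.cod2_Mor[of th] \<A>.H.src_cod2[of th] \<A>.H.trg_cod2[of th] by simp_all
 have "T th \<in> Arr (CC X)" using ph.ha_farr(2)[of X th] by (simp add: X)
 moreover have "mdom (T th) = c h" "mcod (T th) = c h'"
  using hpnt.ra_Dom[OF ph.hpnt, of X th] hpnt.ra_Cod[OF ph.hpnt, of X th] by (simp_all add: X)
 ultimately show ?thesis
  using cone_in_c[of h X] cone_in_c[of h' X] by (simp add: cone_mdf_def cone_mdf_axioms_def)
qed

lemma cone_mdf_K:
 assumes [simp]: "h \<in> Mor H" "trg H h = l" "k \<in> Mor H" "trg H k = src H h"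
 shows "cone_mdf A H \<A> (src H k) W (pnt_comp A CAT (hpost A \<A> H k) (c h)) (c (h o{H} k)) (K k h)" (is "PROP ?C0")
  "iso2 (PS A CAT) (K k h)"
proof -
 have "K k h \<in> Arr (CC (src H k))" using ph.hn_ncmp(2)[of k h] by simp
 moreover have c: "c h \<in> Obj (CC (src H h))" using ph.ho_fobj(2)[of "src H h" h] by simp
 moreover have d: "mdom (K k h) = pnt_comp A CAT (hpost A \<A> H k) (c h)" "mcod (K k h) = c (h o{H} k)"
  using hpnt.n_Dom[OF ph.hpnt, of k h] hpnt.n_Cod[OF ph.hpnt, of k h] c by simp_all
 moreover have "cone_in A H \<A> (src H k) W (pnt_comp A CAT (hpost A \<A> H k) (c h))"
  by (rule cone_in.cone_in_hpost[where X = "src H h"]) (simp_all add: cone_in_c)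
 ultimately show "PROP ?C0"
  by (simp add: cone_mdf_def cone_mdf_axioms_def cone_in_c[of "h o{H} k" "src H k", simplified])
 have "iso_in (CC (src H k)) (K k h)" using hpnt.n_iso[OF ph.hpnt, of k h] by simp
 moreover have "K k h \<in> Arr (CC (src H k))" using ph.hn_ncmp(2)[of k h] by simp
 ultimately show "iso2 (PS A CAT) (K k h)"
  using P.iso_in_homcat[of "K k h"] by simp
qed

lemma T_eqs:
 "h \<in> Mor H ==> trg H h = l ==> T (id2 H h) = mdf_id A CAT (c h)"
 "th \<in> Cell H ==> th' \<in> Cell H ==> trg H (dom2 H th) = l ==> dom2 H th' = cod2 H th ==> T (th' #{H} th) = mdf_vcomp A CAT (T th') (T th)"
 using hpnt.ra_Idn[OF ph.hpnt, of "src H h" h] hpnt.ra_Cmp[OF ph.hpnt, of "src H (dom2 H th)" th th']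
 by simp_all

text \<open>These are the axioms of \<open>ph\<close>. The representable and the cone pseudofunctor
  are strict, so the structure cells occurring in them are identities; removing those leaves
  \<open>K\<close> natural and multiplicative.\<close>

lemma K_eqs:
 assumes [simp]: "h \<in> Mor H" "trg H h = l"
 shows "k \<in> Mor H ==> th \<in> Cell H ==> dom2 H th = h ==> trg H k = src H h ==>
   mdf_vcomp A CAT (K k (cod2 H th)) (mdf_hcomp A CAT (mdf_id A CAT (hpost A \<A> H k)) (T th)) =
   mdf_vcomp A CAT (T (th *{H} id2 H k)) (K k h)" (is "PROP ?C0")
 "xi \<in> Cell H ==> trg H (dom2 H xi) = src H h ==>
   mdf_vcomp A CAT (K (cod2 H xi) h) (mdf_hcomp A CAT (hpost2 A \<A> H xi) (mdf_id A CAT (c h))) =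
   mdf_vcomp A CAT (T (id2 H h *{H} xi)) (K (dom2 H xi) h)" (is "PROP ?C1")
 "k \<in> Mor H ==> k' \<in> Mor H ==> trg H k = src H h ==> trg H k' = src H k ==>
   K (k o{H} k') h = mdf_vcomp A CAT (K k' (h o{H} k)) (mdf_hcomp A CAT (mdf_id A CAT (hpost A \<A> H k')) (K k h))"
 "K (id1 H (src H h)) h = mdf_id A CAT (c h)" (is "PROP ?C3")
proof -
 have c: "c h \<in> Obj (CC (src H h))" using ph.ho_fobj(2)[of "src H h" h] by simp
 show "PROP ?C0"
  using hpnt.n_nat[OF ph.hpnt, of k th] cone_mdf.axioms(3)[OF cone_mdf_T[OF _ _ refl refl refl, of th]]
   cone_mdf.mdom_c[OF cone_mdf_T[OF _ _ refl refl refl, of th]] c by simp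
 show "PROP ?C1"
  using hpnt.n_cell[OF ph.hpnt, of xi h] c by simp
 show "K (k o{H} k') h = mdf_vcomp A CAT (K k' (h o{H} k)) (mdf_hcomp A CAT (mdf_id A CAT (hpost A \<A> H k')) (K k h))"
  if [simp]: "k \<in> Mor H" "k' \<in> Mor H" "trg H k = src H h" "trg H k' = src H k"
 proof -
  interpret kc: cone_mdf A H \<A> "src H (k o{H} k')" W "pnt_comp A CAT (hpost A \<A> H (k o{H} k')) (c h)" "c (h o{H} k o{H} k')" "K (k o{H} k') h"
   using cone_mdf_K(1)[of h "k o{H} k'"] by simp
  interpret k: cone_mdf A H \<A> "src H k" W "pnt_comp A CAT (hpost A \<A> H k) (c h)" "c (h o{H} k)" "K k h"
   using cone_mdf_K(1)[of h k] by simp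
  have [simp]: "modification A CAT (K (k o{H} k') h)" "modification A CAT (K k h)" by (simp_all add: kc.modification_axioms k.modification_axioms)
  interpret ch: cone_in A H \<A> "src H h" W "c h" by (simp add: cone_in_c)
  interpret k'c: cone_mdf A H \<A> "src H k'" W "pnt_comp A CAT (hpost A \<A> H k') (c (h o{H} k))" "c (h o{H} k o{H} k')" "K k' (h o{H} k)"
   using cone_mdf_K(1)[of "h o{H} k" k'] by (simp add: \<A>.H.comp1_assoc')
  have [simp]: "modification A CAT (K k' (h o{H} k))" by (simp_all add: k'c.modification_axioms)
  \<comment> \<open>The composition law of \<open>ph\<close> before the identity 2-cells contributed
    by the two strict pseudofunctors are cancelled.\<close>
  have 1: "K (k o{H} k') h #{PS A CAT} id2 (PS A CAT) (pnt_comp A CAT (hpost A \<A> H (k o{H} k')) (c h)) =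
   T (id2 H (h o{H} (k o{H} k'))) #{PS A CAT} (K k' (h o{H} k) #{PS A CAT} mdf_hcomp A CAT (mdf_id A CAT (hpost A \<A> H k')) (K k h))"
   using hpnt.n_comp[OF ph.hpnt, of k' k h] c by (simp add: P.vcomp_assoc)
  show ?thesis
   using 1 T_eqs(1)[of "h o{H} k o{H} k'"] P.vcomp_id2(1)[of "K (k o{H} k') h"]
    P.vcomp_id2(2)[of "mdf_vcomp A CAT (K k' (h o{H} k)) (mdf_hcomp A CAT (mdf_id A CAT (hpost A \<A> H k')) (K k h))"] by simp
 qed
 interpret k: cone_mdf A H \<A> "src H h" W "pnt_comp A CAT (hpost A \<A> H (id1 H (src H h))) (c h)" "c h" "K (id1 H (src H h)) h"
  using cone_mdf_K(1)[of h "id1 H (src H h)"] by simp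
 have [simp]: "modification A CAT (K (id1 H (src H h)) h)" by (simp add: k.modification_axioms)
 show "PROP ?C3"
  using hpnt.n_id[OF ph.hpnt, of "src H h" h] c T_eqs(1)[of h] P.vcomp_id2(1)[of "K (id1 H (src H h)) h"] by simp
qed

lemma T_simps [simp]:
 assumes [simp]: "th \<in> Cell H" "trg H (dom2 H th) = l" and X: "src H (dom2 H th) = X" and [simp]: "a \<in> Ob A" "f \<in> Obj (psf0 W a)"
 shows "hm (ha ph X th) a f \<in> Cell H" (is "PROP ?C0") "dom2 H (hm (ha ph X th) a f) = ho (ho ph X (dom2 H th)) a f" (is "PROP ?C1")
  "cod2 H (hm (ha ph X th) a f) = ho (ho ph X (cod2 H th)) a f" (is "PROP ?C2")
proof -
 interpret cone_mdf A H \<A> "src H (dom2 H th)" W "c (dom2 H th)" "c (cod2 H th)" "T th"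
  by (rule cone_mdf_T) simp_all
 show "PROP ?C0" "PROP ?C1"
  "PROP ?C2" using X by auto
qed

lemma c_simps [simp]:
 assumes [simp]: "h \<in> Mor H" "trg H h = l" and X: "src H h = X" and [simp]: "a \<in> Ob A" "f \<in> Obj (psf0 W a)"
 shows "ho (ho ph X h) a f \<in> Mor H" (is "PROP ?C0") "src H (ho (ho ph X h) a f) = X" (is "PROP ?C1") "trg H (ho (ho ph X h) a f) = psf0 \<A> a" (is "PROP ?C2")
proof -
 interpret cone_in A H \<A> X W "c h" by (rule cone_in_c) (simp_all add: X)
 show "PROP ?C0" "PROP ?C1" "PROP ?C2" using X by auto
qed

lemma c_simps2 [simp]:
 assumes [simp]: "h \<in> Mor H" "trg H h = l" and X: "src H h = X"
 shows "a \<in> Ob A ==> xi \<in> Arr (psf0 W a) ==> ha (ho ph X h) a xi \<in> Cell H" (is "PROP ?C0")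
  "a \<in> Ob A ==> xi \<in> Arr (psf0 W a) ==> dom2 H (ha (ho ph X h) a xi) = ho (ho ph X h) a (Dom (psf0 W a) xi)" (is "PROP ?C1")
  "a \<in> Ob A ==> xi \<in> Arr (psf0 W a) ==> cod2 H (ha (ho ph X h) a xi) = ho (ho ph X h) a (Cod (psf0 W a) xi)" (is "PROP ?C2")
  "u \<in> Mor A ==> f \<in> Obj (psf0 W (src A u)) ==> hn (ho ph X h) u f \<in> Cell H" (is "PROP ?C3")
  "u \<in> Mor A ==> f \<in> Obj (psf0 W (src A u)) ==> iso2 H (hn (ho ph X h) u f)" (is "PROP ?C4")
  "u \<in> Mor A ==> f \<in> Obj (psf0 W (src A u)) ==> dom2 H (hn (ho ph X h) u f) = psf1 \<A> u o{H} ho (ho ph X h) (src A u) f" (is "PROP ?C5")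
  "u \<in> Mor A ==> f \<in> Obj (psf0 W (src A u)) ==> cod2 H (hn (ho ph X h) u f) = ho (ho ph X h) (trg A u) (fobj (psf1 W u) f)" (is "PROP ?C6")
proof -
 interpret cone_in A H \<A> X W "c h" by (rule cone_in_c) (simp_all add: X)
 show "PROP ?C0"
  "PROP ?C1"
  "PROP ?C2"
  "PROP ?C3"
  "PROP ?C4"
  "PROP ?C5"
  "PROP ?C6"
  using X by auto
qed

lemma K_simps [simp]:
 assumes [simp]: "h \<in> Mor H" "trg H h = l" "k \<in> Mor H" "trg H k = src H h" "a \<in> Ob A" "f \<in> Obj (psf0 W a)"
 shows "hm (K k h) a f \<in> Cell H" (is "PROP ?C0") "dom2 H (hm (K k h) a f) = ho (c h) a f o{H} k" (is "PROP ?C1")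
  "cod2 H (hm (K k h) a f) = ho (ho ph (src H k) (h o{H} k)) a f" (is "PROP ?C2") "iso2 H (hm (K k h) a f)"
proof -
 interpret c0: cone_in A H \<A> "src H h" W "c h" by (rule cone_in_c) simp_all
 interpret cone_mdf A H \<A> "src H k" W "pnt_comp A CAT (hpost A \<A> H k) (c h)" "ho ph (src H k) (h o{H} k)" "K k h"
  using cone_mdf_K(1)[of h k] by simp
 show "PROP ?C0" "PROP ?C1"
  "PROP ?C2" "iso2 H (hm (K k h) a f)"
  using hm_iso cone_mdf_K(2)[of h k] by simp_all
qed

lemma K_cone:
 assumes [simp]: "h \<in> Mor H" "trg H h = l" "k \<in> Mor H" "trg H k = src H h"
 shows "a \<in> Ob A ==> xi \<in> Arr (psf0 W a) ==>
  hm (K k h) a (Cod (psf0 W a) xi) #{H} (ha (c h) a xi *{H} id2 H k) = ha (ho ph (src H k) (h o{H} k)) a xi #{H} hm (K k h) a (Dom (psf0 W a) xi)" (is "PROP ?C0")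
  "u \<in> Mor A ==> f \<in> Obj (psf0 W (src A u)) ==>
  hn (ho ph (src H k) (h o{H} k)) u f #{H} (id2 H (psf1 \<A> u) *{H} hm (K k h) (src A u) f) =
  hm (K k h) (trg A u) (fobj (psf1 W u) f) #{H} (hn (c h) u f *{H} id2 H k)" (is "PROP ?C1")
proof -
 interpret c0: cone_in A H \<A> "src H h" W "c h" by (rule cone_in_c) simp_all
 interpret cone_mdf A H \<A> "src H k" W "pnt_comp A CAT (hpost A \<A> H k) (c h)" "ho ph (src H k) (h o{H} k)" "K k h"
  using cone_mdf_K(1)[of h k] by simp
 show "PROP ?C0"
  "PROP ?C1"
  using mdf_eqs(1)[of a xi] mdf_eqs(2)[of u f] by simp_all
qed

lemma K_nat:
 assumes [simp]: "h \<in> Mor H" "trg H h = l" "a \<in> Ob A" "f \<in> Obj (psf0 W a)"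
 shows "k \<in> Mor H ==> th \<in> Cell H ==> dom2 H th = h ==> trg H k = src H h ==>
   hm (K k (cod2 H th)) a f #{H} (hm (T th) a f *{H} id2 H k) = hm (ha ph (src H k) (th *{H} id2 H k)) a f #{H} hm (K k h) a f"
 "xi \<in> Cell H ==> trg H (dom2 H xi) = src H h ==>
   hm (K (cod2 H xi) h) a f #{H} (id2 H (ho (c h) a f) *{H} xi) = hm (ha ph (src H (dom2 H xi)) (id2 H h *{H} xi)) a f #{H} hm (K (dom2 H xi) h) a f"
 "k \<in> Mor H ==> k' \<in> Mor H ==> trg H k = src H h ==> trg H k' = src H k ==>
   hm (K (k o{H} k') h) a f = hm (K k' (h o{H} k)) a f #{H} (hm (K k h) a f *{H} id2 H k')"
 "hm (K (id1 H (src H h)) h) a f = id2 H (ho (c h) a f)" (is "PROP ?C3")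
proof -
 interpret c: cone_in A H \<A> "src H h" W "c h" by (rule cone_in_c) simp_all
 show "hm (K k (cod2 H th)) a f #{H} (hm (T th) a f *{H} id2 H k) = hm (ha ph (src H k) (th *{H} id2 H k)) a f #{H} hm (K k h) a f"
  if [simp]: "k \<in> Mor H" "th \<in> Cell H" "dom2 H th = h" "trg H k = src H h"
 proof -
  have t: "trg H (cod2 H th) = l" "src H (cod2 H th) = src H h" by (simp_all add: \<A>.H.src_cod2 \<A>.H.trg_cod2)
  interpret t: cone_mdf A H \<A> "src H h" W "c h" "c (cod2 H th)" "ha ph (src H h) th" using cone_mdf_T[of th h "src H h" "cod2 H th"] t by simp
  interpret tk: cone_mdf A H \<A> "src H k" W "ho ph (src H k) (h o{H} k)" "ho ph (src H k) (cod2 H th o{H} k)" "ha ph (src H k) (th *{H} id2 H k)"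
   using cone_mdf_T[of "th *{H} id2 H k" "h o{H} k" "src H k" "cod2 H th o{H} k"] t by simp
  interpret k: cone_mdf A H \<A> "src H k" W "pnt_comp A CAT (hpost A \<A> H k) (c h)" "ho ph (src H k) (h o{H} k)" "K k h"
   using cone_mdf_K(1)[of h k] by simp
  interpret k': cone_mdf A H \<A> "src H k" W "pnt_comp A CAT (hpost A \<A> H k) (c (cod2 H th))" "ho ph (src H k) (cod2 H th o{H} k)" "K k (cod2 H th)"
   using cone_mdf_K(1)[of "cod2 H th" k] t by simp
  have "cone_mdf A H \<A> (src H k) W (pnt_comp A CAT (hpost A \<A> H k) (c h)) (pnt_comp A CAT (hpost A \<A> H k) (c (cod2 H th))) (mdf_hcomp A CAT (mdf_id A CAT (hpost A \<A> H k)) (T th))"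
   using k.c.cone_in_axioms k'.c.cone_in_axioms t.modification_axioms by (simp add: cone_mdf_def cone_mdf_axioms_def)
  from hm_vcomp[OF this k'.cone_mdf_axioms, of a f] hm_vcomp[OF k.cone_mdf_axioms tk.cone_mdf_axioms, of a f]
  show ?thesis using K_eqs(1)[of h k th] t by simp
 qed
 show "hm (K (cod2 H xi) h) a f #{H} (id2 H (ho (c h) a f) *{H} xi) = hm (ha ph (src H (dom2 H xi)) (id2 H h *{H} xi)) a f #{H} hm (K (dom2 H xi) h) a f"
  if [simp]: "xi \<in> Cell H" "trg H (dom2 H xi) = src H h"
 proof -
  let ?X = "src H (dom2 H xi)" let ?k = "dom2 H xi" let ?k' = "cod2 H xi"
  interpret tk: cone_mdf A H \<A> ?X W "ho ph ?X (h o{H} ?k)" "ho ph ?X (h o{H} ?k')" "ha ph ?X (id2 H h *{H} xi)"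
   using cone_mdf_T[of "id2 H h *{H} xi" "h o{H} ?k" ?X "h o{H} ?k'"] by simp
  interpret k: cone_mdf A H \<A> ?X W "pnt_comp A CAT (hpost A \<A> H ?k) (c h)" "ho ph ?X (h o{H} ?k)" "K ?k h"
   using cone_mdf_K(1)[of h ?k] by simp
  interpret k': cone_mdf A H \<A> ?X W "pnt_comp A CAT (hpost A \<A> H ?k') (c h)" "ho ph ?X (h o{H} ?k')" "K ?k' h"
   using cone_mdf_K(1)[of h ?k'] by simp
  have "cone_mdf A H \<A> ?X W (pnt_comp A CAT (hpost A \<A> H ?k) (c h)) (pnt_comp A CAT (hpost A \<A> H ?k') (c h)) (mdf_hcomp A CAT (hpost2 A \<A> H xi) (mdf_id A CAT (c h)))"
   using k.c.cone_in_axioms k'.c.cone_in_axioms c.ph.pseudonatural_axioms by (simp add: cone_mdf_def cone_mdf_axioms_def)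
  from hm_vcomp[OF this k'.cone_mdf_axioms, of a f] hm_vcomp[OF k.cone_mdf_axioms tk.cone_mdf_axioms, of a f]
  show ?thesis using K_eqs(2)[of h xi] by simp
 qed
 show "hm (K (k o{H} k') h) a f = hm (K k' (h o{H} k)) a f #{H} (hm (K k h) a f *{H} id2 H k')"
  if [simp]: "k \<in> Mor H" "k' \<in> Mor H" "trg H k = src H h" "trg H k' = src H k"
 proof -
  interpret ck: cone_in A H \<A> "src H k" W "c (h o{H} k)" by (rule cone_in_c) simp_all
  interpret k: cone_mdf A H \<A> "src H k" W "pnt_comp A CAT (hpost A \<A> H k) (c h)" "c (h o{H} k)" "K k h"
   using cone_mdf_K(1)[of h k] by simp
  interpret k': cone_mdf A H \<A> "src H k'" W "pnt_comp A CAT (hpost A \<A> H k') (c (h o{H} k))" "c (h o{H} k o{H} k')" "K k' (h o{H} k)"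
   using cone_mdf_K(1)[of "h o{H} k" k'] by (simp add: \<A>.H.comp1_assoc')
  interpret kc: cone_in A H \<A> "src H k'" W "pnt_comp A CAT (hpost A \<A> H k') (pnt_comp A CAT (hpost A \<A> H k) (c h))"
   by (rule cone_in.cone_in_hpost[OF k.c.cone_in_axioms]) simp_all
  have "cone_mdf A H \<A> (src H k') W (pnt_comp A CAT (hpost A \<A> H k') (pnt_comp A CAT (hpost A \<A> H k) (c h))) (pnt_comp A CAT (hpost A \<A> H k') (c (h o{H} k)))
    (mdf_hcomp A CAT (mdf_id A CAT (hpost A \<A> H k')) (K k h))"
   using k.modification_axioms k'.c.cone_in_axioms kc.cone_in_axioms by (simp add: cone_mdf_def cone_mdf_axioms_def)
  from hm_vcomp[OF this k'.cone_mdf_axioms, of a f]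
  show ?thesis using K_eqs(3)[of h k k'] by simp
 qed
 show "PROP ?C3"
  using K_eqs(4)[of h] by (simp add: hm_def)
qed

end

locale bilim_universal = bilim_cone +
 assumes equivalence: "pseudonatural_equivalence_CAT (op2 H) ph (rep (op2 H) l) (cones A H W \<A>)"
begin

lemma component_equivalence:
 assumes [simp]: "X \<in> Ob H"
 shows "equivalence1 CAT (pnt1 ph X) (fdom (pnt1 ph X)) (fcod (pnt1 ph X))"
 using two_category.homcat[OF \<A>.H.two_category_op2, of l X] P.homcat[of "psf_comp A CAT in_left W" "psf_comp A CAT in_right (Q X)"]
  rep_along.Q_simps(1)[OF rep_along_X[OF assms]] W.pseudofunctor_axioms
  equivalence1_components[OF equivalence[unfolded pseudonatural_equivalence_CAT_def], of X]
 by (simp add: ph.P.pseudofunctor_axioms ph.Q.pseudofunctor_axioms)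

abbreviation "lam a f \<equiv> ho (ho ph l (id1 H l)) a f"
abbreviation "lam2 a xi \<equiv> ha (ho ph l (id1 H l)) a xi"
abbreviation "lamu u f \<equiv> hn (ho ph l (id1 H l)) u f"
text \<open>The legs of \<open>c h\<close> need not be literally \<open>lam a f \<odot> h\<close>;
  \<open>\<kappa> h\<close> is the invertible comparison, and statements about \<open>c\<close>
  become statements about \<open>lam\<close> by conjugating with it.\<close>

abbreviation "\<kappa> h a f \<equiv> hm (K h (id1 H l)) a f"

lemma kappa_simps [simp]:
 assumes [simp]: "h \<in> Mor H" "trg H h = l" "a \<in> Ob A" "f \<in> Obj (psf0 W a)"
 shows "\<kappa> h a f \<in> Cell H" "dom2 H (\<kappa> h a f) = lam a f o{H} h" "cod2 H (\<kappa> h a f) = ho (c h) a f" "iso2 H (\<kappa> h a f)"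
 using K_simps[of "id1 H l" h a f] by simp_all

lemma T_kappa:
 assumes [simp]: "th \<in> Cell H" "trg H (dom2 H th) = l" "a \<in> Ob A" "f \<in> Obj (psf0 W a)"
 shows "\<kappa> (cod2 H th) a f #{H} (id2 H (lam a f) *{H} th) = hm (T th) a f #{H} \<kappa> (dom2 H th) a f"
 using K_nat(2)[of "id1 H l" a f th] by simp

text \<open>By \<open>T_kappa\<close>, \<open>lam a f \<star> th\<close> is the component of
  \<open>T th\<close> up to conjugation by \<kappa>. So \<open>th\<close> and \<open>th'\<close>
  induce the same morphism of cones, and the component functor of the equivalence is
  faithful.\<close>

lemma lam_faithful:
 assumes [simp]: "th \<in> Cell H" "th' \<in> Cell H" "dom2 H th' = dom2 H th" "cod2 H th' = cod2 H th" "trg H (dom2 H th) = l"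
  and eq: "!!a f. [|a \<in> Ob A; f \<in> Obj (psf0 W a)|] ==> id2 H (lam a f) *{H} th = id2 H (lam a f) *{H} th'"
 shows "th = th'"
proof -
 let ?X = "src H (dom2 H th)"
 interpret t: cone_mdf A H \<A> ?X W "ho ph ?X (dom2 H th)" "ho ph ?X (cod2 H th)" "ha ph ?X th"
  using cone_mdf_T[of th "dom2 H th" ?X "cod2 H th"] by simp
 interpret t': cone_mdf A H \<A> ?X W "ho ph ?X (dom2 H th)" "ho ph ?X (cod2 H th)" "ha ph ?X th'"
  using cone_mdf_T[of th' "dom2 H th" ?X "cod2 H th"] by simp
 have e: "hm (ha ph ?X th) a f = hm (ha ph ?X th') a f" if [simp]: "a \<in> Ob A" "f \<in> Obj (psf0 W a)" for a f
  using T_kappa[of th a f] T_kappa[of th' a f] eq[of a f]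
   \<A>.H.iso2_cancel_right[of "\<kappa> (dom2 H th) a f" "hm (ha ph ?X th) a f" "hm (ha ph ?X th') a f"] by simp
 have "ha ph ?X th = ha ph ?X th'"
 proof (rule mdf_eqI[of A CAT])
  fix a assume a [simp]: "a \<in> Ob A"
  show "mdf2 (ha ph ?X th) a = mdf2 (ha ph ?X th') a"
   by (rule ntr_eqI) (auto simp: t.hm_ncmp t'.hm_ncmp e)
 qed (simp_all add: t.modification_axioms t'.modification_axioms)
 then show ?thesis
  by (intro Inl_inject[OF CAT_equivalenceD(2)[OF component_equivalence, of ?X "Inl th" "Inl th'"]]) simp_all
qed

lemma c_ho [simp]: "h \<in> Mor H ==> trg H h = l ==> src H h = X ==> fobj (pnt1 ph X) (Inl h) = Inr (ho ph X h)"
 using ph.ho_fobj(1)[of X h] \<A>.H.src_Ob[of h] by simp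

lemma T_ha [simp]: "th \<in> Cell H ==> trg H (dom2 H th) = l ==> src H (dom2 H th) = X ==> farr (pnt1 ph X) (Inl th) = Inr (ha ph X th)"
 using ph.ha_farr(1)[of X th] \<A>.H.src_Ob[of "dom2 H th"] by simp

lemma phi_full:
 assumes [simp]: "h \<in> Mor H" "h' \<in> Mor H" "trg H h = l" "trg H h' = l" "src H h = X" "src H h' = X"
  and G: "cone_mdf A H \<A> X W (ho ph X h) (ho ph X h') Ga"
 shows "\<exists>th. th \<in> Cell H & dom2 H th = h & cod2 H th = h' & ha ph X th = Ga"
proof -
 have X [simp]: "X \<in> Ob H" using \<A>.H.src_Ob[of h] by simp
 interpret G: cone_mdf A H \<A> X W "ho ph X h" "ho ph X h'" Ga by fact
 have "\<exists>f. f \<in> Arr (fdom (pnt1 ph X)) & Dom (fdom (pnt1 ph X)) f = Inl h &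
  Cod (fdom (pnt1 ph X)) f = Inl h' & farr (pnt1 ph X) f = Inr Ga"
  by (rule CAT_equivalenceD(1)[OF component_equivalence]) (simp_all add: G.modification_axioms)
 then obtain f where f: "f \<in> Arr (fdom (pnt1 ph X))" "Dom (fdom (pnt1 ph X)) f = Inl h"
  "Cod (fdom (pnt1 ph X)) f = Inl h'" "farr (pnt1 ph X) f = Inr Ga"
  by blast
 from f(1) obtain th where "f = Inl th" "th \<in> Arr (homcat (op2 H) l X)" by auto
 then show ?thesis using f by auto
qed

text \<open>Conjugating \<open>m\<close> by \<kappa> gives a morphism from \<open>c h\<close> to
  \<open>c h'\<close>; fullness of the equivalence yields \<open>th\<close>, and
  \<open>T_kappa\<close> undoes the conjugation.\<close>

lemma lam_full:
 assumes [simp]: "h \<in> Mor H" "h' \<in> Mor H" "trg H h = l" "trg H h' = l" "src H h' = src H h"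
  and m: "!!a f. [|a \<in> Ob A; f \<in> Obj (psf0 W a)|] ==>
   m a f \<in> Cell H & dom2 H (m a f) = lam a f o{H} h & cod2 H (m a f) = lam a f o{H} h'"
  and nat: "!!a xi. [|a \<in> Ob A; xi \<in> Arr (psf0 W a)|] ==>
   m a (Cod (psf0 W a) xi) #{H} (lam2 a xi *{H} id2 H h) = (lam2 a xi *{H} id2 H h') #{H} m a (Dom (psf0 W a) xi)"
  and un: "!!u f. [|u \<in> Mor A; f \<in> Obj (psf0 W (src A u))|] ==>
   (lamu u f *{H} id2 H h') #{H} (id2 H (psf1 \<A> u) *{H} m (src A u) f) = m (trg A u) (fobj (psf1 W u) f) #{H} (lamu u f *{H} id2 H h)"
 shows "\<exists>th. th \<in> Cell H & dom2 H th = h & cod2 H th = h' & (\<forall>a\<in>Ob A. \<forall>f \<in> Obj (psf0 W a). m a f = id2 H (lam a f) *{H} th)"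
proof -
 let ?X = "src H h"
 interpret c: cone_in A H \<A> ?X W "ho ph ?X h" by (rule cone_in_c) simp_all
 interpret c': cone_in A H \<A> ?X W "ho ph ?X h'" using cone_in_c[of h' ?X] by simp
 note [simp] = m
 define n where "n a f = \<kappa> h' a f #{H} m a f #{H} inv2 H (\<kappa> h a f)" for a f
 have n [simp]: "n a f \<in> Cell H" "dom2 H (n a f) = ho (ho ph ?X h) a f" "cod2 H (n a f) = ho (ho ph ?X h') a f"
   and nk: "n a f #{H} \<kappa> h a f = \<kappa> h' a f #{H} m a f"
  if "a \<in> Ob A" "f \<in> Obj (psf0 W a)" for a f using that by (simp_all add: n_def \<A>.H.vcomp_assoc)
 have "hmdf A W (Q ?X) (ho ph ?X h) (ho ph ?X h') n"
 proof (rule hmdf.intro[OF c.hetero_pnt_axioms c'.hetero_pnt_axioms hmdf_axioms.intro], goal_cases)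
  case (4 a xi)
  then have [simp]: "a \<in> Ob A" "xi \<in> Arr (psf0 W a)" "Dom (psf0 W a) xi \<in> Obj (psf0 W a)" "Cod (psf0 W a) xi \<in> Obj (psf0 W a)" by simp_all
  have "n a (Cod (psf0 W a) xi) #{H} ha (ho ph ?X h) a xi #{H} \<kappa> h a (Dom (psf0 W a) xi) =
    ha (ho ph ?X h') a xi #{H} n a (Dom (psf0 W a) xi) #{H} \<kappa> h a (Dom (psf0 W a) xi)"
   using K_cone(1)[of "id1 H l" h a xi] K_cone(1)[of "id1 H l" h' a xi] nat[of a xi] nk[of a "Dom (psf0 W a) xi"]
   \<A>.H.vcomp_pre[OF nk[of a "Cod (psf0 W a) xi"], of "lam2 a xi *{H} id2 H h"]
   \<A>.H.vcomp_pre[OF K_cone(1)[of "id1 H l" h' a xi], of "m a (Dom (psf0 W a) xi)"]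
   by (simp add: \<A>.H.vcomp_assoc)
  then have "(n a (Cod (psf0 W a) xi) #{H} ha (ho ph ?X h) a xi) #{H} \<kappa> h a (Dom (psf0 W a) xi) =
    (ha (ho ph ?X h') a xi #{H} n a (Dom (psf0 W a) xi)) #{H} \<kappa> h a (Dom (psf0 W a) xi)"
   by (simp add: \<A>.H.vcomp_assoc)
  from \<A>.H.iso2_cancel_right[rotated, OF this] show ?case by simp
 next
  case (5 u f)
  then have [simp]: "u \<in> Mor A" "f \<in> Obj (psf0 W (src A u))" "fobj (psf1 W u) f \<in> Obj (psf0 W (trg A u))" by simp_all
  let ?k = "id2 H (psf1 \<A> u) *{H} \<kappa> h (src A u) f"
  have "id2 H (psf1 \<A> u) *{H} (n (src A u) f #{H} \<kappa> h (src A u) f) = id2 H (psf1 \<A> u) *{H} (\<kappa> h' (src A u) f #{H} m (src A u) f)"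
   by (simp add: nk)
  then have "hn (ho ph ?X h') u f #{H} (id2 H (psf1 \<A> u) *{H} n (src A u) f) #{H} ?k =
    hn (ho ph ?X h') u f #{H} (id2 H (psf1 \<A> u) *{H} \<kappa> h' (src A u) f) #{H} (id2 H (psf1 \<A> u) *{H} m (src A u) f)"
   by (simp add: \<A>.H.whisker_vcomp_left)
  also have "... = \<kappa> h' (trg A u) (fobj (psf1 W u) f) #{H} (lamu u f *{H} id2 H h') #{H} (id2 H (psf1 \<A> u) *{H} m (src A u) f)"
   using \<A>.H.vcomp_pre[OF K_cone(2)[of "id1 H l" h' u f], of "id2 H (psf1 \<A> u) *{H} m (src A u) f"] by (simp add: \<A>.H.pasting)
  also have "... = n (trg A u) (fobj (psf1 W u) f) #{H} \<kappa> h (trg A u) (fobj (psf1 W u) f) #{H} (lamu u f *{H} id2 H h)"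
   using \<A>.H.vcomp_pre[OF nk[of "trg A u" "fobj (psf1 W u) f"], of "lamu u f *{H} id2 H h"] by (simp add: un \<A>.H.pasting)
  also have "... = n (trg A u) (fobj (psf1 W u) f) #{H} hn (ho ph ?X h) u f #{H} ?k"
   using K_cone(2)[of "id1 H l" h u f] by simp
  finally have "(hn (ho ph ?X h') u f #{H} (id2 H (psf1 \<A> u) *{H} n (src A u) f)) #{H} ?k =
    (n (trg A u) (fobj (psf1 W u) f) #{H} hn (ho ph ?X h) u f) #{H} ?k" by (simp add: \<A>.H.vcomp_assoc)
  from \<A>.H.iso2_cancel_right[rotated, OF this] show ?case by (simp add: \<A>.H.comp1_assoc')
 qed simp_all
 then interpret n: hmdf A W "Q ?X" "ho ph ?X h" "ho ph ?X h'" n .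
 have "cone_mdf A H \<A> ?X W (ho ph ?X h) (ho ph ?X h') (mk_mdf A W (ho ph ?X h) (ho ph ?X h') n)"
  by (simp add: cone_mdf_def cone_mdf_axioms_def c.cone_in_axioms c'.cone_in_axioms n.modification_mk_mdf)
 from phi_full[OF _ _ _ _ _ _ this] obtain th where t: "th \<in> Cell H" "dom2 H th = h" "cod2 H th = h'"
  "ha ph ?X th = mk_mdf A W (ho ph ?X h) (ho ph ?X h') n" by auto
 have "m a f = id2 H (lam a f) *{H} th" if [simp]: "a \<in> Ob A" "f \<in> Obj (psf0 W a)" for a f
 proof -
  have "\<kappa> h' a f #{H} m a f = \<kappa> h' a f #{H} (id2 H (lam a f) *{H} th)"
   using T_kappa[of th a f] t by (simp add: nk)
  then show ?thesis using t by (intro \<A>.H.iso2_cancel_left[rotated, of "\<kappa> h' a f" "m a f"]) simp_all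
 qed
 then show ?thesis using t by auto
qed

text \<open>With tags put on, \<open>x\<close> is an object of the category of cones. Essential
  surjectivity gives \<open>h\<close> with \<open>c h\<close> isomorphic to it, and
  \<open>\<kappa> h\<close> replaces \<open>c h\<close> by the legs
  \<open>lam a f \<odot> h\<close>.\<close>

lemma lam_representable:
 assumes [simp]: "X \<in> Ob H" and x: "hpnt A W (Q X) x x2 xu"
 shows "\<exists>h k. h \<in> Mor H & src H h = X & trg H h = l &
    (\<forall>a\<in>Ob A. \<forall>f\<in>Obj (psf0 W a). iso2 H (k a f) & dom2 H (k a f) = lam a f o{H} h & cod2 H (k a f) = x a f) &
    (\<forall>a\<in>Ob A. \<forall>xi\<in>Arr (psf0 W a).
     k a (Cod (psf0 W a) xi) #{H} (lam2 a xi *{H} id2 H h) = x2 a xi #{H} k a (Dom (psf0 W a) xi)) &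
    (\<forall>u\<in>Mor A. \<forall>f\<in>Obj (psf0 W (src A u)).
     xu u f #{H} (id2 H (psf1 \<A> u) *{H} k (src A u) f) = k (trg A u) (fobj (psf1 W u) f) #{H} (lamu u f *{H} id2 H h))"
proof -
 interpret x: hpnt A W "Q X" x x2 xu by fact
 let ?x = "mk_pnt A W (Q X) x x2 xu"
 interpret c: cone_in A H \<A> X W ?x
  using x.hetero_mk_pnt rep_along_X[of X] by (simp add: cone_in_def)
 interpret r: rep_along A H \<A> X by (rule rep_along_X) simp
 have "Inr ?x \<in> Obj (fcod (pnt1 ph X))" using x.pseudonatural_mk_pnt by simp
 from CAT_equivalenceD(3)[OF component_equivalence[OF assms(1)] this]
 obtain h' i where h': "h' \<in> Obj (fdom (pnt1 ph X))" and i: "iso_in (fcod (pnt1 ph X)) i"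
   "Dom (fcod (pnt1 ph X)) i = fobj (pnt1 ph X) h'" "Cod (fcod (pnt1 ph X)) i = Inr ?x" by blast
 from h' obtain h where h: "h \<in> Mor H" "src H h = X" "trg H h = l" and h'h: "h' = Inl h" by auto
 note [simp] = h
 have ci [simp]: "category (CC X)" by (rule P.homcat) (simp_all add: W.pseudofunctor_axioms)
 obtain Ga where G: "i = Inr Ga" "iso_in (CC X) Ga" "modification A CAT Ga" "mdom Ga = ho ph X h" "mcod Ga = ?x"
 proof -
  have "i \<in> Arr (fcod (pnt1 ph X))" using i(1) by (rule iso_in_Arr)
  then obtain Ga where "i = Inr Ga" "Ga \<in> Arr (CC X)" by auto
  then show thesis using i by (intro that[of Ga]) (auto simp: h'h)
 qed
 interpret ch: cone_in A H \<A> X W "ho ph X h" using cone_in_c[of h X] by simp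
 interpret G: cone_mdf A H \<A> X W "ho ph X h" ?x Ga
  by (simp add: cone_mdf_def cone_mdf_axioms_def G c.cone_in_axioms ch.cone_in_axioms)
 have Gi [simp]: "a \<in> Ob A ==> f \<in> Obj (psf0 W a) ==> iso2 H (hm Ga a f)" for a f
  by (rule G.hm_iso) (use G P.iso_in_homcat[of Ga] in simp_all)
 define k where "k a f = hm Ga a f #{H} \<kappa> h a f" for a f
 have 1: "iso2 H (k a f) & dom2 H (k a f) = lam a f o{H} h & cod2 H (k a f) = x a f"
  if [simp]: "a \<in> Ob A" "f \<in> Obj (psf0 W a)" for a f
  by (simp add: k_def)
 have 2: "k a (Cod (psf0 W a) xi) #{H} (lam2 a xi *{H} id2 H h) = x2 a xi #{H} k a (Dom (psf0 W a) xi)"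
  if [simp]: "a \<in> Ob A" "xi \<in> Arr (psf0 W a)" for a xi
  using K_cone(1)[of "id1 H l" h a xi] \<A>.H.vcomp_pre[OF G.mdf_eqs(1)[of a xi], of "\<kappa> h a (Dom (psf0 W a) xi)"]
   c.cone_simps2(1-3)[of a xi] by (simp add: k_def \<A>.H.vcomp_assoc)
 have 3: "xu u f #{H} (id2 H (psf1 \<A> u) *{H} k (src A u) f) = k (trg A u) (fobj (psf1 W u) f) #{H} (lamu u f *{H} id2 H h)"
  if [simp]: "u \<in> Mor A" "f \<in> Obj (psf0 W (src A u))" for u f
  using K_cone(2)[of "id1 H l" h u f]
   \<A>.H.vcomp_pre[OF G.mdf_eqs(2)[of u f], of "id2 H (psf1 \<A> u) *{H} \<kappa> h (src A u) f"] c.cone_simps2(4-6)[of u f]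
  by (simp add: k_def \<A>.H.pasting \<A>.H.whisker_vcomp_left)
 show ?thesis using h 1 2 3 by blast
qed

end

section \<open>The family of bilimits: from the equivalence to compatible cones\<close>

locale bilim_family = \<A>: pseudofunctor A H \<A> + t: pseudofunctor A B t + L: pseudofunctor B H L
 for A :: "('a0, 'a1, 'a2) twocat" and H :: "('h0, 'h1, 'h2) twocat" and \<A>
  and B :: "('b0, 'b1, 'b2) twocat" and t L +
 fixes Ph assumes bilim: "weighted_bilimit_psf A B H (yon_along A B t) \<A> L Ph"
begin

abbreviation "W b \<equiv> psf_comp A CAT (rep B b) t"
abbreviation "Q X \<equiv> psf_comp A CAT (rep H X) \<A>"
abbreviation "HA \<equiv> hom_along A H \<A>"
abbreviation "Pg g \<equiv> pnt_post (op2 H) CAT in_right (pnt_pre (op2 H) CAT HA (yon_pnt (PS A CAT) (hpre A t B g)))"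
abbreviation "Px x \<equiv> mdf_post (op2 H) CAT in_right (mdf_pre (op2 H) CAT HA (yon_mdf (PS A CAT) (hpre2 A t B x)))"

sublocale op: two_category "op2 H" by (rule \<A>.H.two_category_op2)
sublocale PA: two_category "PS A CAT" by (simp add: \<A>.A.two_category_axioms two_category_CAT)

lemma Phi_mor: "pseudonatural B (PS (op2 H) CAT) Ph"
 using bilim by (simp add: weighted_bilimit_psf_def equivalence1_def)

sublocale Phi: pseudonatural B "PS (op2 H) CAT" Ph by (rule Phi_mor)

lemma pdom_Phi: "pdom Ph = psf_comp B (PS (op2 H) CAT) (strict_psf H (PS (op2 H) CAT) (repl (op2 H)) (yonl (op2 H)) (yonl2 (op2 H))) L"
 using bilim op.yonl_comp[of B L] L.pseudofunctor_axioms by (simp add: weighted_bilimit_psf_def equivalence1_def)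

text \<open>All layers of the right-hand side are strict, so they collapse to one strict 2-functor
  on B whose action on 1-cells, \<open>Pg\<close>, reindexes cones.\<close>

lemma pcod_Phi: "pcod Ph = strict_psf B (PS (op2 H) CAT) (%b. psf_comp (op2 H) CAT in_right (cones A H (W b) \<A>)) Pg Px"
proof -
 note c = cones_family_strict[OF \<A>.pseudofunctor_axioms t.pseudofunctor_axioms]
 have "pcod Ph = psf_comp B (PS (op2 H) CAT) (postcomp_strict (op2 H) CAT CAT in_right) (cones_family A B H (yon_along A B t) \<A>)"
  using bilim by (simp add: weighted_bilimit_psf_def equivalence1_def)
 then show ?thesis
  using psf_comp_strict_psf[OF c(1) strict_functor_postcomp(2)[OF op.two_category_axioms]] unfolding c(2) postcomp_strict_def
  by (simp add: comp_def cones_def)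
qed

lemma yonl_strict: "strict_functor H (PS (op2 H) CAT) (repl (op2 H)) (yonl (op2 H)) (yonl2 (op2 H))"
 using op.strict_functor_yonl by simp

lemma pdom_simps [simp]:
 "b \<in> Ob B ==> psf0 (pdom Ph) b = repl (op2 H) (psf0 L b)"
 "g \<in> Mor B ==> psf1 (pdom Ph) g = yonl (op2 H) (psf1 L g)"
 "x \<in> Cell B ==> psf2 (pdom Ph) x = yonl2 (op2 H) (psf2 L x)"
 "composable B g f ==> psfc (pdom Ph) g f = yonl2 (op2 H) (psfc L g f)"
 "b \<in> Ob B ==> psfu (pdom Ph) b = yonl2 (op2 H) (psfu L b)"
 by (simp_all add: pdom_Phi strict_functor.psf_comp_strict_psfc[OF yonl_strict L.pseudofunctor_axioms])

lemma pcod_simps [simp]: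
 "b \<in> Ob B ==> psf0 (pcod Ph) b = psf_comp (op2 H) CAT in_right (cones A H (W b) \<A>)"
 "g \<in> Mor B ==> psf1 (pcod Ph) g = Pg g"
 "x \<in> Cell B ==> psf2 (pcod Ph) x = Px x"
 "composable B g f ==> psfc (pcod Ph) g f = mdf_id (op2 H) CAT (Pg (g o{B} f))"
 "b \<in> Ob B ==> psfu (pcod Ph) b = mdf_id (op2 H) CAT (Pg (id1 B b))"
 by (simp_all add: pcod_Phi)

lemma HA_simps [simp]:
 "X \<in> Ob H ==> psf0 HA X = psf_comp A CAT in_right (Q X)"
 "k \<in> Mor H ==> psf1 HA k = hpost A \<A> H k"
 "pseudofunctor (op2 H) (PS A CAT) HA"
 using pseudofunctor_hom_along[OF \<A>.pseudofunctor_axioms]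
 by (simp_all add: hom_along_strict(2)[OF \<A>.pseudofunctor_axioms])

lemma rep_along_b: "b \<in> Ob B ==> rep_along A B t b" by unfold_locales simp

lemma W_pseudofunctor [simp]: "b \<in> Ob B ==> pseudofunctor A CAT (W b)"
 by (rule rep_along.Q_simps[OF rep_along_b])

lemma Q_pseudofunctor [simp]: "X \<in> Ob H ==> pseudofunctor A CAT (Q X)"
 by (intro rep_along.Q_simps) unfold_locales

lemma hpre_pseudonatural [simp]: "g \<in> Mor B ==> pseudonatural A CAT (hpre A t B g)"
 by simp

lemma Pg_pre [simp]:
 "g \<in> Mor B ==> pseudonatural (op2 H) CAT (pnt_pre (op2 H) CAT HA (yon_pnt (PS A CAT) (hpre A t B g)))"
 "x \<in> Cell B ==> modification (op2 H) CAT (mdf_pre (op2 H) CAT HA (yon_mdf (PS A CAT) (hpre2 A t B x)))"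
 by (intro pseudonatural_pnt_pre[OF HA_simps(3)] PA.pseudonatural_yon_pnt, simp,
  intro modification_mdf_pre[OF HA_simps(3)] PA.modification_yon_mdf, simp)

text \<open>The component of the equivalence at \<open>b\<close> is itself an equivalence,
  pseudonatural in the vertex; this makes the results on a single bilimit available for each
  weight.\<close>

lemma universal:
 assumes [simp]: "b \<in> Ob B" shows "bilim_universal A H \<A> (W b) (psf0 L b) (pnt1 Ph b)"
proof -
 interpret R: pseudofunctor "op2 H" CAT "rep (op2 H) (psf0 L b)" by simp
 interpret W: pseudofunctor A CAT "W b" by simp
 interpret C: pseudofunctor "op2 H" CAT "cones A H (W b) \<A>"
  using strict_functor.pseudofunctor_strict[OF cones_strict(1)[OF \<A>.pseudofunctor_axioms W.pseudofunctor_axioms]]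
  by (simp add: cones_strict(2)[OF \<A>.pseudofunctor_axioms W.pseudofunctor_axioms])
 have "equivalence1 (PS (op2 H) CAT) (pnt1 Ph b) (psf0 (pdom Ph) b) (psf0 (pcod Ph) b)"
  by (rule equivalence1_components[of B]) (use bilim in \<open>auto simp: weighted_bilimit_psf_def equivalence1_def\<close>)
 then have e: "equivalence1 (PS (op2 H) CAT) (pnt1 Ph b) (repl (op2 H) (psf0 L b)) (psf_comp (op2 H) CAT in_right (cones A H (W b) \<A>))"
  by simp
 then have p: "pseudonatural (op2 H) CAT (pnt1 Ph b)" "pdom (pnt1 Ph b) = repl (op2 H) (psf0 L b)"
  "pcod (pnt1 Ph b) = psf_comp (op2 H) CAT in_right (cones A H (W b) \<A>)" by (simp_all add: equivalence1_def)
 show ?thesis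
  by (intro bilim_universal.intro bilim_cone.intro bilim_universal_axioms.intro bilim_cone_axioms.intro hetero_pnt.intro hetero_pnt_axioms.intro)
   (simp_all add: p R.pseudofunctor_axioms C.pseudofunctor_axioms \<A>.pseudofunctor_axioms W.pseudofunctor_axioms pseudonatural_equivalence_CAT_def e)
qed

end

locale bilim_family_at = bilim_family +
 fixes g assumes g_Mor [simp]: "g \<in> Mor B"
begin

abbreviation "b \<equiv> src B g"
abbreviation "b' \<equiv> trg B g"

sublocale d: bilim_universal A H \<A> "W b" "psf0 L b" "pnt1 Ph b" by (rule universal) simp
sublocale c: bilim_universal A H \<A> "W b'" "psf0 L b'" "pnt1 Ph b'" by (rule universal) simp

text \<open>The value at \<open>h\<close> of the structure 2-cell of \<open>Ph\<close> at
  \<open>g : b \<rightarrow> b'\<close>: a morphism from the cone of \<open>h\<close> at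
  \<open>b\<close>, reindexed along \<open>g\<close>, to the cone of \<open>L g \<odot> h\<close> at
  \<open>b'\<close>.\<close>

abbreviation "q h \<equiv> hm (pnt2 Ph g) (src H h) h"

abbreviation "al \<equiv> pnt_comp (op2 H) CAT (Pg g) (pnt1 Ph b)"
abbreviation "be \<equiv> pnt_comp (op2 H) CAT (pnt1 Ph b') (yonl (op2 H) (psf1 L g))"

lemma q_modification: "modification (op2 H) CAT (pnt2 Ph g)" "mdom (pnt2 Ph g) = al" "mcod (pnt2 Ph g) = be"
 using Phi.pnt2_Cell[of g] Phi.dom2_pnt2[of g] Phi.cod2_pnt2[of g] by simp_all

lemma hetero_alpha_beta:
 "hetero_pnt (op2 H) (rep (op2 H) (psf0 L b)) (cones A H (W b') \<A>) al" (is "PROP ?C0")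
 "hetero_pnt (op2 H) (rep (op2 H) (psf0 L b)) (cones A H (W b') \<A>) be" (is "PROP ?C1")
proof -
 have p: "pseudonatural (op2 H) CAT al" "pseudonatural (op2 H) CAT be"
  using modification.pseudonatural_mdom[OF q_modification(1)] modification.pseudonatural_mcod[OF q_modification(1)]
  by (simp_all add: q_modification)
 have "pcod al = pcod be" using modification.pcod_mcod[OF q_modification(1)] by (simp add: q_modification)
 then show "PROP ?C0"
  "PROP ?C1"
  using p by (simp_all add: hetero_pnt_def hetero_pnt_axioms_def d.ph.P.pseudofunctor_axioms c.ph.Q.pseudofunctor_axioms)
qed

lemma q_hmdf: "hmdf (op2 H) (rep (op2 H) (psf0 L b)) (cones A H (W b') \<A>) al be (hm (pnt2 Ph g))"
 by (rule hmdf_modification(1)[OF hetero_alpha_beta q_modification])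

lemma d_typing:
 assumes "h \<in> Mor H" "trg H h = psf0 L b" "src H h = X"
 shows "pseudonatural A CAT (ho (pnt1 Ph b) X h)" "pdom (ho (pnt1 Ph b) X h) = psf_comp A CAT in_left (W b)"
  "pcod (ho (pnt1 Ph b) X h) = psf_comp A CAT in_right (Q X)"
 using d.cone_in_c[OF assms] assms(3) by (simp_all add: cone_in_def hetero_pnt_def hetero_pnt_axioms_def)

lemma alpha_simps:
 assumes [simp]: "h \<in> Mor H" "trg H h = psf0 L b" "src H h = X"
 shows "ho al X h = pnt_comp A CAT (ho (pnt1 Ph b) X h) (hpre A t B g)" (is "PROP ?C0")
  "ho be X h = ho (pnt1 Ph b') X (psf1 L g o{H} h)" (is "PROP ?C1")
proof -
 have [simp]: "X \<in> Ob H" using \<A>.H.src_Ob[of h] by simp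
 note [simp] = d_typing[of h X]
 show "PROP ?C0"
  by (simp add: ho_def[of al])
 show "PROP ?C1"
  by (simp add: ho_def[of be])
qed

lemma alpha_simps3:
 assumes [simp]: "h \<in> Mor H" "trg H h = psf0 L b" "k \<in> Mor H" "trg H k = src H h"
 shows "hn al k h = mdf_hcomp A CAT (hn (pnt1 Ph b) k h) (mdf_id A CAT (hpre A t B g))" (is "PROP ?C0")
  "hn be k h = hn (pnt1 Ph b') k (psf1 L g o{H} h)" (is "PROP ?C1")
proof -
 interpret k: cone_mdf A H \<A> "src H k" "W b" "pnt_comp A CAT (hpost A \<A> H k) (ho (pnt1 Ph b) (src H h) h)"
   "ho (pnt1 Ph b) (src H k) (h o{H} k)" "hn (pnt1 Ph b) k h"
  using d.cone_mdf_K(1)[of h k] by simp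
 interpret k': cone_mdf A H \<A> "src H k" "W b'" "pnt_comp A CAT (hpost A \<A> H k) (ho (pnt1 Ph b') (src H h) (psf1 L g o{H} h))"
   "ho (pnt1 Ph b') (src H k) (psf1 L g o{H} h o{H} k)" "hn (pnt1 Ph b') k (psf1 L g o{H} h)"
  using c.cone_mdf_K(1)[of "psf1 L g o{H} h" k] by (simp add: \<A>.H.comp1_assoc')
 note [simp] = d_typing[of h "src H h"] d_typing[of "h o{H} k" "src H k"] k.modification_axioms k'.modification_axioms
 note m = PA.vcomp_id2(1)[of "mdf_hcomp A CAT (hn (pnt1 Ph b) k h) (mdf_id A CAT (hpre A t B g))"]
  PA.vcomp_id2(2)[of "hn (pnt1 Ph b') k (psf1 L g o{H} h)"] c.T_eqs(1)[of "psf1 L g o{H} h o{H} k"]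
 have "pseudonatural A CAT (pnt_comp A CAT (pnt_comp A CAT (hpost A \<A> H k) (ho (pnt1 Ph b) (src H h) h)) (hpre A t B g))"
  by (rule pseudonatural_pnt_comp) (simp_all add: k.c.ph.pseudonatural_axioms)
 show "PROP ?C0"
  using m(1) by (simp add: hn_def[of al] PA.comp1_assoc'[simplified])
 show "PROP ?C1"
  using m by (simp add: hn_def[of be] \<A>.H.comp1_assoc')
qed

end

context bilim_family_at
begin

text \<open>\<open>pnt2 Ph g\<close> is a modification between transformations of CAT-valued
  functors. Two evaluations, at X and at \<open>h\<close>, and the removal of tags leave a morphism
  of cones in H; invertibility passes down the same way.\<close>

lemma q_cone_mdf:
 assumes [simp]: "h \<in> Mor H" "trg H h = psf0 L b" "src H h = X"
 shows "cone_mdf A H \<A> X (W b') (pnt_comp A CAT (ho (pnt1 Ph b) X h) (hpre A t B g)) (ho (pnt1 Ph b') X (psf1 L g o{H} h)) (hm (pnt2 Ph g) X h)" (is "PROP ?C0")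
  and "iso2 (PS A CAT) (hm (pnt2 Ph g) X h)" (is "PROP ?C1")
proof -
 have X [simp]: "X \<in> Ob H" using \<A>.H.src_Ob[of h] by simp
 interpret q: hmdf "op2 H" "rep (op2 H) (psf0 L b)" "cones A H (W b') \<A>" al be "hm (pnt2 Ph g)" by (rule q_hmdf)
 interpret d0: cone_in A H \<A> X "W b" "ho (pnt1 Ph b) X h" using d.cone_in_c[of h X] by simp
 interpret d1: cone_pre A H \<A> X B t g "ho (pnt1 Ph b) X h"
  by (intro cone_pre.intro cone_pre_axioms.intro rep_along_b d0.cone_in_axioms) simp_all
 interpret c0: cone_in A H \<A> X "W b'" "ho (pnt1 Ph b') X (psf1 L g o{H} h)" using c.cone_in_c[of "psf1 L g o{H} h" X] by simp
 have m: "hm (pnt2 Ph g) X h \<in> Arr (c.CC X)" "mdom (hm (pnt2 Ph g) X h) = ho al X h" "mcod (hm (pnt2 Ph g) X h) = ho be X h"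
  using q.m_Arr[of X h] q.m_Dom[of X h] q.m_Cod[of X h] by simp_all
 then show "PROP ?C0"
  by (simp add: cone_mdf_def cone_mdf_axioms_def d1.cone_in_hpre c0.cone_in_axioms alpha_simps)
 have "iso2 CAT (mdf2 (pnt2 Ph g) X)" using Phi.pnt2_iso[of g] by (simp add: iso2_PS)
 moreover have "mdf2 (pnt2 Ph g) X \<in> Cell CAT" "ndom (mdf2 (pnt2 Ph g) X) = pnt1 al X"
  using modification.mdf2_Cell[OF q_modification(1), of X] modification.dom2_mdf2[OF q_modification(1), of X] by (simp_all add: q_modification del: pnt_simps)
 ultimately have "iso_in (fcod (pnt1 al X)) (ncmp (mdf2 (pnt2 Ph g) X) (Inl h))"
  using iso2_CAT[of "mdf2 (pnt2 Ph g) X", THEN iffD1, THEN conjunct2, THEN bspec, of "Inl h"]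
   q.a.pnt1_fnctr[of X] by (simp del: pnt_simps)
 moreover have "ncmp (mdf2 (pnt2 Ph g) X) (Inl h) = Inr (hm (pnt2 Ph g) X h)"
  by (rule hmdf_modification(2)[OF hetero_alpha_beta q_modification]) simp_all
 moreover have "fcod (pnt1 al X) = relabel_cat Inr Inr (c.CC X)"
  using q.a.pnt1_fnctr(3)[of X] by (simp del: pnt_simps)
 ultimately have "iso_in (c.CC X) (hm (pnt2 Ph g) X h)" by (simp del: pnt_simps)
 then show "PROP ?C1" using m PA.iso_in_homcat[of "hm (pnt2 Ph g) X h"] by simp
qed

lemma q_simps [simp]:
 assumes [simp]: "h \<in> Mor H" "trg H h = psf0 L b" "src H h = X" "a \<in> Ob A" "f \<in> Mor B" "src B f = b'" "trg B f = psf0 t a"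
 shows "hm (hm (pnt2 Ph g) X h) a f \<in> Cell H" (is "PROP ?C0") "dom2 H (hm (hm (pnt2 Ph g) X h) a f) = ho (ho (pnt1 Ph b) X h) a (f o{B} g)" (is "PROP ?C1")
  "cod2 H (hm (hm (pnt2 Ph g) X h) a f) = ho (ho (pnt1 Ph b') X (psf1 L g o{H} h)) a f" (is "PROP ?C2")
  "iso2 H (hm (hm (pnt2 Ph g) X h) a f)" (is "PROP ?C3")
proof -
 interpret d0: cone_in A H \<A> X "W b" "ho (pnt1 Ph b) X h" using d.cone_in_c[of h X] by simp
 interpret d1: cone_pre A H \<A> X B t g "ho (pnt1 Ph b) X h"
  by (intro cone_pre.intro cone_pre_axioms.intro rep_along_b d0.cone_in_axioms) simp_all
 interpret q: cone_mdf A H \<A> X "W b'" "pnt_comp A CAT (ho (pnt1 Ph b) X h) (hpre A t B g)" "ho (pnt1 Ph b') X (psf1 L g o{H} h)" "hm (pnt2 Ph g) X h"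
  by (rule q_cone_mdf) simp_all
 show "PROP ?C0" "PROP ?C1"
  "PROP ?C2"
  "PROP ?C3"
  using q.mdf_simps[of a f] q.hm_iso[OF q_cone_mdf(2), of a f] by simp_all
qed

lemma q_cone:
 assumes [simp]: "h \<in> Mor H" "trg H h = psf0 L b"
 shows "a \<in> Ob A ==> xi \<in> Cell B ==> src B (dom2 B xi) = b' ==> trg B (dom2 B xi) = psf0 t a ==>
  hm (q h) a (cod2 B xi) #{H} ha (d.c h) a (xi *{B} id2 B g) = ha (ho (pnt1 Ph b') (src H h) (psf1 L g o{H} h)) a xi #{H} hm (q h) a (dom2 B xi)"
  "u \<in> Mor A ==> f \<in> Mor B ==> src B f = b' ==> trg B f = psf0 t (src A u) ==>
  hn (ho (pnt1 Ph b') (src H h) (psf1 L g o{H} h)) u f #{H} (id2 H (psf1 \<A> u) *{H} hm (q h) (src A u) f) =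
  hm (q h) (trg A u) (psf1 t u o{B} f) #{H} hn (d.c h) u (f o{B} g)"
proof -
 let ?X = "src H h"
 interpret d0: cone_in A H \<A> ?X "W b" "ho (pnt1 Ph b) ?X h" using d.cone_in_c[of h ?X] by simp
 interpret d1: cone_pre A H \<A> ?X B t g "ho (pnt1 Ph b) ?X h"
  by (intro cone_pre.intro cone_pre_axioms.intro rep_along_b d0.cone_in_axioms) simp_all
 interpret q: cone_mdf A H \<A> ?X "W b'" "pnt_comp A CAT (ho (pnt1 Ph b) ?X h) (hpre A t B g)" "ho (pnt1 Ph b') ?X (psf1 L g o{H} h)" "hm (pnt2 Ph g) ?X h"
  by (rule q_cone_mdf) simp_all
 show "hm (q h) a (cod2 B xi) #{H} ha (d.c h) a (xi *{B} id2 B g) = ha (ho (pnt1 Ph b') (src H h) (psf1 L g o{H} h)) a xi #{H} hm (q h) a (dom2 B xi)"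
  if "a \<in> Ob A" "xi \<in> Cell B" "src B (dom2 B xi) = b'" "trg B (dom2 B xi) = psf0 t a"
  using q.mdf_eqs(1)[of a xi] that by simp
 show "hn (ho (pnt1 Ph b') (src H h) (psf1 L g o{H} h)) u f #{H} (id2 H (psf1 \<A> u) *{H} hm (q h) (src A u) f) =
  hm (q h) (trg A u) (psf1 t u o{B} f) #{H} hn (d.c h) u (f o{B} g)"
  if "u \<in> Mor A" "f \<in> Mor B" "src B f = b'" "trg B f = psf0 t (src A u)"
  using q.mdf_eqs(2)[of u f] that by simp
qed

text \<open>The modification axiom of \<open>pnt2 Ph g\<close> in the direction of the vertex:
  comparing along \<open>g\<close> commutes with restricting along \<open>k\<close>.\<close>

lemma q_K:
 assumes [simp]: "h \<in> Mor H" "trg H h = psf0 L b" "k \<in> Mor H" "trg H k = src H h" "a \<in> Ob A" "f \<in> Mor B" "src B f = b'" "trg B f = psf0 t a"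
 shows "hm (hn (pnt1 Ph b') k (psf1 L g o{H} h)) a f #{H} (hm (q h) a f *{H} id2 H k) =
  hm (hm (pnt2 Ph g) (src H k) (h o{H} k)) a f #{H} hm (hn (pnt1 Ph b) k h) a (f o{B} g)"
proof -
 let ?X = "src H h" and ?Y = "src H k"
 interpret Q: hmdf "op2 H" "rep (op2 H) (psf0 L b)" "cones A H (W b') \<A>" al be "hm (pnt2 Ph g)" by (rule q_hmdf)
 interpret q: cone_mdf A H \<A> ?X "W b'" "pnt_comp A CAT (ho (pnt1 Ph b) ?X h) (hpre A t B g)" "ho (pnt1 Ph b') ?X (psf1 L g o{H} h)" "hm (pnt2 Ph g) ?X h"
  by (rule q_cone_mdf) simp_all
 interpret qk: cone_mdf A H \<A> ?Y "W b'" "pnt_comp A CAT (ho (pnt1 Ph b) ?Y (h o{H} k)) (hpre A t B g)" "ho (pnt1 Ph b') ?Y (psf1 L g o{H} h o{H} k)" "hm (pnt2 Ph g) ?Y (h o{H} k)"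
  by (rule q_cone_mdf) simp_all
 interpret K: cone_mdf A H \<A> "src H k" "W b" "pnt_comp A CAT (hpost A \<A> H k) (ho (pnt1 Ph b) (src H h) h)"
   "ho (pnt1 Ph b) (src H k) (h o{H} k)" "hn (pnt1 Ph b) k h"
  using d.cone_mdf_K(1)[of h k] by simp
 interpret K': cone_mdf A H \<A> "src H k" "W b'" "pnt_comp A CAT (hpost A \<A> H k) (ho (pnt1 Ph b') (src H h) (psf1 L g o{H} h))"
   "ho (pnt1 Ph b') (src H k) (psf1 L g o{H} h o{H} k)" "hn (pnt1 Ph b') k (psf1 L g o{H} h)"
  using c.cone_mdf_K(1)[of "psf1 L g o{H} h" k] by (simp add: \<A>.H.comp1_assoc')
 interpret kq: cone_in A H \<A> ?Y "W b'" "pnt_comp A CAT (hpost A \<A> H k) (pnt_comp A CAT (ho (pnt1 Ph b) ?X h) (hpre A t B g))"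
  by (rule q.c.cone_in_hpost) simp_all
 \<comment> \<open>Restricting the vertex and reindexing the weight act on opposite sides of a cone,
   so they commute by associativity in \<open>PS A CAT\<close>.\<close>
 have as: "pnt_comp A CAT (pnt_comp A CAT (hpost A \<A> H k) (ho (pnt1 Ph b) ?X h)) (hpre A t B g) =
   pnt_comp A CAT (hpost A \<A> H k) (pnt_comp A CAT (ho (pnt1 Ph b) ?X h) (hpre A t B g))"
  using PA.comp1_assoc'[of "hpost A \<A> H k" "ho (pnt1 Ph b) ?X h" "hpre A t B g"] d_typing[of h ?X] by simp
 have 1: "cone_mdf A H \<A> ?Y (W b') (pnt_comp A CAT (hpost A \<A> H k) (pnt_comp A CAT (ho (pnt1 Ph b) ?X h) (hpre A t B g)))
   (pnt_comp A CAT (hpost A \<A> H k) (ho (pnt1 Ph b') ?X (psf1 L g o{H} h))) (mdf_hcomp A CAT (mdf_id A CAT (hpost A \<A> H k)) (q h))"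
  using kq.cone_in_axioms K'.c.cone_in_axioms q.modification_axioms q.c.ph.pseudonatural_axioms d_typing[of h ?X] by (simp add: cone_mdf_def cone_mdf_axioms_def)
 interpret P1: cone_pre A H \<A> ?Y B t g "pnt_comp A CAT (hpost A \<A> H k) (ho (pnt1 Ph b) ?X h)"
  by (intro cone_pre.intro cone_pre_axioms.intro rep_along_b K.c.cone_in_axioms) simp_all
 interpret P2: cone_pre A H \<A> ?Y B t g "ho (pnt1 Ph b) ?Y (h o{H} k)"
  by (intro cone_pre.intro cone_pre_axioms.intro rep_along_b K.d.cone_in_axioms) simp_all
 interpret KP: cone_mdf_pre A H \<A> ?Y B t g "pnt_comp A CAT (hpost A \<A> H k) (ho (pnt1 Ph b) ?X h)" "ho (pnt1 Ph b) ?Y (h o{H} k)" "hn (pnt1 Ph b) k h"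
  by (intro cone_mdf_pre.intro P1.cone_pre_axioms P2.cone_pre_axioms K.cone_mdf_axioms)
 have 2: "cone_mdf A H \<A> ?Y (W b') (pnt_comp A CAT (hpost A \<A> H k) (pnt_comp A CAT (ho (pnt1 Ph b) ?X h) (hpre A t B g)))
   (pnt_comp A CAT (ho (pnt1 Ph b) ?Y (h o{H} k)) (hpre A t B g)) (mdf_hcomp A CAT (hn (pnt1 Ph b) k h) (mdf_id A CAT (hpre A t B g)))"
  using kq.cone_in_axioms qk.c.cone_in_axioms K.modification_axioms K.c.ph.pseudonatural_axioms as d_typing[of h ?X] by (simp add: cone_mdf_def cone_mdf_axioms_def)
 have "mdf_vcomp A CAT (hn (pnt1 Ph b') k (psf1 L g o{H} h)) (mdf_hcomp A CAT (mdf_id A CAT (hpost A \<A> H k)) (q h)) =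
   mdf_vcomp A CAT (hm (pnt2 Ph g) (src H k) (h o{H} k)) (mdf_hcomp A CAT (hn (pnt1 Ph b) k h) (mdf_id A CAT (hpre A t B g)))"
  using Q.m_mdf[of k h] q.modification_axioms q.mdom_c q.mcod_d d_typing[of h ?X] by (simp add: alpha_simps3)
 from arg_cong[OF this, of "%z. hm z a f"]
 show ?thesis
  using hm_vcomp[OF 1 K'.cone_mdf_axioms, of a f] hm_vcomp[OF 2 qk.cone_mdf_axioms, of a f] by simp
qed

end

context bilim_family
begin

lemma at [simp]: "g \<in> Mor B ==> bilim_family_at A H \<A> B t L Ph g"
 by (simp add: bilim_family_at_def bilim_family_at_axioms_def bilim_family_axioms)

text \<open>Naturality of \<open>Ph\<close> at the 2-cell \<open>x\<close> of B, evaluated at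
  \<open>h\<close> and then at one leg of the cone.\<close>

lemma q_cell:
 assumes [simp]: "x \<in> Cell B" "h \<in> Mor H" "trg H h = psf0 L (src B (dom2 B x))" "a \<in> Ob A" "f \<in> Mor B"
  "src B f = trg B (dom2 B x)" "trg B f = psf0 t a"
 shows "hm (hm (pnt2 Ph (cod2 B x)) (src H h) h) a f #{H} ha (ho (pnt1 Ph (src B (dom2 B x))) (src H h) h) a (id2 B f *{B} x) =
  hm (ha (pnt1 Ph (trg B (dom2 B x))) (src H h) (psf2 L x *{H} id2 H h)) a f #{H} hm (hm (pnt2 Ph (dom2 B x)) (src H h) h) a f"
proof -
 let ?X = "src H h" and ?g = "dom2 B x" and ?g' = "cod2 B x" and ?b = "src B (dom2 B x)" and ?b' = "trg B (dom2 B x)"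
 interpret x: bilim_family_at A H \<A> B t L Ph "dom2 B x" by simp
 interpret x': bilim_family_at A H \<A> B t L Ph "cod2 B x" by simp
 interpret q: cone_mdf A H \<A> ?X "W ?b'" "pnt_comp A CAT (ho (pnt1 Ph ?b) ?X h) (hpre A t B ?g)" "ho (pnt1 Ph ?b') ?X (psf1 L ?g o{H} h)" "hm (pnt2 Ph ?g) ?X h"
  by (rule x.q_cone_mdf) simp_all
 interpret q': cone_mdf A H \<A> ?X "W ?b'" "pnt_comp A CAT (ho (pnt1 Ph ?b) ?X h) (hpre A t B ?g')" "ho (pnt1 Ph ?b') ?X (psf1 L ?g' o{H} h)" "hm (pnt2 Ph ?g') ?X h"
  using x'.q_cone_mdf[of h ?X] by simp
 interpret T: cone_mdf A H \<A> ?X "W ?b'" "ho (pnt1 Ph ?b') ?X (psf1 L ?g o{H} h)" "ho (pnt1 Ph ?b') ?X (psf1 L ?g' o{H} h)" "ha (pnt1 Ph ?b') ?X (psf2 L x *{H} id2 H h)"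
  using x.c.cone_mdf_T[of "psf2 L x *{H} id2 H h" "psf1 L ?g o{H} h" ?X "psf1 L ?g' o{H} h"] by simp
 interpret d0: cone_in A H \<A> ?X "W ?b" "ho (pnt1 Ph ?b) ?X h" using x.d.cone_in_c[of h ?X] by simp
 interpret d1: cone_pre A H \<A> ?X B t ?g "ho (pnt1 Ph ?b) ?X h"
  by (intro cone_pre.intro cone_pre_axioms.intro rep_along_b d0.cone_in_axioms) simp_all
 have 1: "cone_mdf A H \<A> ?X (W ?b') (pnt_comp A CAT (ho (pnt1 Ph ?b) ?X h) (hpre A t B ?g)) (pnt_comp A CAT (ho (pnt1 Ph ?b) ?X h) (hpre A t B ?g'))
   (mdf_hcomp A CAT (mdf_id A CAT (ho (pnt1 Ph ?b) ?X h)) (hpre2 A t B x))"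
  using q.c.cone_in_axioms q'.c.cone_in_axioms d0.ph.pseudonatural_axioms by (simp add: cone_mdf_def cone_mdf_axioms_def)
 have "mdf_vcomp A CAT (hm (pnt2 Ph ?g') ?X h) (mdf_hcomp A CAT (mdf_id A CAT (ho (pnt1 Ph ?b) ?X h)) (hpre2 A t B x)) =
  mdf_vcomp A CAT (ha (pnt1 Ph ?b') ?X (psf2 L x *{H} id2 H h)) (hm (pnt2 Ph ?g) ?X h)"
  using arg_cong[OF Phi.pnt2_natural[of x], of "%z. ncmp (mdf2 z ?X) (Inl h)"]
   x.d_typing[of h ?X] q.modification_axioms q.mdom_c q.mcod_d modification.dom2_mdf2[OF x.q_modification(1), of ?X] x.q_modification(2)
   hmdf_modification(2)[OF x.hetero_alpha_beta x.q_modification, of ?X h]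
   hmdf_modification(2)[OF x'.hetero_alpha_beta x'.q_modification, of ?X h] by simp
 from arg_cong[OF this, of "%z. hm z a f"]
 show ?thesis
  using hm_vcomp[OF 1 q'.cone_mdf_axioms, of a f] hm_vcomp[OF q.cone_mdf_axioms T.cone_mdf_axioms, of a f] by simp
qed

end

context bilim_family
begin

text \<open>The composition law of \<open>Ph\<close>, evaluated at \<open>h\<close>. Reindexing
  along a composite is strictly the composite of the reindexings (\<open>pre\<close>), so only the
  structure cell \<open>psfc L g' g\<close> survives, through the morphism of cones it
  induces.\<close>

lemma q_comp:
 assumes [simp]: "g \<in> Mor B" "g' \<in> Mor B" "src B g' = trg B g" "h \<in> Mor H" "trg H h = psf0 L (src B g)" "a \<in> Ob A" "f \<in> Mor B"
  "src B f = trg B g'" "trg B f = psf0 t a"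
 shows "hm (hm (pnt2 Ph (g' o{B} g)) (src H h) h) a f =
  hm (ha (pnt1 Ph (trg B g')) (src H h) (psfc L g' g *{H} id2 H h)) a f #{H}
  hm (hm (pnt2 Ph g') (src H h) (psf1 L g o{H} h)) a f #{H} hm (hm (pnt2 Ph g) (src H h) h) a (f o{B} g')"
proof -
 let ?X = "src H h" and ?b = "src B g" and ?b' = "trg B g" and ?b'' = "trg B g'" and ?h = "psf1 L g o{H} h"
 interpret x: bilim_family_at A H \<A> B t L Ph g by simp
 interpret x': bilim_family_at A H \<A> B t L Ph g' by simp
 interpret c: bilim_family_at A H \<A> B t L Ph "g' o{B} g" by simp
 interpret q: cone_mdf A H \<A> ?X "W ?b'" "pnt_comp A CAT (ho (pnt1 Ph ?b) ?X h) (hpre A t B g)" "ho (pnt1 Ph ?b') ?X ?h" "hm (pnt2 Ph g) ?X h"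
  by (rule x.q_cone_mdf) simp_all
 interpret q': cone_mdf A H \<A> ?X "W ?b''" "pnt_comp A CAT (ho (pnt1 Ph ?b') ?X ?h) (hpre A t B g')" "ho (pnt1 Ph ?b'') ?X (psf1 L g' o{H} ?h)" "hm (pnt2 Ph g') ?X ?h"
  using x'.q_cone_mdf[of ?h ?X] by simp
 interpret qc: cone_mdf A H \<A> ?X "W ?b''" "pnt_comp A CAT (ho (pnt1 Ph ?b) ?X h) (hpre A t B (g' o{B} g))" "ho (pnt1 Ph ?b'') ?X (psf1 L (g' o{B} g) o{H} h)" "hm (pnt2 Ph (g' o{B} g)) ?X h"
  using c.q_cone_mdf[of h ?X] by simp
 interpret T: cone_mdf A H \<A> ?X "W ?b''" "ho (pnt1 Ph ?b'') ?X (psf1 L g' o{H} ?h)" "ho (pnt1 Ph ?b'') ?X (psf1 L (g' o{B} g) o{H} h)" "ha (pnt1 Ph ?b'') ?X (psfc L g' g *{H} id2 H h)"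
  using x'.c.cone_mdf_T[of "psfc L g' g *{H} id2 H h" "psf1 L g' o{H} ?h" ?X "psf1 L (g' o{B} g) o{H} h"] by (simp add: \<A>.H.comp1_assoc')
 have pre: "hpre A t B (g' o{B} g) = pnt_comp A CAT (hpre A t B g) (hpre A t B g')"
  using strict_functor.F1_comp1[OF weights_strict(1)[OF t.pseudofunctor_axioms], of g g'] by simp
 have as: "pnt_comp A CAT (ho (pnt1 Ph ?b) ?X h) (hpre A t B (g' o{B} g)) = pnt_comp A CAT (pnt_comp A CAT (ho (pnt1 Ph ?b) ?X h) (hpre A t B g)) (hpre A t B g')"
  using PA.comp1_assoc'[of "ho (pnt1 Ph ?b) ?X h" "hpre A t B g" "hpre A t B g'"] x.d_typing[of h ?X] by (simp add: pre)
 interpret P1: cone_pre A H \<A> ?X B t g' "pnt_comp A CAT (ho (pnt1 Ph ?b) ?X h) (hpre A t B g)"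
  by (intro cone_pre.intro cone_pre_axioms.intro rep_along_b) (use q.c.cone_in_axioms in simp_all)
 interpret P2: cone_pre A H \<A> ?X B t g' "ho (pnt1 Ph ?b') ?X ?h"
  by (intro cone_pre.intro cone_pre_axioms.intro rep_along_b) (use q.d.cone_in_axioms in simp_all)
 interpret P: cone_mdf_pre A H \<A> ?X B t g' "pnt_comp A CAT (ho (pnt1 Ph ?b) ?X h) (hpre A t B g)" "ho (pnt1 Ph ?b') ?X ?h" "hm (pnt2 Ph g) ?X h"
  by (intro cone_mdf_pre.intro P1.cone_pre_axioms P2.cone_pre_axioms) (use q.cone_mdf_axioms in simp_all)
 have 1: "cone_mdf A H \<A> ?X (W ?b'') (pnt_comp A CAT (ho (pnt1 Ph ?b) ?X h) (hpre A t B (g' o{B} g))) (pnt_comp A CAT (ho (pnt1 Ph ?b') ?X ?h) (hpre A t B g'))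
   (mdf_hcomp A CAT (hm (pnt2 Ph g) ?X h) (mdf_id A CAT (hpre A t B g')))"
  using q'.c.cone_in_axioms qc.c.cone_in_axioms q.modification_axioms q.c.ph.pseudonatural_axioms as x.d_typing[of h ?X] by (simp add: cone_mdf_def cone_mdf_axioms_def)
 have 2: "cone_mdf A H \<A> ?X (W ?b'') (pnt_comp A CAT (ho (pnt1 Ph ?b) ?X h) (hpre A t B (g' o{B} g))) (ho (pnt1 Ph ?b'') ?X (psf1 L g' o{H} ?h))
   (mdf_vcomp A CAT (hm (pnt2 Ph g') ?X ?h) (mdf_hcomp A CAT (hm (pnt2 Ph g) ?X h) (mdf_id A CAT (hpre A t B g'))))"
  using PA.vcomp_typing[of "hm (pnt2 Ph g') ?X ?h" "mdf_hcomp A CAT (hm (pnt2 Ph g) ?X h) (mdf_id A CAT (hpre A t B g'))"] cone_mdf.axioms[OF 1] cone_mdf.mcod_d[OF 1]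
   cone_mdf.mdom_c[OF 1] q'.modification_axioms q'.mdom_c q'.d.cone_in_axioms
  by (simp add: cone_mdf_def cone_mdf_axioms_def vseq_def)
 have d': "pseudonatural A CAT (ho (pnt1 Ph ?b') ?X ?h)" "pdom (ho (pnt1 Ph ?b') ?X ?h) = psf_comp A CAT in_left (W ?b')"
  "pcod (ho (pnt1 Ph ?b') ?X ?h) = psf_comp A CAT in_right (Q ?X)"
  using x'.d_typing[of ?h ?X] by simp_all
 note nq = hmdf_modification(2)[OF x.hetero_alpha_beta x.q_modification, of ?X h]
   hmdf_modification(2)[OF x'.hetero_alpha_beta x'.q_modification, of ?X ?h]
   hmdf_modification(2)[OF c.hetero_alpha_beta c.q_modification, of ?X h]
 note nd = modification.dom2_mdf2[OF x.q_modification(1), of ?X, unfolded x.q_modification(2)]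
   modification.dom2_mdf2[OF x'.q_modification(1), of ?X, unfolded x'.q_modification(2)]
   modification.dom2_mdf2[OF c.q_modification(1), of ?X, unfolded c.q_modification(2)]
 \<comment> \<open>Both whiskerings are expanded with the general formula for horizontal composites;
   the identity factors then cancel in the category of cones.\<close>
 have n1: "ncmp (ntr_hcomp (mdf2 (pnt2 Ph g') ?X) (ntr_id (relabel_fnct Inl Inl (yon_fnct (op2 H) (psf1 L g) ?X)))) (Inl h) =
  Inr (hm (pnt2 Ph g') ?X ?h)"
  using nq(2) nd(2) x.c.T_eqs(1)[of ?h] PA.hcomp_id2'[of "ho (pnt1 Ph ?b') ?X ?h" "hpre A t B g'"] PA.vcomp_id2(1)[of "hm (pnt2 Ph g') ?X ?h"]
   d' q'.modification_axioms q'.mdom_c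
  by (subst ntr_simps(9)) simp_all
 have n2: "ncmp (ntr_hcomp (ntr_id (relabel_fnct Inr Inr (yon_fnct (PS A CAT) (hpre A t B g') (psf_comp A CAT in_right (Q ?X))))) (mdf2 (pnt2 Ph g) ?X)) (Inl h) =
  Inr (mdf_hcomp A CAT (hm (pnt2 Ph g) ?X h) (mdf_id A CAT (hpre A t B g')))"
  using nq(1) nd(1) modification.cod2_mdf2[OF x.q_modification(1), of ?X, unfolded x.q_modification(3)] d' q.modification_axioms q.mdom_c q.mcod_d x.d_typing[of h ?X]
  PA.vcomp_id2(2)[of "mdf_hcomp A CAT (hm (pnt2 Ph g) ?X h) (mdf_id A CAT (hpre A t B g'))"]
  by (subst ntr_simps(9)) simp_all

 have "hm (pnt2 Ph (g' o{B} g)) ?X h = mdf_vcomp A CAT (ha (pnt1 Ph ?b'') ?X (psfc L g' g *{H} id2 H h)) (mdf_vcomp A CAT (hm (pnt2 Ph g') ?X ?h) (mdf_hcomp A CAT (hm (pnt2 Ph g) ?X h) (mdf_id A CAT (hpre A t B g'))))"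
  using arg_cong[OF Phi.pnt2_comp1[of g' g], of "%z. ncmp (mdf2 z ?X) (Inl h)"] n1 n2
   x.d_typing[of h ?X] qc.modification_axioms qc.mdom_c PA.vcomp_id2(1)[of "hm (pnt2 Ph (g' o{B} g)) ?X h"] nq nd
  by simp
 from arg_cong[OF this, of "%z. hm z a f"]
 show ?thesis
  using hm_vcomp[OF 1 q'.cone_mdf_axioms, of a f] hm_vcomp[OF 2 T.cone_mdf_axioms, of a f] by simp
qed

lemma q_unit:
 assumes [simp]: "b \<in> Ob B" "h \<in> Mor H" "trg H h = psf0 L b" "a \<in> Ob A" "f \<in> Mor B" "src B f = b" "trg B f = psf0 t a"
 shows "hm (hm (pnt2 Ph (id1 B b)) (src H h) h) a f = hm (ha (pnt1 Ph b) (src H h) (psfu L b *{H} id2 H h)) a f"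
proof -
 let ?X = "src H h"
 interpret x: bilim_family_at A H \<A> B t L Ph "id1 B b" by simp
 interpret b: bilim_universal A H \<A> "W b" "psf0 L b" "pnt1 Ph b" by (rule universal) simp
 interpret q: cone_mdf A H \<A> ?X "W b" "pnt_comp A CAT (ho (pnt1 Ph b) ?X h) (hpre A t B (id1 B b))" "ho (pnt1 Ph b) ?X (psf1 L (id1 B b) o{H} h)" "hm (pnt2 Ph (id1 B b)) ?X h"
  using x.q_cone_mdf[of h ?X] by simp
 have "hm (pnt2 Ph (id1 B b)) ?X h = ha (pnt1 Ph b) ?X (psfu L b *{H} id2 H h)"
  using arg_cong[OF Phi.pnt2_id1[of b], of "%z. ncmp (mdf2 z ?X) (Inl h)"]
   x.d_typing[of h ?X] q.modification_axioms q.mdom_c q.mcod_d PA.vcomp_id2(1)[of "hm (pnt2 Ph (id1 B b)) ?X h"]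
   modification.dom2_mdf2[OF x.q_modification(1), of ?X] x.q_modification(2)
   hmdf_modification(2)[OF x.hetero_alpha_beta x.q_modification, of ?X h]
  by simp
 then show ?thesis by simp
qed

end

context bilim_family
begin

lemmas cone_at = bilim_universal.axioms(1)[OF universal]

lemmas fam_simps [simp] = bilim_cone.c_simps[OF cone_at] bilim_cone.c_simps2[OF cone_at] bilim_cone.K_simps[OF cone_at]
 bilim_cone.T_simps[OF cone_at] bilim_universal.kappa_simps[OF universal]

lemmas fam_q [simp] = bilim_family_at.q_simps[OF at]

abbreviation C where "C b \<equiv> ho (pnt1 Ph b) (psf0 L b) (id1 H (psf0 L b))"

definition "lam a f = ho (C (src B f)) a f"
definition "lam2 a xi = ha (C (src B (dom2 B xi))) a xi"
definition "lamu u f = hn (C (src B f)) u f"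

abbreviation "chi g a f \<equiv> hm (hm (pnt2 Ph g) (psf0 L (src B g)) (id1 H (psf0 L (src B g)))) a f"
abbreviation "kap b h a f \<equiv> hm (hn (pnt1 Ph b) h (id1 H (psf0 L b))) a f"

text \<open>The passage from \<open>lam a f \<odot> L g\<close> to
  \<open>lam a (f \<odot> g)\<close> in two stages, through the cone classified by
  \<open>L g\<close> at the target of \<open>g\<close>: \<open>kap\<close> compares it with the
  restricted cone, and \<open>chi\<close>, the structure cell of the equivalence at
  \<open>g\<close>, with the reindexed one.\<close>

definition "lamg a f g = inv2 H (chi g a f) #{H} kap (src B f) (psf1 L g) a f"

lemma lam_simps [simp]:
 "[|a \<in> Ob A; f \<in> Mor B; trg B f = psf0 t a|] ==> lam a f \<in> Mor H"
 "[|a \<in> Ob A; f \<in> Mor B; trg B f = psf0 t a|] ==> src H (lam a f) = psf0 L (src B f)"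
 "[|a \<in> Ob A; f \<in> Mor B; trg B f = psf0 t a|] ==> trg H (lam a f) = psf0 \<A> a"
 "[|a \<in> Ob A; xi \<in> Cell B; trg B (dom2 B xi) = psf0 t a|] ==> lam2 a xi \<in> Cell H"
 "[|a \<in> Ob A; xi \<in> Cell B; trg B (dom2 B xi) = psf0 t a|] ==> dom2 H (lam2 a xi) = lam a (dom2 B xi)"
 "[|a \<in> Ob A; xi \<in> Cell B; trg B (dom2 B xi) = psf0 t a|] ==> cod2 H (lam2 a xi) = lam a (cod2 B xi)"
 "[|u \<in> Mor A; f \<in> Mor B; trg B f = psf0 t (src A u)|] ==> iso2 H (lamu u f)"
 "[|u \<in> Mor A; f \<in> Mor B; trg B f = psf0 t (src A u)|] ==> lamu u f \<in> Cell H"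
 "[|u \<in> Mor A; f \<in> Mor B; trg B f = psf0 t (src A u)|] ==> dom2 H (lamu u f) = psf1 \<A> u o{H} lam (src A u) f"
 "[|u \<in> Mor A; f \<in> Mor B; trg B f = psf0 t (src A u)|] ==> cod2 H (lamu u f) = lam (trg A u) (psf1 t u o{B} f)"
 by (simp_all add: lam_def lam2_def lamu_def)

lemma lamg_chi:
 assumes [simp]: "a \<in> Ob A" "f \<in> Mor B" "g \<in> Mor B" "src B f = trg B g" "trg B f = psf0 t a"
 shows "lamg a f g \<in> Cell H" "iso2 H (lamg a f g)" "dom2 H (lamg a f g) = lam a f o{H} psf1 L g"
  "cod2 H (lamg a f g) = lam a (f o{B} g)"
  "chi g a f #{H} lamg a f g = kap (src B f) (psf1 L g) a f"
 by (simp_all add: lamg_def lam_def)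

declare lamg_chi(1-4) [simp]

lemma fold_lam [simp]:
 "src B f = b ==> ho (C b) a f = lam a f" "src B (dom2 B xi) = b ==> ha (C b) a xi = lam2 a xi" "src B f = b ==> hn (C b) u f = lamu u f"
 by (auto simp: lam_def lam2_def lamu_def)

text \<open>\<open>lamg\<close> is a quotient of \<open>kap\<close> by \<open>chi\<close>, so its
  laws are checked after composing with the invertible \<open>chi\<close>. Naturality combines
  \<open>T_kappa\<close> and \<open>K_cone\<close>, for \<open>kap\<close>, with
  \<open>q_cell\<close> and \<open>q_cone\<close>, for \<open>chi\<close>.\<close>

lemma lamg_natural:
 assumes [simp]: "a \<in> Ob A" "xi \<in> Cell B" "x \<in> Cell B" "src B (dom2 B xi) = trg B (dom2 B x)" "trg B (dom2 B xi) = psf0 t a"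
 shows "lamg a (cod2 B xi) (cod2 B x) #{H} (lam2 a xi *{H} psf2 L x) = lam2 a (xi *{B} x) #{H} lamg a (dom2 B xi) (dom2 B x)"
proof -
 let ?f = "dom2 B xi" and ?f' = "cod2 B xi" and ?g = "dom2 B x" and ?g' = "cod2 B x"
 let ?b = "src B ?g" and ?b' = "trg B ?g"
 interpret c: bilim_universal A H \<A> "W ?b'" "psf0 L ?b'" "pnt1 Ph ?b'" by (rule universal) simp
 interpret d: cone_in A H \<A> "psf0 L ?b" "W ?b" "C ?b" using bilim_cone.cone_in_c[OF cone_at, of ?b "id1 H (psf0 L ?b)"] by simp
 interpret x: bilim_family_at A H \<A> B t L Ph ?g by simp
 have s: "lam2 a xi *{H} psf2 L x = (id2 H (lam a ?f') *{H} psf2 L x) #{H} (lam2 a xi *{H} id2 H (psf1 L ?g))"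
  using \<A>.H.exchange(3)[of "lam2 a xi" "psf2 L x"] by simp
 have s': "xi *{B} x = (id2 B ?f' *{B} x) #{B} (xi *{B} id2 B ?g)"
  using t.H.exchange(3)[of xi x] by simp
 have s2: "lam2 a (xi *{B} x) = ha (C ?b) a (id2 B ?f' *{B} x) #{H} ha (C ?b) a (xi *{B} id2 B ?g)"
  using d.cone_eqs(2)[of a "xi *{B} id2 B ?g" "id2 B ?f' *{B} x"] by (simp add: s'[symmetric])
 have k1: "kap ?b' (psf1 L ?g') a ?f' #{H} (id2 H (lam a ?f') *{H} psf2 L x) = hm (ha (pnt1 Ph ?b') (psf0 L ?b) (psf2 L x)) a ?f' #{H} kap ?b' (psf1 L ?g) a ?f'"
  using c.T_kappa[of "psf2 L x" a ?f'] by simp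
 have k2: "kap ?b' (psf1 L ?g) a ?f' #{H} (lam2 a xi *{H} id2 H (psf1 L ?g)) = ha (ho (pnt1 Ph ?b') (psf0 L ?b) (psf1 L ?g)) a xi #{H} kap ?b' (psf1 L ?g) a ?f"
  using c.K_cone(1)[of "id1 H (psf0 L ?b')" "psf1 L ?g" a xi] by simp
 have q1: "chi ?g a ?f' #{H} ha (C ?b) a (xi *{B} id2 B ?g) = ha (ho (pnt1 Ph ?b') (psf0 L ?b) (psf1 L ?g)) a xi #{H} chi ?g a ?f"
  using x.q_cone(1)[of "id1 H (psf0 L ?b)" a xi] by simp
 have q2: "chi ?g' a ?f' #{H} ha (C ?b) a (id2 B ?f' *{B} x) = hm (ha (pnt1 Ph ?b') (psf0 L ?b) (psf2 L x)) a ?f' #{H} chi ?g a ?f'"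
  using q_cell[of x "id1 H (psf0 L ?b)" a ?f'] by simp
 have "chi ?g' a ?f' #{H} lamg a ?f' ?g' #{H} (lam2 a xi *{H} psf2 L x) =
   hm (ha (pnt1 Ph ?b') (psf0 L ?b) (psf2 L x)) a ?f' #{H} ha (ho (pnt1 Ph ?b') (psf0 L ?b) (psf1 L ?g)) a xi #{H} kap ?b' (psf1 L ?g) a ?f"
  using \<A>.H.vcomp_pre[OF lamg_chi(5)[of a ?f' ?g'], of "lam2 a xi *{H} psf2 L x"] k2
   \<A>.H.vcomp_pre[OF k1, of "lam2 a xi *{H} id2 H (psf1 L ?g)"] by (simp add: s \<A>.H.vcomp_assoc)
 also have "... = chi ?g' a ?f' #{H} lam2 a (xi *{B} x) #{H} lamg a ?f ?g"
  using \<A>.H.vcomp_pre[OF q2, of "ha (C ?b) a (xi *{B} id2 B ?g) #{H} lamg a ?f ?g"]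
   \<A>.H.vcomp_pre[OF q1, of "lamg a ?f ?g"] lamg_chi(5)[of a ?f ?g] by (simp add: s2 \<A>.H.vcomp_assoc)
 finally show ?thesis by (rule \<A>.H.iso2_cancel_left[of "chi ?g' a ?f'", rotated]) simp_all
qed

text \<open>Three ingredients: the composition law of \<open>chi\<close> (\<open>q_comp\<close>),
  that of \<open>kap\<close> (\<open>K_nat\<close>), and \<open>q_K\<close>, which exchanges a
  \<open>chi\<close> and a \<open>kap\<close> in the middle.\<close>

lemma lamg_assoc:
 assumes [simp]: "a \<in> Ob A" "f \<in> Mor B" "g \<in> Mor B" "g' \<in> Mor B" "src B f = trg B g'" "src B g' = trg B g" "trg B f = psf0 t a"
 shows "lamg a f (g' o{B} g) #{H} (id2 H (lam a f) *{H} psfc L g' g) = lamg a (f o{B} g') g #{H} (lamg a f g' *{H} id2 H (psf1 L g))"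
proof -
 let ?b = "src B g" and ?b' = "trg B g" and ?b2 = "trg B g'"
 interpret c: bilim_universal A H \<A> "W ?b2" "psf0 L ?b2" "pnt1 Ph ?b2" by (rule universal) simp
 interpret x: bilim_family_at A H \<A> B t L Ph g' by simp
 let ?q = "hm (hm (pnt2 Ph g') (psf0 L ?b) (psf1 L g)) a f"
 have q: "chi (g' o{B} g) a f = hm (ha (pnt1 Ph ?b2) (psf0 L ?b) (psfc L g' g)) a f #{H} ?q #{H} chi g a (f o{B} g')"
  using q_comp[of g g' "id1 H (psf0 L ?b)" a f] by simp
 have k: "kap ?b2 (psf1 L (g' o{B} g)) a f #{H} (id2 H (lam a f) *{H} psfc L g' g) =
   hm (ha (pnt1 Ph ?b2) (psf0 L ?b) (psfc L g' g)) a f #{H} kap ?b2 (psf1 L g' o{H} psf1 L g) a f"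
  using c.T_kappa[of "psfc L g' g" a f] by simp
 have k': "kap ?b2 (psf1 L g' o{H} psf1 L g) a f = hm (hn (pnt1 Ph ?b2) (psf1 L g) (psf1 L g')) a f #{H} (kap ?b2 (psf1 L g') a f *{H} id2 H (psf1 L g))"
  using c.K_nat(3)[of "id1 H (psf0 L ?b2)" a f "psf1 L g'" "psf1 L g"] by simp
 have qk: "hm (hn (pnt1 Ph ?b2) (psf1 L g) (psf1 L g')) a f #{H} (chi g' a f *{H} id2 H (psf1 L g)) = ?q #{H} kap ?b' (psf1 L g) a (f o{B} g')"
  using x.q_K[of "id1 H (psf0 L ?b')" "psf1 L g" a f] by simp
 let ?T = "hm (ha (pnt1 Ph ?b2) (psf0 L ?b) (psfc L g' g)) a f"
 have w: "(chi g' a f *{H} id2 H (psf1 L g)) #{H} (lamg a f g' *{H} id2 H (psf1 L g)) = kap ?b2 (psf1 L g') a f *{H} id2 H (psf1 L g)"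
  using arg_cong[OF lamg_chi(5)[of a f g'], of "%z. z *{H} id2 H (psf1 L g)"] by (simp add: \<A>.H.whisker_vcomp_right)
 have "chi (g' o{B} g) a f #{H} lamg a f (g' o{B} g) #{H} (id2 H (lam a f) *{H} psfc L g' g) =
  ?T #{H} hm (hn (pnt1 Ph ?b2) (psf1 L g) (psf1 L g')) a f #{H} (kap ?b2 (psf1 L g') a f *{H} id2 H (psf1 L g))"
  using \<A>.H.vcomp_pre[OF lamg_chi(5)[of a f "g' o{B} g"], of "id2 H (lam a f) *{H} psfc L g' g"] k k'
  by (simp add: \<A>.H.vcomp_assoc)
 also have "... = ?T #{H} ?q #{H} kap ?b' (psf1 L g) a (f o{B} g') #{H} (lamg a f g' *{H} id2 H (psf1 L g))"
  using \<A>.H.vcomp_pre[OF qk, of "lamg a f g' *{H} id2 H (psf1 L g)"] w by (simp add: \<A>.H.pasting)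
 also have "... = chi (g' o{B} g) a f #{H} lamg a (f o{B} g') g #{H} (lamg a f g' *{H} id2 H (psf1 L g))"
  using q \<A>.H.vcomp_pre[OF lamg_chi(5)[of a "f o{B} g'" g], of "lamg a f g' *{H} id2 H (psf1 L g)"]
  by (simp add: \<A>.H.vcomp_assoc t.H.comp1_assoc')
 finally show ?thesis by (rule \<A>.H.iso2_cancel_left[of "chi (g' o{B} g) a f", rotated]) (simp_all add: t.H.comp1_assoc' \<A>.H.comp1_assoc')
qed

text \<open>At an identity of B, both \<open>chi\<close> and the composite of \<open>kap\<close>
  with the unit cell of L equal the component of the cone morphism induced by \<open>psfu L\<close>,
  so they cancel.\<close>

lemma lamg_unit:
 assumes [simp]: "a \<in> Ob A" "f \<in> Mor B" "trg B f = psf0 t a"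
 shows "lamg a f (id1 B (src B f)) #{H} (id2 H (lam a f) *{H} psfu L (src B f)) = id2 H (lam a f)"
proof -
 let ?b = "src B f" and ?i = "id1 B (src B f)"
 interpret c: bilim_universal A H \<A> "W ?b" "psf0 L ?b" "pnt1 Ph ?b" by (rule universal) simp
 have k: "kap ?b (psf1 L ?i) a f #{H} (id2 H (lam a f) *{H} psfu L ?b) = hm (ha (pnt1 Ph ?b) (psf0 L ?b) (psfu L ?b)) a f"
  using c.T_kappa[of "psfu L ?b" a f] c.K_nat(4)[of "id1 H (psf0 L ?b)" a f] by simp
 have q: "chi ?i a f = hm (ha (pnt1 Ph ?b) (psf0 L ?b) (psfu L ?b)) a f"
  using q_unit[of ?b "id1 H (psf0 L ?b)" a f] by simp
 have "chi ?i a f #{H} lamg a f ?i #{H} (id2 H (lam a f) *{H} psfu L ?b) = chi ?i a f #{H} id2 H (lam a f)"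
  using \<A>.H.vcomp_pre[OF lamg_chi(5)[of a f ?i], of "id2 H (lam a f) *{H} psfu L ?b"] k q by simp
 then show ?thesis by (rule \<A>.H.iso2_cancel_left[of "chi ?i a f", rotated]) simp_all
qed

text \<open>\<open>chi\<close> and \<open>kap\<close> are both components of morphisms of cones,
  hence each commutes with the comparison cells along \<open>u\<close>.\<close>

lemma lamu_lamg:
 assumes [simp]: "u \<in> Mor A" "f \<in> Mor B" "g \<in> Mor B" "src B f = trg B g" "trg B f = psf0 t (src A u)"
 shows "lamu u (f o{B} g) #{H} (id2 H (psf1 \<A> u) *{H} lamg (src A u) f g) =
   lamg (trg A u) (psf1 t u o{B} f) g #{H} (lamu u f *{H} id2 H (psf1 L g))"
proof -
 let ?b = "src B g" and ?b' = "trg B g"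
 interpret c: bilim_universal A H \<A> "W ?b'" "psf0 L ?b'" "pnt1 Ph ?b'" by (rule universal) simp
 interpret x: bilim_family_at A H \<A> B t L Ph g by simp
 let ?a = "src A u" and ?a' = "trg A u" and ?uf = "psf1 t u o{B} f" and ?u = "id2 H (psf1 \<A> u)"
 let ?n = "hn (ho (pnt1 Ph ?b') (psf0 L ?b) (psf1 L g)) u f"
 have k: "?n #{H} (?u *{H} kap ?b' (psf1 L g) ?a f) = kap ?b' (psf1 L g) ?a' ?uf #{H} (lamu u f *{H} id2 H (psf1 L g))"
  using c.K_cone(2)[of "id1 H (psf0 L ?b')" "psf1 L g" u f] by simp
 have q: "?n #{H} (?u *{H} chi g ?a f) = chi g ?a' ?uf #{H} lamu u (f o{B} g)"
  using x.q_cone(2)[of "id1 H (psf0 L ?b)" u f] by simp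
 have "?u *{H} kap ?b' (psf1 L g) ?a f = (?u *{H} chi g ?a f) #{H} (?u *{H} lamg ?a f g)"
  using arg_cong[OF lamg_chi(5)[of ?a f g], of "%z. ?u *{H} z"] by (simp add: \<A>.H.whisker_vcomp_left)
 then have "chi g ?a' ?uf #{H} lamu u (f o{B} g) #{H} (?u *{H} lamg ?a f g) = kap ?b' (psf1 L g) ?a' ?uf #{H} (lamu u f *{H} id2 H (psf1 L g))"
  using \<A>.H.vcomp_pre[OF q, of "?u *{H} lamg ?a f g"] k by (simp add: \<A>.H.pasting t.H.comp1_assoc')
 also have "... = chi g ?a' ?uf #{H} lamg ?a' ?uf g #{H} (lamu u f *{H} id2 H (psf1 L g))"
  using \<A>.H.vcomp_pre[OF lamg_chi(5)[of ?a' ?uf g], of "lamu u f *{H} id2 H (psf1 L g)"] by (simp add: \<A>.H.comp1_assoc')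
 finally show ?thesis by (rule \<A>.H.iso2_cancel_left[of "chi g ?a' ?uf", rotated]) (simp_all add: \<A>.H.comp1_assoc' t.H.comp1_assoc')
qed

lemma bimodule: "bimodule_cone A H \<A> B t L lam lam2 lamu lamg"
proof (rule bimodule_cone.intro[OF \<A>.pseudofunctor_axioms t.pseudofunctor_axioms L.pseudofunctor_axioms bimodule_cone_axioms.intro], goal_cases)
 case (7 a f)
 interpret d: cone_in A H \<A> "psf0 L (src B f)" "W (src B f)" "C (src B f)"
  using bilim_cone.cone_in_c[OF cone_at, of "src B f" "id1 H (psf0 L (src B f))"] 7 by simp
 show ?case using d.cone_eqs(1)[of a f] 7 by simp
next
 case (8 a xi xi')
 interpret d: cone_in A H \<A> "psf0 L (src B (dom2 B xi))" "W (src B (dom2 B xi))" "C (src B (dom2 B xi))"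
  using bilim_cone.cone_in_c[OF cone_at, of "src B (dom2 B xi)" "id1 H (psf0 L (src B (dom2 B xi)))"] 8 by simp
 show ?case using d.cone_eqs(2)[of a xi xi'] 8 by simp
next
 case (13 u xi)
 interpret d: cone_in A H \<A> "psf0 L (src B (dom2 B xi))" "W (src B (dom2 B xi))" "C (src B (dom2 B xi))"
  using bilim_cone.cone_in_c[OF cone_at, of "src B (dom2 B xi)" "id1 H (psf0 L (src B (dom2 B xi)))"] 13 by simp
 show ?case using d.cone_eqs(3)[of u xi] 13 by simp
next
 case (14 x f)
 interpret d: cone_in A H \<A> "psf0 L (src B f)" "W (src B f)" "C (src B f)"
  using bilim_cone.cone_in_c[OF cone_at, of "src B f" "id1 H (psf0 L (src B f))"] 14 by simp
 show ?case using d.cone_eqs(4)[of x f] 14 by simp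
next
 case (15 u v f)
 interpret d: cone_in A H \<A> "psf0 L (src B f)" "W (src B f)" "C (src B f)"
  using bilim_cone.cone_in_c[OF cone_at, of "src B f" "id1 H (psf0 L (src B f))"] 15 by simp
 interpret W: rep_along A B t "src B f" using 15 by (intro rep_along_b) simp
 show ?case using d.cone_eqs(5)[of v u f] 15 by simp
next
 case (16 a f)
 interpret d: cone_in A H \<A> "psf0 L (src B f)" "W (src B f)" "C (src B f)"
  using bilim_cone.cone_in_c[OF cone_at, of "src B f" "id1 H (psf0 L (src B f))"] 16 by simp
 interpret W: rep_along A B t "src B f" using 16 by (intro rep_along_b) simp
 show ?case using d.cone_eqs(6)[of a f] 16 by simp
qed (simp_all add: lamg_natural lamg_assoc lamg_unit lamu_lamg)

theorem universal_cone: "universal_cone A H \<A> B t L lam lam2 lamu lamg"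
proof (rule universal_cone.intro[OF bimodule universal_cone_axioms.intro], goal_cases)
 case (1 b h h' m)
 interpret u: bilim_universal A H \<A> "W b" "psf0 L b" "pnt1 Ph b" using 1(1) by (rule universal)
 show ?case using u.lam_full[of h h' m] 1 by (simp add: Ball_def imp_conjL)
next
 case (2 b th th')
 interpret u: bilim_universal A H \<A> "W b" "psf0 L b" "pnt1 Ph b" using 2(1) by (rule universal)
 show ?case by (rule u.lam_faithful) (use 2 in simp_all)
next
 case (3 b X x x2 xu)
 interpret u: bilim_universal A H \<A> "W b" "psf0 L b" "pnt1 Ph b" using 3(1) by (rule universal)
 show ?case using u.lam_representable[OF 3(2,3)] 3(1) by (simp add: Ball_def imp_conjL)
qed

end

section \<open>The cone of a transformation, and the counit\<close>

locale gamma_cone = t: pseudofunctor A B t + S: pseudofunctor B H S + ga: pseudonatural A H ga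
 for A :: "('a0, 'a1, 'a2) twocat" and B :: "('b0, 'b1, 'b2) twocat" and H :: "('h0, 'h1, 'h2) twocat" and t S ga +
 assumes pdom_gamma [simp]: "pdom ga = psf_comp A H S t"
begin

abbreviation "\<A> \<equiv> pcod ga"
definition x where "x a f = pnt1 ga a o{H} psf1 S f"
definition x2 where "x2 a xi = id2 H (pnt1 ga a) *{H} psf2 S xi"
text \<open>In two stages: the structure cell of \<open>ga\<close> at \<open>u\<close> moves the
  component past \<open>\<A> u\<close>, and \<open>psfc S\<close> then merges \<open>S (t u)\<close>
  with \<open>S f\<close>.\<close>

definition xu where "xu u f = (id2 H (pnt1 ga (trg A u)) *{H} psfc S (psf1 t u) f) #{H} (pnt2 ga u *{H} id2 H (psf1 S f))"
definition xg where "xg a f g = id2 H (pnt1 ga a) *{H} psfc S f g"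

lemma comp_simps [simp]:
 "v \<in> Mor A ==> u \<in> Mor A ==> src A v = trg A u ==> psfc (psf_comp A H S t) v u = psf2 S (psfc t v u) #{H} psfc S (psf1 t v) (psf1 t u)"
 "a \<in> Ob A ==> psfu (psf_comp A H S t) a = psf2 S (psfu t a) #{H} psfu S (psf0 t a)"
 by (simp_all add: psf_comp_def)

text \<open>The laws along B are coherence laws of S whiskered by a component of \<open>ga\<close>.
  The laws along A paste axioms of \<open>ga\<close> with coherence of S, and naturality of
  \<open>psfc S\<close> at \<open>psfc t\<close> and \<open>psfu t\<close> absorbs the structure
  cells of \<open>t\<close>.\<close>

lemma bimodule: "bimodule_cone A H \<A> B t S x x2 xu xg"
proof (rule bimodule_cone.intro[OF ga.G.pseudofunctor_axioms t.pseudofunctor_axioms S.pseudofunctor_axioms bimodule_cone_axioms.intro], goal_cases)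
 case (8 a xi xi')
 then show ?case by (simp add: x2_def S.psf2_vcomp S.H.whisker_vcomp_left)
next
 case (13 u xi)
 then have [simp]: "u \<in> Mor A" "xi \<in> Cell B" "trg B (dom2 B xi) = psf0 t (src A u)" by simp_all
 have "(pnt2 ga u *{H} id2 H (psf1 S (cod2 B xi))) #{H} (id2 H (psf1 \<A> u) *{H} id2 H (pnt1 ga (src A u)) *{H} psf2 S xi) =
  (id2 H (pnt1 ga (trg A u)) *{H} id2 H (psf1 S (psf1 t u)) *{H} psf2 S xi) #{H} (pnt2 ga u *{H} id2 H (psf1 S (dom2 B xi)))"
  using S.H.exchange(1)[of "pnt2 ga u" "psf2 S xi"] by (simp add: S.H.pasting)
 moreover have 2: "(id2 H (pnt1 ga (trg A u)) *{H} psfc S (psf1 t u) (cod2 B xi)) #{H} (id2 H (pnt1 ga (trg A u)) *{H} id2 H (psf1 S (psf1 t u)) *{H} psf2 S xi) =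
   (id2 H (pnt1 ga (trg A u)) *{H} psf2 S (id2 B (psf1 t u) *{B} xi)) #{H} (id2 H (pnt1 ga (trg A u)) *{H} psfc S (psf1 t u) (dom2 B xi))"
  using arg_cong[OF S.psfc_natural[of xi "id2 B (psf1 t u)"], of "%z. id2 H (pnt1 ga (trg A u)) *{H} z"]
  by (simp add: S.H.whisker_vcomp_left S.H.pasting)
 ultimately show ?case
  using S.H.vcomp_pre[OF 2, of "pnt2 ga u *{H} id2 H (psf1 S (dom2 B xi))"]
  by (simp add: xu_def x2_def S.H.pasting)
next
 case (14 y f)
 then have [simp]: "y \<in> Cell A" "f \<in> Mor B" "trg B f = psf0 t (src A (dom2 A y))" by simp_all
 let ?g = "id2 H (pnt1 ga (trg A (dom2 A y)))"
 have 1: "(pnt2 ga (cod2 A y) *{H} id2 H (psf1 S f)) #{H} (psf2 \<A> y *{H} id2 H (x (src A (dom2 A y)) f)) =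
   (?g *{H} psf2 S (psf2 t y) *{H} id2 H (psf1 S f)) #{H} (pnt2 ga (dom2 A y) *{H} id2 H (psf1 S f))"
  using arg_cong[OF ga.pnt2_natural[of y], of "%z. z *{H} id2 H (psf1 S f)"]
  by (simp add: x_def S.H.whisker_vcomp_right S.H.pasting)
 have 2: "(?g *{H} psfc S (psf1 t (cod2 A y)) f) #{H} (?g *{H} psf2 S (psf2 t y) *{H} id2 H (psf1 S f)) =
   x2 (trg A (dom2 A y)) (psf2 t y *{B} id2 B f) #{H} (?g *{H} psfc S (psf1 t (dom2 A y)) f)"
  using arg_cong[OF S.psfc_natural[of "id2 B f" "psf2 t y"], of "%z. ?g *{H} z"]
  by (simp add: x2_def S.H.whisker_vcomp_left S.H.pasting)
 show ?case
  using 1 S.H.vcomp_pre[OF 2, of "pnt2 ga (dom2 A y) *{H} id2 H (psf1 S f)"]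
  by (simp add: xu_def x2_def x_def S.H.pasting)
next
 case (15 u v f)
 then have [simp]: "u \<in> Mor A" "v \<in> Mor A" "src A v = trg A u" "f \<in> Mor B" "trg B f = psf0 t (src A u)" by simp_all
 let ?g = "id2 H (pnt1 ga (trg A v))" and ?tu = "psf1 t u" and ?tv = "psf1 t v"
 let ?r = "(pnt2 ga v *{H} id2 H (psf1 S ?tu) *{H} id2 H (psf1 S f)) #{H} (id2 H (psf1 \<A> v) *{H} pnt2 ga u *{H} id2 H (psf1 S f))"
 have 1: "(pnt2 ga (v o{A} u) *{H} id2 H (psf1 S f)) #{H} (psfc \<A> v u *{H} id2 H (x (src A u) f)) =
   (?g *{H} psf2 S (psfc t v u) *{H} id2 H (psf1 S f)) #{H} (?g *{H} psfc S ?tv ?tu *{H} id2 H (psf1 S f)) #{H} ?r"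
  using arg_cong[OF ga.pnt2_comp1[of v u], of "%z. z *{H} id2 H (psf1 S f)"]
  by (simp add: x_def S.H.whisker_vcomp_left S.H.whisker_vcomp_right S.H.pasting)
 have 2: "(?g *{H} psfc S (psf1 t (v o{A} u)) f) #{H} (?g *{H} psf2 S (psfc t v u) *{H} id2 H (psf1 S f)) =
   x2 (trg A v) (psfc t v u *{B} id2 B f) #{H} (?g *{H} psfc S (?tv o{B} ?tu) f)"
  using arg_cong[OF S.psfc_natural[of "id2 B f" "psfc t v u"], of "%z. ?g *{H} z"]
  by (simp add: x2_def S.H.whisker_vcomp_left S.H.pasting)
 have 3: "(?g *{H} psfc S (?tv o{B} ?tu) f) #{H} (?g *{H} psfc S ?tv ?tu *{H} id2 H (psf1 S f)) =
   (?g *{H} psfc S ?tv (?tu o{B} f)) #{H} (?g *{H} id2 H (psf1 S ?tv) *{H} psfc S ?tu f)"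
  using arg_cong[OF S.psfc_assoc[of ?tu f ?tv], of "%z. ?g *{H} z"]
  by (simp add: S.H.whisker_vcomp_left S.H.pasting t.H.comp1_assoc')
 have 4: "(?g *{H} id2 H (psf1 S ?tv) *{H} psfc S ?tu f) #{H} (pnt2 ga v *{H} id2 H (psf1 S ?tu) *{H} id2 H (psf1 S f)) =
   (pnt2 ga v *{H} id2 H (psf1 S (?tu o{B} f))) #{H} (id2 H (psf1 \<A> v) *{H} id2 H (pnt1 ga (trg A u)) *{H} psfc S ?tu f)"
  using S.H.exchange(1)[of "pnt2 ga v" "psfc S ?tu f"] by (simp add: S.H.pasting)
 have "xu (v o{A} u) f #{H} (psfc \<A> v u *{H} id2 H (x (src A u) f)) =
   (?g *{H} psfc S (psf1 t (v o{A} u)) f) #{H} (?g *{H} psf2 S (psfc t v u) *{H} id2 H (psf1 S f)) #{H} (?g *{H} psfc S ?tv ?tu *{H} id2 H (psf1 S f)) #{H} ?r"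
  using 1 by (simp add: xu_def x_def S.H.vcomp_assoc S.H.comp1_assoc')
 also have "... = x2 (trg A v) (psfc t v u *{B} id2 B f) #{H} (?g *{H} psfc S ?tv (?tu o{B} f)) #{H} (?g *{H} id2 H (psf1 S ?tv) *{H} psfc S ?tu f) #{H} ?r"
  using S.H.vcomp_pre[OF 2, of "(?g *{H} psfc S ?tv ?tu *{H} id2 H (psf1 S f)) #{H} ?r"] S.H.vcomp_pre[OF 3, of ?r]
  by (simp add: x2_def S.H.pasting)
 also have "... = x2 (trg A v) (psfc t v u *{B} id2 B f) #{H} xu v (?tu o{B} f) #{H} (id2 H (psf1 \<A> v) *{H} xu u f)"
  using S.H.vcomp_pre[OF 4, of "id2 H (psf1 \<A> v) *{H} pnt2 ga u *{H} id2 H (psf1 S f)"]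
  by (simp add: xu_def x2_def S.H.whisker_vcomp_left S.H.pasting t.H.comp1_assoc')
 finally show ?case .
next
 case (16 a f)
 then have [simp]: "a \<in> Ob A" "f \<in> Mor B" "trg B f = psf0 t a" by simp_all
 let ?g = "id2 H (pnt1 ga a)" and ?t1 = "psf1 t (id1 A a)"
 have 1: "(pnt2 ga (id1 A a) *{H} id2 H (psf1 S f)) #{H} (psfu \<A> a *{H} id2 H (x a f)) =
   (?g *{H} psf2 S (psfu t a) *{H} id2 H (psf1 S f)) #{H} (?g *{H} psfu S (psf0 t a) *{H} id2 H (psf1 S f))"
  using arg_cong[OF ga.pnt2_id1[of a], of "%z. z *{H} id2 H (psf1 S f)"]
  by (simp add: x_def S.H.whisker_vcomp_left S.H.whisker_vcomp_right S.H.pasting)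
 have 2: "(?g *{H} psfc S ?t1 f) #{H} (?g *{H} psf2 S (psfu t a) *{H} id2 H (psf1 S f)) =
   x2 a (psfu t a *{B} id2 B f) #{H} (?g *{H} psfc S (id1 B (psf0 t a)) f)"
  using arg_cong[OF S.psfc_natural[of "id2 B f" "psfu t a"], of "%z. ?g *{H} z"]
  by (simp add: x2_def S.H.whisker_vcomp_left S.H.pasting)
 have 3: "(?g *{H} psfc S (id1 B (psf0 t a)) f) #{H} (?g *{H} psfu S (psf0 t a) *{H} id2 H (psf1 S f)) = id2 H (x a f)"
  using arg_cong[OF S.psfc_unit_left[of f], of "%z. ?g *{H} z"] by (simp add: x_def S.H.whisker_vcomp_left S.H.pasting)
 show ?case
  using 1 3 S.H.vcomp_pre[OF 2, of "?g *{H} psfu S (psf0 t a) *{H} id2 H (psf1 S f)"]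
  by (simp add: xu_def x_def x2_def S.H.pasting)
next
 case (21 a xi xi')
 then show ?case
  using arg_cong[OF S.psfc_natural[of xi' xi], of "%z. id2 H (pnt1 ga a) *{H} z"]
  by (simp add: xg_def x2_def S.H.whisker_vcomp_left S.H.pasting)
next
 case (22 a f g g')
 then show ?case
  using arg_cong[OF S.psfc_assoc[of g' g f], of "%z. id2 H (pnt1 ga a) *{H} z"]
  by (simp add: xg_def x_def S.H.whisker_vcomp_left S.H.pasting)
next
 case (23 a f)
 then show ?case
  using arg_cong[OF S.psfc_unit_right[of f], of "%z. id2 H (pnt1 ga a) *{H} z"]
  by (simp add: xg_def x_def S.H.whisker_vcomp_left S.H.pasting)
next
 case (24 u f g)
 then have [simp]: "u \<in> Mor A" "f \<in> Mor B" "g \<in> Mor B" "src B f = trg B g" "trg B f = psf0 t (src A u)" by simp_all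
 let ?g = "id2 H (pnt1 ga (trg A u))" and ?tu = "psf1 t u"
 have 1: "(?g *{H} psfc S ?tu (f o{B} g)) #{H} (?g *{H} id2 H (psf1 S ?tu) *{H} psfc S f g) = (?g *{H} psfc S (?tu o{B} f) g) #{H} (?g *{H} psfc S ?tu f *{H} id2 H (psf1 S g))"
  using arg_cong[OF S.psfc_assoc[of f g ?tu], of "%z. ?g *{H} z"]
  by (simp add: S.H.whisker_vcomp_left S.H.pasting t.H.comp1_assoc')
 have 2: "(pnt2 ga u *{H} id2 H (psf1 S (f o{B} g))) #{H} (id2 H (psf1 \<A> u) *{H} id2 H (pnt1 ga (src A u)) *{H} psfc S f g) =
   (?g *{H} id2 H (psf1 S ?tu) *{H} psfc S f g) #{H} (pnt2 ga u *{H} id2 H (psf1 S f) *{H} id2 H (psf1 S g))"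
  using S.H.exchange(1)[of "pnt2 ga u" "psfc S f g"] by (simp add: S.H.pasting)
 show ?case
  using 2 S.H.vcomp_pre[OF 1, of "pnt2 ga u *{H} id2 H (psf1 S f) *{H} id2 H (psf1 S g)"]
  by (simp add: xu_def xg_def S.H.whisker_vcomp_right S.H.pasting t.H.comp1_assoc')
qed (simp_all add: x_def x2_def xu_def xg_def S.H.comp1_assoc')

end

sublocale gamma_cone \<subseteq> x: bimodule_cone A H \<A> B t S x x2 xu xg by (rule bimodule)

context bimodule_cone
begin

abbreviation "unit a \<equiv> id1 B (psf0 t a)"
abbreviation "lamu1 u \<equiv> lamu u (unit (src A u))"
abbreviation "l a f \<equiv> lamg a (unit a) f"
text \<open>\<open>l\<close> identifies \<open>lam a 1 \<odot> L f\<close> with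
  \<open>lam a f\<close>. The structure cell of the counit at \<open>u\<close> is thus
  \<open>lamu\<close> at an identity, rewritten through \<open>l\<close> so that its codomain has
  the form required of a transformation out of \<open>L t\<close>.\<close>

definition "eps2 u = inv2 H (l (trg A u) (psf1 t u)) #{H} lamu1 u"
definition "epsilon = \<lparr>pdom = psf_comp A H L t, pcod = \<A>, pnt1 = (\<lambda>a \<in> Ob A. lam a (unit a)), pnt2 = (\<lambda>u \<in> Mor A. eps2 u)\<rparr>"

lemma l_simps [simp]:
 "a \<in> Ob A ==> f \<in> Mor B ==> trg B f = psf0 t a ==> iso2 H (l a f)"
 "a \<in> Ob A ==> f \<in> Mor B ==> trg B f = psf0 t a ==> l a f \<in> Cell H"
 "a \<in> Ob A ==> f \<in> Mor B ==> trg B f = psf0 t a ==> dom2 H (l a f) = lam a (unit a) o{H} psf1 L f"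
 "a \<in> Ob A ==> f \<in> Mor B ==> trg B f = psf0 t a ==> cod2 H (l a f) = lam a f"
 by simp_all

lemma eps2_simps [simp]:
 assumes [simp]: "u \<in> Mor A"
 shows "iso2 H (eps2 u)" "eps2 u \<in> Cell H" "dom2 H (eps2 u) = psf1 \<A> u o{H} lam (src A u) (unit (src A u))"
  "cod2 H (eps2 u) = lam (trg A u) (unit (trg A u)) o{H} psf1 L (psf1 t u)"
 by (simp_all add: eps2_def)

lemma epsilon_simps [simp]:
 "pdom epsilon = psf_comp A H L t" "pcod epsilon = \<A>" "a \<in> Ob A ==> pnt1 epsilon a = lam a (unit a)" "u \<in> Mor A ==> pnt2 epsilon u = eps2 u"
 by (simp_all add: epsilon_def)

lemma l_eps2: "u \<in> Mor A ==> l (trg A u) (psf1 t u) #{H} eps2 u = lamu1 u"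
 by (simp add: eps2_def)

lemma l_natural:
 "a \<in> Ob A ==> xi \<in> Cell B ==> trg B (dom2 B xi) = psf0 t a ==>
  l a (cod2 B xi) #{H} (id2 H (lam a (unit a)) *{H} psf2 L xi) = lam2 a xi #{H} l a (dom2 B xi)"
 using lamg_natural[of a "id2 B (unit a)" xi] by simp

lemma l_assoc:
 "a \<in> Ob A ==> f \<in> Mor B ==> g \<in> Mor B ==> trg B f = psf0 t a ==> src B f = trg B g ==>
  l a (f o{B} g) #{H} (id2 H (lam a (unit a)) *{H} psfc L f g) = lamg a f g #{H} (l a f *{H} id2 H (psf1 L g))"
 using lamg_assoc[of a "unit a" g f] by simp

lemma l_unit:
 "a \<in> Ob A ==> l a (unit a) #{H} (id2 H (lam a (unit a)) *{H} psfu L (psf0 t a)) = id2 H (lam a (unit a))"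
 using lamg_unit[of a "unit a"] by simp

text \<open>Recovers \<open>lamu\<close> at an arbitrary \<open>f\<close> from the counit: start at
  the identity and use compatibility of \<open>lamu\<close> with precomposition by
  \<open>f\<close>.\<close>

lemma lamu_l:
 assumes [simp]: "u \<in> Mor A" "f \<in> Mor B" "trg B f = psf0 t (src A u)"
 shows "lamu u f #{H} (id2 H (psf1 \<A> u) *{H} l (src A u) f) =
  l (trg A u) (psf1 t u o{B} f) #{H} (id2 H (lam (trg A u) (unit (trg A u))) *{H} psfc L (psf1 t u) f) #{H} (eps2 u *{H} id2 H (psf1 L f))"
proof -
 have "(l (trg A u) (psf1 t u) *{H} id2 H (psf1 L f)) #{H} (eps2 u *{H} id2 H (psf1 L f)) = lamu1 u *{H} id2 H (psf1 L f)"
  using arg_cong[OF l_eps2[of u], of "%z. z *{H} id2 H (psf1 L f)"] by (simp add: \<A>.H.whisker_vcomp_right)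
 then show ?thesis
  using lamu_lamg[of u "unit (src A u)" f] \<A>.H.vcomp_pre[OF l_assoc[of "trg A u" "psf1 t u" f], of "eps2 u *{H} id2 H (psf1 L f)"]
  by (simp add: \<A>.H.pasting)
qed

lemma psf_comp_Lt [simp]:
 "v \<in> Mor A ==> u \<in> Mor A ==> src A v = trg A u ==> psfc (psf_comp A H L t) v u = psf2 L (psfc t v u) #{H} psfc L (psf1 t v) (psf1 t u)"
 "a \<in> Ob A ==> psfu (psf_comp A H L t) a = psf2 L (psfu t a) #{H} psfu L (psf0 t a)"
 "pseudofunctor A H (psf_comp A H L t)"
 by (simp_all add: psf_comp_def pseudofunctor_psf_comp[OF t.pseudofunctor_axioms L.pseudofunctor_axioms, unfolded psf_comp_def])

text \<open>Each axiom is the axiom of \<open>lamu\<close> at identities, compared after composing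
  with the invertible \<open>l\<close>; the composition law also needs \<open>lamu_l\<close>, since
  the second 1-cell meets a leg that is no longer an identity.\<close>

lemma pseudonatural_epsilon: "pseudonatural A H epsilon"
proof (rule pseudonatural.intro, goal_cases)
 case (11 y)
 then have [simp]: "y \<in> Cell A" .
 let ?a = "src A (dom2 A y)" and ?a' = "trg A (dom2 A y)" and ?u = "dom2 A y" and ?u' = "cod2 A y"
 have "l ?a' (psf1 t ?u') #{H} eps2 ?u' #{H} (psf2 \<A> y *{H} id2 H (lam ?a (unit ?a))) = lam2 ?a' (psf2 t y) #{H} lamu1 ?u"
  using lamu_cell[of y "unit ?a"] \<A>.H.vcomp_pre[OF l_eps2[of ?u'], of "psf2 \<A> y *{H} id2 H (lam ?a (unit ?a))"] by simp
 also have "... = l ?a' (psf1 t ?u') #{H} (id2 H (lam ?a' (unit ?a')) *{H} psf2 L (psf2 t y)) #{H} eps2 ?u"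
  using \<A>.H.vcomp_pre[OF l_natural[of ?a' "psf2 t y"], of "eps2 ?u"] by (simp add: l_eps2 \<A>.H.vcomp_assoc)
 finally have "eps2 ?u' #{H} (psf2 \<A> y *{H} id2 H (lam ?a (unit ?a))) = (id2 H (lam ?a' (unit ?a')) *{H} psf2 L (psf2 t y)) #{H} eps2 ?u"
  by (rule \<A>.H.iso2_cancel_left[rotated]) simp_all
 then show ?case by simp
next
 case (12 v u)
 then have [simp]: "u \<in> Mor A" "v \<in> Mor A" "src A v = trg A u" by (auto simp: composable_def)
 let ?a = "src A u" and ?b = "trg A u" and ?c = "trg A v" and ?tu = "psf1 t u" and ?tv = "psf1 t v" and ?L = "psf1 L (psf1 t u)"
 let ?r = "(eps2 v *{H} id2 H ?L) #{H} (id2 H (psf1 \<A> v) *{H} eps2 u)"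
 let ?g = "id2 H (lam ?c (unit ?c))"
 have 1: "(id2 H (psf1 \<A> v) *{H} l ?b ?tu) #{H} (id2 H (psf1 \<A> v) *{H} eps2 u) = id2 H (psf1 \<A> v) *{H} lamu1 u"
  using arg_cong[OF l_eps2[of u], of "%z. id2 H (psf1 \<A> v) *{H} z"] by (simp add: \<A>.H.whisker_vcomp_left)
 have "l ?c (psf1 t (v o{A} u)) #{H} eps2 (v o{A} u) #{H} (psfc \<A> v u *{H} id2 H (lam ?a (unit ?a))) = lam2 ?c (psfc t v u) #{H} lamu v ?tu #{H} (id2 H (psf1 \<A> v) *{H} lamu1 u)"
  using lamu_comp[of u v "unit ?a"] \<A>.H.vcomp_pre[OF l_eps2[of "v o{A} u"], of "psfc \<A> v u *{H} id2 H (lam ?a (unit ?a))"] by (simp add: \<A>.H.comp1_assoc')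
 also have "... = lam2 ?c (psfc t v u) #{H} l ?c (?tv o{B} ?tu) #{H} (?g *{H} psfc L ?tv ?tu) #{H} ?r"
  using \<A>.H.vcomp_pre[OF lamu_l[of v ?tu], of "id2 H (psf1 \<A> v) *{H} eps2 u"] by (simp add: 1[symmetric] \<A>.H.pasting)
 also have "... = l ?c (psf1 t (v o{A} u)) #{H} (?g *{H} psf2 L (psfc t v u)) #{H} (?g *{H} psfc L ?tv ?tu) #{H} ?r"
  using \<A>.H.vcomp_pre[OF l_natural[of ?c "psfc t v u"], of "(?g *{H} psfc L ?tv ?tu) #{H} ?r"] by (simp add: \<A>.H.pasting)
 finally have "eps2 (v o{A} u) #{H} (psfc \<A> v u *{H} id2 H (lam ?a (unit ?a))) = (?g *{H} psf2 L (psfc t v u)) #{H} (?g *{H} psfc L ?tv ?tu) #{H} ?r"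
  by (rule \<A>.H.iso2_cancel_left[rotated]) (simp_all add: \<A>.H.comp1_assoc')
 then show ?case by (simp add: \<A>.H.whisker_vcomp_left \<A>.H.pasting)
next
 case (13 a)
 then have [simp]: "a \<in> Ob A" .
 let ?i = "id1 A a" and ?g = "id2 H (lam a (unit a))"
 have "l a (psf1 t ?i) #{H} eps2 ?i #{H} (psfu \<A> a *{H} ?g) = lam2 a (psfu t a)"
  using lamu_unit[of a "unit a"] \<A>.H.vcomp_pre[OF l_eps2[of ?i], of "psfu \<A> a *{H} ?g"] by simp
 also have "... = l a (psf1 t ?i) #{H} (?g *{H} psf2 L (psfu t a)) #{H} (?g *{H} psfu L (psf0 t a))"
  using \<A>.H.vcomp_pre[OF l_natural[of a "psfu t a"], of "?g *{H} psfu L (psf0 t a)"] l_unit[of a] by (simp add: \<A>.H.vcomp_assoc)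
 finally have "eps2 ?i #{H} (psfu \<A> a *{H} ?g) = (?g *{H} psf2 L (psfu t a)) #{H} (?g *{H} psfu L (psf0 t a))"
  by (rule \<A>.H.iso2_cancel_left[rotated]) simp_all
 then show ?case by (simp add: \<A>.H.whisker_vcomp_left)
qed (simp_all add: \<A>.pseudofunctor_axioms, simp_all add: epsilon_def)

end

section \<open>Classification of cones by transformations into L\<close>

text \<open>An isomorphism of cones \<open>lam a f \<odot> al \<cong> x a f\<close>, i.e. \<open>al\<close> is classified by \<open>x\<close>.\<close>

locale classifies = bimodule_cone A H \<A> B t L lam lam2 lamu lamg + x: bimodule_cone A H \<A> B t S x x2 xu xg + al: pseudonatural B H al
 for A :: "('a0, 'a1, 'a2) twocat" and H :: "('h0, 'h1, 'h2) twocat" and \<A>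
  and B :: "('b0, 'b1, 'b2) twocat" and t L lam lam2 lamu lamg S x x2 xu xg al +
 fixes k
 assumes pdom_alpha [simp]: "pdom al = S" and pcod_alpha [simp]: "pcod al = L"
  and k_typing [simp]:
   "[|a \<in> Ob A; f \<in> Mor B; trg B f = psf0 t a|] ==> iso2 H (k a f)"
   "[|a \<in> Ob A; f \<in> Mor B; trg B f = psf0 t a|] ==> k a f \<in> Cell H"
   "[|a \<in> Ob A; f \<in> Mor B; trg B f = psf0 t a|] ==> dom2 H (k a f) = lam a f o{H} pnt1 al (src B f)"
   "[|a \<in> Ob A; f \<in> Mor B; trg B f = psf0 t a|] ==> cod2 H (k a f) = x a f"
  and k_natural: "[|a \<in> Ob A; xi \<in> Cell B; trg B (dom2 B xi) = psf0 t a|] ==>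
   k a (cod2 B xi) #{H} (lam2 a xi *{H} id2 H (pnt1 al (src B (dom2 B xi)))) = x2 a xi #{H} k a (dom2 B xi)"
  and k_u: "[|u \<in> Mor A; f \<in> Mor B; trg B f = psf0 t (src A u)|] ==>
   xu u f #{H} (id2 H (psf1 \<A> u) *{H} k (src A u) f) = k (trg A u) (psf1 t u o{B} f) #{H} (lamu u f *{H} id2 H (pnt1 al (src B f)))"
  and k_g: "[|a \<in> Ob A; f \<in> Mor B; g \<in> Mor B; src B f = trg B g; trg B f = psf0 t a|] ==>
   xg a f g #{H} (k a f *{H} id2 H (psf1 S g)) #{H} (id2 H (lam a f) *{H} pnt2 al g) = k a (f o{B} g) #{H} (lamg a f g *{H} id2 H (pnt1 al (src B g)))"

locale pnt_to_L = bimodule_cone A H \<A> B t L lam lam2 lamu lamg + al: pseudonatural B H al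
 for A :: "('a0, 'a1, 'a2) twocat" and H :: "('h0, 'h1, 'h2) twocat" and \<A>
  and B :: "('b0, 'b1, 'b2) twocat" and t L lam lam2 lamu lamg al +
 assumes pcod_L [simp]: "pcod al = L"
begin

abbreviation "S \<equiv> pdom al"
definition "ga = pnt_comp A H epsilon (pnt_pre A H t al)"

lemma gamma_simps [simp]:
 "pdom ga = psf_comp A H S t" "pcod ga = \<A>" "a \<in> Ob A ==> pnt1 ga a = lam a (unit a) o{H} pnt1 al (psf0 t a)"
 "u \<in> Mor A ==> pnt2 ga u = (id2 H (lam (trg A u) (unit (trg A u))) *{H} pnt2 al (psf1 t u)) #{H} (eps2 u *{H} id2 H (pnt1 al (psf0 t (src A u))))"
 by (simp_all add: ga_def)

lemma pseudonatural_gamma: "pseudonatural A H ga"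
 unfolding ga_def
 by (rule pseudonatural_pnt_comp) (simp_all add: pseudonatural_epsilon pseudonatural_pnt_pre[OF t.pseudofunctor_axioms al.pseudonatural_axioms])

sublocale g: gamma_cone A B H t S ga
 by (intro gamma_cone.intro gamma_cone_axioms.intro t.pseudofunctor_axioms al.pseudofunctor_pdom pseudonatural_gamma) simp

text \<open>The isomorphism from \<open>lam a f \<odot> al\<close> to
  \<open>ga a \<odot> S f\<close>: replace \<open>lam a f\<close> by
  \<open>lam a 1 \<odot> L f\<close>, then move \<open>al\<close> past \<open>L f\<close>. It shows
  that \<open>al\<close> is classified by the cone of its own image under the comparison.\<close>

definition "E a f = (id2 H (lam a (unit a)) *{H} pnt2 al f) #{H} (inv2 H (l a f) *{H} id2 H (pnt1 al (src B f)))"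

text \<open>At identities \<open>E\<close> is a unit cell of S, so equations between cones,
  evaluated there, become equations about the counit alone.\<close>

lemma E_unit:
 assumes [simp]: "a \<in> Ob A" shows "E a (unit a) = id2 H (pnt1 ga a) *{H} psfu S (psf0 t a)"
proof -
 let ?g = "id2 H (lam a (unit a))"
 have "inv2 H (l a (unit a)) = inv2 H (l a (unit a)) #{H} l a (unit a) #{H} (?g *{H} psfu L (psf0 t a))"
  by (simp add: l_unit)
 also have "... = ?g *{H} psfu L (psf0 t a)" by simp
 finally have "E a (unit a) = ?g *{H} (pnt2 al (id1 B (psf0 t a)) #{H} (psfu L (psf0 t a) *{H} id2 H (pnt1 al (psf0 t a))))"
  by (simp add: E_def \<A>.H.whisker_vcomp_left \<A>.H.hcomp_assoc')
 also have "pnt2 al (id1 B (psf0 t a)) #{H} (psfu L (psf0 t a) *{H} id2 H (pnt1 al (psf0 t a))) = id2 H (pnt1 al (psf0 t a)) *{H} psfu S (psf0 t a)"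
  using al.pnt2_id1[of "psf0 t a"] by simp
 finally show ?thesis by (simp add: \<A>.H.pasting)
qed

text \<open>Each condition pastes an axiom of \<open>al\<close>, whiskered by
  \<open>lam a 1\<close>, with a law of \<open>l\<close> rotated by
  \<open>iso2_conjugate\<close>.\<close>

lemma classifies: "classifies A H \<A> B t L lam lam2 lamu lamg S g.x g.x2 g.xu g.xg al E"
proof (rule classifies.intro[OF bimodule_cone_axioms _ al.pseudonatural_axioms classifies_axioms.intro], goal_cases)
 case 1 show ?case using g.bimodule by simp
next
 case (8 a xi)
 then have [simp]: "a \<in> Ob A" "xi \<in> Cell B" "trg B (dom2 B xi) = psf0 t a" .
 let ?f = "dom2 B xi" and ?f' = "cod2 B xi" and ?p = "id2 H (pnt1 al (src B (dom2 B xi)))" and ?g = "id2 H (lam a (unit a))"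
 have "(?g *{H} psf2 L xi) #{H} inv2 H (l a ?f) = inv2 H (l a ?f') #{H} lam2 a xi"
  by (rule \<A>.H.iso2_conjugate) (simp_all add: l_natural)
 from arg_cong[OF this, of "%z. z *{H} ?p"]
 have 1: "(inv2 H (l a ?f') *{H} ?p) #{H} (lam2 a xi *{H} ?p) = (?g *{H} psf2 L xi *{H} ?p) #{H} (inv2 H (l a ?f) *{H} ?p)"
  by (simp add: \<A>.H.whisker_vcomp_right \<A>.H.hcomp_assoc')
 have 2: "(?g *{H} pnt2 al ?f') #{H} (?g *{H} psf2 L xi *{H} ?p) = (?g *{H} id2 H (pnt1 al (psf0 t a)) *{H} psf2 S xi) #{H} (?g *{H} pnt2 al ?f)"
  using arg_cong[OF al.pnt2_natural[of xi], of "%z. ?g *{H} z"] by (simp add: \<A>.H.whisker_vcomp_left)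
 show ?case
  using 1 \<A>.H.vcomp_pre[OF 2, of "inv2 H (l a ?f) *{H} ?p"] by (simp add: E_def g.x2_def \<A>.H.pasting)
next
 case (9 u f)
 then have [simp]: "u \<in> Mor A" "f \<in> Mor B" "trg B f = psf0 t (src A u)" .
 let ?a = "src A u" and ?b = "trg A u" and ?tu = "psf1 t u" and ?p = "id2 H (pnt1 al (src B f))" and ?u = "id2 H (psf1 \<A> u)"
 let ?g = "id2 H (lam ?b (unit ?b))"
 have "((?g *{H} psfc L ?tu f) #{H} (eps2 u *{H} id2 H (psf1 L f))) #{H} inv2 H (?u *{H} l ?a f) = inv2 H (l ?b (?tu o{B} f)) #{H} lamu u f"
  by (rule \<A>.H.iso2_conjugate) (simp_all add: lamu_l \<A>.H.comp1_assoc')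
 from arg_cong[OF this, of "%z. z *{H} ?p"]
 have 1: "(inv2 H (l ?b (?tu o{B} f)) *{H} ?p) #{H} (lamu u f *{H} ?p) =
   (?g *{H} psfc L ?tu f *{H} ?p) #{H} (eps2 u *{H} id2 H (psf1 L f) *{H} ?p) #{H} (?u *{H} inv2 H (l ?a f) *{H} ?p)"
  by (simp add: \<A>.H.whisker_vcomp_right \<A>.H.inv2_hcomp \<A>.H.pasting)
 have 2: "(?g *{H} pnt2 al (?tu o{B} f)) #{H} (?g *{H} psfc L ?tu f *{H} ?p) =
   (?g *{H} id2 H (pnt1 al (psf0 t ?b)) *{H} psfc S ?tu f) #{H} (?g *{H} pnt2 al ?tu *{H} id2 H (psf1 S f)) #{H} (?g *{H} id2 H (psf1 L ?tu) *{H} pnt2 al f)"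
  using arg_cong[OF al.pnt2_comp1[of ?tu f], of "%z. ?g *{H} z"] by (simp add: \<A>.H.whisker_vcomp_left \<A>.H.pasting)
 have 3: "(eps2 u *{H} id2 H (pnt1 al (psf0 t ?a)) *{H} id2 H (psf1 S f)) #{H} (?u *{H} id2 H (lam ?a (unit ?a)) *{H} pnt2 al f) =
   (?g *{H} id2 H (psf1 L ?tu) *{H} pnt2 al f) #{H} (eps2 u *{H} id2 H (psf1 L f) *{H} ?p)"
  using \<A>.H.exchange(1)[of "eps2 u" "pnt2 al f"] by (simp add: \<A>.H.pasting)
 have "E ?b (?tu o{B} f) #{H} (lamu u f *{H} ?p) = (?g *{H} pnt2 al (?tu o{B} f)) #{H} (?g *{H} psfc L ?tu f *{H} ?p) #{H} (eps2 u *{H} id2 H (psf1 L f) *{H} ?p) #{H} (?u *{H} inv2 H (l ?a f) *{H} ?p)"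
  using 1 by (simp add: E_def \<A>.H.vcomp_assoc \<A>.H.comp1_assoc')
 also have "... = (?g *{H} id2 H (pnt1 al (psf0 t ?b)) *{H} psfc S ?tu f) #{H} (?g *{H} pnt2 al ?tu *{H} id2 H (psf1 S f)) #{H} (?g *{H} id2 H (psf1 L ?tu) *{H} pnt2 al f) #{H}
   (eps2 u *{H} id2 H (psf1 L f) *{H} ?p) #{H} (?u *{H} inv2 H (l ?a f) *{H} ?p)"
  using \<A>.H.vcomp_pre[OF 2, of "(eps2 u *{H} id2 H (psf1 L f) *{H} ?p) #{H} (?u *{H} inv2 H (l ?a f) *{H} ?p)"] by (simp add: \<A>.H.pasting)
 also have "... = g.xu u f #{H} (?u *{H} E ?a f)"
  using \<A>.H.vcomp_pre[OF 3, of "?u *{H} inv2 H (l ?a f) *{H} ?p"]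
  by (simp add: E_def g.xu_def \<A>.H.whisker_vcomp_left \<A>.H.whisker_vcomp_right \<A>.H.pasting)
 finally show ?case by simp
next
 case (10 a f g)
 then have [simp]: "a \<in> Ob A" "f \<in> Mor B" "g \<in> Mor B" "src B f = trg B g" "trg B f = psf0 t a" .
 let ?p = "id2 H (pnt1 al (src B g))" and ?g = "id2 H (lam a (unit a))" and ?L = "id2 H (psf1 L g)" and ?S = "id2 H (psf1 S g)"
 have "(?g *{H} psfc L f g) #{H} inv2 H (l a f *{H} ?L) = inv2 H (l a (f o{B} g)) #{H} lamg a f g"
  by (rule \<A>.H.iso2_conjugate) (simp_all add: l_assoc \<A>.H.comp1_assoc')
 from arg_cong[OF this, of "%z. z *{H} ?p"]
 have 1: "(inv2 H (l a (f o{B} g)) *{H} ?p) #{H} (lamg a f g *{H} ?p) = (?g *{H} psfc L f g *{H} ?p) #{H} (inv2 H (l a f) *{H} ?L *{H} ?p)"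
  by (simp add: \<A>.H.whisker_vcomp_right \<A>.H.inv2_hcomp \<A>.H.pasting)
 have 2: "(?g *{H} pnt2 al (f o{B} g)) #{H} (?g *{H} psfc L f g *{H} ?p) =
   (?g *{H} id2 H (pnt1 al (psf0 t a)) *{H} psfc S f g) #{H} (?g *{H} pnt2 al f *{H} ?S) #{H} (?g *{H} id2 H (psf1 L f) *{H} pnt2 al g)"
  using arg_cong[OF al.pnt2_comp1[of f g], of "%z. ?g *{H} z"] by (simp add: \<A>.H.whisker_vcomp_left \<A>.H.pasting)
 have 3: "(inv2 H (l a f) *{H} id2 H (pnt1 al (trg B g)) *{H} ?S) #{H} (id2 H (lam a f) *{H} pnt2 al g) = (?g *{H} id2 H (psf1 L f) *{H} pnt2 al g) #{H} (inv2 H (l a f) *{H} ?L *{H} ?p)"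
  using \<A>.H.exchange(1)[of "inv2 H (l a f)" "pnt2 al g"] by (simp add: \<A>.H.pasting)
 show ?case
  using 1 3 \<A>.H.vcomp_pre[OF 2, of "inv2 H (l a f) *{H} ?L *{H} ?p"]
  by (simp add: E_def g.xg_def \<A>.H.whisker_vcomp_right \<A>.H.pasting)
qed (simp_all add: E_def g.x_def \<A>.H.comp1_assoc')

end

context universal_cone
begin

text \<open>The inverses of the cells \<open>lam a f \<star> th\<close> again form a morphism of
  cones, by rotating exchange squares; \<open>full\<close> lifts them to one 2-cell, which is
  inverse to \<open>th\<close> by faithfulness.\<close>

lemma lam_iso:
 assumes b [simp]: "b \<in> Ob B" and [simp]: "th \<in> Cell H" "trg H (dom2 H th) = psf0 L b"
  and iso: "!!a f. [|a \<in> Ob A; f \<in> Mor B; src B f = b; trg B f = psf0 t a|] ==> iso2 H (id2 H (lam a f) *{H} th)"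
 shows "iso2 H th"
proof -
 note [simp] = iso
 let ?h = "dom2 H th" and ?h' = "cod2 H th"
 define m where "m a f = inv2 H (id2 H (lam a f) *{H} th)" for a f
 have "\<exists>th'. th' \<in> Cell H & dom2 H th' = ?h' & cod2 H th' = ?h &
    (\<forall>a\<in>Ob A. \<forall>f\<in>Mor B. src B f = b & trg B f = psf0 t a --> m a f = id2 H (lam a f) *{H} th')"
 proof (rule full[OF b], goal_cases)
  case (7 a xi)
  then have [simp]: "a \<in> Ob A" "xi \<in> Cell B" "src B (dom2 B xi) = b" "trg B (dom2 B xi) = psf0 t a" .
  have "(lam2 a xi *{H} id2 H ?h) #{H} inv2 H (id2 H (lam a (dom2 B xi)) *{H} th) = inv2 H (id2 H (lam a (cod2 B xi)) *{H} th) #{H} (lam2 a xi *{H} id2 H ?h')"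
   using \<A>.H.exchange(1)[of "lam2 a xi" th] by (intro \<A>.H.iso2_conjugate) simp_all
  then show ?case by (simp add: m_def)
 next
  case (8 u f)
  then have [simp]: "u \<in> Mor A" "f \<in> Mor B" "src B f = b" "trg B f = psf0 t (src A u)" .
  let ?y = "id2 H (psf1 \<A> u) *{H} id2 H (lam (src A u) f) *{H} th"
  have i: "inv2 H ?y = id2 H (psf1 \<A> u) *{H} m (src A u) f"
   using \<A>.H.inv2_hcomp[of "id2 H (lam (src A u) f) *{H} th" "id2 H (psf1 \<A> u)"] by (simp add: m_def)
  have y: "iso2 H ?y" by (rule \<A>.H.iso2_hcomp) simp_all
  have "(lamu u f *{H} id2 H ?h) #{H} inv2 H ?y = m (trg A u) (psf1 t u o{B} f) #{H} (lamu u f *{H} id2 H ?h')"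
   unfolding m_def using \<A>.H.exchange(1)[of "lamu u f" th] y by (intro \<A>.H.iso2_conjugate) (simp_all add: \<A>.H.pasting)
  then show ?case by (simp add: i)
 qed (simp_all add: m_def)
 then obtain th' where t: "th' \<in> Cell H" "dom2 H th' = ?h'" "cod2 H th' = ?h"
  and m: "!!a f. [|a \<in> Ob A; f \<in> Mor B; src B f = b; trg B f = psf0 t a|] ==> m a f = id2 H (lam a f) *{H} th'" by blast
 have e: "(id2 H (lam a f) *{H} th') #{H} (id2 H (lam a f) *{H} th) = id2 H (lam a f o{H} ?h)"
  "(id2 H (lam a f) *{H} th) #{H} (id2 H (lam a f) *{H} th') = id2 H (lam a f o{H} ?h')"
  if [simp]: "a \<in> Ob A" "f \<in> Mor B" "src B f = b" "trg B f = psf0 t a" for a f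
  unfolding m[OF that, symmetric] by (simp_all add: m_def)
 have 1: "th' #{H} th = id2 H ?h" by (rule faithful[OF b]) (use t e in \<open>simp_all add: \<A>.H.whisker_vcomp_left\<close>)
 have 2: "th #{H} th' = id2 H ?h'" by (rule faithful[OF b]) (use t e in \<open>simp_all add: \<A>.H.whisker_vcomp_left\<close>)
 show ?thesis by (rule \<A>.H.iso2I[of th']) (use t 1 2 in simp_all)
qed

end

locale classify = universal_cone A H \<A> B t L lam lam2 lamu lamg + x: bimodule_cone A H \<A> B t S x x2 xu xg
 for A :: "('a0, 'a1, 'a2) twocat" and H :: "('h0, 'h1, 'h2) twocat" and \<A>
  and B :: "('b0, 'b1, 'b2) twocat" and t L lam lam2 lamu lamg S x x2 xu xg
begin

definition represents where "represents b h k \<longleftrightarrow> h \<in> Mor H & src H h = psf0 S b & trg H h = psf0 L b &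
    (\<forall>a\<in>Ob A. \<forall>f\<in>Mor B. src B f = b & trg B f = psf0 t a --> iso2 H (k a f) & dom2 H (k a f) = lam a f o{H} h & cod2 H (k a f) = x a f) &
    (\<forall>a\<in>Ob A. \<forall>xi\<in>Cell B. src B (dom2 B xi) = b & trg B (dom2 B xi) = psf0 t a -->
     k a (cod2 B xi) #{H} (lam2 a xi *{H} id2 H h) = x2 a xi #{H} k a (dom2 B xi)) &
    (\<forall>u\<in>Mor A. \<forall>f\<in>Mor B. src B f = b & trg B f = psf0 t (src A u) -->
     xu u f #{H} (id2 H (psf1 \<A> u) *{H} k (src A u) f) = k (trg A u) (psf1 t u o{B} f) #{H} (lamu u f *{H} id2 H h))"

lemma pointwise: "b \<in> Ob B ==> \<exists>h k. represents b h k"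
 unfolding represents_def by (rule representable[OF _ _ x.cone_hpnt]) simp_all

text \<open>Representability gives a classifying 1-cell \<open>p b\<close> for each \<open>b\<close>
  separately. How these vary with \<open>b\<close> is decided by 2-cells into L, which
  \<open>full\<close> produces and \<open>faithful\<close> compares.\<close>

lemma classify: "\<exists>al k. classifies A H \<A> B t L lam lam2 lamu lamg S x x2 xu xg al k"
proof -
 obtain p kk where p1: "!!b. b \<in> Ob B ==> represents b (p b) (kk b)" using pointwise by metis
 note p0 = p1[unfolded represents_def]
 define k where "k a f = kk (src B f) a f" for a f
 have p [simp]: "p b \<in> Mor H" "src H (p b) = psf0 S b" "trg H (p b) = psf0 L b" if "b \<in> Ob B" for b using p0[OF that] by simp_all
 have k [simp]: "iso2 H (k a f)" "dom2 H (k a f) = lam a f o{H} p (src B f)" "cod2 H (k a f) = x a f"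
  if "a \<in> Ob A" "f \<in> Mor B" "trg B f = psf0 t a" for a f using p0[of "src B f"] that by (simp_all add: k_def)
 have kC [simp]: "k a f \<in> Cell H" if "a \<in> Ob A" "f \<in> Mor B" "trg B f = psf0 t a" for a f using k(1)[OF that] by (rule \<A>.H.iso2_Cell)
 have k0: "k a (cod2 B xi) #{H} (lam2 a xi *{H} id2 H (p (src B (dom2 B xi)))) = x2 a xi #{H} k a (dom2 B xi)"
  if "a \<in> Ob A" "xi \<in> Cell B" "trg B (dom2 B xi) = psf0 t a" for a xi using p0[of "src B (dom2 B xi)"] that by (simp add: k_def)
 have k1: "xu u f #{H} (id2 H (psf1 \<A> u) *{H} k (src A u) f) = k (trg A u) (psf1 t u o{B} f) #{H} (lamu u f *{H} id2 H (p (src B f)))"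
  if "u \<in> Mor A" "f \<in> Mor B" "trg B f = psf0 t (src A u)" for u f using p0[of "src B f"] that by (simp add: k_def)
 \<comment> \<open>\<open>j\<close> and \<open>z\<close>, defined below, are two isomorphisms onto
   \<open>x a (f \<odot> g)\<close>, from \<open>lam a f \<odot> p \<odot> S g\<close> and from
   \<open>lam a f \<odot> L g \<odot> p\<close>. The structure cell \<open>q g\<close> is induced by
   going out along \<open>z\<close> and back along \<open>j\<close>.\<close>
 define j where "j a f g = xg a f g #{H} (k a f *{H} id2 H (psf1 S g))" for a f g
 have j [simp]: "j a f g \<in> Cell H" "iso2 H (j a f g)" "dom2 H (j a f g) = lam a f o{H} p (src B f) o{H} psf1 S g" "cod2 H (j a f g) = x a (f o{B} g)"
  if "a \<in> Ob A" "f \<in> Mor B" "g \<in> Mor B" "src B f = trg B g" "trg B f = psf0 t a" for a f g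
  using that by (simp_all add: j_def \<A>.H.comp1_assoc')
 \<comment> \<open>This and the three similar facts \<open>j1\<close>, \<open>z0\<close>,
   \<open>z1\<close> say that \<open>j\<close> and \<open>z\<close> are morphisms of cones in
   \<open>f\<close>, which is what \<open>full\<close> asks for to produce
   \<open>q g\<close>.\<close>
 have j0: "j a (cod2 B xi) g #{H} (lam2 a xi *{H} id2 H (p (trg B g)) *{H} id2 H (psf1 S g)) = x2 a (xi *{B} id2 B g) #{H} j a (dom2 B xi) g"
  if [simp]: "a \<in> Ob A" "xi \<in> Cell B" "g \<in> Mor B" "src B (dom2 B xi) = trg B g" "trg B (dom2 B xi) = psf0 t a" for a xi g
 proof -
  have "(k a (cod2 B xi) *{H} id2 H (psf1 S g)) #{H} (lam2 a xi *{H} id2 H (p (trg B g)) *{H} id2 H (psf1 S g)) = (x2 a xi *{H} id2 H (psf1 S g)) #{H} (k a (dom2 B xi) *{H} id2 H (psf1 S g))"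
   using arg_cong[OF k0[of a xi], of "%z. z *{H} id2 H (psf1 S g)"] by (simp add: \<A>.H.whisker_vcomp_right \<A>.H.pasting)
  then show ?thesis using \<A>.H.vcomp_pre[OF x.lamg_natural[of a xi "id2 B g"], of "k a (dom2 B xi) *{H} id2 H (psf1 S g)"]
   by (simp add: j_def \<A>.H.pasting)
 qed
 have j1: "j (trg A u) (psf1 t u o{B} f) g #{H} (lamu u f *{H} id2 H (p (trg B g)) *{H} id2 H (psf1 S g)) = xu u (f o{B} g) #{H} (id2 H (psf1 \<A> u) *{H} j (src A u) f g)"
  if [simp]: "u \<in> Mor A" "f \<in> Mor B" "g \<in> Mor B" "src B f = trg B g" "trg B f = psf0 t (src A u)" for u f g
 proof -
  have "(k (trg A u) (psf1 t u o{B} f) *{H} id2 H (psf1 S g)) #{H} (lamu u f *{H} id2 H (p (trg B g)) *{H} id2 H (psf1 S g)) =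
    (xu u f *{H} id2 H (psf1 S g)) #{H} (id2 H (psf1 \<A> u) *{H} k (src A u) f *{H} id2 H (psf1 S g))"
   using arg_cong[OF k1[of u f], of "%z. z *{H} id2 H (psf1 S g)"] by (simp add: \<A>.H.whisker_vcomp_right \<A>.H.pasting)
  then show ?thesis
   using \<A>.H.vcomp_pre[OF x.lamu_lamg[of u f g], of "id2 H (psf1 \<A> u) *{H} k (src A u) f *{H} id2 H (psf1 S g)"]
   by (simp add: j_def \<A>.H.whisker_vcomp_left \<A>.H.pasting)
 qed
 define z where "z a f g = k a (f o{B} g) #{H} (lamg a f g *{H} id2 H (p (src B g)))" for a f g
 have z [simp]: "z a f g \<in> Cell H" "iso2 H (z a f g)" "dom2 H (z a f g) = lam a f o{H} psf1 L g o{H} p (src B g)" "cod2 H (z a f g) = x a (f o{B} g)"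
  if "a \<in> Ob A" "f \<in> Mor B" "g \<in> Mor B" "src B f = trg B g" "trg B f = psf0 t a" for a f g
  using that by (simp_all add: z_def \<A>.H.comp1_assoc')
 have z0: "z a (cod2 B xi) g #{H} (lam2 a xi *{H} id2 H (psf1 L g) *{H} id2 H (p (src B g))) = x2 a (xi *{B} id2 B g) #{H} z a (dom2 B xi) g"
  if [simp]: "a \<in> Ob A" "xi \<in> Cell B" "g \<in> Mor B" "src B (dom2 B xi) = trg B g" "trg B (dom2 B xi) = psf0 t a" for a xi g
 proof -
  have "(lamg a (cod2 B xi) g *{H} id2 H (p (src B g))) #{H} (lam2 a xi *{H} id2 H (psf1 L g) *{H} id2 H (p (src B g))) = (lam2 a (xi *{B} id2 B g) *{H} id2 H (p (src B g))) #{H} (lamg a (dom2 B xi) g *{H} id2 H (p (src B g)))"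
   using arg_cong[OF lamg_natural[of a xi "id2 B g"], of "%z. z *{H} id2 H (p (src B g))"] by (simp add: \<A>.H.whisker_vcomp_right \<A>.H.pasting)
  then show ?thesis using \<A>.H.vcomp_pre[OF k0[of a "xi *{B} id2 B g"], of "lamg a (dom2 B xi) g *{H} id2 H (p (src B g))"]
   by (simp add: z_def \<A>.H.pasting)
 qed
 have z1: "z (trg A u) (psf1 t u o{B} f) g #{H} (lamu u f *{H} id2 H (psf1 L g) *{H} id2 H (p (src B g))) = xu u (f o{B} g) #{H} (id2 H (psf1 \<A> u) *{H} z (src A u) f g)"
  if [simp]: "u \<in> Mor A" "f \<in> Mor B" "g \<in> Mor B" "src B f = trg B g" "trg B f = psf0 t (src A u)" for u f g
 proof -
  have "(lamg (trg A u) (psf1 t u o{B} f) g *{H} id2 H (p (src B g))) #{H} (lamu u f *{H} id2 H (psf1 L g) *{H} id2 H (p (src B g))) =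
    (lamu u (f o{B} g) *{H} id2 H (p (src B g))) #{H} (id2 H (psf1 \<A> u) *{H} lamg (src A u) f g *{H} id2 H (p (src B g)))"
   using arg_cong[OF lamu_lamg[of u f g], of "%z. z *{H} id2 H (p (src B g))"] by (simp add: \<A>.H.whisker_vcomp_right \<A>.H.pasting)
  then show ?thesis
   using \<A>.H.vcomp_pre[OF k1[of u "f o{B} g"], of "id2 H (psf1 \<A> u) *{H} lamg (src A u) f g *{H} id2 H (p (src B g))"]
   by (simp add: z_def \<A>.H.whisker_vcomp_left \<A>.H.pasting t.H.comp1_assoc')
 qed
 have "\<exists>th. th \<in> Cell H & dom2 H th = psf1 L g o{H} p (src B g) & cod2 H th = p (trg B g) o{H} psf1 S g &
    (\<forall>a\<in>Ob A. \<forall>f\<in>Mor B. src B f = trg B g & trg B f = psf0 t a --> inv2 H (j a f g) #{H} z a f g = id2 H (lam a f) *{H} th)"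
  if g [simp]: "g \<in> Mor B" for g
 proof (rule full[where b = "trg B g"], goal_cases)
  case (8 a xi)
  then have [simp]: "a \<in> Ob A" "xi \<in> Cell B" "src B (dom2 B xi) = trg B g" "trg B (dom2 B xi) = psf0 t a" .
  have "j a (cod2 B xi) g #{H} (lam2 a xi *{H} id2 H (p (trg B g) o{H} psf1 S g)) #{H} inv2 H (j a (dom2 B xi) g) #{H} z a (dom2 B xi) g = x2 a (xi *{B} id2 B g) #{H} z a (dom2 B xi) g"
   using \<A>.H.vcomp_pre[OF j0[of a xi g], of "inv2 H (j a (dom2 B xi) g) #{H} z a (dom2 B xi) g"] by (simp add: \<A>.H.pasting)
  also have "... = j a (cod2 B xi) g #{H} inv2 H (j a (cod2 B xi) g) #{H} z a (cod2 B xi) g #{H} (lam2 a xi *{H} id2 H (psf1 L g o{H} p (src B g)))"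
   using z0[of a xi g] by (simp add: \<A>.H.pasting)
  finally have "(lam2 a xi *{H} id2 H (p (trg B g) o{H} psf1 S g)) #{H} inv2 H (j a (dom2 B xi) g) #{H} z a (dom2 B xi) g =
    inv2 H (j a (cod2 B xi) g) #{H} z a (cod2 B xi) g #{H} (lam2 a xi *{H} id2 H (psf1 L g o{H} p (src B g)))"
   by (rule \<A>.H.iso2_cancel_left[rotated]) simp_all
  then show ?case by (simp add: \<A>.H.vcomp_assoc)
 next
  case (9 u f)
  then have [simp]: "u \<in> Mor A" "f \<in> Mor B" "src B f = trg B g" "trg B f = psf0 t (src A u)" .
  let ?u = "id2 H (psf1 \<A> u)" and ?j = "j (src A u) f g" and ?z = "z (src A u) f g" and ?f = "psf1 t u o{B} f"
  have w: "(?u *{H} ?j) #{H} (?u *{H} (inv2 H ?j #{H} ?z)) = ?u *{H} ?z"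
   using \<A>.H.whisker_vcomp_left[of "?j" "inv2 H ?j #{H} ?z" "psf1 \<A> u"] by simp
  have "j (trg A u) ?f g #{H} (lamu u f *{H} id2 H (p (trg B g) o{H} psf1 S g)) #{H} (?u *{H} (inv2 H ?j #{H} ?z)) = xu u (f o{B} g) #{H} (?u *{H} ?z)"
   using \<A>.H.vcomp_pre[OF j1[of u f g], of "?u *{H} (inv2 H ?j #{H} ?z)"] w by (simp add: \<A>.H.pasting)
  also have "... = j (trg A u) ?f g #{H} inv2 H (j (trg A u) ?f g) #{H} z (trg A u) ?f g #{H} (lamu u f *{H} id2 H (psf1 L g o{H} p (src B g)))"
   using z1[of u f g] by (simp add: \<A>.H.pasting t.H.comp1_assoc')
  finally have "(lamu u f *{H} id2 H (p (trg B g) o{H} psf1 S g)) #{H} (?u *{H} (inv2 H ?j #{H} ?z)) =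
    inv2 H (j (trg A u) ?f g) #{H} z (trg A u) ?f g #{H} (lamu u f *{H} id2 H (psf1 L g o{H} p (src B g)))"
   by (rule \<A>.H.iso2_cancel_left[rotated]) (simp_all add: \<A>.H.comp1_assoc')
  then show ?case by (simp add: \<A>.H.pasting)
 qed simp_all
 then obtain q where q [simp]: "!!g. g \<in> Mor B ==> q g \<in> Cell H" "!!g. g \<in> Mor B ==> dom2 H (q g) = psf1 L g o{H} p (src B g)"
   "!!g. g \<in> Mor B ==> cod2 H (q g) = p (trg B g) o{H} psf1 S g"
   and q0: "!!g a f. [|g \<in> Mor B; a \<in> Ob A; f \<in> Mor B; src B f = trg B g; trg B f = psf0 t a|] ==> inv2 H (j a f g) #{H} z a f g = id2 H (lam a f) *{H} q g"
  by metis
 have jq: "j a f g #{H} (id2 H (lam a f) *{H} q g) = z a f g"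
  if [simp]: "g \<in> Mor B" "a \<in> Ob A" "f \<in> Mor B" "src B f = trg B g" "trg B f = psf0 t a" for a f g
  using q0[of g a f] by (simp add: q0[symmetric])
 have qi [simp]: "iso2 H (q g)" if g [simp]: "g \<in> Mor B" for g
  by (rule lam_iso[of "trg B g"]) (simp_all add: q0[symmetric])
 define al where "al = \<lparr>pdom = S, pcod = L, pnt1 = restrict p (Ob B), pnt2 = restrict q (Mor B)\<rparr>"
 have a [simp]: "pdom al = S" "pcod al = L" "!!b. b \<in> Ob B ==> pnt1 al b = p b" "!!g. g \<in> Mor B ==> pnt2 al g = q g" by (simp_all add: al_def)
 have pn: "pseudonatural B H al"
 proof (rule pseudonatural.intro, goal_cases)
  case (11 y)
  then have [simp]: "y \<in> Cell B" .
  let ?g = "dom2 B y" and ?g' = "cod2 B y" and ?b = "src B (dom2 B y)" and ?b' = "trg B (dom2 B y)"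
  \<comment> \<open>Coherence of \<open>q\<close> is tested after whiskering with
    \<open>lam a f\<close>, where \<open>jq\<close> trades \<open>q\<close> for \<open>z\<close> and
    the laws of \<open>lamg\<close>, \<open>xg\<close> and \<open>k\<close> finish; composing with
    the invertible \<open>j\<close> makes both sides comparable.\<close>
  have "q ?g' #{H} (psf2 L y *{H} id2 H (p ?b)) = (id2 H (p ?b') *{H} psf2 S y) #{H} q ?g"
  proof (rule faithful[of ?b'], goal_cases)
   case (7 a f)
   then have [simp]: "a \<in> Ob A" "f \<in> Mor B" "src B f = ?b'" "trg B f = psf0 t a" .
   let ?l = "id2 H (lam a f)" and ?p = "id2 H (p ?b)"
   have 1: "(lamg a f ?g' *{H} ?p) #{H} (?l *{H} psf2 L y *{H} ?p) = (lam2 a (id2 B f *{B} y) *{H} ?p) #{H} (lamg a f ?g *{H} ?p)"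
    using arg_cong[OF lamg_natural[of a "id2 B f" y], of "%z. z *{H} ?p"] by (simp add: \<A>.H.whisker_vcomp_right \<A>.H.pasting)
   have 2: "(k a f *{H} id2 H (psf1 S ?g')) #{H} (?l *{H} id2 H (p ?b') *{H} psf2 S y) = (id2 H (x a f) *{H} psf2 S y) #{H} (k a f *{H} id2 H (psf1 S ?g))"
    using \<A>.H.exchange(1)[of "k a f" "psf2 S y"] by (simp add: \<A>.H.pasting)
   have "j a f ?g' #{H} (?l *{H} q ?g') #{H} (?l *{H} psf2 L y *{H} ?p) = x2 a (id2 B f *{B} y) #{H} z a f ?g"
    using 1 \<A>.H.vcomp_pre[OF jq[of ?g' a f], of "?l *{H} psf2 L y *{H} ?p"] \<A>.H.vcomp_pre[OF k0[of a "id2 B f *{B} y"], of "lamg a f ?g *{H} ?p"]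
    by (simp add: z_def \<A>.H.pasting)
   also have "... = j a f ?g' #{H} (?l *{H} id2 H (p ?b') *{H} psf2 S y) #{H} (?l *{H} q ?g)"
    using 2 \<A>.H.vcomp_pre[OF x.lamg_natural[of a "id2 B f" y], of "(k a f *{H} id2 H (psf1 S ?g)) #{H} (?l *{H} q ?g)"]
     \<A>.H.vcomp_pre[OF 2, of "?l *{H} q ?g"]
    by (simp add: jq[symmetric] j_def \<A>.H.pasting)
   finally have "(?l *{H} q ?g') #{H} (?l *{H} psf2 L y *{H} ?p) = (?l *{H} id2 H (p ?b') *{H} psf2 S y) #{H} (?l *{H} q ?g)"
    by (rule \<A>.H.iso2_cancel_left[rotated]) (simp_all add: \<A>.H.comp1_assoc')
   then show ?case by (simp add: \<A>.H.whisker_vcomp_left)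
  qed simp_all
  then show ?case by simp
 next
  case (12 g' g)
  then have [simp]: "g \<in> Mor B" "g' \<in> Mor B" "src B g' = trg B g" by (auto simp: composable_def)
  let ?b = "src B g" and ?b' = "trg B g" and ?c = "trg B g'"
  have "q (g' o{B} g) #{H} (psfc L g' g *{H} id2 H (p ?b)) = (id2 H (p ?c) *{H} psfc S g' g) #{H} (q g' *{H} id2 H (psf1 S g)) #{H} (id2 H (psf1 L g') *{H} q g)"
  proof (rule faithful[of ?c], goal_cases)
   case (7 a f)
   then have [simp]: "a \<in> Ob A" "f \<in> Mor B" "src B f = ?c" "trg B f = psf0 t a" .
   let ?l = "id2 H (lam a f)" and ?p = "id2 H (p ?b)" and ?S = "id2 H (psf1 S g)"
   have 1: "(lamg a f (g' o{B} g) *{H} ?p) #{H} (?l *{H} psfc L g' g *{H} ?p) = (lamg a (f o{B} g') g *{H} ?p) #{H} (lamg a f g' *{H} id2 H (psf1 L g) *{H} ?p)"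
    using arg_cong[OF lamg_assoc[of a f g g'], of "%z. z *{H} ?p"] by (simp add: \<A>.H.whisker_vcomp_right \<A>.H.pasting)
   have 2: "(k a f *{H} id2 H (psf1 S (g' o{B} g))) #{H} (?l *{H} id2 H (p ?c) *{H} psfc S g' g) = (id2 H (x a f) *{H} psfc S g' g) #{H} (k a f *{H} id2 H (psf1 S g') *{H} ?S)"
    using \<A>.H.exchange(1)[of "k a f" "psfc S g' g"] by (simp add: \<A>.H.pasting)
   have 3: "(xg a f g' *{H} ?S) #{H} (k a f *{H} id2 H (psf1 S g') *{H} ?S) #{H} (?l *{H} q g' *{H} ?S) = (k a (f o{B} g') *{H} ?S) #{H} (lamg a f g' *{H} id2 H (p ?b') *{H} ?S)"
    using arg_cong[OF jq[of g' a f], of "%z. z *{H} ?S"] by (simp add: j_def z_def \<A>.H.whisker_vcomp_right \<A>.H.pasting)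
   have 4: "(lamg a f g' *{H} id2 H (p ?b') *{H} ?S) #{H} (?l *{H} id2 H (psf1 L g') *{H} q g) = (id2 H (lam a (f o{B} g')) *{H} q g) #{H} (lamg a f g' *{H} id2 H (psf1 L g) *{H} ?p)"
    using \<A>.H.exchange(1)[of "lamg a f g'" "q g"] by (simp add: \<A>.H.pasting)
   let ?r = "?l *{H} id2 H (psf1 L g') *{H} q g"
   have "j a f (g' o{B} g) #{H} (?l *{H} q (g' o{B} g)) #{H} (?l *{H} psfc L g' g *{H} ?p) = z a (f o{B} g') g #{H} (lamg a f g' *{H} id2 H (psf1 L g) *{H} ?p)"
    using 1 \<A>.H.vcomp_pre[OF jq[of "g' o{B} g" a f], of "?l *{H} psfc L g' g *{H} ?p"] by (simp add: z_def \<A>.H.pasting t.H.comp1_assoc')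
   also have "... = j a (f o{B} g') g #{H} (id2 H (lam a (f o{B} g')) *{H} q g) #{H} (lamg a f g' *{H} id2 H (psf1 L g) *{H} ?p)"
    using \<A>.H.vcomp_pre[OF jq[of g a "f o{B} g'"], of "lamg a f g' *{H} id2 H (psf1 L g) *{H} ?p"] by (simp add: \<A>.H.pasting)
   also have "... = xg a (f o{B} g') g #{H} (xg a f g' *{H} ?S) #{H} (k a f *{H} id2 H (psf1 S g') *{H} ?S) #{H} (?l *{H} q g' *{H} ?S) #{H} ?r"
    using 4 \<A>.H.vcomp_pre[OF 3, of ?r] by (simp add: j_def \<A>.H.pasting)
   also have "... = j a f (g' o{B} g) #{H} (?l *{H} id2 H (p ?c) *{H} psfc S g' g) #{H} (?l *{H} q g' *{H} ?S) #{H} ?r"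
    using \<A>.H.vcomp_pre[OF x.lamg_assoc[of a f g g'], of "(k a f *{H} id2 H (psf1 S g') *{H} ?S) #{H} (?l *{H} q g' *{H} ?S) #{H} ?r"]
     \<A>.H.vcomp_pre[OF 2, of "(?l *{H} q g' *{H} ?S) #{H} ?r"]
    by (simp add: j_def \<A>.H.pasting t.H.comp1_assoc')
   finally have "(?l *{H} q (g' o{B} g)) #{H} (?l *{H} psfc L g' g *{H} ?p) = (?l *{H} id2 H (p ?c) *{H} psfc S g' g) #{H} (?l *{H} q g' *{H} ?S) #{H} ?r"
    by (rule \<A>.H.iso2_cancel_left[rotated]) (simp_all add: \<A>.H.comp1_assoc')
   then show ?case by (simp add: \<A>.H.whisker_vcomp_left \<A>.H.pasting)
  qed (simp_all add: \<A>.H.comp1_assoc')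
  then show ?case by simp
 next
  case (13 b)
  then have [simp]: "b \<in> Ob B" .
  have "q (id1 B b) #{H} (psfu L b *{H} id2 H (p b)) = id2 H (p b) *{H} psfu S b"
  proof (rule faithful[of b], goal_cases)
   case (7 a f)
   then have [simp]: "a \<in> Ob A" "f \<in> Mor B" "src B f = b" "trg B f = psf0 t a" .
   let ?l = "id2 H (lam a f)" and ?p = "id2 H (p b)"
   have 1: "(lamg a f (id1 B b) *{H} ?p) #{H} (?l *{H} psfu L b *{H} ?p) = id2 H (lam a f o{H} p b)"
    using arg_cong[OF lamg_unit[of a f], of "%z. z *{H} ?p"] by (simp add: \<A>.H.whisker_vcomp_right \<A>.H.pasting)
   have 2: "(k a f *{H} id2 H (psf1 S (id1 B b))) #{H} (?l *{H} ?p *{H} psfu S b) = (id2 H (x a f) *{H} psfu S b) #{H} k a f"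
    using \<A>.H.exchange(1)[of "k a f" "psfu S b"] by (simp add: \<A>.H.pasting)
   have "j a f (id1 B b) #{H} (?l *{H} q (id1 B b)) #{H} (?l *{H} psfu L b *{H} ?p) = k a f"
    using 1 \<A>.H.vcomp_pre[OF jq[of "id1 B b" a f], of "?l *{H} psfu L b *{H} ?p"] by (simp add: z_def \<A>.H.pasting)
   also have "... = j a f (id1 B b) #{H} (?l *{H} ?p *{H} psfu S b)"
    using 2 \<A>.H.vcomp_pre[OF x.lamg_unit[of a f], of "k a f"] by (simp add: j_def \<A>.H.pasting)
   finally have "(?l *{H} q (id1 B b)) #{H} (?l *{H} psfu L b *{H} ?p) = ?l *{H} ?p *{H} psfu S b"
    by (rule \<A>.H.iso2_cancel_left[rotated]) simp_all
   then show ?case by (simp add: \<A>.H.whisker_vcomp_left \<A>.H.pasting)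
  qed simp_all
  then show ?case by simp
 qed (simp_all add: L.pseudofunctor_axioms x.L.pseudofunctor_axioms, simp_all add: al_def)
 have "classifies A H \<A> B t L lam lam2 lamu lamg S x x2 xu xg al k"
 proof (rule classifies.intro[OF bimodule_cone_axioms x.bimodule_cone_axioms pn classifies_axioms.intro], goal_cases)
  case (9 a f g)
  then show ?case using jq[of g a f] by (simp add: j_def z_def \<A>.H.pasting)
 qed (simp_all add: k0 k1)
 then show ?thesis by blast
qed

end

locale classify2 = universal_cone A H \<A> B t L lam lam2 lamu lamg +
 c: classifies A H \<A> B t L lam lam2 lamu lamg S x x2 xu xg al k + d: classifies A H \<A> B t L lam lam2 lamu lamg S y y2 yu yg be k'
 for A :: "('a0, 'a1, 'a2) twocat" and H :: "('h0, 'h1, 'h2) twocat" and \<A>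
  and B :: "('b0, 'b1, 'b2) twocat" and t L lam lam2 lamu lamg S x x2 xu xg al k y y2 yu yg be k'
begin

text \<open>The 2-dimensional part of the universal property. By \<open>n0\<close> and
  \<open>n1\<close>, conjugating \<open>n\<close> by the classifying isomorphisms gives a morphism
  of cones for each \<open>b\<close>, which lifts to \<open>q b\<close>; \<open>n2\<close>,
  compatibility along B, makes this family a modification.\<close>

lemma lift_modification:
 assumes n [simp]: "!!a f. [|a \<in> Ob A; f \<in> Mor B; trg B f = psf0 t a|] ==> n a f \<in> Cell H"
   "!!a f. [|a \<in> Ob A; f \<in> Mor B; trg B f = psf0 t a|] ==> dom2 H (n a f) = x a f"
   "!!a f. [|a \<in> Ob A; f \<in> Mor B; trg B f = psf0 t a|] ==> cod2 H (n a f) = y a f"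
  and n0: "!!a xi. [|a \<in> Ob A; xi \<in> Cell B; trg B (dom2 B xi) = psf0 t a|] ==> n a (cod2 B xi) #{H} x2 a xi = y2 a xi #{H} n a (dom2 B xi)"
  and n1: "!!u f. [|u \<in> Mor A; f \<in> Mor B; trg B f = psf0 t (src A u)|] ==>
   yu u f #{H} (id2 H (psf1 \<A> u) *{H} n (src A u) f) = n (trg A u) (psf1 t u o{B} f) #{H} xu u f"
  and n2: "!!a f g. [|a \<in> Ob A; f \<in> Mor B; g \<in> Mor B; src B f = trg B g; trg B f = psf0 t a|] ==>
   yg a f g #{H} (n a f *{H} id2 H (psf1 S g)) = n a (f o{B} g) #{H} xg a f g"
 shows "\<exists>th. modification B H th & mdom th = al & mcod th = be &
  (\<forall>a\<in>Ob A. \<forall>f\<in>Mor B. trg B f = psf0 t a --> k' a f #{H} (id2 H (lam a f) *{H} mdf2 th (src B f)) = n a f #{H} k a f)"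
proof -
 define m where "m a f = inv2 H (k' a f) #{H} n a f #{H} k a f" for a f
 have m [simp]: "m a f \<in> Cell H" "dom2 H (m a f) = lam a f o{H} pnt1 al (src B f)" "cod2 H (m a f) = lam a f o{H} pnt1 be (src B f)"
  and km: "k' a f #{H} m a f = n a f #{H} k a f"
  if "a \<in> Ob A" "f \<in> Mor B" "trg B f = psf0 t a" for a f using that by (simp_all add: m_def)
 have "\<exists>th. th \<in> Cell H & dom2 H th = pnt1 al b & cod2 H th = pnt1 be b &
    (\<forall>a\<in>Ob A. \<forall>f\<in>Mor B. src B f = b & trg B f = psf0 t a --> m a f = id2 H (lam a f) *{H} th)"
  if b [simp]: "b \<in> Ob B" for b
 proof (rule full[OF b], goal_cases)
  case (7 a xi)
  then have [simp]: "a \<in> Ob A" "xi \<in> Cell B" "src B (dom2 B xi) = b" "trg B (dom2 B xi) = psf0 t a" .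
  have "k' a (cod2 B xi) #{H} m a (cod2 B xi) #{H} (lam2 a xi *{H} id2 H (pnt1 al b)) = n a (cod2 B xi) #{H} x2 a xi #{H} k a (dom2 B xi)"
   using \<A>.H.vcomp_pre[OF km[of a "cod2 B xi"], of "lam2 a xi *{H} id2 H (pnt1 al b)"] c.k_natural[of a xi] by (simp add: \<A>.H.pasting)
  also have "... = k' a (cod2 B xi) #{H} (lam2 a xi *{H} id2 H (pnt1 be b)) #{H} m a (dom2 B xi)"
   using \<A>.H.vcomp_pre[OF n0[of a xi], of "k a (dom2 B xi)"] \<A>.H.vcomp_pre[OF d.k_natural[of a xi], of "m a (dom2 B xi)"] km[of a "dom2 B xi"]
   by (simp add: \<A>.H.pasting)
  finally show ?case by (rule \<A>.H.iso2_cancel_left[rotated]) simp_all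
 next
  case (8 u f)
  then have [simp]: "u \<in> Mor A" "f \<in> Mor B" "src B f = b" "trg B f = psf0 t (src A u)" .
  let ?u = "id2 H (psf1 \<A> u)" and ?f = "psf1 t u o{B} f" and ?a = "src A u" and ?b = "trg A u"
  have w: "(?u *{H} k' ?a f) #{H} (?u *{H} m ?a f) = (?u *{H} n ?a f) #{H} (?u *{H} k ?a f)"
   using arg_cong[OF km[of ?a f], of "%z. ?u *{H} z"] by (simp add: \<A>.H.whisker_vcomp_left)
  have "k' ?b ?f #{H} (lamu u f *{H} id2 H (pnt1 be b)) #{H} (?u *{H} m ?a f) = yu u f #{H} (?u *{H} n ?a f) #{H} (?u *{H} k ?a f)"
   using \<A>.H.vcomp_pre[OF d.k_u[of u f], of "?u *{H} m ?a f"] w by (simp add: \<A>.H.pasting)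
  also have "... = n ?b ?f #{H} k ?b ?f #{H} (lamu u f *{H} id2 H (pnt1 al b))"
   using \<A>.H.vcomp_pre[OF n1[of u f], of "?u *{H} k ?a f"] c.k_u[of u f] by (simp add: \<A>.H.pasting)
  also have "... = k' ?b ?f #{H} m ?b ?f #{H} (lamu u f *{H} id2 H (pnt1 al b))"
   using \<A>.H.vcomp_pre[OF km[of ?b ?f], of "lamu u f *{H} id2 H (pnt1 al b)"] by (simp add: \<A>.H.pasting)
  finally show ?case by (rule \<A>.H.iso2_cancel_left[rotated]) (simp_all add: \<A>.H.comp1_assoc')
 qed simp_all
 then obtain q where q [simp]: "!!b. b \<in> Ob B ==> q b \<in> Cell H" "!!b. b \<in> Ob B ==> dom2 H (q b) = pnt1 al b" "!!b. b \<in> Ob B ==> cod2 H (q b) = pnt1 be b"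
  and q0: "!!b a f. [|b \<in> Ob B; a \<in> Ob A; f \<in> Mor B; src B f = b; trg B f = psf0 t a|] ==> m a f = id2 H (lam a f) *{H} q b"
  by metis
 have kq: "k' a f #{H} (id2 H (lam a f) *{H} q (src B f)) = n a f #{H} k a f" if "a \<in> Ob A" "f \<in> Mor B" "trg B f = psf0 t a" for a f
  using km[OF that] q0[of "src B f" a f] that by simp
 define th where "th = \<lparr>mdom = al, mcod = be, mdf2 = restrict q (Ob B)\<rparr>"
 have th [simp]: "mdom th = al" "mcod th = be" "!!b. b \<in> Ob B ==> mdf2 th b = q b" by (simp_all add: th_def)
 have "modification B H th"
 proof (rule modification.intro, goal_cases)
  case (9 g)
  then have [simp]: "g \<in> Mor B" .
  let ?b = "src B g" and ?b' = "trg B g" and ?S = "id2 H (psf1 S g)" and ?L = "id2 H (psf1 L g)"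
  have "pnt2 be g #{H} (?L *{H} q ?b) = (q ?b' *{H} ?S) #{H} pnt2 al g"
  proof (rule faithful[of ?b'], goal_cases)
   case (7 a f)
   then have [simp]: "a \<in> Ob A" "f \<in> Mor B" "src B f = ?b'" "trg B f = psf0 t a" .
   let ?l = "id2 H (lam a f)" and ?j = "yg a f g #{H} (k' a f *{H} ?S)"
   have 1: "(lamg a f g *{H} id2 H (pnt1 be ?b)) #{H} (?l *{H} ?L *{H} q ?b) = (id2 H (lam a (f o{B} g)) *{H} q ?b) #{H} (lamg a f g *{H} id2 H (pnt1 al ?b))"
    using \<A>.H.exchange(1)[of "lamg a f g" "q ?b"] by (simp add: \<A>.H.pasting)
   have 2: "(k' a f *{H} ?S) #{H} (?l *{H} q ?b' *{H} ?S) = (n a f *{H} ?S) #{H} (k a f *{H} ?S)"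
    using arg_cong[OF kq[of a f], of "%z. z *{H} ?S"] by (simp add: \<A>.H.whisker_vcomp_right \<A>.H.pasting)
   have 3: "?j #{H} (?l *{H} pnt2 be g) = k' a (f o{B} g) #{H} (lamg a f g *{H} id2 H (pnt1 be ?b))"
    using d.k_g[of a f g] by (simp add: \<A>.H.pasting)
   have "?j #{H} (?l *{H} pnt2 be g) #{H} (?l *{H} ?L *{H} q ?b) = k' a (f o{B} g) #{H} (id2 H (lam a (f o{B} g)) *{H} q ?b) #{H} (lamg a f g *{H} id2 H (pnt1 al ?b))"
    using 1 \<A>.H.vcomp_pre[OF 3, of "?l *{H} ?L *{H} q ?b"] by (simp add: \<A>.H.pasting)
   also have "... = n a (f o{B} g) #{H} k a (f o{B} g) #{H} (lamg a f g *{H} id2 H (pnt1 al ?b))"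
    using \<A>.H.vcomp_pre[OF kq[of a "f o{B} g"], of "lamg a f g *{H} id2 H (pnt1 al ?b)"] by (simp add: \<A>.H.pasting)
   also have "... = ?j #{H} (?l *{H} q ?b' *{H} ?S) #{H} (?l *{H} pnt2 al g)"
    using c.k_g[of a f g] \<A>.H.vcomp_pre[OF n2[of a f g], of "(k a f *{H} ?S) #{H} (?l *{H} pnt2 al g)"] \<A>.H.vcomp_pre[OF 2, of "?l *{H} pnt2 al g"]
    by (simp add: \<A>.H.pasting)
   finally have "(?l *{H} pnt2 be g) #{H} (?l *{H} ?L *{H} q ?b) = (?l *{H} q ?b' *{H} ?S) #{H} (?l *{H} pnt2 al g)"
    by (rule \<A>.H.iso2_cancel_left[rotated]) (simp_all add: \<A>.H.comp1_assoc')
   then show ?case by (simp add: \<A>.H.whisker_vcomp_left)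
  qed simp_all
  then show ?case by simp
 qed (simp_all add: c.al.pseudonatural_axioms d.al.pseudonatural_axioms, simp add: th_def)
 then show ?thesis using kq by (intro exI[of _ th]) simp
qed

end

section \<open>The counit induces equivalences of hom-categories\<close>

context universal_cone
begin

lemma pnt_to_LI: "pseudonatural B H al ==> pcod al = L ==> pnt_to_L A H \<A> B t L lam lam2 lamu lamg al"
 by (simp add: pnt_to_L_def pnt_to_L_axioms_def bimodule_cone_axioms)

text \<open>\<open>Ga\<close> lives over the objects of A; whiskering with \<open>S f\<close>
  extends it to a morphism \<open>n\<close> between the cones of the two images, which lifts by
  \<open>lift_modification\<close>. Evaluation at identities recovers \<open>Ga\<close>.\<close>

lemma epsilon_full:
 assumes a: "pseudonatural B H al" "pcod al = L" "pdom al = S" and b: "pseudonatural B H be" "pcod be = L" "pdom be = S"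
  and G: "modification A H Ga" "mdom Ga = pnt_comp A H epsilon (pnt_pre A H t al)" "mcod Ga = pnt_comp A H epsilon (pnt_pre A H t be)"
 shows "\<exists>th. modification B H th & mdom th = al & mcod th = be & mdf_hcomp A H (mdf_id A H epsilon) (mdf_pre A H t th) = Ga"
proof -
 interpret a: pnt_to_L A H \<A> B t L lam lam2 lamu lamg al using a(1,2) by (rule pnt_to_LI)
 interpret b: pnt_to_L A H \<A> B t L lam lam2 lamu lamg be using b(1,2) by (rule pnt_to_LI)
 interpret G: modification A H Ga by fact
 note pd [simp] = a(3) b(3)
 have Gd [simp]: "mdom Ga = a.ga" "mcod Ga = b.ga" using G by (simp_all add: a.ga_def b.ga_def)
 have S: "pseudofunctor B H S" using a.al.pseudofunctor_pdom by simp
 interpret ag: gamma_cone A B H t S a.ga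
  by (intro gamma_cone.intro gamma_cone_axioms.intro t.pseudofunctor_axioms S a.pseudonatural_gamma) simp
 interpret bg: gamma_cone A B H t S b.ga
  by (intro gamma_cone.intro gamma_cone_axioms.intro t.pseudofunctor_axioms S b.pseudonatural_gamma) simp
 interpret classify2 A H \<A> B t L lam lam2 lamu lamg S ag.x ag.x2 ag.xu ag.xg al a.E bg.x bg.x2 bg.xu bg.xg be b.E
  using a.classifies b.classifies universal_cone_axioms by (simp add: classify2_def)
 define n where "n a f = mdf2 Ga a *{H} id2 H (psf1 S f)" for a f
 have "\<exists>th. modification B H th & mdom th = al & mcod th = be &
  (\<forall>a\<in>Ob A. \<forall>f\<in>Mor B. trg B f = psf0 t a --> b.E a f #{H} (id2 H (lam a f) *{H} mdf2 th (src B f)) = n a f #{H} a.E a f)"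
 proof (rule lift_modification, goal_cases)
  case (4 a xi)
  then have [simp]: "a \<in> Ob A" "xi \<in> Cell B" "trg B (dom2 B xi) = psf0 t a" .
  show ?case using \<A>.H.exchange(1)[of "mdf2 Ga a" "psf2 S xi"]
   by (simp add: n_def ag.x2_def bg.x2_def del: a.gamma_simps(3,4) b.gamma_simps(3,4))
 next
  case (5 u f)
  then have [simp]: "u \<in> Mor A" "f \<in> Mor B" "trg B f = psf0 t (src A u)" .
  let ?S = S and ?a = "src A u" and ?b = "trg A u" and ?u = "id2 H (psf1 \<A> u)"
  let ?Sf = "id2 H (psf1 ?S f)" and ?tu = "psf1 t u"
  have 1: "(pnt2 b.ga u *{H} ?Sf) #{H} (?u *{H} mdf2 Ga ?a *{H} ?Sf) = (mdf2 Ga ?b *{H} id2 H (psf1 ?S ?tu) *{H} ?Sf) #{H} (pnt2 a.ga u *{H} ?Sf)"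
   using arg_cong[OF G.mdf2_natural[of u], of "%z. z *{H} ?Sf"] by (simp add: \<A>.H.whisker_vcomp_right \<A>.H.pasting del: a.gamma_simps(3,4) b.gamma_simps(3,4))
  have 2: "(id2 H (pnt1 b.ga ?b) *{H} psfc ?S ?tu f) #{H} (mdf2 Ga ?b *{H} id2 H (psf1 ?S ?tu) *{H} ?Sf) = (mdf2 Ga ?b *{H} id2 H (psf1 ?S (?tu o{B} f))) #{H} (id2 H (pnt1 a.ga ?b) *{H} psfc ?S ?tu f)"
   using \<A>.H.exchange(1)[of "mdf2 Ga ?b" "psfc ?S ?tu f"] by (simp add: \<A>.H.pasting del: a.gamma_simps(3,4) b.gamma_simps(3,4))
  show ?case
   using 1 \<A>.H.vcomp_pre[OF 2, of "pnt2 a.ga u *{H} ?Sf"]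
   by (simp add: n_def ag.xu_def bg.xu_def \<A>.H.pasting del: a.gamma_simps(3,4) b.gamma_simps(3,4))
 next
  case (6 a f g)
  then have [simp]: "a \<in> Ob A" "f \<in> Mor B" "g \<in> Mor B" "src B f = trg B g" "trg B f = psf0 t a" .
  show ?case using \<A>.H.exchange(1)[of "mdf2 Ga a" "psfc S f g"]
   by (simp add: n_def ag.xg_def bg.xg_def \<A>.H.hcomp_assoc' del: a.gamma_simps(3,4) b.gamma_simps(3,4))
 qed (simp_all add: n_def ag.x_def bg.x_def)
 then obtain th where t: "modification B H th" "mdom th = al" "mcod th = be"
  and e: "!!a f. [|a \<in> Ob A; f \<in> Mor B; trg B f = psf0 t a|] ==> b.E a f #{H} (id2 H (lam a f) *{H} mdf2 th (src B f)) = n a f #{H} a.E a f" by blast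
 interpret th: modification B H th by fact
 note [simp] = t
 have "id2 H (lam a (unit a)) *{H} mdf2 th (psf0 t a) = mdf2 Ga a" if [simp]: "a \<in> Ob A" for a
 proof -
  \<comment> \<open>At the identity both cells \<open>E\<close> are unit cells of S; after one is
    moved past \<open>Ga\<close> by interchange, the common factor cancels.\<close>
  let ?i = "id2 H (pnt1 b.ga a) *{H} psfu S (psf0 t a)"
  have 1: "(mdf2 Ga a *{H} id2 H (psf1 S (unit a))) #{H} (id2 H (pnt1 a.ga a) *{H} psfu S (psf0 t a)) = ?i #{H} mdf2 Ga a"
   using \<A>.H.exchange(1)[of "mdf2 Ga a" "psfu S (psf0 t a)"] by (simp del: a.gamma_simps(3,4) b.gamma_simps(3,4))
  have "?i #{H} (id2 H (lam a (unit a)) *{H} mdf2 th (psf0 t a)) = ?i #{H} mdf2 Ga a"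
   using e[of a "unit a"] 1 by (simp add: a.E_unit b.E_unit n_def)
  then show ?thesis by (rule \<A>.H.iso2_cancel_left[rotated]) (simp_all add: \<A>.H.comp1_assoc')
 qed
 moreover have "modification A H (mdf_hcomp A H (mdf_id A H epsilon) (mdf_pre A H t th))"
  by (rule modification_mdf_hcomp) (simp_all add: pseudonatural_epsilon modification_mdf_pre[OF t.pseudofunctor_axioms t(1)])
 ultimately have "mdf_hcomp A H (mdf_id A H epsilon) (mdf_pre A H t th) = Ga"
  by (intro mdf_eqI[of A H]) (simp_all add: G.modification_axioms a.ga_def b.ga_def)
 then show ?thesis using t by blast
qed

text \<open>Through \<open>E\<close>, the cell \<open>lam a f \<star> th\<close> is expressed by
  \<open>lam a 1 \<star> th\<close>. Agreement at identities therefore spreads to all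
  \<open>f\<close>, and the legs of the cone are jointly faithful.\<close>

lemma epsilon_faithful:
 assumes t: "modification B H th" "modification B H th'" "mdom th' = mdom th" "mcod th' = mcod th" "pcod (mdom th) = L"
  and e: "mdf_hcomp A H (mdf_id A H epsilon) (mdf_pre A H t th) = mdf_hcomp A H (mdf_id A H epsilon) (mdf_pre A H t th')"
 shows "th = th'"
proof -
 interpret th: modification B H th by fact
 interpret th': modification B H th' by fact
 let ?al = "mdom th" and ?be = "mcod th"
 interpret a: pnt_to_L A H \<A> B t L lam lam2 lamu lamg ?al using th.pseudonatural_mdom t(5) by (rule pnt_to_LI)
 interpret b: pnt_to_L A H \<A> B t L lam lam2 lamu lamg ?be using th.pseudonatural_mcod by (rule pnt_to_LI) (simp add: th.pcod_mcod t)
 note [simp] = t(3-5) th.pdom_mcod th.pcod_mcod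
 have E: "b.E a f #{H} (id2 H (lam a f) *{H} mdf2 si (src B f)) = (id2 H (lam a (unit a)) *{H} mdf2 si (psf0 t a) *{H} id2 H (psf1 (pdom ?al) f)) #{H} a.E a f"
  if s: "modification B H si" and d [simp]: "mdom si = ?al" "mcod si = ?be" and [simp]: "a \<in> Ob A" "f \<in> Mor B" "trg B f = psf0 t a" for si a f
 proof -
  interpret s: modification B H si by fact
  let ?l = "id2 H (lam a (unit a))" and ?s = "mdf2 si (src B f)"
  have 1: "(inv2 H (l a f) *{H} id2 H (pnt1 ?be (src B f))) #{H} (id2 H (lam a f) *{H} ?s) = (?l *{H} id2 H (psf1 L f) *{H} ?s) #{H} (inv2 H (l a f) *{H} id2 H (pnt1 ?al (src B f)))"
   using \<A>.H.exchange(1)[of "inv2 H (l a f)" ?s] by (simp add: \<A>.H.pasting)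
  have 2: "(?l *{H} pnt2 ?be f) #{H} (?l *{H} id2 H (psf1 L f) *{H} ?s) = (?l *{H} mdf2 si (psf0 t a) *{H} id2 H (psf1 (pdom ?al) f)) #{H} (?l *{H} pnt2 ?al f)"
   using arg_cong[OF s.mdf2_natural[of f], of "%z. ?l *{H} z"] by (simp add: \<A>.H.whisker_vcomp_left)
  show ?thesis using 1 \<A>.H.vcomp_pre[OF 2, of "inv2 H (l a f) *{H} id2 H (pnt1 ?al (src B f))"]
   by (simp add: a.E_def b.E_def \<A>.H.pasting)
 qed
 have ea: "id2 H (lam a (unit a)) *{H} mdf2 th (psf0 t a) = id2 H (lam a (unit a)) *{H} mdf2 th' (psf0 t a)" if "a \<in> Ob A" for a
  using arg_cong[OF e, of "%z. mdf2 z a"] that by simp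
 have "mdf2 th b = mdf2 th' b" if [simp]: "b \<in> Ob B" for b
 proof (rule faithful[of b], goal_cases)
  case (7 a f)
  then have [simp]: "a \<in> Ob A" "f \<in> Mor B" "src B f = b" "trg B f = psf0 t a" .
  have w: "id2 H (lam a (unit a)) *{H} mdf2 th (psf0 t a) *{H} id2 H (psf1 (pdom ?al) f) = id2 H (lam a (unit a)) *{H} mdf2 th' (psf0 t a) *{H} id2 H (psf1 (pdom ?al) f)"
   using arg_cong[OF ea[of a], of "%z. z *{H} id2 H (psf1 (pdom ?al) f)"] by (simp add: \<A>.H.hcomp_assoc')
  have i [simp]: "iso2 H (b.E a f)" "b.E a f \<in> Cell H" "dom2 H (b.E a f) = lam a f o{H} pnt1 ?be b"
   by (simp_all add: b.E_def \<A>.H.comp1_assoc')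
  have "b.E a f #{H} (id2 H (lam a f) *{H} mdf2 th b) = b.E a f #{H} (id2 H (lam a f) *{H} mdf2 th' b)"
   using E[of th a f] E[of th' a f] t w by simp
  then show ?case by (rule \<A>.H.iso2_cancel_left[rotated]) simp_all
 qed simp_all
 then show ?thesis by (intro mdf_eqI[of B H]) (simp_all add: t)
qed

text \<open>Classifying the cone of \<open>ga\<close> gives \<open>al\<close>. Its isomorphism
  \<open>k\<close> at an identity ends in \<open>ga a \<odot> S 1\<close>; removing the unit cell of
  S leaves the component \<open>n a\<close> of an isomorphism onto \<open>ga\<close>.\<close>

lemma epsilon_eso:
 assumes S: "pseudofunctor B H S" and g: "pseudonatural A H ga" "pdom ga = psf_comp A H S t" "pcod ga = \<A>"
 shows "\<exists>al n. pseudonatural B H al & pdom al = S & pcod al = L & iso2 (PS A H) n &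
  mdom n = pnt_comp A H epsilon (pnt_pre A H t al) & mcod n = ga"
proof -
 interpret S: pseudofunctor B H S by fact
 interpret g: gamma_cone A B H t S ga by (intro gamma_cone.intro gamma_cone_axioms.intro S g t.pseudofunctor_axioms)
 note [simp] = g(3)
 interpret classify A H \<A> B t L lam lam2 lamu lamg S g.x g.x2 g.xu g.xg
  using g.bimodule universal_cone_axioms by (simp add: classify_def)
 obtain al k where "classifies A H \<A> B t L lam lam2 lamu lamg S g.x g.x2 g.xu g.xg al k" using classify by blast
 then interpret c: classifies A H \<A> B t L lam lam2 lamu lamg S g.x g.x2 g.xu g.xg al k .
 interpret a: pnt_to_L A H \<A> B t L lam lam2 lamu lamg al using c.al.pseudonatural_axioms c.pcod_alpha by (rule pnt_to_LI)
 let ?i = "%a. id2 H (pnt1 ga a) *{H} psfu S (psf0 t a)"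
 define n where "n a = inv2 H (?i a) #{H} k a (unit a)" for a
 have n [simp]: "n a \<in> Cell H" "iso2 H (n a)" "dom2 H (n a) = lam a (unit a) o{H} pnt1 al (psf0 t a)" "cod2 H (n a) = pnt1 ga a"
  and ni: "?i a #{H} n a = k a (unit a)" if "a \<in> Ob A" for a using that by (simp_all add: n_def g.x_def)
 define N where "N = \<lparr>mdom = a.ga, mcod = ga, mdf2 = restrict n (Ob A)\<rparr>"
 have N [simp]: "mdom N = a.ga" "mcod N = ga" "!!a. a \<in> Ob A ==> mdf2 N a = n a" by (simp_all add: N_def)
 have "modification A H N"
 proof (rule modification.intro, goal_cases)
  case (9 u)
  then have [simp]: "u \<in> Mor A" .
  let ?a = "src A u" and ?b = "trg A u" and ?tu = "psf1 t u" and ?u = "id2 H (psf1 \<A> u)" and ?S = "id2 H (psf1 S (psf1 t u))"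
  let ?p = "id2 H (pnt1 al (psf0 t (src A u)))" and ?l = "id2 H (lam ?b (unit ?b))" and ?g = "id2 H (pnt1 ga ?b)"
  have 1: "(?g *{H} psfc S (unit ?b) ?tu) #{H} (?g *{H} psfu S (psf0 t ?b) *{H} ?S) = ?g *{H} ?S"
   using arg_cong[OF S.psfc_unit_left[of ?tu], of "%z. ?g *{H} z"] by (simp add: \<A>.H.whisker_vcomp_left)
  have 2: "(?g *{H} psfu S (psf0 t ?b) *{H} ?S) #{H} (n ?b *{H} ?S) = k ?b (unit ?b) *{H} ?S"
   using arg_cong[OF ni[of ?b], of "%z. z *{H} ?S"] by (simp add: \<A>.H.whisker_vcomp_right \<A>.H.pasting)
  have 3: "(l ?b ?tu *{H} ?p) #{H} (eps2 u *{H} ?p) = lamu1 u *{H} ?p"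
   using arg_cong[OF l_eps2[of u], of "%z. z *{H} ?p"] by (simp add: \<A>.H.whisker_vcomp_right)
  have 4: "(?g *{H} psfc S (unit ?b) ?tu) #{H} (k ?b (unit ?b) *{H} ?S) #{H} (?l *{H} pnt2 al ?tu) = k ?b ?tu #{H} (l ?b ?tu *{H} ?p)"
   using c.k_g[of ?b "unit ?b" ?tu] by (simp add: g.xg_def)
  have 5: "(?u *{H} ?i ?a) #{H} (?u *{H} n ?a) = ?u *{H} k ?a (unit ?a)"
   using arg_cong[OF ni[of ?a], of "%z. ?u *{H} z"] by (simp add: \<A>.H.whisker_vcomp_left)
  have 6: "(pnt2 ga u *{H} id2 H (psf1 S (unit ?a))) #{H} (?u *{H} ?i ?a) = (?g *{H} ?S *{H} psfu S (psf0 t ?a)) #{H} pnt2 ga u"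
   using \<A>.H.exchange(1)[of "pnt2 ga u" "psfu S (psf0 t ?a)"] by (simp add: \<A>.H.pasting)
  have 7: "(?g *{H} psfc S ?tu (unit ?a)) #{H} (?g *{H} ?S *{H} psfu S (psf0 t ?a)) = ?g *{H} ?S"
   using arg_cong[OF S.psfc_unit_right[of ?tu], of "%z. ?g *{H} z"] by (simp add: \<A>.H.whisker_vcomp_left)
  \<comment> \<open>The isomorphism is carried across \<open>u\<close> by \<open>k_g\<close> at an
    identity and \<open>t u\<close>, followed by \<open>k_u\<close> at an identity; the first and
    last lines only insert and remove unit cells of S.\<close>
  have "(n ?b *{H} ?S) #{H} pnt2 a.ga u = (?g *{H} psfc S (unit ?b) ?tu) #{H} (k ?b (unit ?b) *{H} ?S) #{H} pnt2 a.ga u"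
   using \<A>.H.vcomp_pre[OF 1, of "(n ?b *{H} ?S) #{H} pnt2 a.ga u"] \<A>.H.vcomp_pre[OF 2, of "pnt2 a.ga u"] by (simp add: \<A>.H.pasting del: a.gamma_simps(4))
  also have "... = k ?b ?tu #{H} (lamu1 u *{H} ?p)"
   using \<A>.H.vcomp_pre[OF 4, of "eps2 u *{H} ?p"] 3 by (simp add: g.x_def \<A>.H.pasting)
  also have "... = g.xu u (unit ?a) #{H} (?u *{H} k ?a (unit ?a))" using c.k_u[of u "unit ?a"] by simp
  also have "... = pnt2 ga u #{H} (?u *{H} n ?a)"
   using \<A>.H.vcomp_pre[OF 6, of "?u *{H} n ?a"] \<A>.H.vcomp_pre[OF 7, of "pnt2 ga u #{H} (?u *{H} n ?a)"]
   by (simp add: g.xu_def 5[symmetric] \<A>.H.pasting)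
  finally show ?case by simp
 qed (simp_all add: a.pseudonatural_gamma g, simp add: N_def)
 then have "iso2 (PS A H) N" by (simp add: iso2_PS)
 then show ?thesis using c.al.pseudonatural_axioms N(1,2) unfolding a.ga_def by (intro exI[of _ al] exI[of _ N]) simp
qed

end

section \<open>Comparison functors and uniqueness of representing objects\<close>

text \<open>
 For a strict 2-functor \<open>T : M \<rightarrow> N\<close> and \<open>ep : T R \<rightarrow> a\<close>, the comparison \<open>M(S, R) \<rightarrow> N(T S, a)\<close>,
 \<open>al \<mapsto> ep (T al)\<close>; Kan extensions are the case where \<open>T\<close> is precomposition with \<open>t\<close>.
\<close>

locale strict_comparison = T: strict_functor M N T0 T1 T2
 for M :: "('p, 'n, 'd) twocat" and N :: "('q, 'k, 'e) twocat" and T0 T1 T2 +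
 fixes R a ep
 assumes R_Ob [simp]: "R \<in> Ob M" and eps [simp]: "ep \<in> Mor N" "src N ep = T0 R" "trg N ep = a"
begin

lemma a_Ob [simp]: "a \<in> Ob N"
 using T.H.trg_Ob[of ep] by simp

sublocale opM: two_category "op2 M" by (rule T.A.two_category_op2)
sublocale opN: two_category "op2 N" by (rule T.H.two_category_op2)

abbreviation "P \<equiv> rep (op2 M) R"
abbreviation "Q \<equiv> psf_comp (op2 M) CAT (rep (op2 N) a) (strict_psf (op2 M) (op2 N) T0 T1 T2)"
abbreviation "ro S x \<equiv> ep o{N} T1 x"
abbreviation "ra S y \<equiv> id2 N ep *{N} T2 y"
text \<open>T preserves composition strictly, so \<open>ep \<odot> T (x \<odot> si)\<close> equals
  \<open>ep \<odot> T x \<odot> T si\<close> and the structure cells are identities.\<close>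

abbreviation "n si x \<equiv> id2 N (ep o{N} T1 x o{N} T1 si)"

lemma strict_op: "strict_functor (op2 M) (op2 N) T0 T1 T2"
 by (rule strict_functor_op2) (simp_all add: T.strict_functor_axioms opM.two_category_axioms)

lemma Q_strict: "strict_functor (op2 M) CAT (homcat (op2 N) a \<circ> T0) (rep_fnct (op2 N) a \<circ> T1) (rep_ntr (op2 N) a \<circ> T2)"
 "Q = strict_psf (op2 M) CAT (homcat (op2 N) a \<circ> T0) (rep_fnct (op2 N) a \<circ> T1) (rep_ntr (op2 N) a \<circ> T2)"
 using strict_functor_comp[OF strict_op opN.strict_functor_rep[of a]] psf_comp_strict_psf[OF strict_op opN.strict_functor_rep[of a]]
 by (simp_all add: rep_def)

lemma Q_simps [simp]:
 "pseudofunctor (op2 M) CAT Q"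
 "X \<in> Ob M ==> psf0 Q X = homcat (op2 N) a (T0 X)" "f \<in> Mor M ==> psf1 Q f = rep_fnct (op2 N) a (T1 f)"
 "xi \<in> Cell M ==> psf2 Q xi = rep_ntr (op2 N) a (T2 xi)"
 "composable M f g ==> psfc Q g f = ntr_id (rep_fnct (op2 N) a (T1 (f o{M} g)))"
 "X \<in> Ob M ==> psfu Q X = ntr_id (rep_fnct (op2 N) a (T1 (id1 M X)))"
 using strict_functor.pseudofunctor_strict[OF Q_strict(1)] by (simp_all add: Q_strict(2))

lemma hpnt: "hpnt (op2 M) P Q ro ra n"
proof (rule hpnt.intro[OF _ _ hpnt_axioms.intro], goal_cases)
 case (14 g f x)
 then have [simp]: "f \<in> Mor M" "g \<in> Mor M" "src M f = trg M g" "x \<in> Mor M" "src M x = trg M f" "trg M x = R"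
  by (auto simp: composable_def)
 show ?case by (simp add: T.H.pasting T.A.comp1_assoc')
qed (auto simp: T.H.pasting T.H.whisker_vcomp_left T.A.comp1_assoc' opN.iso_in_homcat)

sublocale hpnt "op2 M" P Q ro ra n by (rule hpnt)
sublocale h: hetero_pnt "op2 M" P Q "mk_pnt (op2 M) P Q ro ra n" by (rule hetero_mk_pnt)

text \<open>Kept in the shape of \<open>kan_comparison\<close>, so that the two can be matched by
  unfolding; \<open>comparison_eq\<close> identifies it with \<open>mk_pnt\<close>, from which it
  inherits pseudonaturality.\<close>

definition comparison where
 "comparison = \<lparr>pdom = psf_comp (op2 M) CAT in_left P, pcod = psf_comp (op2 M) CAT in_right Q,
  pnt1 = (\<lambda>S \<in> Ob M. hfnct (psf0 P S) (psf0 Q S) (ro S) (ra S)),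
  pnt2 = (\<lambda>si \<in> Mor M. ntr_id (fnct_comp (psf1 (psf_comp (op2 M) CAT in_right Q) si)
    (hfnct (psf0 P (trg M si)) (psf0 Q (trg M si)) (ro (trg M si)) (ra (trg M si)))))\<rparr>"

lemma comparison_eq: "comparison = mk_pnt (op2 M) P Q ro ra n"
proof -
 have "pnt2 comparison si = pnt2 (mk_pnt (op2 M) P Q ro ra n) si" if s [simp]: "si \<in> Mor M" for si
 proof -
  have 1: "fnct_comp (hfnct (psf0 P (src M si)) (psf0 Q (src M si)) (ro (src M si)) (ra (src M si))) (relabel_fnct Inl Inl (psf1 P si)) =
    fnct_comp (relabel_fnct Inr Inr (psf1 Q si)) (hfnct (psf0 P (trg M si)) (psf0 Q (trg M si)) (ro (trg M si)) (ra (trg M si)))"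

   by (rule fnct_eqI) (use nat_trans.fnctr_ndom[OF nat_trans_pnt2[of si]] nat_trans.fnctr_ncod[OF nat_trans_pnt2[of si]] in \<open>auto simp: T.H.pasting opM.fnctr_rep opN.fnctr_rep\<close>)
  show ?thesis
   by (rule ntr_eqI) (use h.pnt2_ntr[of si] nat_trans_pnt2[of si] nat_trans.fnctr_ndom[OF nat_trans_pnt2[of si]] 1 in \<open>auto simp: comparison_def T.H.pasting\<close>)
 qed
 moreover have "pnt2 comparison \<in> extensional (Mor M)" "pnt2 (mk_pnt (op2 M) P Q ro ra n) \<in> extensional (Mor M)"
  by (simp_all add: comparison_def mk_pnt_def)
 ultimately have "pnt2 comparison = pnt2 (mk_pnt (op2 M) P Q ro ra n)" by (intro extensionalityI)
 then show ?thesis by (simp add: comparison_def mk_pnt_def)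
qed

text \<open>This and the next two conditions state the equivalence in cells of M and N. In this form
  the counit lemmas supply them and the uniqueness argument consumes them.\<close>

definition full_comparison where "full_comparison \<longleftrightarrow> (\<forall>al\<in>Mor M. \<forall>be\<in>Mor M. \<forall>Ga\<in>Cell N. trg M al = R & trg M be = R & src M be = src M al &
  dom2 N Ga = ep o{N} T1 al & cod2 N Ga = ep o{N} T1 be --> (\<exists>th\<in>Cell M. dom2 M th = al & cod2 M th = be & id2 N ep *{N} T2 th = Ga))"
definition faithful_comparison where "faithful_comparison \<longleftrightarrow> (\<forall>th\<in>Cell M. \<forall>th'\<in>Cell M. trg M (dom2 M th) = R & dom2 M th' = dom2 M th & cod2 M th' = cod2 M th &
  id2 N ep *{N} T2 th = id2 N ep *{N} T2 th' --> th = th')"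
definition eso_comparison where "eso_comparison \<longleftrightarrow> (\<forall>S\<in>Ob M. \<forall>ga\<in>Mor N. src N ga = T0 S & trg N ga = a -->
  (\<exists>al\<in>Mor M. src M al = S & trg M al = R & isomorphic1 N (ep o{N} T1 al) ga))"

lemma h_fnctr [simp]:
 assumes "S \<in> Ob M"
 shows "fdom (pnt1 comparison S) = relabel_cat Inl Inl (homcat (op2 M) R S)" "fcod (pnt1 comparison S) = relabel_cat Inr Inr (homcat (op2 N) a (T0 S))"
  "fnctr (pnt1 comparison S)"
  "x \<in> Mor M ==> trg M x = R ==> src M x = S ==> fobj (pnt1 comparison S) (Inl x) = Inr (ep o{N} T1 x)"
  "y \<in> Cell M ==> trg M (dom2 M y) = R ==> src M (dom2 M y) = S ==> farr (pnt1 comparison S) (Inl y) = Inr (id2 N ep *{N} T2 y)"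
 using assms h.pnt1_fnctr[of S] by (simp_all add: comparison_eq)

text \<open>At each object the conditions make the component functor full, faithful and essentially
  surjective; \<open>equivalence1_PS\<close> then supplies the pseudonatural inverse.\<close>

theorem comparison_equivalenceI:
 assumes full: full_comparison and faithful: faithful_comparison and eso: eso_comparison
 shows "pseudonatural_equivalence_CAT (op2 M) comparison P Q"
proof -
 have "equivalence1 CAT (pnt1 comparison S) (fdom (pnt1 comparison S)) (fcod (pnt1 comparison S))" if S [simp]: "S \<in> Ob M" for S
 proof (rule CAT_equivalenceI[OF _ refl refl], goal_cases)
  case (2 x y g)
  then obtain x' y' g' where [simp]: "x = Inl x'" "y = Inl y'" "g = Inr g'" by auto
  have x: "x' \<in> Mor M" "trg M x' = R" "src M x' = S" "y' \<in> Mor M" "trg M y' = R" "src M y' = S" "g' \<in> Cell N"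
   using 2(1-3) by auto
  have "dom2 N g' = ep o{N} T1 x'" "cod2 N g' = ep o{N} T1 y'" using 2(4,5) x by simp_all
  then have "\<exists>th\<in>Cell M. dom2 M th = x' & cod2 M th = y' & id2 N ep *{N} T2 th = g'"
   using full[unfolded full_comparison_def, rule_format, of x' y' g'] x by simp
  then obtain th where "th \<in> Cell M" "dom2 M th = x'" "cod2 M th = y'" "id2 N ep *{N} T2 th = g'" by blast
  then show ?case using x by (intro exI[of _ "Inl th"]) simp
 next
  case (3 f f')
  then obtain g g' where e [simp]: "f = Inl g" "f' = Inl g'" by auto
  have x: "g \<in> Cell M" "trg M (dom2 M g) = R" "src M (dom2 M g) = S" "g' \<in> Cell M" "trg M (dom2 M g') = R" "src M (dom2 M g') = S"
   using 3(1,2) by auto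
  have d: "dom2 M g' = dom2 M g" "cod2 M g' = cod2 M g" using 3(3,4) x by simp_all
  have "id2 N ep *{N} T2 g = id2 N ep *{N} T2 g'" using 3(5) x by simp
  then have "g = g'" using faithful[unfolded faithful_comparison_def, rule_format, of g g'] x d by blast
  then show ?case by simp
 next
  case (4 d)
  then obtain ga where d [simp]: "d = Inr ga" and g: "ga \<in> Mor N" "trg N ga = a" "src N ga = T0 S" by auto
  have "\<exists>al\<in>Mor M. src M al = S & trg M al = R & isomorphic1 N (ep o{N} T1 al) ga"
   by (rule eso[unfolded eso_comparison_def, rule_format]) (use g in simp_all)
  then obtain al i where al: "al \<in> Mor M" "src M al = S" "trg M al = R" and i: "iso2 N i" "dom2 N i = ep o{N} T1 al" "cod2 N i = ga"
   unfolding isomorphic1_def by blast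
  have "i \<in> Cell N" using i(1) by (rule T.H.iso2_Cell)
  then show ?case using al i by (intro exI[of _ "Inl al"] exI[of _ "Inr i"]) (simp add: opN.iso_in_homcat)
 qed simp
 then have "equivalence1 (PS (op2 M) CAT) comparison (pdom comparison) (pcod comparison)"
  by (intro equivalence1_PS) (auto simp: comparison_eq pseudonatural_mk_pnt)
 then show ?thesis by (simp add: pseudonatural_equivalence_CAT_def comparison_def)
qed

theorem comparison_equivalenceD:
 assumes "pseudonatural_equivalence_CAT (op2 M) comparison P Q"
 shows full_comparison faithful_comparison eso_comparison
proof -
 have e: "equivalence1 CAT (pnt1 comparison S) (fdom (pnt1 comparison S)) (fcod (pnt1 comparison S))" if S [simp]: "S \<in> Ob M" for S
  using equivalence1_components[OF assms[unfolded pseudonatural_equivalence_CAT_def], of S] by (simp add: equivalence1_def)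
 show full_comparison unfolding full_comparison_def
 proof (intro ballI impI, elim conjE)
  fix al be Ga assume [simp]: "al \<in> Mor M" "be \<in> Mor M" "Ga \<in> Cell N" "trg M al = R" "trg M be = R" "src M be = src M al"
   "dom2 N Ga = ep o{N} T1 al" "cod2 N Ga = ep o{N} T1 be"
  have "\<exists>f. f \<in> Arr (fdom (pnt1 comparison (src M al))) & Dom (fdom (pnt1 comparison (src M al))) f = Inl al &
    Cod (fdom (pnt1 comparison (src M al))) f = Inl be & farr (pnt1 comparison (src M al)) f = Inr Ga"
   by (rule CAT_equivalenceD(1)[OF e]) simp_all
  then obtain f where f: "f \<in> Arr (fdom (pnt1 comparison (src M al)))" "Dom (fdom (pnt1 comparison (src M al))) f = Inl al"
    "Cod (fdom (pnt1 comparison (src M al))) f = Inl be" "farr (pnt1 comparison (src M al)) f = Inr Ga" by blast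
  from f(1) obtain th where "f = Inl th" "th \<in> Arr (homcat (op2 M) R (src M al))" by auto
  then show "\<exists>th\<in>Cell M. dom2 M th = al & cod2 M th = be & id2 N ep *{N} T2 th = Ga" using f by auto
 qed
 show faithful_comparison unfolding faithful_comparison_def
 proof (intro ballI impI)
  fix th th' assume t: "th \<in> Cell M" "th' \<in> Cell M"
   "trg M (dom2 M th) = R & dom2 M th' = dom2 M th & cod2 M th' = cod2 M th & id2 N ep *{N} T2 th = id2 N ep *{N} T2 th'"
  show "th = th'"
   by (rule Inl_inject[OF CAT_equivalenceD(2)[OF e, of "src M (dom2 M th)" "Inl th" "Inl th'"]]) (use t in simp_all)
 qed
 show eso_comparison unfolding eso_comparison_def
 proof (intro ballI impI)
  fix S ga assume [simp]: "S \<in> Ob M" and g: "ga \<in> Mor N" "src N ga = T0 S & trg N ga = a"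
  have "Inr ga \<in> Obj (fcod (pnt1 comparison S))" using g by simp
  from CAT_equivalenceD(3)[OF e[OF \<open>S \<in> Ob M\<close>] this] obtain x i where x: "x \<in> Obj (fdom (pnt1 comparison S))"
   and i: "iso_in (fcod (pnt1 comparison S)) i" "Dom (fcod (pnt1 comparison S)) i = fobj (pnt1 comparison S) x" "Cod (fcod (pnt1 comparison S)) i = Inr ga" by blast
  from x obtain al where al: "x = Inl al" "al \<in> Mor M" "src M al = S" "trg M al = R" by auto
  have "i \<in> Arr (fcod (pnt1 comparison S))" using i(1) by (rule iso_in_Arr)
  then obtain k where k: "i = Inr k" "k \<in> Arr (homcat (op2 N) a (T0 S))" by auto
  have "iso2 N k" using i(1) k opN.iso_in_homcat[of k a "T0 S"] by simp
  then have "isomorphic1 N (ep o{N} T1 al) ga" unfolding isomorphic1_def using i k al by (intro exI[of _ k]) simp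
  then show "\<exists>al\<in>Mor M. src M al = S & trg M al = R & isomorphic1 N (ep o{N} T1 al) ga" using al by blast
 qed
qed

text \<open>Preimages of an isomorphism and of its inverse are inverse to each other by
  faithfulness.\<close>

lemma reflects_isomorphic1:
 assumes full: full_comparison and faithful: faithful_comparison
  and a [simp]: "al \<in> Mor M" "be \<in> Mor M" "trg M al = R" "trg M be = R" "src M be = src M al"
  and i: "isomorphic1 N (ep o{N} T1 al) (ep o{N} T1 be)"
 shows "isomorphic1 M al be"
proof -
 obtain Ga where G [simp]: "iso2 N Ga" "dom2 N Ga = ep o{N} T1 al" "cod2 N Ga = ep o{N} T1 be" using i unfolding isomorphic1_def by blast
 have GC [simp]: "Ga \<in> Cell N" using G(1) by (rule T.H.iso2_Cell)
 obtain th where t [simp]: "th \<in> Cell M" "dom2 M th = al" "cod2 M th = be" and tG: "id2 N ep *{N} T2 th = Ga"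
  using full[unfolded full_comparison_def, rule_format, of al be Ga] by auto
 obtain th' where t' [simp]: "th' \<in> Cell M" "dom2 M th' = be" "cod2 M th' = al" and tG': "id2 N ep *{N} T2 th' = inv2 N Ga"
  using full[unfolded full_comparison_def, rule_format, of be al "inv2 N Ga"] by auto
 have c: "id2 N ep *{N} T2 (y #{M} x) = (id2 N ep *{N} T2 y) #{N} (id2 N ep *{N} T2 x)"
  if "x \<in> Cell M" "y \<in> Cell M" "dom2 M y = cod2 M x" "trg M (dom2 M x) = R" for x y
  using that by (simp add: T.H.whisker_vcomp_left)
 have 1: "th' #{M} th = id2 M al"
  by (rule faithful[unfolded faithful_comparison_def, rule_format]) (simp_all add: c tG tG' del: T.F2_vcomp)
 have 2: "th #{M} th' = id2 M be"
  by (rule faithful[unfolded faithful_comparison_def, rule_format]) (simp_all add: c tG tG' del: T.F2_vcomp)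
 have "iso2 M th" by (rule T.A.iso2I[of th']) (simp_all add: 1 2)
 then show ?thesis unfolding isomorphic1_def by (intro exI[of _ th]) simp
qed

end

text \<open>Essential surjectivity of each comparison, applied to the other counit, gives 1-cells in
  both directions. Their composites preserve the counits up to isomorphism, and reflection of
  isomorphisms identifies them with the identities.\<close>

lemma comparison_unique:
 assumes "strict_comparison M N T0 T1 T2 R a ep" "strict_comparison M N T0 T1 T2 R' a ep'"
  and u: "strict_comparison.full_comparison M N T1 T2 R ep" "strict_comparison.faithful_comparison M N T2 R ep" "strict_comparison.eso_comparison M N T0 T1 R a ep"
  and u': "strict_comparison.full_comparison M N T1 T2 R' ep'" "strict_comparison.faithful_comparison M N T2 R' ep'" "strict_comparison.eso_comparison M N T0 T1 R' a ep'"
 shows "\<exists>th. equivalence1 M th R R'"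
proof -
 interpret c: strict_comparison M N T0 T1 T2 R a ep by fact
 interpret c': strict_comparison M N T0 T1 T2 R' a ep' by fact
 obtain th where t [simp]: "th \<in> Mor M" "src M th = R" "trg M th = R'" and ti: "isomorphic1 N (ep' o{N} T1 th) ep"
  using u'(3)[unfolded c'.eso_comparison_def, rule_format, of R ep] by auto
 obtain \<psi> where p [simp]: "\<psi> \<in> Mor M" "src M \<psi> = R'" "trg M \<psi> = R" and pi: "isomorphic1 N (ep o{N} T1 \<psi>) ep'"
  using u(3)[unfolded c.eso_comparison_def, rule_format, of R' ep'] by auto
 have "isomorphic1 N ((ep o{N} T1 \<psi>) o{N} T1 th) (ep' o{N} T1 th)"
  by (rule c.T.H.isomorphic1_comp1[OF c.T.H.isomorphic1_refl pi]) simp_all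
 then have "isomorphic1 N ((ep o{N} T1 \<psi>) o{N} T1 th) ep" using ti by (rule c.T.H.isomorphic1_trans)
 then have 1: "isomorphic1 M (\<psi> o{M} th) (id1 M R)"
  by (intro c.reflects_isomorphic1 u) (simp_all add: c.T.H.comp1_assoc')
 have "isomorphic1 N ((ep' o{N} T1 th) o{N} T1 \<psi>) (ep o{N} T1 \<psi>)"
  by (rule c.T.H.isomorphic1_comp1[OF c.T.H.isomorphic1_refl ti]) simp_all
 then have "isomorphic1 N ((ep' o{N} T1 th) o{N} T1 \<psi>) ep'" using pi by (rule c.T.H.isomorphic1_trans)
 then have 2: "isomorphic1 M (th o{M} \<psi>) (id1 M R')"
  by (intro c'.reflects_isomorphic1 u') (simp_all add: c.T.H.comp1_assoc')
 show ?thesis unfolding equivalence1_def using 1 2 by (intro exI[of _ th] conjI bexI[of _ \<psi>]) simp_all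
qed

lemma strict_comparison_kan:
 assumes t: "pseudofunctor A B t" and R: "pseudofunctor B H R" and e: "pseudonatural A H ep" "pdom ep = psf_comp A H R t" "pcod ep = \<A>"
 shows "strict_comparison (PS B H) (PS A H) (%F. psf_comp A H F t) (pnt_pre A H t) (mdf_pre A H t) R \<A> ep"
proof -
 interpret R: pseudofunctor B H R by fact
 show ?thesis using strict_functor_pre[OF t R.H.two_category_axioms]
  by (simp add: strict_comparison_def strict_comparison_axioms_def R e)
qed

text \<open>With T taken to be precomposition with \<open>t\<close>, the constituents of the Kan
  extension become those of the comparison by unfolding, once \<open>psf_op\<close> of a strict
  2-functor is rewritten as a strict 2-functor.\<close>

lemma right_pseudo_Kan_extension_iff:
 assumes t: "pseudofunctor A B t" and R: "pseudofunctor B H R" and e: "pseudonatural A H ep" "pdom ep = psf_comp A H R t" "pcod ep = \<A>"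
 shows "right_pseudo_Kan_extension A B H t \<A> R ep \<longleftrightarrow>
  pseudonatural_equivalence_CAT (op2 (PS B H)) (strict_comparison.comparison (PS B H) (PS A H) (%F. psf_comp A H F t) (pnt_pre A H t) (mdf_pre A H t) R \<A> ep)
   (rep (op2 (PS B H)) R) (psf_comp (op2 (PS B H)) CAT (rep (op2 (PS A H)) \<A>) (strict_psf (op2 (PS B H)) (op2 (PS A H)) (%F. psf_comp A H F t) (pnt_pre A H t) (mdf_pre A H t)))"
proof -
 interpret c: strict_comparison "PS B H" "PS A H" "%F. psf_comp A H F t" "pnt_pre A H t" "mdf_pre A H t" R \<A> ep
  using assms by (rule strict_comparison_kan)
 have P: "kan_hom B H R = c.P" by (simp add: kan_hom_def)
 have Q: "kan_hom_along A B H t \<A> = c.Q"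
  using psf_op_strict_psf[of "op2 (PS B H)" "PS A H" "%F. psf_comp A H F t" "pnt_pre A H t" "mdf_pre A H t"]
  by (simp add: kan_hom_along_def precomp_def)
 have f: "kan_fnct A B H t \<A> R ep S = hfnct (psf0 c.P S) (psf0 c.Q S) (c.ro S) (c.ra S)" for S
  by (simp add: kan_fnct_def hfnct_def P Q)
 have "kan_comparison A B H t \<A> R ep = c.comparison"
  by (simp add: kan_comparison_def c.comparison_def P Q f)
 then show ?thesis using R e by (simp add: right_pseudo_Kan_extension_def P Q)
qed

section \<open>Existence of the Kan extension and its identification\<close>

text \<open>The universal property of the counit in a form on which both existence and uniqueness
  draw.\<close>

lemma comparison_bilim:
 assumes \<A>: "pseudofunctor A H \<A>" and t: "pseudofunctor A B t" and L: "weighted_bilimit_psf A B H (yon_along A B t) \<A> L Ph"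
 shows "\<exists>ep. pseudonatural A H ep & pdom ep = psf_comp A H L t & pcod ep = \<A> &
  strict_comparison.full_comparison (PS B H) (PS A H) (pnt_pre A H t) (mdf_pre A H t) L ep &
  strict_comparison.faithful_comparison (PS B H) (PS A H) (mdf_pre A H t) L ep &
  strict_comparison.eso_comparison (PS B H) (PS A H) (%F. psf_comp A H F t) (pnt_pre A H t) L \<A> ep"
proof -
 have Lp: "pseudofunctor B H L" using L by (simp add: weighted_bilimit_psf_def)
 interpret f: bilim_family A H \<A> B t L Ph
  by (intro bilim_family.intro bilim_family_axioms.intro \<A> t Lp L)
 interpret u: universal_cone A H \<A> B t L f.lam f.lam2 f.lamu f.lamg by (rule f.universal_cone)
 note e = u.pseudonatural_epsilon u.epsilon_simps(1,2)
 interpret c: strict_comparison "PS B H" "PS A H" "%F. psf_comp A H F t" "pnt_pre A H t" "mdf_pre A H t" L \<A> u.epsilon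
  using t Lp e by (rule strict_comparison_kan)
 have 1: c.full_comparison unfolding c.full_comparison_def
 proof (intro ballI impI, elim conjE)
  fix al be Ga assume a: "al \<in> Mor (PS B H)" "be \<in> Mor (PS B H)" "Ga \<in> Cell (PS A H)" "trg (PS B H) al = L" "trg (PS B H) be = L"
   "src (PS B H) be = src (PS B H) al" "dom2 (PS A H) Ga = u.epsilon o{PS A H} pnt_pre A H t al" "cod2 (PS A H) Ga = u.epsilon o{PS A H} pnt_pre A H t be"
  show "\<exists>th\<in>Cell (PS B H). dom2 (PS B H) th = al & cod2 (PS B H) th = be & id2 (PS A H) u.epsilon *{PS A H} mdf_pre A H t th = Ga"
   using u.epsilon_full[of al "pdom al" be Ga] a by auto
 qed
 have 2: c.faithful_comparison unfolding c.faithful_comparison_def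
  by (intro ballI impI u.epsilon_faithful) simp_all
 have 3: c.eso_comparison unfolding c.eso_comparison_def isomorphic1_def
 proof (intro ballI impI)
  fix S ga assume "S \<in> Ob (PS B H)" "ga \<in> Mor (PS A H)" "src (PS A H) ga = psf_comp A H S t & trg (PS A H) ga = \<A>"
  then obtain al n where "pseudonatural B H al" "pdom al = S" "pcod al = L" "iso2 (PS A H) n"
   "mdom n = pnt_comp A H u.epsilon (pnt_pre A H t al)" "mcod n = ga"
   using u.epsilon_eso[of S ga] by auto
  then show "\<exists>al\<in>Mor (PS B H). src (PS B H) al = S & trg (PS B H) al = L &
    (\<exists>i. iso2 (PS A H) i & dom2 (PS A H) i = u.epsilon o{PS A H} pnt_pre A H t al & cod2 (PS A H) i = ga)"
   by (intro bexI[of _ al] conjI exI[of _ n]) simp_all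
 qed
 show ?thesis using e 1 2 3 by blast
qed

theorem theorem3p14:
  fixes A :: "('a0, 'a1, 'a2) twocat"
    and B :: "('b0, 'b1, 'b2) twocat"
    and H :: "('h0, 'h1, 'h2) twocat"
  assumes "two_category A" and "two_category B" and "two_category H"
    and "pseudofunctor A H \<A>" and "pseudofunctor A B t"
    and "\<And>b. b \<in> Ob B \<Longrightarrow>
      \<exists>L \<phi>. weighted_bilimit A H (psf_comp A CAT (rep B b) t) \<A> L \<phi>"
  shows "(\<exists>R \<epsilon>. right_pseudo_Kan_extension A B H t \<A> R \<epsilon>) \<and>
    (\<forall>bilim \<phi>.
      (\<forall>b \<in> Ob B. weighted_bilimit A H (psf_comp A CAT (rep B b) t) \<A> (bilim b) (\<phi> b)) \<longrightarrow>
      (\<exists>L \<Phi>. weighted_bilimit_psf A B H (yon_along A B t) \<A> L \<Phi> \<and>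
        (\<forall>b \<in> Ob B. psf0 L b = bilim b \<and> pnt1 \<Phi> b = \<phi> b)) \<and>
      (\<forall>L \<Phi>. weighted_bilimit_psf A B H (yon_along A B t) \<A> L \<Phi> \<and>
        (\<forall>b \<in> Ob B. psf0 L b = bilim b \<and> pnt1 \<Phi> b = \<phi> b) \<longrightarrow>
        (\<forall>R \<epsilon>. right_pseudo_Kan_extension A B H t \<A> R \<epsilon> \<longrightarrow>
          (\<exists>\<theta>. equivalence1 (PS B H) \<theta> R L))))"
proof (intro conjI allI impI)
  note \<A> = assms(4) and t = assms(5)
  obtain bilim \<phi> where "\<And>b. b \<in> Ob B \<Longrightarrow> weighted_bilimit A H (psf_comp A CAT (rep B b) t) \<A> (bilim b) (\<phi> b)"
    using assms(6) by metis
  from weighted_bilimit_psf_exists[OF \<A> t this]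
  obtain L \<Phi> where L: "weighted_bilimit_psf A B H (yon_along A B t) \<A> L \<Phi>" by blast
  obtain \<epsilon> where e: "pseudonatural A H \<epsilon>" "pdom \<epsilon> = psf_comp A H L t" "pcod \<epsilon> = \<A>"
    and c: "strict_comparison.full_comparison (PS B H) (PS A H) (pnt_pre A H t) (mdf_pre A H t) L \<epsilon>"
      "strict_comparison.faithful_comparison (PS B H) (PS A H) (mdf_pre A H t) L \<epsilon>"
      "strict_comparison.eso_comparison (PS B H) (PS A H) (\<lambda>F. psf_comp A H F t) (pnt_pre A H t) L \<A> \<epsilon>"
    using comparison_bilim[OF \<A> t L] by blast
  have Lp: "pseudofunctor B H L" using L by (simp add: weighted_bilimit_psf_def)
  show "\<exists>R \<epsilon>. right_pseudo_Kan_extension A B H t \<A> R \<epsilon>"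
    using right_pseudo_Kan_extension_iff[OF t Lp e] 
      strict_comparison.comparison_equivalenceI[OF strict_comparison_kan[OF t Lp e] c] by blast
next
  fix bilim \<phi> assume "\<forall>b \<in> Ob B. weighted_bilimit A H (psf_comp A CAT (rep B b) t) \<A> (bilim b) (\<phi> b)"
  then show "\<exists>L \<Phi>. weighted_bilimit_psf A B H (yon_along A B t) \<A> L \<Phi> \<and> (\<forall>b \<in> Ob B. psf0 L b = bilim b \<and> pnt1 \<Phi> b = \<phi> b)"
    by (intro weighted_bilimit_psf_exists assms(4,5)) blast
next
  note \<A> = assms(4) and t = assms(5)
  fix bilim \<phi> L \<Phi> R \<epsilon>'
  assume "weighted_bilimit_psf A B H (yon_along A B t) \<A> L \<Phi> \<and> (\<forall>b \<in> Ob B. psf0 L b = bilim b \<and> pnt1 \<Phi> b = \<phi> b)"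
    and K: "right_pseudo_Kan_extension A B H t \<A> R \<epsilon>'"
  then have L: "weighted_bilimit_psf A B H (yon_along A B t) \<A> L \<Phi>" by blast
  obtain \<epsilon> where e: "pseudonatural A H \<epsilon>" "pdom \<epsilon> = psf_comp A H L t" "pcod \<epsilon> = \<A>"
    and c: "strict_comparison.full_comparison (PS B H) (PS A H) (pnt_pre A H t) (mdf_pre A H t) L \<epsilon>"
      "strict_comparison.faithful_comparison (PS B H) (PS A H) (mdf_pre A H t) L \<epsilon>"
      "strict_comparison.eso_comparison (PS B H) (PS A H) (\<lambda>F. psf_comp A H F t) (pnt_pre A H t) L \<A> \<epsilon>"
    using comparison_bilim[OF \<A> t L] by blast
  have Lp: "pseudofunctor B H L" using L by (simp add: weighted_bilimit_psf_def)
  have R: "pseudofunctor B H R" "pseudonatural A H \<epsilon>'" "pdom \<epsilon>' = psf_comp A H R t" "pcod \<epsilon>' = \<A>"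
    using K by (simp_all add: right_pseudo_Kan_extension_def)
  \<comment> \<open>R, by hypothesis, and L, through its counit, both satisfy the three comparison
    conditions over \<open>\<A>\<close>; so they represent the same 2-functor.\<close>
  show "\<exists>\<theta>. equivalence1 (PS B H) \<theta> R L"
    using K unfolding right_pseudo_Kan_extension_iff[OF t R]
    by (intro comparison_unique[OF strict_comparison_kan[OF t R] strict_comparison_kan[OF t Lp e]] c
      strict_comparison.comparison_equivalenceD[OF strict_comparison_kan[OF t R]])
qed

end
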